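(* For all sufficiently small $\varepsilon>0$, the point spectrum (set of eigenvalues) of $\mathcal{H}_\varepsilon$ consists of at most countably many eigenvalues of finite multiplicity and has no finite accumulation points.
   Context: Let $p,q:\mathbb{R}\to\mathbb{R}$ be $1$-periodic, $p$ piecewise continuously differentiable (continuous with piecewise continuous derivative), $q$ piecewise continuous, $p(x)\geq p_0>0$ for all $x$, and $p(0)=1$. Let $\mathcal{H}_0:=-\frac{d}{dx}p\frac{d}{dx}+q$ be the self-adjoint operator in $L_2(\mathbb{R})$ with domain $W_2^2(\mathbb{R})$. Let $Q\subset\mathbb{R}$ be a fixed bounded open interval. For each small $\varepsilon>0$ let $\mathcal{L}_\varepsilon:W_2^2(Q)\to L_2(Q)$ be a linear operator, bounded uniformly in $\varepsilon$ (operator norms bounded by a constant independent of $\varepsilon$). Denote also by $\mathcal{L}_\varepsilon$ the operator $W_{2,loc}^2(\mathbb{R})\to L_2(\mathbb{R})$ that restricts a function to $Q$, applies $\mathcal{L}_\varepsilon$, and extends the result by zero outside $Q$. Set $\mathcal{H}_\varepsilon:=\mathcal{H}_0-\varepsilon\mathcal{L}_\varepsilon$, an operator in $L_2(\mathbb{R})$ with domain $W_2^2(\mathbb{R})$. The multiplicity of an eigenvalue is the dimension of its eigenspace. *)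

theory Defs
  imports "HOL-Analysis.Analysis"
begin

text \<open>
  Elements of \<open>L\<^sub>2(S)\<close> and \<open>W\<^sub>2\<^sup>2(S)\<close> are represented by functions \<open>real \<Rightarrow> complex\<close>, of which only
  the values on \<open>S\<close> matter; two functions represent the same element iff they agree almost
  everywhere on \<open>S\<close>. Every equality between such elements is therefore an equality a.e.
\<close>

definition L2 :: "real set \<Rightarrow> (real \<Rightarrow> complex) set" where
  "L2 S = {f. f \<in> borel_measurable (lebesgue_on S) \<and>
              integrable (lebesgue_on S) (\<lambda>x. (cmod (f x))\<^sup>2)}"

definition L2_norm :: "real set \<Rightarrow> (real \<Rightarrow> complex) \<Rightarrow> real" where
  "L2_norm S f = sqrt (LINT x|lebesgue_on S. (cmod (f x))\<^sup>2)"

text \<open>\<open>C\<^sub>c\<^sup>\<infinity>(S)\<close> for open \<open>S\<close>; test functions are extended by zero to the whole line.\<close>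

definition test_function :: "real set \<Rightarrow> (real \<Rightarrow> real) \<Rightarrow> bool" where
  "test_function S \<phi> \<longleftrightarrow>
     (\<forall>n. (deriv ^^ n) \<phi> differentiable_on UNIV) \<and>
     (\<exists>K. compact K \<and> K \<subseteq> S \<and> (\<forall>x. x \<notin> K \<longrightarrow> \<phi> x = 0))"

definition locally_integrable :: "real set \<Rightarrow> (real \<Rightarrow> complex) \<Rightarrow> bool" where
  "locally_integrable S f \<longleftrightarrow> (\<forall>K. compact K \<and> K \<subseteq> S \<longrightarrow> f absolutely_integrable_on K)"

definition has_weak_deriv :: "real set \<Rightarrow> (real \<Rightarrow> complex) \<Rightarrow> (real \<Rightarrow> complex) \<Rightarrow> bool" where
  "has_weak_deriv S f g \<longleftrightarrow>
     locally_integrable S f \<and> locally_integrable S g \<and>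
     (\<forall>\<phi>. test_function S \<phi> \<longrightarrow>
        (LINT x|lebesgue_on S. f x * of_real (deriv \<phi> x)) =
        - (LINT x|lebesgue_on S. g x * of_real (\<phi> x)))"

text \<open>A representative of the weak derivative, which is unique up to a null set when it exists
  (and is a junk value otherwise).\<close>

definition weak_deriv :: "real set \<Rightarrow> (real \<Rightarrow> complex) \<Rightarrow> (real \<Rightarrow> complex)" where
  "weak_deriv S f = (SOME g. has_weak_deriv S f g)"

definition W22 :: "real set \<Rightarrow> (real \<Rightarrow> complex) set" where
  "W22 S = {f \<in> L2 S. \<exists>g \<in> L2 S. \<exists>h \<in> L2 S. has_weak_deriv S f g \<and> has_weak_deriv S g h}"

definition W22_norm :: "real set \<Rightarrow> (real \<Rightarrow> complex) \<Rightarrow> real" where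
  "W22_norm S f = sqrt ((L2_norm S f)\<^sup>2 + (L2_norm S (weak_deriv S f))\<^sup>2
                        + (L2_norm S (weak_deriv S (weak_deriv S f)))\<^sup>2)"

text \<open>The first conjunct says that \<open>A\<close> is well defined on classes modulo a.e. equality.\<close>

definition linear_W22_L2 ::
    "real set \<Rightarrow> ((real \<Rightarrow> complex) \<Rightarrow> (real \<Rightarrow> complex)) \<Rightarrow> bool" where
  "linear_W22_L2 S A \<longleftrightarrow>
     (\<forall>f \<in> W22 S. \<forall>g \<in> W22 S. (AE x in lebesgue_on S. f x = g x) \<longrightarrow>
        (AE x in lebesgue_on S. A f x = A g x)) \<and>
     (\<forall>f \<in> W22 S. A f \<in> L2 S) \<and>
     (\<forall>f \<in> W22 S. \<forall>g \<in> W22 S.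
        AE x in lebesgue_on S. A (\<lambda>y. f y + g y) x = A f x + A g x) \<and>
     (\<forall>f \<in> W22 S. \<forall>c. AE x in lebesgue_on S. A (\<lambda>y. c * f y) x = c * A f x)"

text \<open>Piecewise continuity: on every bounded interval only finitely many discontinuities, each of
  the first kind (finite one-sided limits).\<close>

definition piecewise_continuous :: "(real \<Rightarrow> real) \<Rightarrow> bool" where
  "piecewise_continuous f \<longleftrightarrow>
     (\<forall>a b. finite {x \<in> {a..b}. \<not> isCont f x}) \<and>
     (\<forall>x. (\<exists>l. (f \<longlongrightarrow> l) (at_left x)) \<and> (\<exists>r. (f \<longlongrightarrow> r) (at_right x)))"

text \<open>Unlike \<open>piecewise_C1_differentiable_on\<close>, this requires the derivative to have finite
  one-sided limits at the break points.\<close>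

definition piecewise_C1 :: "(real \<Rightarrow> real) \<Rightarrow> bool" where
  "piecewise_C1 f \<longleftrightarrow> continuous_on UNIV f \<and>
     (\<exists>f'. piecewise_continuous f' \<and>
           (\<forall>a b. finite {x \<in> {a..b}. \<not> (f has_real_derivative f' x) (at x)}))"

definition H0 ::
    "(real \<Rightarrow> real) \<Rightarrow> (real \<Rightarrow> real) \<Rightarrow> (real \<Rightarrow> complex) \<Rightarrow> (real \<Rightarrow> complex)" where
  "H0 p q u = (\<lambda>x. - weak_deriv UNIV (\<lambda>y. of_real (p y) * weak_deriv UNIV u y) x
                   + of_real (q x) * u x)"

definition localized ::
    "real set \<Rightarrow> ((real \<Rightarrow> complex) \<Rightarrow> (real \<Rightarrow> complex)) \<Rightarrow> (real \<Rightarrow> complex) \<Rightarrow> (real \<Rightarrow> complex)"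
  where "localized Q A u = (\<lambda>x. if x \<in> Q then A (restrict u Q) x else 0)"

definition H_pert ::
    "(real \<Rightarrow> real) \<Rightarrow> (real \<Rightarrow> real) \<Rightarrow> real set \<Rightarrow>
     (real \<Rightarrow> (real \<Rightarrow> complex) \<Rightarrow> (real \<Rightarrow> complex)) \<Rightarrow> real \<Rightarrow>
     (real \<Rightarrow> complex) \<Rightarrow> (real \<Rightarrow> complex)" where
  "H_pert p q Q L \<epsilon> u = (\<lambda>x. H0 p q u x - of_real \<epsilon> * localized Q (L \<epsilon>) u x)"

text \<open>In the following, \<open>A\<close> is an operator in \<open>L\<^sub>2(\<real>)\<close> with domain \<open>D\<close>.\<close>

definition eigenspace ::
    "(real \<Rightarrow> complex) set \<Rightarrow> ((real \<Rightarrow> complex) \<Rightarrow> (real \<Rightarrow> complex)) \<Rightarrow> complex \<Rightarrow>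
     (real \<Rightarrow> complex) set" where
  "eigenspace D A z = {u \<in> D. AE x in lebesgue. A u x = z * u x}"

definition point_spectrum ::
    "(real \<Rightarrow> complex) set \<Rightarrow> ((real \<Rightarrow> complex) \<Rightarrow> (real \<Rightarrow> complex)) \<Rightarrow> complex set" where
  "point_spectrum D A = {z. \<exists>u \<in> eigenspace D A z. \<not> (AE x in lebesgue. u x = 0)}"

text \<open>Finite dimension over the complex numbers, modulo a.e. equality.\<close>

definition finite_dimensional :: "(real \<Rightarrow> complex) set \<Rightarrow> bool" where
  "finite_dimensional E \<longleftrightarrow>
     (\<exists>B. finite B \<and> B \<subseteq> E \<and>
        (\<forall>u \<in> E. \<exists>c :: (real \<Rightarrow> complex) \<Rightarrow> complex.
           AE x in lebesgue. u x = (\<Sum>b\<in>B. c b * b x)))"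

end

theory Submission
  imports Defs "HOL-Complex_Analysis.Complex_Analysis" "Jordan_Normal_Form.Determinant"
begin

text \<open>
By elliptic regularity an eigenfunction \<open>u\<close> of the perturbed operator and its flux \<open>v = p u'\<close> are
indefinite integrals of \<open>v / p\<close> and of \<open>(q - z) u - \<epsilon> L u\<close>, and both tend to zero at the two ends of the
line (\<open>eigenfunction_classical\<close>). The theorem is proved for such decaying pairs \<open>(u, v)\<close>.

Let \<alpha> and \<beta> be integers such that \<open>Q\<close> lies between them. Outside \<open>{\<alpha>..\<beta>}\<close> the equation is the
unperturbed periodic one. Its transfer matrix over one period is holomorphic in \<open>z\<close> and has determinant 1;
its eigenvalues are the two roots \<open>l\<close>, \<open>1 / l\<close> of \<open>l\<^sup>2 - D l + 1 = 0\<close>, where \<open>D\<close> is its trace. If \<open>l\<close> is a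
root with \<open>cmod l \<le> 1\<close>, then a certain linear combination of \<open>u\<close> and \<open>v\<close> is multiplied by \<open>1 / l\<close> with each
period to the right, and since it tends to zero, it vanishes at \<beta>; the same happens at \<alpha>. Every
decaying solution therefore satisfies two boundary conditions, linear in the data at \<alpha> and \<beta>
(\<open>esol_boundary\<close>). This argument covers the case \<open>cmod l = 1\<close>, that is, eigenvalues embedded in the continuous
spectrum and at its edges.

Between \<alpha> and \<beta> the perturbation is of the same order as the operator itself, so that it can be
handled only through its smallness. Let \<open>f = - v'\<close> be the unknown; then \<open>u\<close> is the image of \<open>f\<close> under a double
integration plus a combination of two fixed functions with coefficients \<open>u \<alpha>\<close> and \<open>v \<alpha>\<close>. In the term of
order zero, split \<open>u\<close> into its values at the points of a fine grid, which become further unknowns, and the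
remainder, which is small relative to \<open>f\<close>. The resulting equation for \<open>f\<close> is a contraction, uniformly for \<open>z\<close> in a
given disc, and its solution is a Neumann series, holomorphic in \<open>z\<close> (\<open>fsol_exists\<close>). The definition of the
grid values and the two boundary conditions give a homogeneous linear system for finitely many unknowns,
whose determinant \<open>\<Phi> z l\<close> is holomorphic in \<open>z\<close> and \<open>l\<close> and vanishes whenever \<open>z\<close> is an eigenvalue
(\<open>eigenvalue_kernel\<close>). The finitely many unknowns determine the solution, hence eigenspaces have finite
dimension (\<open>eigenspace_finite_span\<close>).

It remains to see that the zeros of \<open>\<Phi>\<close> are isolated (\<open>no_accumulation\<close>), where the difficulty is that the
root \<open>l\<close> is a two-valued function of \<open>z\<close>. Near a point \<open>z0\<close> the substitution \<open>z = z0 + k\<^sup>2\<close> makes both roots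
holomorphic in \<open>k\<close>. If eigenvalues accumulated at \<open>z0\<close>, then \<open>\<Phi>\<close> would vanish identically along a root
of modulus less than 1 at some nonreal points near \<open>z0\<close>. For nonreal \<open>z\<close> no root has modulus 1, because
the periodic operator is symmetric; so the root inside the unit disc is a holomorphic function on each half
disc, and by the identity theorem \<open>\<Phi>\<close> along this root would vanish at \<i> or \<open>- \<i>\<close>. But for small \<epsilon> an energy estimate
shows that at \<open>z = \<plusminus> \<i>\<close> the boundary value problem has only the trivial solution (\<open>energy_uniqueness\<close>). Finally,
a subset of the plane without limit points is countable.
\<close>

section \<open>Indefinite integrals\<close>

text \<open>
The equation is a first-order system with merely integrable coefficients. Its solutions are absolutely
continuous, and the form of absolute continuity used here is that \<open>F\<close> is an indefinite integral of \<open>f\<close>. For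
\<open>b < a\<close> the condition is void, so that statements over all intervals need no case distinction.
\<close>

definition prim :: "real \<Rightarrow> real \<Rightarrow> (real \<Rightarrow> complex) \<Rightarrow> (real \<Rightarrow> complex) \<Rightarrow> bool" where
  "prim a b F f \<longleftrightarrow> f absolutely_integrable_on {a..b} \<and>
     (\<forall>x\<in>{a..b}. integral {a..x} f = F x - F a)"

lemma absolutely_integrable_imp_integrable_subinterval:
  fixes f :: "real \<Rightarrow> 'b::euclidean_space"
  assumes "f absolutely_integrable_on {a..b}" "a \<le> c" "d \<le> b"
  shows "f integrable_on {c..d}"
  using absolutely_integrable_on_subinterval[OF assms(1), of c d] assms(2,3)
  by (auto intro: set_lebesgue_integral_eq_integral(1))

lemma integral_increment:
  fixes f :: "real \<Rightarrow> 'b::euclidean_space"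
  assumes "f absolutely_integrable_on {a..b}" "a \<le> s" "s \<le> t" "t \<le> b"
  shows "integral {s..t} f = integral {a..t} f - integral {a..s} f"
proof -
  have "f integrable_on {a..t}"
    using absolutely_integrable_imp_integrable_subinterval[OF assms(1), of a t] assms by simp
  then have "integral {a..s} f + integral {s..t} f = integral {a..t} f"
    using assms by (intro Henstock_Kurzweil_Integration.integral_combine) auto
  then show ?thesis by (metis add_diff_cancel_left')
qed

lemma prim_integrable: "prim a b F f \<Longrightarrow> f absolutely_integrable_on {a..b}"
  by (simp add: prim_def)

lemma prim_diff:
  assumes "prim a b F f" "a \<le> x" "x \<le> y" "y \<le> b"
  shows "integral {x..y} f = F y - F x"
proof -
  have "integral {a..x} f = F x - F a" "integral {a..y} f = F y - F a"
    using assms by (auto simp: prim_def)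
  then show ?thesis
    using integral_increment[OF prim_integrable[OF assms(1)] assms(2-4)] by simp
qed

lemma prim_subinterval:
  assumes "prim a b F f" "a \<le> c" "d \<le> b"
  shows "prim c d F f"
  unfolding prim_def
proof (intro conjI ballI)
  show "f absolutely_integrable_on {c..d}"
    by (rule absolutely_integrable_on_subinterval[OF prim_integrable[OF assms(1)]]) (use assms in auto)
  fix x assume "x \<in> {c..d}"
  then show "integral {c..x} f = F x - F c"
    using prim_diff[OF assms(1), of c x] assms by auto
qed

lemma primI:
  assumes "f absolutely_integrable_on {a..b}"
    "\<And>x. a \<le> x \<Longrightarrow> x \<le> b \<Longrightarrow> (f has_integral (F x - F a)) {a..x}"
  shows "prim a b F f"
  unfolding prim_def using assms(1) integral_unique[OF assms(2)] by auto

lemma prim_indefinite: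
  assumes "f absolutely_integrable_on {a..b}"
  shows "prim a b (\<lambda>x. integral {a..x} f) f"
  unfolding prim_def using assms by auto

lemma prim_continuous:
  assumes "prim a b F f"
  shows "continuous_on {a..b} F"
proof -
  have "continuous_on {a..b} (\<lambda>x. F a + integral {a..x} f)"
    using assms by (intro continuous_intros indefinite_integral_continuous_1)
       (auto simp: prim_def absolutely_integrable_on_def)
  then show ?thesis
    by (rule continuous_on_eq) (use assms in \<open>auto simp: prim_def\<close>)
qed

lemma prim_lincomb:
  assumes "prim a b F f" "prim a b G g"
  shows "prim a b (\<lambda>x. F x + c * G x) (\<lambda>x. f x + c * g x)"
  unfolding prim_def
proof (intro conjI ballI)
  have 1: "f absolutely_integrable_on {a..b}" "g absolutely_integrable_on {a..b}"
    using assms by (auto simp: prim_def)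
  then show "(\<lambda>x. f x + c * g x) absolutely_integrable_on {a..b}"
    by (intro set_integral_add set_integrable_mult_right) auto
  fix x assume x: "x \<in> {a..b}"
  have 2: "f integrable_on {a..x}" "g integrable_on {a..x}"
    using 1 x by (auto intro: absolutely_integrable_imp_integrable_subinterval)
  show "integral {a..x} (\<lambda>x. f x + c * g x) = F x + c * G x - (F a + c * G a)"
  proof -
    have "integral {a..x} f = F x - F a" "integral {a..x} g = G x - G a"
      using assms x by (auto simp: prim_def)
    moreover have "(\<lambda>x. c * g x) integrable_on {a..x}" using 2 by (intro integrable_on_mult_right)
    ultimately show ?thesis
      using 2 by (simp add: Henstock_Kurzweil_Integration.integral_add right_diff_distrib)
  qed
qed

lemma prim_cmult:
  assumes "prim a b F f"
  shows "prim a b (\<lambda>x. c * F x) (\<lambda>x. c * f x)"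
proof -
  have "prim a b (\<lambda>x. 0) (\<lambda>x. 0)" by (auto simp: prim_def)
  from prim_lincomb[OF this assms, of c] show ?thesis by simp
qed

lemma prim_const: "prim a b (\<lambda>x. c) (\<lambda>x. 0)"
  by (auto simp: prim_def)

lemma prim_cnj:
  assumes "prim a b F f"
  shows "prim a b (\<lambda>x. cnj (F x)) (\<lambda>x. cnj (f x))"
  unfolding prim_def
proof (intro conjI ballI)
  have 1: "f absolutely_integrable_on {a..b}" using assms by (auto simp: prim_def)
  then show "(\<lambda>x. cnj (f x)) absolutely_integrable_on {a..b}"
    using absolutely_integrable_linear[OF 1 bounded_linear_cnj] by (simp add: o_def)
  fix x assume x: "x \<in> {a..b}"
  have 2: "f integrable_on {a..x}"
    using 1 x by (auto intro: absolutely_integrable_imp_integrable_subinterval)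
  show "integral {a..x} (\<lambda>x. cnj (f x)) = cnj (F x) - cnj (F a)"
    using assms x by (simp add: prim_def integral_cnj[symmetric])
qed

lemma prim_spike:
  assumes "prim a b F f" "negligible N" "\<And>x. x \<in> {a..b} - N \<Longrightarrow> g x = f x"
    and "\<And>x. x \<in> {a..b} \<Longrightarrow> G x = F x"
  shows "prim a b G g"
  unfolding prim_def
proof (intro conjI ballI)
  show "g absolutely_integrable_on {a..b}"
    by (rule absolutely_integrable_spike[OF prim_integrable[OF assms(1)] assms(2)]) (use assms in auto)
  fix x assume x: "x \<in> {a..b}"
  have "integral {a..x} f = integral {a..x} g"
    by (rule integral_spike[OF assms(2)]) (use assms x in auto)
  then show "integral {a..x} g = G x - G a" using assms x by (auto simp: prim_def)
qed

lemma prim_AE: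
  assumes "prim a b F f" "AE x in lebesgue_on {a<..<b}. g x = f x"
    and "\<And>x. x \<in> {a..b} \<Longrightarrow> G x = F x"
  shows "prim a b G g"
proof -
  have "AE x in lebesgue. x \<in> {a<..<b} \<longrightarrow> g x = f x"
    using assms(2) by (subst (asm) AE_restrict_space_iff) auto
  then obtain N where N: "negligible N" "{x. \<not> (x \<in> {a<..<b} \<longrightarrow> g x = f x)} \<subseteq> N"
    unfolding eventually_ae_filter negligible_iff_null_sets by auto
  show ?thesis
    by (rule prim_spike[OF assms(1), of "N \<union> {a, b}"]) (use N assms(3) in \<open>force intro: negligible_Un\<close>)+
qed

lemma prim_norm_le:
  assumes "prim a b F f" "a \<le> x" "x \<le> y" "y \<le> b"
  shows "cmod (F y - F x) \<le> integral {x..y} (\<lambda>t. cmod (f t))"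
proof -
  have "f absolutely_integrable_on {x..y}"
    by (rule absolutely_integrable_on_subinterval[OF prim_integrable[OF assms(1)]]) (use assms in auto)
  then show ?thesis unfolding prim_diff[OF assms, symmetric]
    by (intro Henstock_Kurzweil_Integration.integral_norm_bound_integral)
       (auto simp: absolutely_integrable_on_def)
qed

text \<open>
A local bound on the increments of \<open>H\<close> by those of \<open>\<Phi>\<close> adds up over a subdivision of mesh less than \<open>d\<close>.
\<close>

lemma chain_increments:
  fixes H :: "real \<Rightarrow> complex" and \<Phi> :: "real \<Rightarrow> real"
  assumes "d > 0" and local: "\<And>x y. a \<le> x \<Longrightarrow> x \<le> y \<Longrightarrow> y \<le> b \<Longrightarrow> y \<le> x + d \<Longrightarrow> cmod (H y - H x) \<le> \<Phi> y - \<Phi> x"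
    and "a \<le> b"
  shows "cmod (H b - H a) \<le> \<Phi> b - \<Phi> a"
proof -
  have "a \<le> x \<Longrightarrow> x \<le> b \<Longrightarrow> x \<le> a + real n * d \<Longrightarrow> cmod (H x - H a) \<le> \<Phi> x - \<Phi> a" for n x
  proof (induction n arbitrary: x)
    case 0 then have "x = a" by auto then show ?case by simp
  next
    case (Suc n)
    define y where "y = max a (x - d)"
    have y: "a \<le> y" "y \<le> x" "x \<le> y + d" "y \<le> a + real n * d" "y \<le> b"
      using Suc.prems \<open>d > 0\<close> by (auto simp: y_def algebra_simps)
    have "cmod (H x - H a) \<le> cmod (H x - H y) + cmod (H y - H a)"
      by (metis norm_triangle_ineq add.commute diff_add_cancel add_diff_eq)
    also have "\<dots> \<le> (\<Phi> x - \<Phi> y) + (\<Phi> y - \<Phi> a)"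
      using y Suc.prems by (intro add_mono local Suc.IH) auto
    finally show ?case by simp
  qed
  moreover obtain n where "(b - a) / d \<le> real n" using real_arch_simple by blast
  then have "b \<le> a + real n * d" using \<open>d > 0\<close> by (simp add: field_simps)
  ultimately show ?thesis using \<open>a \<le> b\<close> by blast
qed

lemma absolutely_integrable_mult_continuous:
  fixes f G :: "real \<Rightarrow> complex"
  assumes "f absolutely_integrable_on {a..b}" "continuous_on {a..b} G"
  shows "(\<lambda>x. f x * G x) absolutely_integrable_on {a..b}"
proof -
  have "bounded (G ` {a..b})"
    using assms(2) compact_continuous_image compact_imp_bounded by blast
  moreover have "G \<in> borel_measurable (lebesgue_on {a..b})"
    using assms(2) by (rule continuous_imp_measurable_on_sets_lebesgue) auto
  ultimately have "(\<lambda>x. G x * f x) absolutely_integrable_on {a..b}"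
    using assms(1) by (intro absolutely_integrable_bounded_measurable_product[OF bilinear_times]) auto
  then show ?thesis by (simp add: mult.commute)
qed

text \<open>
On a short interval \<open>{s..t}\<close> the function \<open>f G + F g\<close> differs from \<open>f G(t) + F(s) g\<close>, whose integral is exactly the
increment of \<open>F G\<close>, by at most \<open>e (\<bar>f\<bar> + \<bar>g\<bar>)\<close>, as \<open>F\<close> and \<open>G\<close> are uniformly continuous. Summing over a
subdivision bounds the total error by \<open>e\<close> times a constant.
\<close>

lemma prim_mult:
  assumes F: "prim a b F f" and G: "prim a b G g"
  shows "prim a b (\<lambda>x. F x * G x) (\<lambda>x. f x * G x + F x * g x)"
proof -
  let ?h = "\<lambda>x. f x * G x + F x * g x"
  have fG: "(\<lambda>x. f x * G x) absolutely_integrable_on {a..b}"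
    by (intro absolutely_integrable_mult_continuous prim_integrable[OF F] prim_continuous[OF G])
  have Fg: "(\<lambda>x. F x * g x) absolutely_integrable_on {a..b}"
    using absolutely_integrable_mult_continuous[OF prim_integrable[OF G] prim_continuous[OF F]]
    by (simp add: mult.commute)
  have h: "?h absolutely_integrable_on {a..b}" using fG Fg by (rule set_integral_add)
  define k where "k = (\<lambda>x. cmod (f x) + cmod (g x))"
  have k: "k absolutely_integrable_on {a..b}"
    unfolding k_def
    using prim_integrable[OF F] prim_integrable[OF G] by (intro set_integral_add absolutely_integrable_norm[unfolded o_def]) 
  have main: "F x * G x - F a * G a = integral {a..x} ?h" if x: "a \<le> x" "x \<le> b" for x
  proof -
    note sub = absolutely_integrable_imp_integrable_subinterval
    define H where "H = (\<lambda>x. F x * G x - integral {a..x} ?h)"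
    define K where "K = integral {a..x} k"
    have K0: "K \<ge> 0" unfolding K_def by (rule Henstock_Kurzweil_Integration.integral_nonneg[OF sub[OF k]]) (use x in \<open>auto simp: k_def\<close>)
    have "cmod (H x - H a) \<le> e * K" if "e > 0" for e
    proof -
      have "uniformly_continuous_on {a..b} F" "uniformly_continuous_on {a..b} G"
        by (auto intro!: compact_uniformly_continuous prim_continuous[OF F] prim_continuous[OF G])
      then obtain d1 d2 where d: "d1 > 0" "d2 > 0"
        "\<And>s t. s \<in> {a..b} \<Longrightarrow> t \<in> {a..b} \<Longrightarrow> dist t s < d1 \<Longrightarrow> dist (F t) (F s) < e"
        "\<And>s t. s \<in> {a..b} \<Longrightarrow> t \<in> {a..b} \<Longrightarrow> dist t s < d2 \<Longrightarrow> dist (G t) (G s) < e"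
        unfolding uniformly_continuous_on_def using \<open>e > 0\<close> by (elim allE[of _ e] impE) auto
      define dd where "dd = min d1 d2 / 2"
      have dd: "dd > 0" using d by (auto simp: dd_def)
      have "cmod (H x - H a) \<le> e * integral {a..x} k - e * integral {a..a} k"
      proof (rule chain_increments[OF dd _ x(1)])
        fix s t assume st: "a \<le> s" "s \<le> t" "t \<le> x" "t \<le> s + dd"
        have Ih: "integral {s..t} ?h = integral {a..t} ?h - integral {a..s} ?h"
          using st x by (intro integral_increment[OF h]) auto
        have Ik: "integral {s..t} k = integral {a..t} k - integral {a..s} k"
          using st x by (intro integral_increment[OF k]) auto
        have e1: "((\<lambda>r. f r * G t) has_integral ((F t - F s) * G t)) {s..t}"
          using prim_diff[OF F, of s t] sub[OF prim_integrable[OF F], of s t] st x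
          by (intro has_integral_mult_left) (auto simp: has_integral_integral)
        have e2: "((\<lambda>r. F s * g r) has_integral (F s * (G t - G s))) {s..t}"
          using prim_diff[OF G, of s t] sub[OF prim_integrable[OF G], of s t] st x
          by (intro has_integral_mult_right) (auto simp: has_integral_integral)
        have "((\<lambda>r. f r * G t + F s * g r - ?h r) has_integral ((F t - F s) * G t + F s * (G t - G s) - integral {s..t} ?h)) {s..t}"
          using sub[OF h, of s t] st x by (intro has_integral_diff has_integral_add e1 e2) (auto simp: has_integral_integral)
        moreover have "(F t - F s) * G t + F s * (G t - G s) - integral {s..t} ?h = H t - H s"
          unfolding Ih H_def by (simp add: algebra_simps)
        moreover have "(\<lambda>r. f r * G t + F s * g r - ?h r) = (\<lambda>r. f r * (G t - G r) + (F s - F r) * g r)"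
          by (simp add: algebra_simps)
        ultimately have hi: "((\<lambda>r. f r * (G t - G r) + (F s - F r) * g r) has_integral (H t - H s)) {s..t}"
          by simp
        have "cmod (H t - H s) \<le> integral {s..t} (\<lambda>r. e * k r)"
          unfolding integral_unique[OF hi, symmetric]
        proof (rule Henstock_Kurzweil_Integration.integral_norm_bound_integral)
          show "(\<lambda>r. f r * (G t - G r) + (F s - F r) * g r) integrable_on {s..t}" using hi by blast
          show "(\<lambda>r. e * k r) integrable_on {s..t}"
            using sub[OF k, of s t] st x by (intro integrable_on_mult_right) auto
          fix r assume r: "r \<in> {s..t}"
          have "dd < d1" "dd < d2" using d(1,2) by (auto simp: dd_def)
          then have "cmod (G t - G r) \<le> e" "cmod (F s - F r) \<le> e"
            using d(3)[of r s] d(4)[of r t] r st x d(1,2) by (auto simp: dist_norm norm_minus_commute)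
          then have "cmod (f r * (G t - G r)) \<le> cmod (f r) * e" "cmod ((F s - F r) * g r) \<le> e * cmod (g r)"
            by (auto simp: norm_mult intro: mult_left_mono mult_right_mono)
          then show "cmod (f r * (G t - G r) + (F s - F r) * g r) \<le> e * k r"
            unfolding k_def by (smt (verit) norm_triangle_ineq distrib_left mult.commute)
        qed
        also have "\<dots> = e * integral {s..t} k" by simp
        finally show "cmod (H t - H s) \<le> e * integral {a..t} k - e * integral {a..s} k"
          unfolding Ik by (simp add: right_diff_distrib)
      qed
      then show ?thesis by (simp add: K_def)
    qed
    then have "cmod (H x - H a) \<le> 0"
    proof (cases "K = 0")
      case True then show ?thesis using \<open>\<And>e. e > 0 \<Longrightarrow> cmod (H x - H a) \<le> e * K\<close>[of 1] by simp
    next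
      case False
      then have "K > 0" using K0 by simp
      show ?thesis
      proof (rule field_le_epsilon)
        fix e :: real assume "e > 0"
        then show "cmod (H x - H a) \<le> 0 + e"
          using \<open>\<And>e. e > 0 \<Longrightarrow> cmod (H x - H a) \<le> e * K\<close>[of "e / K"] \<open>K > 0\<close> by simp
      qed
    qed
    then show ?thesis by (simp add: H_def algebra_simps)
  qed
  show ?thesis unfolding prim_def using h main by auto
qed

lemma prim_unique:
  assumes "prim a b F f" "prim a b G g" "F a = G a" "AE x in lebesgue_on {a<..<b}. f x = g x"
    "x \<in> {a..b}"
  shows "F x = G x"
proof -
  have "prim a b F g" by (rule prim_AE[OF assms(1)]) (use assms in \<open>auto elim: eventually_mono\<close>)
  then have "F x - F a = G x - G a" using assms(2,5) by (metis prim_def)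
  with assms(3) show ?thesis by simp
qed

lemma prim_FTC:
  assumes "a \<le> b" "finite S" "continuous_on {a..b} F" "f absolutely_integrable_on {a..b}"
    "\<And>x. x \<in> {a<..<b} - S \<Longrightarrow> (F has_vector_derivative f x) (at x)"
  shows "prim a b F f"
proof (rule primI[OF assms(4)])
  fix x assume x: "a \<le> x" "x \<le> b"
  show "(f has_integral F x - F a) {a..x}"
    by (rule fundamental_theorem_of_calculus_interior_strong[OF assms(2)])
      (use x assms in \<open>auto intro: continuous_on_subset\<close>)
qed

lemma prim_shift:
  assumes "prim a b F f"
  shows "prim (a - c) (b - c) (\<lambda>x. F (x + c)) (\<lambda>x. f (x + c))"
  unfolding prim_def
proof (intro conjI ballI)
  have i: "((\<lambda>x. h (x + c)) has_integral integral {s..t} h) {s - c..t - c}"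
    if "h absolutely_integrable_on {a..b}" "a \<le> s" "t \<le> b" for s t and h :: "real \<Rightarrow> 'b::euclidean_space"
  proof -
    have "(h has_integral integral {s..t} h) {s..t}"
      using absolutely_integrable_imp_integrable_subinterval[OF that] by (simp add: has_integral_integral)
    from has_integral_affinity'[of h _ s t 1 c] this show ?thesis by simp
  qed
  have f: "f absolutely_integrable_on {a..b}" using assms by (simp add: prim_def)
  show "(\<lambda>x. f (x + c)) absolutely_integrable_on {a - c..b - c}"
    unfolding absolutely_integrable_on_def
    using i[OF f, of a b] i[OF absolutely_integrable_norm[OF f], of a b] by (auto simp: o_def)
  fix x assume x: "x \<in> {a - c..b - c}"
  then show "integral {a - c..x} (\<lambda>x. f (x + c)) = F (x + c) - F (a - c + c)"
    using i[OF f, of a "x + c"] assms by (auto simp: prim_def dest!: integral_unique)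
qed

section \<open>Square-integrable functions\<close>

lemma L2_measurable: "f \<in> L2 S \<Longrightarrow> f \<in> borel_measurable (lebesgue_on S)"
  by (simp add: L2_def)

lemma L2_norm_nonneg [simp]: "L2_norm S f \<ge> 0"
  by (simp add: L2_norm_def)

lemma L2_norm_square: "(L2_norm S f)\<^sup>2 = (LINT x|lebesgue_on S. (cmod (f x))\<^sup>2)"
  by (simp add: L2_norm_def)

lemma L2_dominated:
  assumes "f \<in> borel_measurable (lebesgue_on S)" "integrable (lebesgue_on S) h"
    "AE x in lebesgue_on S. (cmod (f x))\<^sup>2 \<le> h x"
  shows "f \<in> L2 S"
  unfolding L2_def
  using assms by (auto intro!: Bochner_Integration.integrable_bound[OF assms(2)] elim: eventually_mono)

lemma L2_lincomb:
  assumes "f \<in> L2 S" "g \<in> L2 S"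
  shows "(\<lambda>x. f x + c * g x) \<in> L2 S"
proof (rule L2_dominated)
  show "(\<lambda>x. f x + c * g x) \<in> borel_measurable (lebesgue_on S)"
    using assms by (auto simp: L2_def)
  show "integrable (lebesgue_on S) (\<lambda>x. 2 * (cmod (f x))\<^sup>2 + 2 * (cmod c)\<^sup>2 * (cmod (g x))\<^sup>2)"
    using assms by (auto simp: L2_def)
  have "(cmod (f x + c * g x))\<^sup>2 \<le> 2 * (cmod (f x))\<^sup>2 + 2 * (cmod c)\<^sup>2 * (cmod (g x))\<^sup>2" for x
  proof -
    have "(cmod (f x + c * g x))\<^sup>2 \<le> (cmod (f x) + cmod (c * g x))\<^sup>2"
      by (intro power_mono norm_triangle_ineq) auto
    also have "\<dots> \<le> 2 * (cmod (f x))\<^sup>2 + 2 * (cmod (c * g x))\<^sup>2"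
      using zero_le_power2[of "cmod (f x) - cmod (c * g x)"] unfolding power2_sum power2_diff by linarith
    finally show ?thesis by (simp add: norm_mult power_mult_distrib mult.assoc)
  qed
  then show "AE x in lebesgue_on S. (cmod (f x + c * g x))\<^sup>2 \<le> 2 * (cmod (f x))\<^sup>2 + 2 * (cmod c)\<^sup>2 * (cmod (g x))\<^sup>2"
    by simp
qed

lemma L2_zero [simp]: "(\<lambda>x. 0) \<in> L2 S"
  by (simp add: L2_def)

lemma L2_add: "f \<in> L2 S \<Longrightarrow> g \<in> L2 S \<Longrightarrow> (\<lambda>x. f x + g x) \<in> L2 S"
  using L2_lincomb[of f S g 1] by simp

lemma L2_diff: "f \<in> L2 S \<Longrightarrow> g \<in> L2 S \<Longrightarrow> (\<lambda>x. f x - g x) \<in> L2 S"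
  using L2_lincomb[of f S g "-1"] by simp

lemma L2_cmult: "f \<in> L2 S \<Longrightarrow> (\<lambda>x. c * f x) \<in> L2 S"
  using L2_lincomb[OF L2_zero, of f S c] by simp

lemma L2_sum: "(\<And>i. i \<in> I \<Longrightarrow> f i \<in> L2 S) \<Longrightarrow> (\<lambda>x. \<Sum>i\<in>I. f i x) \<in> L2 S"
  by (induction I rule: infinite_finite_induct) (auto intro: L2_add)

lemma L2_norm_AE_cong:
  assumes "AE x in lebesgue_on S. f x = g x" "f \<in> L2 S" "g \<in> L2 S"
  shows "L2_norm S f = L2_norm S g"
proof -
  have "(LINT x|lebesgue_on S. (cmod (f x))\<^sup>2) = (LINT x|lebesgue_on S. (cmod (g x))\<^sup>2)"
    using assms by (intro integral_cong_AE) (auto simp: L2_def elim: eventually_mono)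
  then show ?thesis by (simp add: L2_norm_def)
qed

lemma L2_AE_cong:
  assumes "AE x in lebesgue_on S. f x = g x" "f \<in> L2 S" "g \<in> borel_measurable (lebesgue_on S)"
  shows "g \<in> L2 S"
  by (rule L2_dominated[OF assms(3), of "\<lambda>x. (cmod (f x))\<^sup>2"])
     (use assms in \<open>auto simp: L2_def elim: eventually_mono\<close>)

lemma L2_norm_mono_AE:
  assumes "AE x in lebesgue_on S. cmod (f x) \<le> cmod (g x)" "f \<in> L2 S" "g \<in> L2 S"
  shows "L2_norm S f \<le> L2_norm S g"
  unfolding L2_norm_def
  using assms by (intro real_sqrt_le_mono integral_mono_AE) (auto simp: L2_def elim!: eventually_mono intro: power_mono)

lemma L2_norm_eq_0_iff:
  assumes "f \<in> L2 S"
  shows "L2_norm S f = 0 \<longleftrightarrow> (AE x in lebesgue_on S. f x = 0)"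
proof -
  have "L2_norm S f = 0 \<longleftrightarrow> (LINT x|lebesgue_on S. (cmod (f x))\<^sup>2) = 0" by (simp add: L2_norm_def)
  also have "\<dots> \<longleftrightarrow> (AE x in lebesgue_on S. (cmod (f x))\<^sup>2 = 0)"
    using assms by (intro integral_nonneg_eq_0_iff_AE) (auto simp: L2_def)
  finally show ?thesis by simp
qed

lemma L2_norm_cmult: "L2_norm S (\<lambda>x. c * f x) = cmod c * L2_norm S f"
  by (simp add: L2_norm_def norm_mult power_mult_distrib real_sqrt_mult)

lemma L2_norm_zero [simp]: "L2_norm S (\<lambda>x. 0) = 0"
  by (simp add: L2_norm_def)

lemma L2_product_integrable:
  assumes "f \<in> L2 S" "g \<in> L2 S"
  shows "integrable (lebesgue_on S) (\<lambda>x. cmod (f x) * cmod (g x))"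
proof (rule Bochner_Integration.integrable_bound)
  show "integrable (lebesgue_on S) (\<lambda>x. (cmod (f x))\<^sup>2 + (cmod (g x))\<^sup>2)"
    using assms by (auto simp: L2_def)
  have "cmod (f x) * cmod (g x) \<le> (cmod (f x))\<^sup>2 + (cmod (g x))\<^sup>2" for x
    using zero_le_power2[of "cmod (f x) - cmod (g x)"] mult_nonneg_nonneg[OF norm_ge_zero norm_ge_zero, of "f x" "g x"]
    unfolding power2_diff mult.assoc by linarith
  then show "AE x in lebesgue_on S. norm (cmod (f x) * cmod (g x)) \<le> norm ((cmod (f x))\<^sup>2 + (cmod (g x))\<^sup>2)"
    by simp
qed (use assms in \<open>auto simp: L2_def\<close>)

lemma L2_Cauchy_Schwarz:
  assumes "f \<in> L2 S" "g \<in> L2 S"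
  shows "(LINT x|lebesgue_on S. cmod (f x) * cmod (g x)) \<le> L2_norm S f * L2_norm S g"
proof (cases "L2_norm S f = 0 \<or> L2_norm S g = 0")
  case True
  then have "(AE x in lebesgue_on S. f x = 0) \<or> (AE x in lebesgue_on S. g x = 0)"
    using L2_norm_eq_0_iff assms by blast
  then have "AE x in lebesgue_on S. cmod (f x) * cmod (g x) = 0"
    by (auto elim: eventually_mono)
  then have "(LINT x|lebesgue_on S. cmod (f x) * cmod (g x)) = 0" by (rule integral_eq_zero_AE)
  then show ?thesis by simp
next
  case False
  define a b where "a = L2_norm S f" and "b = L2_norm S g"
  have ab: "a > 0" "b > 0" using False by (auto simp: a_def b_def less_le)
  have i: "integrable (lebesgue_on S) (\<lambda>x. (cmod (f x))\<^sup>2)" "integrable (lebesgue_on S) (\<lambda>x. (cmod (g x))\<^sup>2)"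
    using assms by (auto simp: L2_def)
  have "(LINT x|lebesgue_on S. cmod (f x) * cmod (g x)) \<le>
    (LINT x|lebesgue_on S. b / (2 * a) * (cmod (f x))\<^sup>2 + a / (2 * b) * (cmod (g x))\<^sup>2)"
  proof (rule integral_mono)
    show "integrable (lebesgue_on S) (\<lambda>x. b / (2 * a) * (cmod (f x))\<^sup>2 + a / (2 * b) * (cmod (g x))\<^sup>2)"
      using i by simp
    fix x
    have "0 \<le> (b * cmod (f x) - a * cmod (g x))\<^sup>2" by simp
    then have "2 * a * b * (cmod (f x) * cmod (g x)) \<le> b\<^sup>2 * (cmod (f x))\<^sup>2 + a\<^sup>2 * (cmod (g x))\<^sup>2"
      by (simp add: power2_diff power_mult_distrib algebra_simps)
    then show "cmod (f x) * cmod (g x) \<le> b / (2 * a) * (cmod (f x))\<^sup>2 + a / (2 * b) * (cmod (g x))\<^sup>2"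
      using ab by (simp add: field_simps power2_eq_square)
  qed (rule L2_product_integrable[OF assms])
  also have "\<dots> = b / (2 * a) * a\<^sup>2 + a / (2 * b) * b\<^sup>2"
    using i by (simp add: a_def b_def L2_norm_square)
  also have "\<dots> = a * b" using ab by (simp add: field_simps power2_eq_square)
  finally show ?thesis by (simp add: a_def b_def)
qed

lemma L2_norm_triangle:
  assumes "f \<in> L2 S" "g \<in> L2 S"
  shows "L2_norm S (\<lambda>x. f x + g x) \<le> L2_norm S f + L2_norm S g"
proof (rule power2_le_imp_le)
  have i: "integrable (lebesgue_on S) (\<lambda>x. (cmod (f x))\<^sup>2)" "integrable (lebesgue_on S) (\<lambda>x. (cmod (g x))\<^sup>2)"
    using assms by (auto simp: L2_def)
  note p = L2_product_integrable[OF assms]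
  have "(L2_norm S (\<lambda>x. f x + g x))\<^sup>2 = (LINT x|lebesgue_on S. (cmod (f x + g x))\<^sup>2)"
    by (rule L2_norm_square)
  also have "\<dots> \<le> (LINT x|lebesgue_on S. (cmod (f x))\<^sup>2 + (cmod (g x))\<^sup>2 + 2 * (cmod (f x) * cmod (g x)))"
  proof (rule integral_mono)
    show "integrable (lebesgue_on S) (\<lambda>x. (cmod (f x + g x))\<^sup>2)"
      using L2_add[OF assms] by (simp add: L2_def)
    show "integrable (lebesgue_on S) (\<lambda>x. (cmod (f x))\<^sup>2 + (cmod (g x))\<^sup>2 + 2 * (cmod (f x) * cmod (g x)))"
      using i p by simp
    fix x
    have "(cmod (f x + g x))\<^sup>2 \<le> (cmod (f x) + cmod (g x))\<^sup>2"
      by (intro power_mono norm_triangle_ineq) auto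
    then show "(cmod (f x + g x))\<^sup>2 \<le> (cmod (f x))\<^sup>2 + (cmod (g x))\<^sup>2 + 2 * (cmod (f x) * cmod (g x))"
      by (simp add: power2_sum)
  qed
  also have "\<dots> = (L2_norm S f)\<^sup>2 + (L2_norm S g)\<^sup>2 + 2 * (LINT x|lebesgue_on S. cmod (f x) * cmod (g x))"
    using i p by (simp add: L2_norm_square)
  also have "\<dots> \<le> (L2_norm S f + L2_norm S g)\<^sup>2"
    using L2_Cauchy_Schwarz[OF assms] by (simp add: power2_sum)
  finally show "(L2_norm S (\<lambda>x. f x + g x))\<^sup>2 \<le> (L2_norm S f + L2_norm S g)\<^sup>2" .
qed simp

lemma L2_norm_minus: "L2_norm S (\<lambda>x. - f x) = L2_norm S f"
  by (simp add: L2_norm_def)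

lemma L2_norm_triangle_diff:
  assumes "f \<in> L2 S" "g \<in> L2 S"
  shows "L2_norm S (\<lambda>x. f x - g x) \<le> L2_norm S f + L2_norm S g"
  using L2_norm_triangle[OF assms(1) L2_cmult[OF assms(2), of "-1"]] L2_norm_minus[of S g] by simp

lemma L2_norm_sum_le:
  assumes "\<And>i. i \<in> I \<Longrightarrow> f i \<in> L2 S"
  shows "L2_norm S (\<lambda>x. \<Sum>i\<in>I. f i x) \<le> (\<Sum>i\<in>I. L2_norm S (f i))"
  using assms
proof (induction I rule: infinite_finite_induct)
  case (insert i I)
  have "L2_norm S (\<lambda>x. f i x + (\<Sum>i\<in>I. f i x)) \<le> L2_norm S (f i) + L2_norm S (\<lambda>x. \<Sum>i\<in>I. f i x)"
    using insert.prems by (intro L2_norm_triangle L2_sum) auto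
  then show ?case using insert by force
qed auto

lemma finite_measure_interval: "finite_measure (lebesgue_on {a<..<b::real})"
  using lmeasurable_box[of a b] by (intro finite_measure_lebesgue_on) simp

lemma L2_bounded:
  assumes "f \<in> borel_measurable (lebesgue_on {a<..<b})" "\<And>x. x \<in> {a<..<b} \<Longrightarrow> cmod (f x) \<le> B"
    and "a \<le> b"
  shows "f \<in> L2 {a<..<b}" "L2_norm {a<..<b} f \<le> sqrt (b - a) * B"
proof -
  interpret finite_measure "lebesgue_on {a<..<b}" by (rule finite_measure_interval)
  have le: "(cmod (f x))\<^sup>2 \<le> B\<^sup>2" if "x \<in> {a<..<b}" for x
    using assms(2)[OF that] by (intro power_mono) auto
  show 1: "f \<in> L2 {a<..<b}"
    by (rule L2_dominated[OF assms(1), of "\<lambda>x. B\<^sup>2"]) (use le in \<open>auto intro!: AE_I2\<close>)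
  show "L2_norm {a<..<b} f \<le> sqrt (b - a) * B"
  proof (cases "a = b")
    case True then show ?thesis by (simp add: L2_norm_def)
  next
    case False
    then have "(a + b) / 2 \<in> {a<..<b}" using assms(3) by auto
    then have B: "B \<ge> 0" using assms(2) norm_ge_zero order_trans by blast
    have "(LINT x|lebesgue_on {a<..<b}. (cmod (f x))\<^sup>2) \<le> (LINT x|lebesgue_on {a<..<b}. B\<^sup>2)"
      using 1 le by (intro integral_mono) (auto simp: L2_def)
    also have "\<dots> = B\<^sup>2 * (b - a)" using assms(3) by (simp add: measure_restrict_space)
    finally have "L2_norm {a<..<b} f \<le> sqrt (B\<^sup>2 * (b - a))" unfolding L2_norm_def by (rule real_sqrt_le_mono)
    then show ?thesis using B by (simp add: real_sqrt_mult mult.commute)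
  qed
qed

lemma L2_integrable_interval:
  assumes "f \<in> L2 {a<..<b}" "a \<le> b"
  shows "integrable (lebesgue_on {a<..<b}) f" 
    "(LINT x|lebesgue_on {a<..<b}. cmod (f x)) \<le> sqrt (b - a) * L2_norm {a<..<b} f"
proof -
  have 1: "(\<lambda>x. 1) \<in> L2 {a<..<b}" "L2_norm {a<..<b} (\<lambda>x. 1) \<le> sqrt (b - a)"
    using L2_bounded[of "\<lambda>x. 1" a b 1] assms(2) by auto
  from L2_product_integrable[OF assms(1) 1(1)] have "integrable (lebesgue_on {a<..<b}) (\<lambda>x. cmod (f x))" by simp
  then show "integrable (lebesgue_on {a<..<b}) f"
    using integrable_norm_cancel L2_measurable[OF assms(1)] by blast
  have "(LINT x|lebesgue_on {a<..<b}. cmod (f x)) \<le> L2_norm {a<..<b} f * L2_norm {a<..<b} (\<lambda>x. 1)"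
    using L2_Cauchy_Schwarz[OF assms(1) 1(1)] by simp
  also have "\<dots> \<le> L2_norm {a<..<b} f * sqrt (b - a)" using 1(2) by (intro mult_left_mono) auto
  finally show "(LINT x|lebesgue_on {a<..<b}. cmod (f x)) \<le> sqrt (b - a) * L2_norm {a<..<b} f" by (simp add: mult.commute)
qed

lemma L2_absolutely_integrable:
  assumes "f \<in> L2 {a<..<b}" "a \<le> b"
  shows "f absolutely_integrable_on {a..b}"
  using L2_integrable_interval(1)[OF assms]
  unfolding absolutely_integrable_on_Icc_iff_Ioo
  by (simp add: integrable_restrict_space set_integrable_def)

text \<open>
The form of completeness needed for Neumann series. Normal convergence in \<open>L2\<close> implies pointwise absolute
convergence almost everywhere, and Fatou's lemma estimates the tails.
\<close>

lemma L2_series_complete: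
  assumes h: "\<And>n. h n \<in> L2 {a<..<b}" "\<And>n. L2_norm {a<..<b} (h n) \<le> c n" and "summable c" and ab: "a \<le> b"
  obtains f where "f \<in> L2 {a<..<b}"
    "\<And>n. L2_norm {a<..<b} (\<lambda>x. f x - (\<Sum>k<n. h k x)) \<le> (\<Sum>k. c (k + n))"
proof -
  let ?J = "{a<..<b}" let ?M = "lebesgue_on {a<..<b}"
  have c0: "c n \<ge> 0" for n using h(2)[of n] L2_norm_nonneg order_trans by blast
  have hm[measurable]: "h n \<in> borel_measurable ?M" for n using h(1) by (rule L2_measurable)
  have "(\<integral>\<^sup>+x. (\<Sum>n. ennreal (cmod (h n x))) \<partial>?M) = (\<Sum>n. \<integral>\<^sup>+x. ennreal (cmod (h n x)) \<partial>?M)"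
    by (rule nn_integral_suminf) auto
  also have "\<dots> \<le> (\<Sum>n. ennreal (sqrt (b - a) * c n))"
  proof (intro suminf_le summableI)
    fix n
    have "(\<integral>\<^sup>+x. ennreal (cmod (h n x)) \<partial>?M) = ennreal (LINT x|?M. cmod (h n x))"
      using L2_integrable_interval(1)[OF h(1) ab, of n] by (intro nn_integral_eq_integral) auto
    also have "\<dots> \<le> ennreal (sqrt (b - a) * c n)"
      using order_trans[OF L2_integrable_interval(2)[OF h(1) ab] mult_left_mono[OF h(2)]] ab by (intro ennreal_leI) auto
    finally show "(\<integral>\<^sup>+x. ennreal (cmod (h n x)) \<partial>?M) \<le> ennreal (sqrt (b - a) * c n)" .
  qed
  also have "\<dots> = ennreal (\<Sum>n. sqrt (b - a) * c n)"
    using ab c0 \<open>summable c\<close> by (intro suminf_ennreal2) auto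
  finally have "(\<integral>\<^sup>+x. (\<Sum>n. ennreal (cmod (h n x))) \<partial>?M) \<noteq> \<infinity>"
    by (metis ennreal_less_top infinity_ennreal_def leD top.not_eq_extremum)
  then have "AE x in ?M. (\<Sum>n. ennreal (cmod (h n x))) \<noteq> \<infinity>"
    by (intro nn_integral_noteq_infinite) auto
  then have summ: "AE x in ?M. summable (\<lambda>n. h n x)"
  proof (eventually_elim)
    case (elim x)
    then have "summable (\<lambda>n. norm (h n x))" by (intro summable_suminf_not_top) auto
    then show ?case by (rule summable_norm_cancel)
  qed
  define f where "f = (\<lambda>x. \<Sum>n. h n x)"
  have fm[measurable]: "f \<in> borel_measurable ?M" unfolding f_def by (intro borel_measurable_suminf hm)
  define T where "T = (\<lambda>n. \<Sum>k. c (k + n))"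
  have T0: "T n \<ge> 0" for n unfolding T_def using c0 \<open>summable c\<close> by (intro suminf_nonneg) (auto simp: summable_iff_shift)
  have key: "(\<integral>\<^sup>+x. ennreal ((cmod (f x - (\<Sum>k<n. h k x)))\<^sup>2) \<partial>?M) \<le> ennreal ((T n)\<^sup>2)" for n
  proof -
    define g where "g = (\<lambda>m x. \<Sum>k<m. h (k + n) x)"
    have g_L2: "g m \<in> L2 ?J" for m unfolding g_def using h(1) by (intro L2_sum) auto
    have gm[measurable]: "g m \<in> borel_measurable ?M" for m using g_L2 by (rule L2_measurable)
    have "L2_norm ?J (g m) \<le> T n" for m
    proof -
      have "L2_norm ?J (g m) \<le> (\<Sum>k<m. L2_norm ?J (h (k + n)))"
        unfolding g_def using h(1) by (intro L2_norm_sum_le) auto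
      also have "\<dots> \<le> (\<Sum>k<m. c (k + n))" by (intro sum_mono h)
      also have "\<dots> \<le> T n" unfolding T_def using c0 \<open>summable c\<close>
        by (intro sum_le_suminf) (auto simp: summable_iff_shift)
      finally show ?thesis .
    qed
    then have g_int: "(\<integral>\<^sup>+x. ennreal ((cmod (g m x))\<^sup>2) \<partial>?M) \<le> ennreal ((T n)\<^sup>2)" for m
    proof -
      have "(\<integral>\<^sup>+x. ennreal ((cmod (g m x))\<^sup>2) \<partial>?M) = ennreal ((L2_norm ?J (g m))\<^sup>2)"
        unfolding L2_norm_square using g_L2 by (intro nn_integral_eq_integral) (auto simp: L2_def)
      also have "\<dots> \<le> ennreal ((T n)\<^sup>2)" using \<open>L2_norm ?J (g m) \<le> T n\<close> by (intro ennreal_leI power_mono) auto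
      finally show ?thesis .
    qed
    have "(\<integral>\<^sup>+x. ennreal ((cmod (f x - (\<Sum>k<n. h k x)))\<^sup>2) \<partial>?M) = (\<integral>\<^sup>+x. liminf (\<lambda>m. ennreal ((cmod (g m x))\<^sup>2)) \<partial>?M)"
    proof (rule nn_integral_cong_AE, use summ in eventually_elim)
      case (elim x)
      have "(\<lambda>k. h (k + n) x) sums (f x - (\<Sum>k<n. h k x))"
        unfolding f_def using elim by (intro sums_iff_shift[THEN iffD2]) (simp add: summable_sums)
      then have "(\<lambda>m. g m x) \<longlonglongrightarrow> f x - (\<Sum>k<n. h k x)" by (simp add: g_def sums_def)
      then have "(\<lambda>m. ennreal ((cmod (g m x))\<^sup>2)) \<longlonglongrightarrow> ennreal ((cmod (f x - (\<Sum>k<n. h k x)))\<^sup>2)"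
        by (intro tendsto_intros) 
      then show ?case by (intro lim_imp_Liminf[symmetric]) auto
    qed
    also have "\<dots> \<le> liminf (\<lambda>m. \<integral>\<^sup>+x. ennreal ((cmod (g m x))\<^sup>2) \<partial>?M)"
      by (rule nn_integral_liminf) auto
    also have "\<dots> \<le> limsup (\<lambda>m. \<integral>\<^sup>+x. ennreal ((cmod (g m x))\<^sup>2) \<partial>?M)"
      by (rule Liminf_le_Limsup) auto
    also have "\<dots> \<le> ennreal ((T n)\<^sup>2)" using g_int by (intro Limsup_bounded) auto
    finally show ?thesis .
  qed
  have int: "integrable ?M (\<lambda>x. (cmod (f x - (\<Sum>k<n. h k x)))\<^sup>2)" for n
    using key[of n] by (intro integrableI_bounded) (auto simp: le_less_trans)
  have "f \<in> L2 ?J" using int[of 0] by (simp add: L2_def)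
  moreover have "L2_norm ?J (\<lambda>x. f x - (\<Sum>k<n. h k x)) \<le> T n" for n
  proof -
    have "ennreal (LINT x|?M. (cmod (f x - (\<Sum>k<n. h k x)))\<^sup>2) \<le> ennreal ((T n)\<^sup>2)"
      using key[of n] nn_integral_eq_integral[OF int[of n]] by simp
    then have "(LINT x|?M. (cmod (f x - (\<Sum>k<n. h k x)))\<^sup>2) \<le> (T n)\<^sup>2" by (simp add: ennreal_le_iff)
    then show ?thesis unfolding L2_norm_def using T0[of n] real_le_lsqrt by simp
  qed
  ultimately show ?thesis using that unfolding T_def by blast
qed

section \<open>Neumann series depending holomorphically on a parameter\<close>

text \<open>
Operators act on functions rather than on classes, hence linearity is required only almost everywhere.
Applied to functions with equal classes it gives results with equal classes, by the bound on the norm.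
\<close>

definition bounded_operator :: "real set \<Rightarrow> ((real \<Rightarrow> complex) \<Rightarrow> (real \<Rightarrow> complex)) \<Rightarrow> bool" where
  "bounded_operator S T \<longleftrightarrow> (\<forall>f\<in>L2 S. T f \<in> L2 S) \<and> (\<exists>k. \<forall>f\<in>L2 S. L2_norm S (T f) \<le> k * L2_norm S f) \<and>
     (\<forall>f\<in>L2 S. \<forall>g\<in>L2 S. \<forall>c. AE x in lebesgue_on S. T (\<lambda>y. f y + c * g y) x = T f x + c * T g x)"

definition bounded_functional :: "real set \<Rightarrow> ((real \<Rightarrow> complex) \<Rightarrow> complex) \<Rightarrow> bool" where
  "bounded_functional S l \<longleftrightarrow> (\<exists>k. \<forall>f\<in>L2 S. cmod (l f) \<le> k * L2_norm S f) \<and>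
     (\<forall>f\<in>L2 S. \<forall>g\<in>L2 S. \<forall>c. l (\<lambda>y. f y + c * g y) = l f + c * l g)"

lemma bounded_operator_diff_bound:
  assumes "bounded_operator S T"
  obtains k where "k \<ge> 0" "\<And>f g. f \<in> L2 S \<Longrightarrow> g \<in> L2 S \<Longrightarrow>
     L2_norm S (\<lambda>x. T f x - T g x) \<le> k * L2_norm S (\<lambda>x. f x - g x)"
proof -
  obtain k where k: "\<And>f. f \<in> L2 S \<Longrightarrow> L2_norm S (T f) \<le> k * L2_norm S f"
    using assms unfolding bounded_operator_def by blast
  have "L2_norm S (\<lambda>x. T f x - T g x) \<le> max k 0 * L2_norm S (\<lambda>x. f x - g x)"
    if fg: "f \<in> L2 S" "g \<in> L2 S" for f g
  proof -
    have "AE x in lebesgue_on S. T (\<lambda>y. f y + (-1) * g y) x = T f x + (-1) * T g x"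
      using assms fg unfolding bounded_operator_def by blast
    then have "AE x in lebesgue_on S. T f x - T g x = T (\<lambda>y. f y - g y) x"
      by (auto elim: eventually_mono)
    then have "L2_norm S (\<lambda>x. T f x - T g x) = L2_norm S (T (\<lambda>y. f y - g y))"
      using assms fg unfolding bounded_operator_def by (intro L2_norm_AE_cong L2_diff) (auto intro: L2_diff)
    also have "\<dots> \<le> k * L2_norm S (\<lambda>x. f x - g x)" using fg by (intro k L2_diff)
    also have "\<dots> \<le> max k 0 * L2_norm S (\<lambda>x. f x - g x)" by (intro mult_right_mono) auto
    finally show ?thesis .
  qed
  then show ?thesis using that[of "max k 0"] by auto
qed

lemma bounded_functional_diff_bound:
  assumes "bounded_functional S l"
  obtains k where "k \<ge> 0" "\<And>f g. f \<in> L2 S \<Longrightarrow> g \<in> L2 S \<Longrightarrow>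
     cmod (l f - l g) \<le> k * L2_norm S (\<lambda>x. f x - g x)"
proof -
  obtain k where k: "\<And>f. f \<in> L2 S \<Longrightarrow> cmod (l f) \<le> k * L2_norm S f"
    using assms unfolding bounded_functional_def by blast
  have "cmod (l f - l g) \<le> max k 0 * L2_norm S (\<lambda>x. f x - g x)"
    if fg: "f \<in> L2 S" "g \<in> L2 S" for f g
  proof -
    have "l (\<lambda>y. f y + (-1) * g y) = l f + (-1) * l g"
      using assms fg unfolding bounded_functional_def by blast
    then have "cmod (l f - l g) = cmod (l (\<lambda>y. f y - g y))" by simp
    also have "\<dots> \<le> k * L2_norm S (\<lambda>x. f x - g x)" using fg by (intro k L2_diff)
    also have "\<dots> \<le> max k 0 * L2_norm S (\<lambda>x. f x - g x)" by (intro mult_right_mono) auto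
    finally show ?thesis .
  qed
  then show ?thesis using that[of "max k 0"] by auto
qed

lemma bounded_functional_cong:
  assumes "bounded_functional S l" "f \<in> L2 S" "g \<in> L2 S" "AE x in lebesgue_on S. f x = g x"
  shows "l f = l g"
proof -
  obtain k where k: "\<And>f g. f \<in> L2 S \<Longrightarrow> g \<in> L2 S \<Longrightarrow>
     cmod (l f - l g) \<le> k * L2_norm S (\<lambda>x. f x - g x)"
    using bounded_functional_diff_bound[OF assms(1)] by metis
  have "L2_norm S (\<lambda>x. f x - g x) = 0"
    using assms by (subst L2_norm_eq_0_iff) (auto intro: L2_diff elim: eventually_mono)
  then show ?thesis using k[OF assms(2,3)] by simp
qed

lemma bounded_functional_comp:
  assumes l: "bounded_functional S l" and T: "bounded_operator S T"
  shows "bounded_functional S (\<lambda>f. l (T f))"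
proof -
  obtain k where k: "\<And>f. f \<in> L2 S \<Longrightarrow> cmod (l f) \<le> k * L2_norm S f"
    using l unfolding bounded_functional_def by blast
  obtain k' where k': "\<And>f. f \<in> L2 S \<Longrightarrow> L2_norm S (T f) \<le> k' * L2_norm S f"
    using T unfolding bounded_operator_def by blast
  have TL: "T f \<in> L2 S" if "f \<in> L2 S" for f using T that unfolding bounded_operator_def by blast
  have "cmod (l (T f)) \<le> (max k 0 * k') * L2_norm S f" if "f \<in> L2 S" for f
  proof -
    have "cmod (l (T f)) \<le> max k 0 * L2_norm S (T f)"
      using k[OF TL[OF that]] by (smt (verit) L2_norm_nonneg mult_right_mono)
    also have "\<dots> \<le> max k 0 * (k' * L2_norm S f)" using k'[OF that] by (intro mult_left_mono) auto
    finally show ?thesis by (simp add: mult.assoc)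
  qed
  moreover have "l (T (\<lambda>y. f y + c * g y)) = l (T f) + c * l (T g)" if fg: "f \<in> L2 S" "g \<in> L2 S" for f g c
  proof -
    have "AE x in lebesgue_on S. T (\<lambda>y. f y + c * g y) x = T f x + c * T g x"
      using T fg unfolding bounded_operator_def by blast
    then have "l (T (\<lambda>y. f y + c * g y)) = l (\<lambda>x. T f x + c * T g x)"
      using fg by (intro bounded_functional_cong[OF l] TL L2_lincomb) auto
    also have "\<dots> = l (T f) + c * l (T g)"
      using l TL fg unfolding bounded_functional_def by blast
    finally show ?thesis .
  qed
  ultimately show ?thesis unfolding bounded_functional_def by blast
qed

fun neumann_iterate :: "((real \<Rightarrow> complex) \<Rightarrow> (real \<Rightarrow> complex)) \<Rightarrow> ((real \<Rightarrow> complex) \<Rightarrow> (real \<Rightarrow> complex)) \<Rightarrow>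
    (real \<Rightarrow> complex) \<Rightarrow> (real \<Rightarrow> complex) \<Rightarrow> complex \<Rightarrow> nat \<Rightarrow> real \<Rightarrow> complex" where
  "neumann_iterate A B g0 g1 z 0 = (\<lambda>x. g0 x + z * g1 x)"
| "neumann_iterate A B g0 g1 z (Suc n) =
     (\<lambda>x. A (neumann_iterate A B g0 g1 z n) x + z * B (neumann_iterate A B g0 g1 z n) x)"

text \<open>
Iterating \<open>f \<mapsto> g0 + z g1 + A f + z B f\<close> gives a series of terms polynomial in \<open>z\<close>. A summable bound uniform in \<open>z\<close>
makes every bounded functional of the sum a locally uniform limit of polynomials. Holomorphy is stated through
functionals to avoid holomorphic functions with values in \<open>L2\<close>.
\<close>

lemma neumann_series:
  assumes A: "bounded_operator {a<..<b} A" and B: "bounded_operator {a<..<b} B"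
    and g: "g0 \<in> L2 {a<..<b}" "g1 \<in> L2 {a<..<b}" and ab: "a \<le> b" and "open D"
    and c: "\<And>z n. z \<in> D \<Longrightarrow> L2_norm {a<..<b} (neumann_iterate A B g0 g1 z n) \<le> c n" and "summable c"
  obtains f where "\<And>z. z \<in> D \<Longrightarrow> f z \<in> L2 {a<..<b}"
    "\<And>z. z \<in> D \<Longrightarrow> AE x in lebesgue_on {a<..<b}. f z x = g0 x + z * g1 x + A (f z) x + z * B (f z) x"
    "\<And>l. bounded_functional {a<..<b} l \<Longrightarrow> (\<lambda>z. l (f z)) holomorphic_on D"
proof -
  let ?J = "{a<..<b}" let ?M = "lebesgue_on {a<..<b}"
  define it where "it = neumann_iterate A B g0 g1"
  have AL: "A h \<in> L2 ?J" "B h \<in> L2 ?J" if "h \<in> L2 ?J" for h using A B that unfolding bounded_operator_def by auto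
  have linA: "AE x in ?M. A (\<lambda>y. h y + c * h' y) x = A h x + c * A h' x" if "h \<in> L2 ?J" "h' \<in> L2 ?J" for h h' c
    using A that unfolding bounded_operator_def by blast
  have linB: "AE x in ?M. B (\<lambda>y. h y + c * h' y) x = B h x + c * B h' x" if "h \<in> L2 ?J" "h' \<in> L2 ?J" for h h' c
    using B that unfolding bounded_operator_def by blast
  have it0: "it z 0 = (\<lambda>x. g0 x + z * g1 x)" and itS: "it z (Suc n) = (\<lambda>x. A (it z n) x + z * B (it z n) x)" for z n
    by (auto simp: it_def)
  have itL: "it z n \<in> L2 ?J" for z n
  proof (induction n)
    case 0 show ?case unfolding it0 by (intro L2_lincomb g)
  next
    case (Suc n) then show ?case unfolding itS by (intro L2_lincomb AL)
  qed
  define P where "P = (\<lambda>z n x. \<Sum>k<n. it z k x)"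
  have PL: "P z n \<in> L2 ?J" for z n unfolding P_def by (intro L2_sum itL)
  define T where "T = (\<lambda>n. \<Sum>k. c (k + n))"
  have T_lim: "T \<longlonglongrightarrow> 0"
    unfolding T_def using \<open>summable c\<close> by (rule suminf_exist_split2)
  have "\<exists>h. h \<in> L2 ?J \<and> (\<forall>n. L2_norm ?J (\<lambda>x. h x - P z n x) \<le> T n)" if z: "z \<in> D" for z
  proof -
    obtain h where "h \<in> L2 ?J" "\<And>n. L2_norm ?J (\<lambda>x. h x - (\<Sum>k<n. it z k x)) \<le> (\<Sum>k. c (k + n))"
      using L2_series_complete[of "it z" a b c] itL c[OF z] \<open>summable c\<close> ab unfolding it_def by metis
    then show ?thesis unfolding P_def T_def by blast
  qed
  then obtain f where f: "\<And>z. z \<in> D \<Longrightarrow> f z \<in> L2 ?J" "\<And>z n. z \<in> D \<Longrightarrow> L2_norm ?J (\<lambda>x. f z x - P z n x) \<le> T n"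
    by metis
  \<comment> \<open>The partial sums satisfy the fixed point equation up to a shift of the index.\<close>
  have P_rec: "AE x in ?M. P z (Suc n) x = g0 x + z * g1 x + A (P z n) x + z * B (P z n) x" for z n
  proof (induction n)
    case 0
    have Z: "AE x in ?M. A (\<lambda>x. 0) x = 0" "AE x in ?M. B (\<lambda>x. 0) x = 0"
    proof -
      have "AE x in ?M. A (\<lambda>y. 0 + 1 * 0) x = A (\<lambda>x. 0) x + 1 * A (\<lambda>x. 0) x"
        by (rule linA[OF L2_zero L2_zero])
      moreover have "AE x in ?M. B (\<lambda>y. 0 + 1 * 0) x = B (\<lambda>x. 0) x + 1 * B (\<lambda>x. 0) x"
        by (rule linB[OF L2_zero L2_zero])
      ultimately show "AE x in ?M. A (\<lambda>x. 0) x = 0" "AE x in ?M. B (\<lambda>x. 0) x = 0" by auto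
    qed
    show ?case unfolding P_def using Z by eventually_elim (simp add: it0)
  next
    case (Suc n)
    have "P z (Suc n) = (\<lambda>y. P z n y + 1 * it z n y)" by (simp add: P_def)
    then have "AE x in ?M. A (P z (Suc n)) x = A (P z n) x + 1 * A (it z n) x"
      "AE x in ?M. B (P z (Suc n)) x = B (P z n) x + 1 * B (it z n) x"
      using linA[OF PL itL, of z n 1 z n] linB[OF PL itL, of z n 1 z n] by simp_all
    with Suc show ?case
    proof eventually_elim
      case (elim x)
      have "P z (Suc (Suc n)) x = P z (Suc n) x + it z (Suc n) x" by (simp add: P_def)
      then show ?case using elim by (simp add: itS algebra_simps)
    qed
  qed
  have fix_eq: "AE x in ?M. f z x = g0 x + z * g1 x + A (f z) x + z * B (f z) x" if z: "z \<in> D" for z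
  proof -
    obtain kA where kA: "kA \<ge> 0" "\<And>f g. f \<in> L2 ?J \<Longrightarrow> g \<in> L2 ?J \<Longrightarrow>
     L2_norm ?J (\<lambda>x. A f x - A g x) \<le> kA * L2_norm ?J (\<lambda>x. f x - g x)" by (rule bounded_operator_diff_bound[OF A]) blast
    obtain kB where kB: "kB \<ge> 0" "\<And>f g. f \<in> L2 ?J \<Longrightarrow> g \<in> L2 ?J \<Longrightarrow>
     L2_norm ?J (\<lambda>x. B f x - B g x) \<le> kB * L2_norm ?J (\<lambda>x. f x - g x)" by (rule bounded_operator_diff_bound[OF B]) blast
    define G where "G = (\<lambda>h x. g0 x + z * g1 x + A h x + z * B h x)"
    have GL: "G h \<in> L2 ?J" if "h \<in> L2 ?J" for h
      unfolding G_def by (intro L2_add L2_cmult g AL that)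
    have bound: "L2_norm ?J (\<lambda>x. f z x - G (f z) x) \<le> T (Suc n) + (kA + cmod z * kB) * T n" for n
    proof -
      let ?d1 = "\<lambda>x. f z x - P z (Suc n) x" let ?d2 = "\<lambda>x. A (f z) x - A (P z n) x" let ?d3 = "\<lambda>x. z * (B (f z) x - B (P z n) x)"
      have L: "?d1 \<in> L2 ?J" "?d2 \<in> L2 ?J" "?d3 \<in> L2 ?J"
        using f(1)[OF z] PL AL by (auto intro!: L2_diff L2_cmult)
      have "AE x in ?M. f z x - G (f z) x = ?d1 x - (?d2 x + ?d3 x)"
        using P_rec[of z n] by eventually_elim (simp add: G_def algebra_simps)
      then have "L2_norm ?J (\<lambda>x. f z x - G (f z) x) = L2_norm ?J (\<lambda>x. ?d1 x - (?d2 x + ?d3 x))"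
        by (intro L2_norm_AE_cong L2_diff[OF f(1)[OF z] GL[OF f(1)[OF z]]] L2_diff[OF L(1) L2_add[OF L(2,3)]])
      also have "\<dots> \<le> L2_norm ?J ?d1 + (L2_norm ?J ?d2 + L2_norm ?J ?d3)"
        using L2_norm_triangle_diff[OF L(1) L2_add[OF L(2,3)]] L2_norm_triangle[OF L(2,3)] by linarith
      also have "L2_norm ?J ?d1 \<le> T (Suc n)" by (rule f(2)[OF z])
      also have "L2_norm ?J ?d2 \<le> kA * T n"
        using kA(2)[OF f(1)[OF z] PL[of z n]] mult_left_mono[OF f(2)[OF z, of n] kA(1)] by linarith
      also have "L2_norm ?J ?d3 \<le> cmod z * (kB * T n)"
        using kB(2)[OF f(1)[OF z] PL[of z n]] mult_left_mono[OF f(2)[OF z, of n] kB(1)]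
        unfolding L2_norm_cmult by (intro mult_left_mono) auto
      finally show ?thesis by (simp add: algebra_simps)
    qed
    have "(\<lambda>n. T (Suc n) + (kA + cmod z * kB) * T n) \<longlonglongrightarrow> 0 + (kA + cmod z * kB) * 0"
      by (intro tendsto_intros T_lim LIMSEQ_Suc)
    then have "L2_norm ?J (\<lambda>x. f z x - G (f z) x) \<le> 0"
      using bound by (intro LIMSEQ_le_const) auto
    then have "L2_norm ?J (\<lambda>x. f z x - G (f z) x) = 0" by (simp add: order_antisym)
    then have "AE x in ?M. f z x - G (f z) x = 0"
      by (subst (asm) L2_norm_eq_0_iff) (auto intro: L2_diff f z GL)
    then show ?thesis by (auto simp: G_def elim: eventually_mono)
  qed
  have hol_it: "(\<lambda>z. l (it z n)) holomorphic_on D" if "bounded_functional ?J l" for l n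
    using that
  proof (induction n arbitrary: l)
    case 0
    have "l (it z 0) = l g0 + z * l g1" for z
      using 0 g unfolding bounded_functional_def it0 by blast
    then show ?case by (auto intro!: holomorphic_intros)
  next
    case (Suc n)
    have "l (it z (Suc n)) = l (A (it z n)) + z * l (B (it z n))" for z
      using Suc.prems AL itL unfolding bounded_functional_def itS by blast
    then show ?case
      using Suc.IH[OF bounded_functional_comp[OF Suc.prems A]] Suc.IH[OF bounded_functional_comp[OF Suc.prems B]]
      by (auto intro!: holomorphic_intros)
  qed
  have hol: "(\<lambda>z. l (f z)) holomorphic_on D" if l: "bounded_functional ?J l" for l
  proof (rule holomorphic_uniform_sequence[OF \<open>open D\<close>])
    show "(\<lambda>z. \<Sum>k<n. l (it z k)) holomorphic_on D" for n
      by (intro holomorphic_on_sum hol_it l)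
    fix w assume w: "w \<in> D"
    then obtain d where d: "d > 0" "cball w d \<subseteq> D" using \<open>open D\<close> open_contains_cball_eq by blast
    obtain k where k: "k \<ge> 0" "\<And>f g. f \<in> L2 ?J \<Longrightarrow> g \<in> L2 ?J \<Longrightarrow>
     cmod (l f - l g) \<le> k * L2_norm ?J (\<lambda>x. f x - g x)" by (rule bounded_functional_diff_bound[OF l]) blast
    have linl: "l (\<lambda>y. h y + c * h' y) = l h + c * l h'" if "h \<in> L2 ?J" "h' \<in> L2 ?J" for h h' c
      using l that unfolding bounded_functional_def by blast
    have lP: "l (P z n) = (\<Sum>k<n. l (it z k))" for z n
    proof (induction n)
      case 0
      have "l (\<lambda>y. 0 + 1 * 0) = l (\<lambda>x. 0) + 1 * l (\<lambda>x. 0)" by (rule linl[OF L2_zero L2_zero])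
      then show ?case by (simp add: P_def)
    next
      case (Suc n)
      have "P z (Suc n) = (\<lambda>y. P z n y + 1 * it z n y)" by (simp add: P_def)
      then have "l (P z (Suc n)) = l (P z n) + 1 * l (it z n)"
        using linl[OF PL itL, of z n 1 z n] by simp
      then show ?case using Suc by simp
    qed
    have "uniform_limit (cball w d) (\<lambda>n z. \<Sum>k<n. l (it z k)) (\<lambda>z. l (f z)) sequentially"
    proof (rule uniform_limitI)
      fix e :: real assume "e > 0"
      have "(\<lambda>n. k * T n) \<longlonglongrightarrow> k * 0" by (intro tendsto_intros T_lim)
      then have "\<forall>\<^sub>F n in sequentially. k * T n < e" using \<open>e > 0\<close> order_tendstoD(2) by fastforce
      then show "\<forall>\<^sub>F n in sequentially. \<forall>z\<in>cball w d. dist (\<Sum>k<n. l (it z k)) (l (f z)) < e"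
      proof eventually_elim
        case (elim n)
        show ?case
        proof
          fix z assume "z \<in> cball w d"
          then have z: "z \<in> D" using d by auto
          have "cmod (l (f z) - l (P z n)) \<le> k * T n"
            using k(2)[OF f(1)[OF z] PL[of z n]] mult_left_mono[OF f(2)[OF z, of n] k(1)] by linarith
          then show "dist (\<Sum>k<n. l (it z k)) (l (f z)) < e"
            using elim unfolding lP by (simp add: dist_norm norm_minus_commute)
        qed
      qed
    qed
    then show "\<exists>d>0. cball w d \<subseteq> D \<and> uniform_limit (cball w d) (\<lambda>n z. \<Sum>k<n. l (it z k)) (\<lambda>z. l (f z)) sequentially"
      using d by blast
  qed
  show ?thesis by (rule that[OF f(1) fix_eq hol])
qed

section \<open>Determinants and finite-dimensional spans\<close>

text \<open>
Matrices are given as functions of their indices, so that entries can depend on parameters; only the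
determinant passes through the matrix type.
\<close>

definition kernel_det :: "nat \<Rightarrow> (nat \<Rightarrow> nat \<Rightarrow> complex) \<Rightarrow> complex" where
  "kernel_det n A = Determinant.det (Matrix.mat n n (\<lambda>(r, i). A r i))"

lemma kernel_det_eq_0_iff:
  "kernel_det n A = 0 \<longleftrightarrow> (\<exists>y. (\<exists>i<n. y i \<noteq> 0) \<and> (\<forall>r<n. (\<Sum>i<n. A r i * y i) = 0))"
proof -
  let ?M = "Matrix.mat n n (\<lambda>(r, i). A r i)"
  have M: "?M \<in> carrier_mat n n" by simp
  have ent: "vec_index (?M *\<^sub>v v) r = (\<Sum>i<n. A r i * vec_index v i)" if "v \<in> carrier_vec n" "r < n" for v r
    using that by (simp add: scalar_prod_def lessThan_atLeast0)
  have "(\<exists>v. v \<in> carrier_vec n \<and> v \<noteq> 0\<^sub>v n \<and> ?M *\<^sub>v v = 0\<^sub>v n) \<longleftrightarrow>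
    (\<exists>y. (\<exists>i<n. y i \<noteq> 0) \<and> (\<forall>r<n. (\<Sum>i<n. A r i * y i) = 0))"
  proof
    assume "\<exists>v. v \<in> carrier_vec n \<and> v \<noteq> 0\<^sub>v n \<and> ?M *\<^sub>v v = 0\<^sub>v n"
    then obtain v where v: "v \<in> carrier_vec n" "v \<noteq> 0\<^sub>v n" "?M *\<^sub>v v = 0\<^sub>v n" by blast
    have "\<exists>i<n. vec_index v i \<noteq> 0"
    proof (rule ccontr)
      assume "\<not> ?thesis"
      then have "v = 0\<^sub>v n" using v(1) by (intro eq_vecI) auto
      then show False using v by simp
    qed
    moreover have "(\<Sum>i<n. A r i * vec_index v i) = 0" if "r < n" for r
      using ent[OF v(1) that] v(3) that by simp
    ultimately show "\<exists>y. (\<exists>i<n. y i \<noteq> 0) \<and> (\<forall>r<n. (\<Sum>i<n. A r i * y i) = 0)"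
      by (intro exI[of _ "vec_index v"]) auto
  next
    assume "\<exists>y. (\<exists>i<n. y i \<noteq> 0) \<and> (\<forall>r<n. (\<Sum>i<n. A r i * y i) = 0)"
    then obtain y i where y: "i < n" "y i \<noteq> 0" "\<And>r. r < n \<Longrightarrow> (\<Sum>i<n. A r i * y i) = 0" by blast
    let ?v = "Matrix.vec n y"
    have v: "?v \<in> carrier_vec n" by simp
    have "?v \<noteq> 0\<^sub>v n" using y(1,2) by (metis index_vec index_zero_vec(1))
    moreover have "?M *\<^sub>v ?v = 0\<^sub>v n"
    proof (rule eq_vecI)
      fix r assume "r < dim_vec (0\<^sub>v n :: complex Matrix.vec)"
      then have r: "r < n" by simp
      show "vec_index (?M *\<^sub>v ?v) r = vec_index (0\<^sub>v n) r"
        using y(3)[OF r] r by (subst ent[OF v r]) simp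
    qed simp
    ultimately show "\<exists>v. v \<in> carrier_vec n \<and> v \<noteq> 0\<^sub>v n \<and> ?M *\<^sub>v v = 0\<^sub>v n"
      using v by blast
  qed
  then show ?thesis unfolding kernel_det_def det_0_iff_vec_prod_zero_field[OF M] .
qed

lemma holomorphic_kernel_det:
  assumes "\<And>r i. r < n \<Longrightarrow> i < n \<Longrightarrow> (\<lambda>x. A x r i) holomorphic_on X"
  shows "(\<lambda>x. kernel_det n (A x)) holomorphic_on X"
proof -
  have "(\<lambda>x. \<Sum>p\<in>{p. p permutes {0..<n}}. signof p * (\<Prod>i=0..<n. A x i (p i))) holomorphic_on X"
    by (intro holomorphic_on_sum holomorphic_on_mult holomorphic_on_const holomorphic_on_prod assms)
      (auto simp: permutes_in_image dest: permutes_in_image)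
  moreover have "(\<lambda>x. \<Sum>p\<in>{p. p permutes {0..<n}}. signof p * (\<Prod>i=0..<n. A x i (p i))) = (\<lambda>x. kernel_det n (A x))"
  proof
    fix x
    let ?M = "Matrix.mat n n (\<lambda>(r, i). A x r i)"
    have "?M \<in> carrier_mat n n" by simp
    from det_def'[OF this] have "kernel_det n (A x) = (\<Sum>p\<in>{p. p permutes {0..<n}}. signof p * (\<Prod>i=0..<n. ?M $$ (i, p i)))"
      by (simp add: kernel_det_def)
    also have "\<dots> = (\<Sum>p\<in>{p. p permutes {0..<n}}. signof p * (\<Prod>i=0..<n. A x i (p i)))"
      by (intro sum.cong prod.cong arg_cong2[of _ _ _ _ "(*)"] refl) (auto dest: permutes_in_image)
    finally show "(\<Sum>p\<in>{p. p permutes {0..<n}}. signof p * (\<Prod>i=0..<n. A x i (p i))) = kernel_det n (A x)" ..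
  qed
  ultimately show ?thesis by simp
qed

text \<open>
The spanning set is taken from \<open>X\<close> itself, which is only a set and need not be a subspace. Induction on the number
of coordinates: if the combination that matches the first \<open>m\<close> coordinates fails to match the next one for some
element \<open>w\<close> of \<open>X\<close>, adding \<open>w\<close> repairs it for all.
\<close>

lemma finite_spanning_subset:
  fixes X :: "(nat \<Rightarrow> complex) set"
  shows "\<exists>B. finite B \<and> B \<subseteq> X \<and> (\<forall>x\<in>X. \<exists>c. \<forall>j<m. x j = (\<Sum>b\<in>B. c b * b j))"
proof (induction m)
  case 0 then show ?case by (intro exI[of _ "{}"]) auto
next
  case (Suc m)
  then obtain B where B: "finite B" "B \<subseteq> X" "\<And>x. x \<in> X \<Longrightarrow> \<exists>c. \<forall>j<m. x j = (\<Sum>b\<in>B. c b * b j)"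
    by blast
  then obtain C where C: "\<And>x j. x \<in> X \<Longrightarrow> j < m \<Longrightarrow> x j = (\<Sum>b\<in>B. C x b * b j)" by metis
  define r where "r = (\<lambda>x. x m - (\<Sum>b\<in>B. C x b * b m))"
  show ?case
  proof (cases "\<forall>x\<in>X. r x = 0")
    case True
    have "\<forall>x\<in>X. \<forall>j<Suc m. x j = (\<Sum>b\<in>B. C x b * b j)"
      using C True by (auto simp: less_Suc_eq r_def)
    then show ?thesis using B by (intro exI[of _ B]) blast
  next
    case False
    then obtain w where w: "w \<in> X" "r w \<noteq> 0" by blast
    have "\<exists>c. \<forall>j<Suc m. x j = (\<Sum>b\<in>insert w B. c b * b j)" if x: "x \<in> X" for x
    proof -
      define t where "t = r x / r w"
      define c where "c = (\<lambda>b. (if b \<in> B then C x b - t * C w b else 0) + (if b = w then t else 0))"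
      have "(\<Sum>b\<in>insert w B. c b * b j) = (\<Sum>b\<in>B. (C x b - t * C w b) * b j) + t * w j" for j
      proof -
        have "(\<Sum>b\<in>insert w B. c b * b j) =
          (\<Sum>b\<in>insert w B. (if b \<in> B then C x b - t * C w b else 0) * b j) + (\<Sum>b\<in>insert w B. (if b = w then t else 0) * b j)"
          by (simp add: c_def distrib_right sum.distrib)
        also have "(\<Sum>b\<in>insert w B. (if b = w then t else 0) * b j) = (\<Sum>b\<in>insert w B. if b = w then t * b j else 0)"
          by (intro sum.cong) auto
        also have "\<dots> = t * w j" using B(1) by (simp add: sum.delta)
        also have "(\<Sum>b\<in>insert w B. (if b \<in> B then C x b - t * C w b else 0) * b j) = (\<Sum>b\<in>B. (C x b - t * C w b) * b j)"
          using B(1) by (intro sum.mono_neutral_cong_right) auto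
        finally show ?thesis .
      qed
      moreover have "(\<Sum>b\<in>B. (C x b - t * C w b) * b j) + t * w j =
         (\<Sum>b\<in>B. C x b * b j) + t * (w j - (\<Sum>b\<in>B. C w b * b j))" for j
        by (simp add: algebra_simps sum_subtractf sum_distrib_left)
      moreover have "(\<Sum>b\<in>B. C x b * b m) + t * (w m - (\<Sum>b\<in>B. C w b * b m)) = x m"
        using w(2) by (simp add: t_def r_def[symmetric]) (simp add: r_def)
      ultimately have "\<forall>j<Suc m. x j = (\<Sum>b\<in>insert w B. c b * b j)"
        using C[OF x] C[OF w(1)] by (auto simp: less_Suc_eq)
      then show ?thesis by blast
    qed
    then show ?thesis using B w by (intro exI[of _ "insert w B"]) auto
  qed
qed

section \<open>Zeros along the roots of a quadratic with holomorphic trace\<close>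

lemma holomorphic_zeros_isolated:
  assumes "f holomorphic_on ball 0 r" "r > 0" "\<not> (\<forall>k\<in>ball 0 r. f k = 0)"
  shows "\<exists>e>0. e \<le> r \<and> (\<forall>k. k \<noteq> 0 \<and> cmod k < e \<longrightarrow> f k \<noteq> 0)"
proof (rule ccontr)
  assume neg: "\<not> ?thesis"
  let ?U = "{k \<in> ball 0 r. f k = 0}"
  have lim: "0 islimpt ?U"
    unfolding islimpt_approachable
  proof (intro allI impI)
    fix e :: real assume "e > 0"
    then have "min e r > 0" "min e r \<le> r" using assms by auto
    then obtain k where "k \<noteq> 0 \<and> cmod k < min e r \<and> f k = 0" using neg by meson
    then show "\<exists>x'\<in>?U. x' \<noteq> 0 \<and> dist x' 0 < e" by (intro bexI[of _ k]) auto
  qed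
  have "f w = 0" if "w \<in> ball 0 r" for w
    by (rule analytic_continuation[OF assms(1) open_ball connected_ball _ _ lim _ that]) (use assms in auto)
  then show False using assms by blast
qed

lemma open_has_nonreal:
  assumes "open V" "z \<in> V"
  obtains w where "w \<in> V" "Im w \<noteq> 0"
proof (cases "Im z = 0")
  case True
  obtain e where e: "e > 0" "ball z e \<subseteq> V" using assms by (meson open_contains_ball)
  have "z + \<i> * of_real (e/2) \<in> ball z e" using e by (simp add: dist_norm norm_mult)
  then show ?thesis using e True that[of "z + \<i> * of_real (e/2)"] by auto
qed (use assms that in blast)

text \<open>
The roots of \<open>\<theta>\<^sup>2 - d \<theta> + 1\<close> in terms of a square root \<open>s\<close> of the discriminant; replacing \<open>s\<close> by \<open>- s\<close> gives the
other root, which is the inverse of the first.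
\<close>

lemma quadratic_roots:
  fixes d s t :: complex
  assumes "s\<^sup>2 = d\<^sup>2 - 4"
  shows "((d + s) / 2)\<^sup>2 - d * ((d + s) / 2) + 1 = 0" "(d + s) / 2 * ((d - s) / 2) = 1"
proof -
  have "((d + s) / 2)\<^sup>2 - d * ((d + s) / 2) + 1 = (s\<^sup>2 - (d\<^sup>2 - 4)) / 4"
    by (simp add: field_simps power2_eq_square)
  then show "((d + s) / 2)\<^sup>2 - d * ((d + s) / 2) + 1 = 0" using assms by simp
  have "(d + s) / 2 * ((d - s) / 2) = (d\<^sup>2 - s\<^sup>2) / 4"
    by (simp add: field_simps power2_eq_square)
  then show "(d + s) / 2 * ((d - s) / 2) = 1" using assms by simp
qed

lemma small_root_unique:
  fixes d s t :: complex
  assumes "s\<^sup>2 - d * s + 1 = 0" "t\<^sup>2 - d * t + 1 = 0" "cmod s < 1" "cmod t < 1"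
  shows "s = t"
proof -
  have "(s - t) * (s * t - 1) = s * (t\<^sup>2 - d * t + 1) * (-1) + t * (s\<^sup>2 - d * s + 1)"
    by (simp add: algebra_simps power2_eq_square)
  then have "(s - t) * (s * t - 1) = 0" using assms by simp
  moreover have "s * t \<noteq> 1"
  proof
    assume "s * t = 1"
    then have "cmod s * cmod t = 1" by (metis norm_mult norm_one)
    moreover have "cmod s * cmod t \<le> cmod s * 1" using assms(4) by (intro mult_left_mono) auto
    ultimately show False using assms(3) by simp
  qed
  ultimately show ?thesis by auto
qed

text \<open>
Near a zero \<open>z0\<close> of order \<open>n\<close> the discriminant is \<open>(z - z0)\<^sup>n\<close> times the square of a holomorphic function, and
substituting \<open>z = z0 + k\<^sup>2\<close> turns the first factor into the square of \<open>k\<^sup>n\<close>.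
\<close>

lemma local_branches:
  assumes D: "D holomorphic_on ball z0 r" "r > 0" and nc: "\<exists>z\<in>ball z0 r. (D z)\<^sup>2 \<noteq> 4"
  obtains s d where "d > 0" "d\<^sup>2 \<le> r" "s holomorphic_on ball 0 d"
    "\<And>k. k \<in> ball 0 d \<Longrightarrow> (s k)\<^sup>2 = (D (z0 + k\<^sup>2))\<^sup>2 - 4"
proof -
  let ?f = "\<lambda>z. (D z)\<^sup>2 - 4"
  have f: "?f holomorphic_on ball z0 r" by (intro holomorphic_intros D)
  have "\<exists>n e g. e > 0 \<and> e \<le> r \<and> g holomorphic_on ball z0 e \<and> (\<forall>w\<in>ball z0 e. ?f w = (w - z0)^n * g w \<and> g w \<noteq> 0)"
  proof (cases "?f z0 = 0")
    case True
    have nc': "\<not> ?f constant_on ball z0 r"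
    proof
      assume "?f constant_on ball z0 r"
      then have "\<forall>z\<in>ball z0 r. ?f z = ?f z0" using D(2) unfolding constant_on_def by (metis centre_in_ball)
      then show False using nc True by auto
    qed
    obtain g e n where g: "0 < n" "0 < e" "ball z0 e \<subseteq> ball z0 r" "g holomorphic_on ball z0 e"
      "\<And>w. w \<in> ball z0 e \<Longrightarrow> ?f w = (w - z0)^n * g w" "\<And>w. w \<in> ball z0 e \<Longrightarrow> g w \<noteq> 0"
      using holomorphic_factor_zero_nonconstant[OF f _ _ _ True nc'] D(2) by (metis centre_in_ball connected_ball open_ball)
    have "e \<le> r" using g(2,3) D(2) by (simp add: ball_subset_ball_iff)
    then show ?thesis using g by blast
  next
    case False
    have "continuous_on (ball z0 r) ?f" using f by (rule holomorphic_on_imp_continuous_on)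
    then have "isCont ?f z0" using D(2) by (simp add: continuous_on_eq_continuous_at)
    then have "(?f \<longlongrightarrow> ?f z0) (nhds z0)"
      unfolding isCont_def by (rule iffD1[OF tendsto_at_iff_tendsto_nhds])
    from tendsto_imp_eventually_ne[OF this False] have "\<forall>\<^sub>F z in nhds z0. ?f z \<noteq> 0" .
    then obtain e where e: "e > 0" "\<And>z. dist z z0 < e \<Longrightarrow> ?f z \<noteq> 0"
      unfolding eventually_nhds_metric by blast
    have "?f holomorphic_on ball z0 (min e r)" by (rule holomorphic_on_subset[OF f]) auto
    then show ?thesis using e D(2) 
      by (intro exI[of _ 0] exI[of _ "min e r"] exI[of _ ?f]) (auto simp: dist_commute)
  qed
  then obtain n e g where g: "e > 0" "e \<le> r" "g holomorphic_on ball z0 e"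
    "\<And>w. w \<in> ball z0 e \<Longrightarrow> ?f w = (w - z0)^n * g w" "\<And>w. w \<in> ball z0 e \<Longrightarrow> g w \<noteq> 0" by blast
  obtain h where h: "h holomorphic_on ball z0 e" "\<And>w. w \<in> ball z0 e \<Longrightarrow> g w = (h w)\<^sup>2"
    using contractible_imp_holomorphic_sqrt[OF g(3) _ g(5)] convex_imp_contractible[OF convex_ball] by blast
  have in_ball: "z0 + k\<^sup>2 \<in> ball z0 e" if "k \<in> ball 0 (sqrt e)" for k
  proof -
    have "(cmod k)\<^sup>2 < (sqrt e)\<^sup>2" using that by (intro power_strict_mono) auto
    then show ?thesis using g(1) by (simp add: dist_norm norm_power)
  qed
  show thesis
  proof (rule that[of "sqrt e" "\<lambda>k. k ^ n * h (z0 + k\<^sup>2)"])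
    have "h \<circ> (\<lambda>k. z0 + k\<^sup>2) holomorphic_on ball 0 (sqrt e)"
      by (intro holomorphic_on_compose_gen[OF _ h(1)] holomorphic_intros) (use in_ball in auto)
    then show "(\<lambda>k. k ^ n * h (z0 + k\<^sup>2)) holomorphic_on ball 0 (sqrt e)"
      by (intro holomorphic_intros) (simp add: o_def)
    fix k :: complex assume "k \<in> ball 0 (sqrt e)"
    from in_ball[OF this] show "(k ^ n * h (z0 + k\<^sup>2))\<^sup>2 = (D (z0 + k\<^sup>2))\<^sup>2 - 4"
      using g(4)[of "z0 + k\<^sup>2"] h(2)[of "z0 + k\<^sup>2"]
      by (simp add: power_mult_distrib power_mult[symmetric] mult.commute)
  qed (use g in auto)
qed

text \<open>
The analytic core of the theorem. Here \<open>\<Lambda>\<close> is the set of eigenvalues, \<open>D\<close> the trace of the transfer matrix and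
\<open>\<Phi>\<close> the characteristic determinant. Suppose eigenvalues accumulate at \<open>z0\<close>. In the coordinate \<open>k\<close> with \<open>z = z0 + k\<^sup>2\<close>
both roots are holomorphic, and \<open>\<Phi>\<close> along a root that has modulus at most 1 at an eigenvalue close to \<open>z0\<close> vanishes
identically, its zeros being isolated otherwise. The assumption \<open>base\<close> excludes that such a root has modulus
less than 1 anywhere near \<open>z0\<close>. Hence it has modulus 1 at that eigenvalue, so has the other root, and both have
modulus at least 1, therefore exactly 1, on a full neighbourhood; this contradicts \<open>nonreal\<close>.
\<close>

lemma no_accumulation:
  fixes D :: "complex \<Rightarrow> complex" and \<Phi> :: "complex \<Rightarrow> complex \<Rightarrow> complex" and \<Lambda> :: "complex set"
  assumes R: "R > 1" and D: "D holomorphic_on ball 0 R"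
    and \<Phi>: "\<And>X w \<theta>. open X \<Longrightarrow> w holomorphic_on X \<Longrightarrow> \<theta> holomorphic_on X \<Longrightarrow> w ` X \<subseteq> ball 0 R \<Longrightarrow>
       (\<And>x. x \<in> X \<Longrightarrow> \<theta> x \<noteq> 0) \<Longrightarrow> (\<lambda>x. \<Phi> (w x) (\<theta> x)) holomorphic_on X"
    and ev: "\<And>z \<theta>. z \<in> \<Lambda> \<Longrightarrow> cmod z < R \<Longrightarrow> \<theta>\<^sup>2 - D z * \<theta> + 1 = 0 \<Longrightarrow> cmod \<theta> \<le> 1 \<Longrightarrow> \<Phi> z \<theta> = 0"
    and nonreal: "\<And>z \<theta>. Im z \<noteq> 0 \<Longrightarrow> cmod z < R \<Longrightarrow> \<theta>\<^sup>2 - D z * \<theta> + 1 = 0 \<Longrightarrow> cmod \<theta> \<noteq> 1"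
    and base: "\<And>z \<theta>. z \<in> {\<i>, - \<i>} \<Longrightarrow> \<theta>\<^sup>2 - D z * \<theta> + 1 = 0 \<Longrightarrow> cmod \<theta> < 1 \<Longrightarrow> \<Phi> z \<theta> \<noteq> 0"
    and z0: "cmod z0 < R"
  shows "\<not> z0 islimpt \<Lambda>"
proof
  assume lim: "z0 islimpt \<Lambda>"
  have root_nz: "\<theta> \<noteq> 0" if "\<theta>\<^sup>2 - D z * \<theta> + 1 = 0" for \<theta> z
    using that by auto
  \<comment> \<open>On an open set \<open>\<Phi>\<close> cannot vanish along a root of modulus less than 1: within a half disc this root is
    a single holomorphic function, and the identity theorem carries the zeros to \<open>\<plusminus> \<i>\<close>.\<close>
  have half: False if U: "open U" "U \<noteq> {}" "U \<subseteq> ball 0 R"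
    "\<And>z. z \<in> U \<Longrightarrow> \<exists>\<theta>. \<theta>\<^sup>2 - D z * \<theta> + 1 = 0 \<and> cmod \<theta> < 1 \<and> \<Phi> z \<theta> = 0" for U
  proof -
    obtain z1 where z1: "z1 \<in> U" "Im z1 \<noteq> 0" using open_has_nonreal U(1,2) by blast
    define \<sigma> :: real where "\<sigma> = sgn (Im z1)"
    define H where "H = ball 0 R \<inter> {z. \<sigma> * Im z > 0}"
    have \<sigma>: "\<sigma> = 1 \<or> \<sigma> = -1" using z1 by (auto simp: \<sigma>_def sgn_real_def)
    have "{z. \<sigma> * Im z > 0} = (if \<sigma> = 1 then {z. Im z > 0} else {z. Im z < 0})" using \<sigma> by auto
    then have oc: "open {z. \<sigma> * Im z > 0}" "convex {z. \<sigma> * Im z > 0}"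
      by (auto simp: open_halfspace_Im_gt open_halfspace_Im_lt convex_halfspace_Im_gt convex_halfspace_Im_lt)
    have H: "open H" "convex H" unfolding H_def using oc by (auto intro: convex_Int)
    have conn: "connected H" using H convex_connected by blast
    have z1H: "z1 \<in> H" using z1 U(3) by (auto simp: H_def \<sigma>_def sgn_real_def)
    define b where "b = \<i> * of_real \<sigma>"
    have b: "b \<in> H" "b \<in> {\<i>, - \<i>}" using \<sigma> R by (auto simp: H_def b_def)
    have HI: "Im z \<noteq> 0" "cmod z < R" if "z \<in> H" for z using that by (auto simp: H_def)
    have D': "D holomorphic_on H" by (rule holomorphic_on_subset[OF D]) (auto simp: H_def)
    have nz: "(D z)\<^sup>2 - 4 \<noteq> 0" if "z \<in> H" for z
    proof
      assume "(D z)\<^sup>2 - 4 = 0"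
      then have "D z = 2 \<or> D z = -2" using power2_eq_iff[of "D z" 2] by simp
      then have "1\<^sup>2 - D z * 1 + 1 = 0 \<or> (-1)\<^sup>2 - D z * (-1) + 1 = 0" by auto
      then show False using nonreal[OF HI[OF that], of 1] nonreal[OF HI[OF that], of "-1"] by auto
    qed
    have "(\<lambda>z. (D z)\<^sup>2 - 4) holomorphic_on H" by (intro holomorphic_intros D')
    then obtain s where s: "s holomorphic_on H" "\<And>z. z \<in> H \<Longrightarrow> (D z)\<^sup>2 - 4 = (s z)\<^sup>2"
      by (rule contractible_imp_holomorphic_sqrt[OF _ convex_imp_contractible[OF H(2)] nz]) blast+
    define t where "t = (\<lambda>\<tau> z. (D z + of_real \<tau> * s z) / 2)"
    have t_root: "(t \<tau> z)\<^sup>2 - D z * t \<tau> z + 1 = 0" "t \<tau> z * t (-\<tau>) z = 1" if "\<tau> = 1 \<or> \<tau> = -1" "z \<in> H" for \<tau> z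
      using quadratic_roots[of "of_real \<tau> * s z" "D z"] s(2)[OF that(2)] that(1) by (auto simp: t_def power_mult_distrib)
    have t_hol: "t \<tau> holomorphic_on H" for \<tau> unfolding t_def by (intro holomorphic_intros D' s) auto
    have t_norm: "cmod (t \<tau> z) \<noteq> 1" if "\<tau> = 1 \<or> \<tau> = -1" "z \<in> H" for \<tau> z
      using nonreal[OF HI[OF that(2)] t_root(1)[OF that]] .
    have prod1: "cmod (t 1 z) * cmod (t (-1) z) = 1" if "z \<in> H" for z
      using t_root(2)[of 1 z] that by (metis norm_mult norm_one)
    have "\<exists>\<tau>. (\<tau> = 1 \<or> \<tau> = -1) \<and> cmod (t \<tau> z1) < 1"
    proof (cases "cmod (t 1 z1) < 1")
      case False
      then have "cmod (t 1 z1) > 1" using t_norm[of 1 z1] z1H by auto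
      then have "cmod (t (-1) z1) < 1" using prod1[OF z1H]
        using mult_right_mono[of 1 "cmod (t 1 z1)" "cmod (t (-1) z1)"] t_norm[of "-1" z1] z1H by force
      then show ?thesis by auto
    qed auto
    then obtain \<tau> where \<tau>: "\<tau> = 1 \<or> \<tau> = -1" "cmod (t \<tau> z1) < 1" by blast
    \<comment> \<open>By connectedness, since the modulus never equals 1 on the half disc.\<close>
    have small: "cmod (t \<tau> z) < 1" if "z \<in> H" for z
    proof (rule ccontr)
      assume "\<not> ?thesis"
      then have "cmod (t \<tau> z) > 1" using t_norm[OF \<tau>(1) that] by auto
      then have gt: "1 \<le> cmod (t \<tau> z)" by simp
      have "connected ((\<lambda>z. cmod (t \<tau> z)) ` H)"
        by (intro connected_continuous_image continuous_intros holomorphic_on_imp_continuous_on t_hol conn)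
      from connectedD_interval[OF this imageI[OF z1H] imageI[OF that] less_imp_le[OF \<tau>(2)] gt]
      have "1 \<in> (\<lambda>z. cmod (t \<tau> z)) ` H" .
      then show False using t_norm[OF \<tau>(1)] by auto
    qed
    define g where "g = (\<lambda>z. \<Phi> z (t \<tau> z))"
    have g: "g holomorphic_on H"
      unfolding g_def
    proof (rule \<Phi>[OF H(1) holomorphic_on_ident t_hol])
      show "(\<lambda>x. x) ` H \<subseteq> ball 0 R" by (auto simp: H_def)
      show "t \<tau> x \<noteq> 0" if "x \<in> H" for x by (rule root_nz[OF t_root(1)[OF \<tau>(1) that]])
    qed
    have "g b = 0"
    proof (rule analytic_continuation[OF g H(1) conn _ z1H])
      show "U \<inter> H \<subseteq> H" by auto
      show "z1 islimpt U \<inter> H" using U(1) H(1) z1 z1H by (intro open_imp_islimpt) auto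
      show "g z = 0" if zUH: "z \<in> U \<inter> H" for z
      proof -
        obtain \<theta> where \<theta>: "\<theta>\<^sup>2 - D z * \<theta> + 1 = 0" "cmod \<theta> < 1" "\<Phi> z \<theta> = 0" using U(4)[of z] zUH by blast
        have "\<theta> = t \<tau> z" using small_root_unique[OF \<theta>(1) t_root(1)[OF \<tau>(1)] \<theta>(2) small] zUH by auto
        then show ?thesis using \<theta> by (simp add: g_def)
      qed
    qed (rule b)
    then show False
      using base[OF b(2) t_root(1)[OF \<tau>(1) b(1)] small[OF b(1)]] by (simp add: g_def)
  qed
  \<comment> \<open>The coordinate \<open>k\<close> near \<open>z0\<close>, in which both roots are holomorphic.\<close>
  define r where "r = R - cmod z0"
  have r: "r > 0" using z0 by (simp add: r_def)
  have sub: "ball z0 r \<subseteq> ball 0 R"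
    unfolding r_def by (auto simp: dist_norm) (smt (verit) norm_triangle_sub norm_minus_commute)
  have nc: "\<exists>z\<in>ball z0 r. (D z)\<^sup>2 \<noteq> 4"
  proof -
    obtain z where z: "z \<in> ball z0 r" "Im z \<noteq> 0" using open_has_nonreal[of "ball z0 r" z0] r by auto
    have "(D z)\<^sup>2 \<noteq> 4"
    proof
      assume "(D z)\<^sup>2 = 4"
      then have "D z = 2 \<or> D z = -2" using power2_eq_iff[of "D z" 2] by simp
      then have "1\<^sup>2 - D z * 1 + 1 = 0 \<or> (-1)\<^sup>2 - D z * (-1) + 1 = 0" by auto
      then show False using nonreal[OF z(2), of 1] nonreal[OF z(2), of "-1"] z(1) sub by auto
    qed
    then show ?thesis using z by blast
  qed
  obtain s d where sd: "d > 0" "d\<^sup>2 \<le> r" "s holomorphic_on ball 0 d"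
    "\<And>k. k \<in> ball 0 d \<Longrightarrow> (s k)\<^sup>2 = (D (z0 + k\<^sup>2))\<^sup>2 - 4"
    using local_branches[OF holomorphic_on_subset[OF D sub] r nc] by blast
  define w where "w = (\<lambda>k::complex. z0 + k\<^sup>2)"
  have w_in: "w k \<in> ball z0 r" if "k \<in> ball 0 d" for k
  proof -
    have "(cmod k)\<^sup>2 < d\<^sup>2" using that by (intro power_strict_mono) auto
    then show ?thesis using sd(2) by (simp add: w_def dist_norm norm_power)
  qed
  then have w_R: "w k \<in> ball 0 R" if "k \<in> ball 0 d" for k using sub that by blast
  have w_hol: "w holomorphic_on X" for X unfolding w_def by (intro holomorphic_intros)
  define t where "t = (\<lambda>\<tau> k. (D (w k) + of_real \<tau> * s k) / 2)"
  have t_root: "(t \<tau> k)\<^sup>2 - D (w k) * t \<tau> k + 1 = 0" "t \<tau> k * t (-\<tau>) k = 1" if "\<tau> = 1 \<or> \<tau> = -1" "k \<in> ball 0 d" for \<tau> k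
    using quadratic_roots[of "of_real \<tau> * s k" "D (w k)"] sd(4)[OF that(2)] that(1) by (auto simp: t_def w_def power_mult_distrib)
  have "(D \<circ> w) holomorphic_on ball 0 d"
    by (rule holomorphic_on_compose_gen[OF w_hol D]) (use w_R in auto)
  then have t_hol: "t \<tau> holomorphic_on ball 0 d" for \<tau>
    unfolding t_def by (intro holomorphic_intros sd(3)) (simp_all add: o_def)
  have prod1: "cmod (t \<tau> k) * cmod (t (-\<tau>) k) = 1" if "\<tau> = 1 \<or> \<tau> = -1" "k \<in> ball 0 d" for \<tau> k
    using t_root(2)[OF that] by (metis norm_mult norm_one)
  define F where "F = (\<lambda>\<tau> k. \<Phi> (w k) (t \<tau> k))"
  have F_hol: "F \<tau> holomorphic_on ball 0 d" if "\<tau> = 1 \<or> \<tau> = -1" for \<tau>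
    unfolding F_def
  proof (rule \<Phi>[OF open_ball w_hol t_hol])
    show "w ` ball 0 d \<subseteq> ball 0 R" using w_R by blast
    show "t \<tau> x \<noteq> 0" if "x \<in> ball 0 d" for x by (rule root_nz[OF t_root(1)[OF \<open>\<tau> = 1 \<or> \<tau> = -1\<close> that]])
  qed
  \<comment> \<open>The image of an open set of parameters \<open>k\<close> is open, so the result on half discs applies to it.\<close>
  have w_open: "open (w ` N)" if "open N" for N
  proof (rule open_mapping_thm[OF w_hol open_UNIV connected_UNIV that])
    show "\<not> w constant_on UNIV"
    proof
      assume "w constant_on UNIV"
      then have "w 0 = w 1" unfolding constant_on_def by auto
      then show False by (simp add: w_def)
    qed
  qed auto
  have F_zero: "cmod (t \<tau> k) \<ge> 1" if \<tau>: "\<tau> = 1 \<or> \<tau> = -1" and F0: "\<forall>k\<in>ball 0 d. F \<tau> k = 0" and k: "k \<in> ball 0 d" for \<tau> k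
  proof (rule ccontr)
    assume neg: "\<not> ?thesis"
    define N where "N = {k \<in> ball 0 d. cmod (t \<tau> k) < 1}"
    have "continuous_on (ball 0 d) (\<lambda>k. cmod (t \<tau> k))"
      by (intro continuous_intros holomorphic_on_imp_continuous_on t_hol)
    then have "open ((\<lambda>k. cmod (t \<tau> k)) -` {..<1} \<inter> ball 0 d)"
      by (simp add: continuous_on_open_vimage)
    moreover have "N = (\<lambda>k. cmod (t \<tau> k)) -` {..<1} \<inter> ball 0 d" by (auto simp: N_def)
    ultimately have "open N" by simp
    show False
    proof (rule half[of "w ` N"])
      show "open (w ` N)" using w_open \<open>open N\<close> by blast
      show "w ` N \<noteq> {}" using neg k by (auto simp: N_def)
      show "w ` N \<subseteq> ball 0 R" using w_R by (auto simp: N_def)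
      fix z assume "z \<in> w ` N"
      then obtain k where "k \<in> N" "z = w k" by auto
      then show "\<exists>\<theta>. \<theta>\<^sup>2 - D z * \<theta> + 1 = 0 \<and> cmod \<theta> < 1 \<and> \<Phi> z \<theta> = 0"
        using t_root(1)[OF \<tau>, of k] F0 by (intro exI[of _ "t \<tau> k"]) (auto simp: N_def F_def)
    qed
  qed
  have "\<forall>\<tau>\<in>{1, -1}. \<exists>e>0. e \<le> d \<and> ((\<forall>k\<in>ball 0 d. F \<tau> k = 0) \<or> (\<forall>k. k \<noteq> 0 \<and> cmod k < e \<longrightarrow> F \<tau> k \<noteq> 0))"
    using holomorphic_zeros_isolated[OF F_hol sd(1)] sd(1) by blast
  then obtain e1 e2 where e: "e1 > 0" "e1 \<le> d" "e2 > 0" "e2 \<le> d"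
    "(\<forall>k\<in>ball 0 d. F 1 k = 0) \<or> (\<forall>k. k \<noteq> 0 \<and> cmod k < e1 \<longrightarrow> F 1 k \<noteq> 0)"
    "(\<forall>k\<in>ball 0 d. F (-1) k = 0) \<or> (\<forall>k. k \<noteq> 0 \<and> cmod k < e2 \<longrightarrow> F (-1) k \<noteq> 0)"
    by auto
  define e where "e = min e1 e2"
  have "e > 0" using e by (simp add: e_def)
  have e': "(\<forall>k\<in>ball 0 d. F \<tau> k = 0) \<or> (\<forall>k. k \<noteq> 0 \<and> cmod k < e \<longrightarrow> F \<tau> k \<noteq> 0)" if "\<tau> = 1 \<or> \<tau> = -1" for \<tau>
    using that e(5,6) by (auto simp: e_def)
  obtain z where z: "z \<in> \<Lambda>" "z \<noteq> z0" "dist z z0 < e\<^sup>2"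
    using lim \<open>e > 0\<close> unfolding islimpt_approachable by (metis zero_less_power)
  define k where "k = csqrt (z - z0)"
  have k2: "k\<^sup>2 = z - z0" by (simp add: k_def)
  have "(cmod k)\<^sup>2 < e\<^sup>2" using z(3) k2 by (metis dist_norm norm_power)
  then have ke: "cmod k < e" using \<open>e > 0\<close> by (meson less_imp_le power2_less_imp_less)
  then have kd: "k \<in> ball 0 d" using e by (simp add: e_def)
  have k0: "k \<noteq> 0" using k2 z by auto
  have wk: "w k = z" using k2 by (simp add: w_def)
  have zR: "cmod z < R" using w_R[OF kd] wk by simp
  have vanish: "\<forall>k\<in>ball 0 d. F \<tau> k = 0" if "\<tau> = 1 \<or> \<tau> = -1" "cmod (t \<tau> k) \<le> 1" for \<tau>
  proof -
    have "F \<tau> k = 0" unfolding F_def wk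
      using ev[OF z(1) zR, of "t \<tau> k"] t_root(1)[OF that(1) kd] wk that(2) by simp
    then show ?thesis using e'[OF that(1)] k0 ke by blast
  qed
  have "\<exists>\<tau>. (\<tau> = 1 \<or> \<tau> = -1) \<and> cmod (t \<tau> k) \<le> 1"
  proof (cases "cmod (t 1 k) \<le> 1")
    case False
    then have "cmod (t (-1) k) \<le> 1" using prod1[of 1 k] kd
      using mult_right_mono[of 1 "cmod (t 1 k)" "cmod (t (-1) k)"] by simp
    then show ?thesis by auto
  qed auto
  then obtain \<tau> where \<tau>: "\<tau> = 1 \<or> \<tau> = -1" "cmod (t \<tau> k) \<le> 1" by blast
  have \<tau>': "-\<tau> = 1 \<or> -\<tau> = -1" using \<tau> by auto
  have v1: "\<forall>k\<in>ball 0 d. F \<tau> k = 0" by (rule vanish[OF \<tau>])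
  have "cmod (t \<tau> k) = 1" using F_zero[OF \<tau>(1) v1 kd] \<tau>(2) by simp
  then have "cmod (t (-\<tau>) k) \<le> 1" using prod1[OF \<tau>(1) kd] by simp
  then have v2: "\<forall>k\<in>ball 0 d. F (-\<tau>) k = 0" by (rule vanish[OF \<tau>'])
  have all1: "cmod (t \<tau> j) = 1" if "j \<in> ball 0 d" for j
  proof -
    have "cmod (t \<tau> j) \<ge> 1" "cmod (t (-\<tau>) j) \<ge> 1" using F_zero \<tau>(1) \<tau>' v1 v2 that by blast+
    moreover have "cmod (t \<tau> j) * cmod (t (-\<tau>) j) = 1" using prod1 \<tau>(1) that by blast
    ultimately show ?thesis by (smt (verit) mult_less_cancel_left1 mult_le_cancel_left1)
  qed
  obtain z1 where z1: "z1 \<in> w ` ball 0 d" "Im z1 \<noteq> 0"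
    using open_has_nonreal[OF w_open[OF open_ball], of "w 0" 0 d] sd(1) by auto
  then obtain j where j: "j \<in> ball 0 d" "z1 = w j" by auto
  show False
    using nonreal[of "w j" "t \<tau> j"] z1 j w_R[OF j(1)] t_root(1)[OF \<tau>(1) j(1)] all1[OF j(1)] by auto
qed

section \<open>Test functions and weak derivatives\<close>

text \<open>
Differentiability of the first \<open>n + 1\<close> derivatives, in a recursive form suited to induction.
\<close>

fun smooth_upto :: "nat \<Rightarrow> (real \<Rightarrow> real) \<Rightarrow> bool" where
  "smooth_upto 0 f \<longleftrightarrow> (\<forall>x. f field_differentiable at x)"
| "smooth_upto (Suc n) f \<longleftrightarrow> (\<forall>x. f field_differentiable at x) \<and> smooth_upto n (deriv f)"

lemma smooth_upto_diff: "smooth_upto n f \<Longrightarrow> f field_differentiable at x"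
  by (cases n) auto

lemma smooth_upto_Suc: "smooth_upto (Suc n) f \<Longrightarrow> smooth_upto n f"
  by (induction n arbitrary: f) (auto dest: smooth_upto_diff)

lemma smooth_upto_iff: "smooth_upto n f \<longleftrightarrow> (\<forall>k\<le>n. (deriv ^^ k) f differentiable_on UNIV)"
proof (induction n arbitrary: f)
  case 0
  then show ?case
    by (auto simp: differentiable_on_def real_differentiable_def field_differentiable_def)
next
  case (Suc n)
  have "(\<forall>x. f field_differentiable at x) \<longleftrightarrow> f differentiable_on UNIV"
    by (auto simp: differentiable_on_def real_differentiable_def field_differentiable_def)
  moreover have "(\<forall>k\<le>Suc n. (deriv ^^ k) f differentiable_on UNIV) \<longleftrightarrow>
     f differentiable_on UNIV \<and> (\<forall>k\<le>n. (deriv ^^ k) (deriv f) differentiable_on UNIV)"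
  proof -
    have "(\<forall>k\<le>Suc n. P k) \<longleftrightarrow> P 0 \<and> (\<forall>k\<le>n. P (Suc k))" for P
      by (metis Suc_le_mono bot_nat_0.extremum old.nat.exhaust)
    then show ?thesis by (simp add: funpow_swap1[symmetric] funpow_Suc_right del: funpow.simps(2))
  qed
  ultimately show ?case using Suc by simp
qed

lemma smooth_upto_scale_affine: "smooth_upto n f \<Longrightarrow> smooth_upto n (\<lambda>x. c * f (a * x + b))"
proof (induction n arbitrary: f c)
  have d: "((\<lambda>x. c * f (a * x + b)) has_field_derivative (c * a) * deriv f (a * x + b)) (at x)"
    if "\<And>x. f field_differentiable at x" for f x c
  proof -
    have "(f has_field_derivative deriv f (a * x + b)) (at (a * x + b))"
      using that by (rule field_differentiable_derivI)
    moreover have "((\<lambda>x. a * x + b) has_field_derivative a) (at x)"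
      by (auto intro!: derivative_eq_intros)
    ultimately have "((\<lambda>x. f (a * x + b)) has_field_derivative deriv f (a * x + b) * a) (at x)"
      by (rule DERIV_chain2)
    from DERIV_cmult[OF this, of c] show ?thesis by (simp add: mult_ac)
  qed
  {
    case 0
    then have "((\<lambda>x. c * f (a * x + b)) has_field_derivative (c * a) * deriv f (a * x + b)) (at x)" for x
      by (intro d) simp
    then show ?case unfolding smooth_upto.simps field_differentiable_def by blast
  next
    case (Suc n)
    have df: "((\<lambda>x. c * f (a * x + b)) has_field_derivative (c * a) * deriv f (a * x + b)) (at x)" for x
      using Suc.prems by (intro d) simp
    have "deriv (\<lambda>x. c * f (a * x + b)) = (\<lambda>x. (c * a) * deriv f (a * x + b))"
      by (intro ext DERIV_imp_deriv df)
    moreover have "smooth_upto n (\<lambda>x. (c * a) * deriv f (a * x + b))"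
      using Suc.prems by (intro Suc.IH) simp
    ultimately show ?case using df unfolding smooth_upto.simps field_differentiable_def by auto
  }
qed

lemma smooth_upto_add: "smooth_upto n f \<Longrightarrow> smooth_upto n g \<Longrightarrow> smooth_upto n (\<lambda>x. f x + g x)"
proof (induction n arbitrary: f g)
  case 0 then show ?case by (auto intro: field_differentiable_add)
next
  case (Suc n)
  have "deriv (\<lambda>x. f x + g x) = (\<lambda>x. deriv f x + deriv g x)"
    using Suc.prems by (auto intro!: deriv_add)
  then show ?case using Suc by (auto intro: field_differentiable_add)
qed

lemma smooth_upto_mult: "smooth_upto n f \<Longrightarrow> smooth_upto n g \<Longrightarrow> smooth_upto n (\<lambda>x. f x * g x)"
proof (induction n arbitrary: f g)
  case 0 then show ?case by (auto intro: field_differentiable_mult)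
next
  case (Suc n)
  have "deriv (\<lambda>x. f x * g x) = (\<lambda>x. f x * deriv g x + deriv f x * g x)"
    using Suc.prems by (auto intro!: deriv_mult)
  moreover have "smooth_upto n (\<lambda>x. f x * deriv g x + deriv f x * g x)"
    using Suc.prems smooth_upto_Suc by (intro smooth_upto_add Suc.IH) auto
  ultimately show ?case using Suc.prems by (auto intro: field_differentiable_mult)
qed

text \<open>
The functions that occur as derivatives of \<open>exp (- (1 / x))\<close>, extended by zero. The family is closed under
differentiation, hence all its members are smooth.
\<close>

definition flat :: "real poly \<Rightarrow> real \<Rightarrow> real" where
  "flat P x = (if x > 0 then poly P (1 / x) * exp (- (1 / x)) else 0)"

lemma poly_exp_tendsto_0: "((\<lambda>x. poly P x * exp (- x)) \<longlongrightarrow> 0) at_top" for P :: "real poly"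
proof -
  have "((\<lambda>x. \<Sum>i\<le>degree P. coeff P i * (x ^ i / exp x)) \<longlongrightarrow> (\<Sum>i\<le>degree P. coeff P i * 0)) at_top"
    by (intro tendsto_intros tendsto_power_div_exp_0)
  then show ?thesis by (simp add: poly_altdef exp_minus field_simps sum_distrib_left)
qed

lemma flat_has_derivative: "(flat P has_field_derivative flat ([:0, 0, 1:] * (P - pderiv P)) x) (at x)"
proof -
  consider "x > 0" | "x < 0" | "x = 0" by linarith
  then show ?thesis
  proof cases
    case 1
    have "((\<lambda>x. poly P (1 / x) * exp (- (1 / x))) has_field_derivative
       poly ([:0, 0, 1:] * (P - pderiv P)) (1 / x) * exp (- (1 / x))) (at x)"
      using 1 by (auto intro!: derivative_eq_intros simp: field_simps power2_eq_square)
    then show ?thesis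
      unfolding flat_def using 1
      by (subst DERIV_cong_ev[OF refl _ refl, of _ "\<lambda>x. poly P (1 / x) * exp (- (1 / x))"])
        (auto intro: eventually_mono[OF eventually_nhds_in_open[of "{0<..}" x]])
  next
    case 2
    then show ?thesis
      by (subst DERIV_cong_ev[OF refl _ refl, of _ "\<lambda>x. 0"])
        (auto simp: flat_def intro: eventually_mono[OF eventually_nhds_in_open[of "{..<0}" x]])
  next
    case 3
    have "((\<lambda>h. flat P h / h) \<longlongrightarrow> 0) (at_right 0)"
    proof -
      have "((\<lambda>h. poly ([:0, 1:] * P) (inverse h) * exp (- inverse h)) \<longlongrightarrow> 0) (at_right 0)"
        by (rule filterlim_compose[OF poly_exp_tendsto_0 filterlim_inverse_at_top_right])
      then show ?thesis
        by (rule Lim_transform_eventually) (auto simp: eventually_at_right_less flat_def field_simps intro!: eventually_at_rightI[of 0 1])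
    qed
    moreover have "((\<lambda>h. flat P h / h) \<longlongrightarrow> 0) (at_left 0)"
      by (rule Lim_transform_eventually[OF tendsto_const]) (auto simp: flat_def intro!: eventually_at_leftI[of "-1"])
    ultimately have "((\<lambda>h. flat P h / h) \<longlongrightarrow> 0) (at 0)" by (intro filterlim_split_at)
    then show ?thesis using 3 by (simp add: DERIV_def flat_def)
  qed
qed

lemma smooth_flat: "smooth_upto n (flat P)"
proof (induction n arbitrary: P)
  case 0 then show ?case using flat_has_derivative by (auto simp: field_differentiable_def)
next
  case (Suc n)
  have "deriv (flat P) = flat ([:0, 0, 1:] * (P - pderiv P))"
    using flat_has_derivative by (auto intro: DERIV_imp_deriv)
  then show ?case using Suc flat_has_derivative by (auto simp: field_differentiable_def)
qed

lemma test_function_iff: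
  "test_function S \<phi> \<longleftrightarrow> (\<forall>n. smooth_upto n \<phi>) \<and> (\<exists>K. compact K \<and> K \<subseteq> S \<and> (\<forall>x. x \<notin> K \<longrightarrow> \<phi> x = 0))"
  unfolding test_function_def smooth_upto_iff by auto

text \<open>
Smooth, supported in \<open>{c..d}\<close>, positive inside, and increasing to the indicator of the open interval as \<open>n\<close> grows.
\<close>

definition bump :: "nat \<Rightarrow> real \<Rightarrow> real \<Rightarrow> real \<Rightarrow> real" where
  "bump n c d x = flat 1 (real (Suc n) * (x - c)) * flat 1 (real (Suc n) * (d - x))"

lemma bump_test_function: "{c..d} \<subseteq> S \<Longrightarrow> test_function S (bump n c d)"
  unfolding test_function_iff
proof (intro conjI allI exI[of _ "{c..d}"])
  fix k
  have "smooth_upto k (\<lambda>x. 1 * flat 1 (real (Suc n) * x + (- real (Suc n) * c)))"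
    "smooth_upto k (\<lambda>x. 1 * flat 1 ((- real (Suc n)) * x + real (Suc n) * d))"
    by (intro smooth_upto_scale_affine smooth_flat)+
  from smooth_upto_mult[OF this] show "smooth_upto k (bump n c d)"
    unfolding bump_def by (simp add: algebra_simps)
qed (auto simp: bump_def flat_def zero_less_mult_iff)

lemma bump_bounds: "0 \<le> bump n c d x" "bump n c d x \<le> 1"
proof -
  have "0 \<le> flat 1 y" "flat 1 y \<le> 1" for y by (auto simp: flat_def)
  then show "0 \<le> bump n c d x" "bump n c d x \<le> 1"
    unfolding bump_def by (auto intro: mult_le_one)
qed

lemma bump_outside: "x \<notin> {c<..<d} \<Longrightarrow> bump n c d x = 0"
  by (auto simp: bump_def flat_def zero_less_mult_iff)

lemma bump_pos: "x \<in> {c<..<d} \<Longrightarrow> bump n c d x > 0"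
  by (auto simp: bump_def flat_def)

lemma bump_tendsto_1:
  assumes "x \<in> {c<..<d}"
  shows "(\<lambda>n. bump n c d x) \<longlonglongrightarrow> 1"
proof -
  have "(\<lambda>n. flat 1 (real (Suc n) * y)) \<longlonglongrightarrow> 1" if "y > 0" for y
  proof -
    have "(\<lambda>n. exp (- ((1 / y) * inverse (real (Suc n))))) \<longlonglongrightarrow> exp (- ((1 / y) * 0))"
      by (intro tendsto_intros LIMSEQ_inverse_real_of_nat)
    moreover have "(\<lambda>n. flat 1 (real (Suc n) * y)) = (\<lambda>n. exp (- ((1 / y) * inverse (real (Suc n)))))"
      using that by (auto simp: flat_def add_pos_nonneg distrib_left field_simps)
    ultimately show ?thesis by simp
  qed
  from tendsto_mult[OF this this, of "x - c" "d - x"] show ?thesis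
    using assms unfolding bump_def by auto
qed

lemma test_function_continuous: "test_function S \<phi> \<Longrightarrow> continuous_on X \<phi>"
  unfolding test_function_iff
  by (metis field_differentiable_imp_continuous_at continuous_at_imp_continuous_on smooth_upto.simps(1))

lemma test_function_deriv:
  assumes "test_function S \<phi>"
  shows "(\<phi> has_real_derivative deriv \<phi> x) (at x)" "continuous_on X (deriv \<phi>)"
proof -
  have "smooth_upto (Suc 0) \<phi>" using assms unfolding test_function_iff by blast
  then show "(\<phi> has_real_derivative deriv \<phi> x) (at x)" "continuous_on X (deriv \<phi>)"
    by (auto intro: field_differentiable_derivI field_differentiable_imp_continuous_at continuous_at_imp_continuous_on)
qed

lemma test_integral:
  fixes h :: "real \<Rightarrow> complex" and \<phi> :: "real \<Rightarrow> real"
  assumes h: "h absolutely_integrable_on {c..d}" and S: "{c..d} \<subseteq> S" "S \<in> sets lebesgue"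
    and \<phi>: "continuous_on {c..d} \<phi>" "\<And>x. x \<notin> {c..d} \<Longrightarrow> \<phi> x = 0"
  shows "(LINT x|lebesgue_on S. h x * of_real (\<phi> x)) = integral {c..d} (\<lambda>x. h x * of_real (\<phi> x))"
proof -
  have a: "(\<lambda>x. h x * of_real (\<phi> x)) absolutely_integrable_on {c..d}"
    by (intro absolutely_integrable_mult_continuous h continuous_intros \<phi>)
  have "(LINT x|lebesgue_on S. h x * of_real (\<phi> x)) = (LINT x|lebesgue. indicator S x *\<^sub>R (h x * of_real (\<phi> x)))"
    using S by (intro integral_restrict_space) auto
  also have "\<dots> = (LINT x:{c..d}|lebesgue. h x * of_real (\<phi> x))"
    unfolding set_lebesgue_integral_def
    using S \<phi>(2) by (intro Bochner_Integration.integral_cong) (auto simp: indicator_def)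
  also have "\<dots> = integral {c..d} (\<lambda>x. h x * of_real (\<phi> x))"
    by (rule set_lebesgue_integral_eq_integral(2)[OF a])
  finally show ?thesis .
qed

text \<open>
If all integrals of \<open>g\<close> over subintervals vanish, the error terms in Henstock's lemma are the terms of Riemann sums of
\<open>norm \<circ> g\<close>, which therefore has integral zero.
\<close>

lemma negligible_of_null_integrals:
  fixes g :: "real \<Rightarrow> complex"
  assumes g: "g absolutely_integrable_on {a..b}" and z: "\<And>c d. a \<le> c \<Longrightarrow> c \<le> d \<Longrightarrow> d \<le> b \<Longrightarrow> integral {c..d} g = 0"
  shows "negligible {x \<in> {a..b}. g x \<noteq> 0}"
proof -
  have "((\<lambda>x. norm (g x)) has_integral 0) (cbox a b)"
    unfolding has_integral
  proof (intro allI impI)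
    fix e :: real assume "e > 0"
    have gi: "g integrable_on cbox a b" using g by (simp add: absolutely_integrable_on_def)
    obtain \<gamma> where \<gamma>: "gauge \<gamma>"
      "\<And>p. \<lbrakk>p tagged_partial_division_of (cbox a b); \<gamma> fine p\<rbrakk> \<Longrightarrow> (\<Sum>(x,k)\<in>p. norm (measure lborel k *\<^sub>R g x - integral k g)) < e"
      by (rule Henstock_lemma[OF gi \<open>e > 0\<close>]) blast
    show "\<exists>\<gamma>. gauge \<gamma> \<and> (\<forall>\<D>. \<D> tagged_division_of cbox a b \<and> \<gamma> fine \<D> \<longrightarrow>
        norm ((\<Sum>(x, k)\<in>\<D>. measure lborel k *\<^sub>R norm (g x)) - 0) < e)"
    proof (intro exI[of _ \<gamma>] conjI allI impI \<gamma>(1))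
      fix p assume p: "p tagged_division_of cbox a b \<and> \<gamma> fine p"
      have "(\<Sum>(x, k)\<in>p. measure lborel k *\<^sub>R norm (g x)) = (\<Sum>(x,k)\<in>p. norm (measure lborel k *\<^sub>R g x - integral k g))"
      proof (rule sum.cong[OF refl], safe)
        fix x k assume xk: "(x, k) \<in> p"
        then obtain c d where k: "k = cbox c d" using tagged_division_ofD(4)[OF conjunct1[OF p] xk] by blast
        have "k \<subseteq> cbox a b" using tagged_division_ofD(3)[OF conjunct1[OF p] xk] .
        moreover have "x \<in> k" using tagged_division_ofD(2)[OF conjunct1[OF p] xk] .
        ultimately have "integral k g = 0" using z[of c d] k by auto
        then show "measure lborel k *\<^sub>R norm (g x) = norm (measure lborel k *\<^sub>R g x - integral k g)" by simp
      qed
      also have "\<dots> < e" using \<gamma>(2)[of p] p unfolding tagged_division_of_def by blast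
      finally have 1: "(\<Sum>(x, k)\<in>p. measure lborel k *\<^sub>R norm (g x)) < e" .
      have "0 \<le> (\<Sum>(x, k)\<in>p. measure lborel k *\<^sub>R norm (g x))" by (intro sum_nonneg) auto
      with 1 show "norm ((\<Sum>(x, k)\<in>p. measure lborel k *\<^sub>R norm (g x)) - 0) < e" by simp
    qed
  qed
  then have "integral {a..b} (\<lambda>x. norm (g x)) = 0" by (simp add: integral_unique)
  moreover have n: "(\<lambda>x. norm (g x)) absolutely_integrable_on {a..b}" using absolutely_integrable_norm[OF g] by (simp add: o_def)
  ultimately have "(LINT x:{a..b}|lebesgue. norm (g x)) = 0" using set_lebesgue_integral_eq_integral(2)[OF n] by simp
  then have "AE x in lebesgue. indicator {a..b} x *\<^sub>R norm (g x) = 0"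
    using n unfolding set_lebesgue_integral_def set_integrable_def
    by (subst (asm) integral_nonneg_eq_0_iff_AE) (auto simp: indicator_def)
  then have "AE x in lebesgue. \<not> (x \<in> {a..b} \<and> g x \<noteq> 0)" by (auto simp: indicator_def elim: eventually_mono)
  then obtain N where "N \<in> null_sets lebesgue" "{x. x \<in> {a..b} \<and> g x \<noteq> 0} \<subseteq> N"
    unfolding eventually_ae_filter by auto
  then show ?thesis by (metis (no_types, lifting) negligible_iff_null_sets negligible_subset)
qed

text \<open>
The bumps tend boundedly to the indicator of the interval, so the integrals of \<open>g\<close> itself vanish.
\<close>

lemma fundamental_lemma_interval:
  fixes g :: "real \<Rightarrow> complex"
  assumes g: "g absolutely_integrable_on {a..b}"
    and z: "\<And>n c d. a \<le> c \<Longrightarrow> c \<le> d \<Longrightarrow> d \<le> b \<Longrightarrow> integral {c..d} (\<lambda>x. g x * of_real (bump n c d x)) = 0"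
  shows "negligible {x \<in> {a..b}. g x \<noteq> 0}"
proof (rule negligible_of_null_integrals[OF g])
  fix c d assume cd: "a \<le> c" "c \<le> d" "d \<le> b"
  have gc: "g absolutely_integrable_on {c..d}" by (rule absolutely_integrable_on_subinterval[OF g]) (use cd in auto)
  have test: "test_function UNIV (bump n c d)" for n by (rule bump_test_function) auto
  have "integral {c..d} (\<lambda>x. g x * of_real (bump n c d x)) = 0" for n by (rule z[OF cd])
  moreover have "(\<lambda>n. integral {c..d} (\<lambda>x. g x * of_real (bump n c d x))) \<longlonglongrightarrow> integral {c..d} (\<lambda>x. g x * indicator {c<..<d} x)"
  proof (rule dominated_convergence(2)[where h = "\<lambda>x. norm (g x)"])
    show "(\<lambda>x. g x * of_real (bump n c d x)) integrable_on {c..d}" for n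
      by (intro set_lebesgue_integral_eq_integral(1) absolutely_integrable_mult_continuous gc continuous_intros test_function_continuous[OF test])
    show "(\<lambda>x. norm (g x)) integrable_on {c..d}" using gc by (simp add: absolutely_integrable_on_def)
    show "norm (g x * of_real (bump n c d x)) \<le> norm (g x)" for n x
      using bump_bounds[of n c d x] by (simp add: norm_mult mult_left_le)
    show "(\<lambda>n. g x * of_real (bump n c d x)) \<longlonglongrightarrow> g x * indicator {c<..<d} x" for x
    proof (cases "x \<in> {c<..<d}")
      case True
      have "(\<lambda>n. g x * of_real (bump n c d x)) \<longlonglongrightarrow> g x * of_real 1" by (intro tendsto_intros bump_tendsto_1 True)
      then show ?thesis using True by simp
    qed (simp add: bump_outside)
  qed
  ultimately have "(\<lambda>n::nat. 0) \<longlonglongrightarrow> integral {c..d} (\<lambda>x. g x * indicator {c<..<d} x)" by simp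
  then have "integral {c..d} (\<lambda>x. g x * indicator {c<..<d} x) = 0"
    by (simp add: LIMSEQ_const_iff)
  moreover have "integral {c..d} (\<lambda>x. g x * indicator {c<..<d} x) = integral {c..d} g"
    by (rule integral_spike[of "{c, d}"]) auto
  ultimately show "integral {c..d} g = 0" by simp
qed

lemma AE_open_of_intervals:
  fixes S :: "real set"
  assumes S: "open S" and P: "\<And>c d. {c..d} \<subseteq> S \<Longrightarrow> negligible {x \<in> {c..d}. \<not> P x}"
  shows "AE x in lebesgue_on S. P x"
proof -
  obtain \<D> where D: "countable \<D>" "\<D> \<subseteq> Pow S" "\<And>X. X \<in> \<D> \<Longrightarrow> \<exists>a b. X = cbox a b" "\<Union>\<D> = S"
    using open_countable_Union_open_cbox[OF S] by metis
  have "negligible (\<Union>X\<in>\<D>. {x \<in> X. \<not> P x})"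
  proof (rule negligible_countable_Union)
    show "countable ((\<lambda>X. {x \<in> X. \<not> P x}) ` \<D>)" using D by auto
    fix T assume "T \<in> (\<lambda>X. {x \<in> X. \<not> P x}) ` \<D>"
    then obtain X where X: "X \<in> \<D>" "T = {x \<in> X. \<not> P x}" by auto
    obtain c d where "X = cbox c d" using D(3)[OF X(1)] by auto
    then show "negligible T" using P[of c d] X D(2) by auto
  qed
  moreover have "(\<Union>X\<in>\<D>. {x \<in> X. \<not> P x}) = {x. \<not> (x \<in> S \<longrightarrow> P x)}" using D(4) by blast
  ultimately have "AE x in lebesgue. x \<in> S \<longrightarrow> P x"
    unfolding negligible_iff_null_sets by (intro AE_I') auto
  then show ?thesis using S by (subst AE_restrict_space_iff) auto
qed

lemma locally_integrable_Icc: "locally_integrable S f \<Longrightarrow> {c..d} \<subseteq> S \<Longrightarrow> f absolutely_integrable_on {c..d}"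
  unfolding locally_integrable_def by auto

lemma weak_deriv_unique:
  assumes S: "open S" and "has_weak_deriv S f g" "has_weak_deriv S f h"
  shows "AE x in lebesgue_on S. g x = h x"
proof (rule AE_open_of_intervals[OF S])
  fix c d assume cd: "{c..d} \<subseteq> S"
  have lg: "locally_integrable S g" "locally_integrable S h" using assms unfolding has_weak_deriv_def by auto
  have gh: "(\<lambda>x. g x - h x) absolutely_integrable_on {c..d}"
    using lg cd by (intro set_integral_diff locally_integrable_Icc)
  have "negligible {x \<in> {c..d}. g x - h x \<noteq> 0}"
  proof (rule fundamental_lemma_interval[OF gh])
    fix n s t assume st: "c \<le> s" "s \<le> t" "t \<le> d"
    have sub: "{s..t} \<subseteq> S" using st cd by auto
    have gi: "g absolutely_integrable_on {s..t}" "h absolutely_integrable_on {s..t}"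
      using lg sub by (auto intro: locally_integrable_Icc)
    have t: "test_function S (bump n s t)" by (rule bump_test_function[OF sub])
    have "(LINT x|lebesgue_on S. g x * of_real (bump n s t x)) = (LINT x|lebesgue_on S. h x * of_real (bump n s t x))"
    proof -
      have "- (LINT x|lebesgue_on S. g x * of_real (bump n s t x)) = - (LINT x|lebesgue_on S. h x * of_real (bump n s t x))"
        using assms(2,3) t unfolding has_weak_deriv_def by simp
      then show ?thesis by simp
    qed
    note LINT_eq = this
    have "integral {s..t} (\<lambda>x. g x * of_real (bump n s t x)) = integral {s..t} (\<lambda>x. h x * of_real (bump n s t x))"
    proof -
      have out: "bump n s t x = 0" if "x \<notin> {s..t}" for x using that by (intro bump_outside) auto
      have "S \<in> sets lebesgue" using S by auto
      note ti = test_integral[OF _ sub this test_function_continuous[OF t] out]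
      have "(LINT x|lebesgue_on S. g x * of_real (bump n s t x)) = integral {s..t} (\<lambda>x. g x * of_real (bump n s t x))"
        by (rule ti[OF gi(1)])
      moreover have "(LINT x|lebesgue_on S. h x * of_real (bump n s t x)) = integral {s..t} (\<lambda>x. h x * of_real (bump n s t x))"
        by (rule ti[OF gi(2)])
      ultimately show ?thesis using LINT_eq by simp
    qed
    moreover have "(\<lambda>x. g x * of_real (bump n s t x)) integrable_on {s..t}" "(\<lambda>x. h x * of_real (bump n s t x)) integrable_on {s..t}"
      by (intro set_lebesgue_integral_eq_integral(1) absolutely_integrable_mult_continuous gi continuous_intros test_function_continuous[OF t])+
    ultimately show "integral {s..t} (\<lambda>x. (g x - h x) * of_real (bump n s t x)) = 0"
      by (simp add: left_diff_distrib Henstock_Kurzweil_Integration.integral_diff)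
  qed
  then show "negligible {x \<in> {c..d}. \<not> g x = h x}" by simp
qed

lemma compact_subset_open_interval:
  fixes S K :: "real set"
  assumes S: "open S" "is_interval S" "S \<noteq> {}" and K: "compact K" "K \<subseteq> S"
  obtains c d where "c < d" "{c..d} \<subseteq> S" "K \<subseteq> {c<..<d}"
proof -
  obtain w where w: "w \<in> S" using S by blast
  define K' where "K' = insert w K"
  have K': "compact K'" "K' \<noteq> {}" "K' \<subseteq> S" using K w by (auto simp: K'_def)
  obtain l where l: "l \<in> K'" "\<And>x. x \<in> K' \<Longrightarrow> l \<le> x" using compact_attains_inf[OF K'(1,2)] by blast
  obtain u where u: "u \<in> K'" "\<And>x. x \<in> K' \<Longrightarrow> x \<le> u" using compact_attains_sup[OF K'(1,2)] by blast
  obtain e1 where e1: "e1 > 0" "ball l e1 \<subseteq> S" using S(1) l(1) K'(3) by (meson open_contains_ball subsetD)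
  obtain e2 where e2: "e2 > 0" "ball u e2 \<subseteq> S" using S(1) u(1) K'(3) by (meson open_contains_ball subsetD)
  have "l - e1 / 2 \<in> S" "u + e2 / 2 \<in> S"
    using e1 e2 by (auto simp: subset_iff dist_real_def)
  then have "{l - e1/2 .. u + e2/2} \<subseteq> S" using S(2) unfolding is_interval_1 by (meson atLeastAtMost_iff subsetI)
  moreover have "K \<subseteq> {l - e1/2 <..< u + e2/2}"
  proof
    fix x assume "x \<in> K"
    then have "l \<le> x" "x \<le> u" using l u by (auto simp: K'_def)
    then show "x \<in> {l - e1/2 <..< u + e2/2}" using e1(1) e2(1) by auto
  qed
  moreover have "l - e1/2 < u + e2/2" using l u e1(1) e2(1) by (smt (verit) half_gt_zero)
  ultimately show ?thesis using that by blast
qed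

text \<open>
Reduces the integrals in the definition of a weak derivative to one compact interval containing the support.
\<close>

lemma test_function_integrals:
  assumes S: "open S" "is_interval S" "S \<noteq> {}" and \<phi>: "test_function S \<phi>"
  obtains c d where "c < d" "{c..d} \<subseteq> S" "\<phi> c = 0" "\<phi> d = 0"
    "\<And>f. locally_integrable S f \<Longrightarrow> (LINT x|lebesgue_on S. f x * of_real (\<phi> x)) = integral {c..d} (\<lambda>x. f x * of_real (\<phi> x))"
    "\<And>f. locally_integrable S f \<Longrightarrow> (LINT x|lebesgue_on S. f x * of_real (deriv \<phi> x)) = integral {c..d} (\<lambda>x. f x * of_real (deriv \<phi> x))"
proof -
  obtain K where K: "compact K" "K \<subseteq> S" "\<And>x. x \<notin> K \<Longrightarrow> \<phi> x = 0" using \<phi> unfolding test_function_def by blast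
  obtain c d where cd: "c < d" "{c..d} \<subseteq> S" "K \<subseteq> {c<..<d}" by (rule compact_subset_open_interval[OF S K(1,2)])
  have out: "\<phi> x = 0" if "x \<notin> {c..d}" for x using that cd(3) by (intro K(3)) auto
  have dout: "deriv \<phi> x = 0" if "x \<notin> {c..d}" for x
  proof (rule DERIV_imp_deriv)
    have "open (- {c..d})" by (simp add: open_Compl)
    then have "\<forall>\<^sub>F y in nhds x. y \<in> - {c..d}" using that by (intro eventually_nhds_in_open) auto
    then have "\<forall>\<^sub>F y in nhds x. \<phi> y = 0" by (rule eventually_mono) (use out in auto)
    then show "(\<phi> has_field_derivative 0) (at x)" by (subst DERIV_cong_ev[OF refl _ refl, of _ "\<lambda>_. 0"]) auto
  qed
  have Sm: "S \<in> sets lebesgue" using S(1) by auto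
  show ?thesis
  proof (rule that[OF cd(1,2)])
    show "\<phi> c = 0" "\<phi> d = 0" using cd(3) by (auto intro!: K(3))
    fix f assume "locally_integrable S f"
    then have f: "f absolutely_integrable_on {c..d}" using cd(2) by (rule locally_integrable_Icc)
    show "(LINT x|lebesgue_on S. f x * of_real (\<phi> x)) = integral {c..d} (\<lambda>x. f x * of_real (\<phi> x))"
      by (rule test_integral[OF f cd(2) Sm test_function_continuous[OF \<phi>] out])
    show "(LINT x|lebesgue_on S. f x * of_real (deriv \<phi> x)) = integral {c..d} (\<lambda>x. f x * of_real (deriv \<phi> x))"
      by (rule test_integral[OF f cd(2) Sm test_function_deriv(2)[OF \<phi>] dout])
  qed
qed

lemma locally_integrable_if_Icc:
  assumes S: "open S" "is_interval S" "S \<noteq> {}" and f: "\<And>c d. {c..d} \<subseteq> S \<Longrightarrow> f absolutely_integrable_on {c..d}"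
  shows "locally_integrable S f"
  unfolding locally_integrable_def
proof (intro allI impI)
  fix K assume K: "compact K \<and> K \<subseteq> S"
  then obtain c d where cd: "{c..d} \<subseteq> S" "K \<subseteq> {c<..<d}" by (metis compact_subset_open_interval[OF S])
  have "K \<in> sets lebesgue" using K by (simp add: compact_imp_closed)
  then show "f absolutely_integrable_on K"
    by (rule set_integrable_subset[OF f[OF cd(1)]]) (use cd(2) in force)
qed

text \<open>Integration by parts; the boundary terms vanish with the test function.\<close>

lemma prim_imp_weak_deriv:
  assumes S: "open S" "is_interval S" "S \<noteq> {}" and F: "\<And>c d. {c..d} \<subseteq> S \<Longrightarrow> prim c d F f"
  shows "has_weak_deriv S F f"
proof -
  have lf: "locally_integrable S f" by (rule locally_integrable_if_Icc[OF S prim_integrable[OF F]])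
  have lF: "locally_integrable S F"
    by (rule locally_integrable_if_Icc[OF S]) (rule absolutely_integrable_continuous_real[OF prim_continuous[OF F]])
  have "(LINT x|lebesgue_on S. F x * of_real (deriv \<phi> x)) = - (LINT x|lebesgue_on S. f x * of_real (\<phi> x))"
    if \<phi>: "test_function S \<phi>" for \<phi>
  proof -
    obtain c d where cd: "c < d" "{c..d} \<subseteq> S" "\<phi> c = 0" "\<phi> d = 0"
      and i: "\<And>f. locally_integrable S f \<Longrightarrow> (LINT x|lebesgue_on S. f x * of_real (\<phi> x)) = integral {c..d} (\<lambda>x. f x * of_real (\<phi> x))"
      "\<And>f. locally_integrable S f \<Longrightarrow> (LINT x|lebesgue_on S. f x * of_real (deriv \<phi> x)) = integral {c..d} (\<lambda>x. f x * of_real (deriv \<phi> x))"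
      by (rule test_function_integrals[OF S \<phi>]) blast
    have p: "prim c d (\<lambda>x. complex_of_real (\<phi> x)) (\<lambda>x. complex_of_real (deriv \<phi> x))"
    proof (rule prim_FTC[of _ _ "{}"])
      show "continuous_on {c..d} (\<lambda>x. complex_of_real (\<phi> x))" by (intro continuous_intros test_function_continuous[OF \<phi>])
      show "(\<lambda>x. complex_of_real (deriv \<phi> x)) absolutely_integrable_on {c..d}"
        by (intro absolutely_integrable_continuous_real continuous_intros test_function_deriv[OF \<phi>])
      show "((\<lambda>x. complex_of_real (\<phi> x)) has_vector_derivative complex_of_real (deriv \<phi> x)) (at x)" for x
        using test_function_deriv(1)[OF \<phi>, of x] by (intro has_vector_derivative_of_real) (simp add: has_real_derivative_iff_has_vector_derivative)
    qed (use cd in auto)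
    note m = prim_mult[OF F[OF cd(2)] p]
    have "integral {c..d} (\<lambda>x. f x * of_real (\<phi> x) + F x * of_real (deriv \<phi> x)) = 0"
      using prim_diff[OF m, of c d] cd by simp
    moreover have "(\<lambda>x. f x * of_real (\<phi> x)) integrable_on {c..d}" 
      by (intro set_lebesgue_integral_eq_integral(1) absolutely_integrable_mult_continuous prim_integrable[OF F[OF cd(2)]]
          continuous_intros test_function_continuous[OF \<phi>])
    moreover have "(\<lambda>x. F x * of_real (deriv \<phi> x)) integrable_on {c..d}"
      by (intro integrable_continuous_real continuous_intros prim_continuous[OF F[OF cd(2)]] test_function_deriv[OF \<phi>])
    ultimately show ?thesis unfolding i(1)[OF lf] i(2)[OF lF]
      by (simp add: Henstock_Kurzweil_Integration.integral_add add_eq_0_iff)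
  qed
  then show ?thesis unfolding has_weak_deriv_def using lf lF by blast
qed

lemma AE_lebesgue_on_Icc:
  fixes S :: "real set"
  assumes "AE x in lebesgue_on S. P x" "S \<in> sets lebesgue" "{c..d} \<subseteq> S"
  obtains N where "negligible N" "\<And>x. x \<in> {c..d} - N \<Longrightarrow> P x"
proof -
  have "AE x in lebesgue. x \<in> S \<longrightarrow> P x"
    using assms(1,2) by (subst (asm) AE_restrict_space_iff) auto
  then obtain N where "N \<in> null_sets lebesgue" "{x. \<not> (x \<in> S \<longrightarrow> P x)} \<subseteq> N"
    unfolding eventually_ae_filter by auto
  then have "negligible N" "\<And>x. x \<in> {c..d} - N \<Longrightarrow> P x" using assms(3) by (auto simp: negligible_iff_null_sets)
  then show ?thesis by (rule that)
qed

lemma locally_integrable_cong: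
  assumes S: "open S" "is_interval S" "S \<noteq> {}" and "locally_integrable S f" "AE x in lebesgue_on S. f x = g x"
  shows "locally_integrable S g"
proof (rule locally_integrable_if_Icc[OF S])
  fix c d assume cd: "{c..d} \<subseteq> S"
  obtain N where N: "negligible N" "\<And>x. x \<in> {c..d} - N \<Longrightarrow> f x = g x"
    using AE_lebesgue_on_Icc[OF assms(5) _ cd] S(1) by auto
  show "g absolutely_integrable_on {c..d}"
    by (rule absolutely_integrable_spike[OF locally_integrable_Icc[OF assms(4) cd] N(1)]) (use N in auto)
qed

lemma has_weak_deriv_cong:
  assumes S: "open S" "is_interval S" "S \<noteq> {}" and w: "has_weak_deriv S f g"
    and ff: "AE x in lebesgue_on S. f x = f' x" and gg: "AE x in lebesgue_on S. g x = g' x"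
  shows "has_weak_deriv S f' g'"
proof -
  have l: "locally_integrable S f" "locally_integrable S g" using w by (auto simp: has_weak_deriv_def)
  have l': "locally_integrable S f'" "locally_integrable S g'"
    using l locally_integrable_cong[OF S _ ff] locally_integrable_cong[OF S _ gg] by auto
  have "(LINT x|lebesgue_on S. f' x * of_real (deriv \<phi> x)) = - (LINT x|lebesgue_on S. g' x * of_real (\<phi> x))"
    if \<phi>: "test_function S \<phi>" for \<phi>
  proof -
    obtain c d where cd: "c < d" "{c..d} \<subseteq> S"
      and i: "\<And>f. locally_integrable S f \<Longrightarrow> (LINT x|lebesgue_on S. f x * of_real (\<phi> x)) = integral {c..d} (\<lambda>x. f x * of_real (\<phi> x))"
      "\<And>f. locally_integrable S f \<Longrightarrow> (LINT x|lebesgue_on S. f x * of_real (deriv \<phi> x)) = integral {c..d} (\<lambda>x. f x * of_real (deriv \<phi> x))"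
      by (rule test_function_integrals[OF S \<phi>]) blast
    have Sm: "S \<in> sets lebesgue" using S(1) by auto
    obtain N where N: "negligible N" "\<And>x. x \<in> {c..d} - N \<Longrightarrow> f x = f' x" using AE_lebesgue_on_Icc[OF ff Sm cd(2)] by blast
    obtain N' where N': "negligible N'" "\<And>x. x \<in> {c..d} - N' \<Longrightarrow> g x = g' x" using AE_lebesgue_on_Icc[OF gg Sm cd(2)] by blast
    have "integral {c..d} (\<lambda>x. f x * of_real (deriv \<phi> x)) = - integral {c..d} (\<lambda>x. g x * of_real (\<phi> x))"
      using w \<phi> i(1)[OF l(2)] i(2)[OF l(1)] unfolding has_weak_deriv_def by simp
    moreover have "integral {c..d} (\<lambda>x. f x * of_real (deriv \<phi> x)) = integral {c..d} (\<lambda>x. f' x * of_real (deriv \<phi> x))"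
      by (rule integral_spike[OF N(1)]) (use N in auto)
    moreover have "integral {c..d} (\<lambda>x. g x * of_real (\<phi> x)) = integral {c..d} (\<lambda>x. g' x * of_real (\<phi> x))"
      by (rule integral_spike[OF N'(1)]) (use N' in auto)
    ultimately show ?thesis unfolding i(1)[OF l'(2)] i(2)[OF l'(1)] by simp
  qed
  then show ?thesis unfolding has_weak_deriv_def using l' by blast
qed

lemma weak_deriv_AE:
  assumes "open S" "has_weak_deriv S f g"
  shows "has_weak_deriv S f (weak_deriv S f)" "AE x in lebesgue_on S. weak_deriv S f x = g x"
proof -
  show w: "has_weak_deriv S f (weak_deriv S f)" unfolding weak_deriv_def by (rule someI[of "has_weak_deriv S f", OF assms(2)])
  show "AE x in lebesgue_on S. weak_deriv S f x = g x" by (rule weak_deriv_unique[OF assms(1) w assms(2)])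
qed

lemma primitive_exists:
  assumes "\<And>a b. g absolutely_integrable_on {a..b}"
  obtains G where "\<And>a b. prim a b G g"
proof
  fix a b :: real
  let ?G = "\<lambda>x. if x \<ge> 0 then integral {0..x} g else - integral {x..0} g"
  have inc: "?G y - ?G x = integral {x..y} g" if "x \<le> y" for x y
  proof -
    have g: "g integrable_on {s..t}" for s t using assms[of s t] by (simp add: absolutely_integrable_on_def)
    have c: "integral {s..t} g + integral {t..u} g = integral {s..u} g" if "s \<le> t" "t \<le> u" for s t u
      using that g by (intro Henstock_Kurzweil_Integration.integral_combine) auto
    show ?thesis using c[of 0 x y] c[of x 0 y] c[of x y 0] that by (auto simp: algebra_simps)
  qed
  show "prim a b ?G g"
    unfolding prim_def using assms inc by auto
qed

text \<open>
Every bump, corrected by a multiple of the fixed bump on \<open>{0..1}\<close> to have integral zero, is the derivative of a test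
function. Hence testing \<open>h\<close> with a bump gives a constant \<open>k\<close> times the integral of the bump, and \<open>h - k\<close> vanishes
almost everywhere.
\<close>

lemma zero_weak_deriv_imp_const:
  fixes h :: "real \<Rightarrow> complex"
  assumes h: "\<And>a b. h absolutely_integrable_on {a..b}"
    and z: "\<And>\<phi>. test_function UNIV \<phi> \<Longrightarrow> (LINT x|lebesgue_on UNIV. h x * of_real (deriv \<phi> x)) = 0"
  obtains k where "AE x in lebesgue. h x = k"
proof -
  note U = open_UNIV is_interval_univ UNIV_not_empty
  have lh: "locally_integrable UNIV h" by (rule locally_integrable_if_Icc[OF U h])
  define m0 where "m0 = integral {0..1} (bump 0 0 1)"
  have bc: "continuous_on {a..b} (bump n c d)" for a b n c d by (rule test_function_continuous[OF bump_test_function[of c d UNIV]]) auto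
  have m0: "m0 > 0"
  proof -
    have "m0 \<noteq> 0"
      unfolding m0_def using integral_eq_0_iff[OF bc[of 0 1 0 0 1]] bump_bounds bump_pos[of "1/2" 0 1 0] by force
    moreover have "m0 \<ge> 0" unfolding m0_def
      by (intro Henstock_Kurzweil_Integration.integral_nonneg integrable_continuous_real bc bump_bounds)
    ultimately show ?thesis by simp
  qed
  define \<phi>0 where "\<phi>0 = bump 0 0 1"
  define k where "k = integral {0..1} (\<lambda>x. h x * of_real (\<phi>0 x)) / of_real m0"
  have main: "integral {c..d} (\<lambda>x. (h x - k) * of_real (bump n c d x)) = 0" if cd: "c \<le> d" for n c d
  proof -
    define \<psi> where "\<psi> = bump n c d"
    define m where "m = integral {c..d} \<psi>"
    define \<eta> where "\<eta> = (\<lambda>x. \<psi> x + (- m / m0) * \<phi>0 x)"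
    define A B where "A = min c 0 - 1" and "B = max d 1 + 1"
    have AB: "A < c" "d < B" "A < 0" "1 < B" by (auto simp: A_def B_def)
    have t: "test_function UNIV \<psi>" "test_function UNIV \<phi>0" unfolding \<psi>_def \<phi>0_def by (intro bump_test_function subset_UNIV)+
    have \<psi>out: "\<psi> x = 0" if "x \<notin> {c<..<d}" for x using that unfolding \<psi>_def by (rule bump_outside)
    have \<phi>out: "\<phi>0 x = 0" if "x \<notin> {0<..<1}" for x using that unfolding \<phi>0_def by (rule bump_outside)
    have smooth: "smooth_upto j \<eta>" for j
    proof -
      have "smooth_upto j (\<lambda>x. (- m / m0) * \<phi>0 (1 * x + 0))" using t(2) by (intro smooth_upto_scale_affine) (simp add: test_function_iff)
      then show ?thesis unfolding \<eta>_def using t(1) by (intro smooth_upto_add) (auto simp: test_function_iff)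
    qed
    have \<eta>cont: "continuous_on X \<eta>" for X
      using smooth[of 0] by (auto intro: field_differentiable_imp_continuous_at continuous_at_imp_continuous_on)
    have \<eta>out: "\<eta> x = 0" if "x \<le> A + 1 \<or> x \<ge> B - 1" for x
      using that \<psi>out[of x] \<phi>out[of x] by (auto simp: \<eta>_def A_def B_def)
    have ext: "integral {A..B} f = integral {s..t} f" if "\<And>x. x \<notin> {s..t} \<Longrightarrow> f x = 0" "A \<le> s" "t \<le> B"
      for f :: "real \<Rightarrow> 'b::banach" and s t
      using that by (intro integral_spike_set) (auto intro: empty_imp_negligible)
    have \<eta>0: "integral {A..B} \<eta> = 0"
    proof -
      have "integral {A..B} \<psi> = m" unfolding m_def using AB \<psi>out by (intro ext) auto
      moreover have "integral {A..B} \<phi>0 = m0" unfolding m0_def \<phi>0_def[symmetric] using AB \<phi>out by (intro ext) auto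
      moreover have "integral {A..B} \<eta> = integral {A..B} \<psi> + (- m / m0) * integral {A..B} \<phi>0"
      proof -
        have "\<psi> integrable_on {A..B}" "(\<lambda>x. (- m / m0) * \<phi>0 x) integrable_on {A..B}"
          by (intro integrable_on_mult_right integrable_continuous_real test_function_continuous[OF t(1)] test_function_continuous[OF t(2)])+
        from Henstock_Kurzweil_Integration.integral_add[OF this]
        show ?thesis unfolding \<eta>_def by (simp only: integral_mult_right)
      qed
      ultimately show ?thesis using m0 by simp
    qed
    define \<Phi> where "\<Phi> = (\<lambda>x. integral {A..x} \<eta>)"
    have d\<Phi>: "(\<Phi> has_real_derivative \<eta> x) (at x)" for x
    proof (cases "x > A")
      case True
      have "(\<Phi> has_real_derivative \<eta> x) (at x within {A..x+1})"
        unfolding \<Phi>_def by (rule integral_has_real_derivative[OF \<eta>cont]) (use True in auto)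
      moreover have "at x within {A..x+1} = at x" using True by (intro at_within_interior) (auto simp: interior_atLeastAtMost_real)
      ultimately show ?thesis by simp
    next
      case False
      have 0: "\<Phi> y = 0" if "y \<in> {..<A+1}" for y
      proof -
        have "integral {A..y} \<eta> = integral {A..y} (\<lambda>_. 0)"
          by (rule Henstock_Kurzweil_Integration.integral_cong) (use that \<eta>out in auto)
        then show ?thesis by (simp add: \<Phi>_def)
      qed
      have "\<forall>\<^sub>F y in nhds x. y \<in> {..<A+1}" using False by (intro eventually_nhds_in_open) auto
      then have "\<forall>\<^sub>F y in nhds x. \<Phi> y = 0" by (rule eventually_mono) (rule 0)
      then show ?thesis using \<eta>out[of x] False by (subst DERIV_cong_ev[OF refl _ refl, of _ "\<lambda>_. 0"]) auto
    qed
    have der: "deriv \<Phi> = \<eta>" using d\<Phi> by (auto intro: DERIV_imp_deriv)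
    have \<Phi>out: "\<Phi> x = 0" if "x \<notin> {A..B}" for x
    proof (cases "x < A")
      case False
      then have x: "x > B" using that by auto
      have "integral {A..x} \<eta> = integral {A..B} \<eta>"
        using x AB cd \<eta>out by (intro integral_spike_set) (auto intro: empty_imp_negligible)
      then show ?thesis using \<eta>0 by (simp add: \<Phi>_def)
    qed (simp add: \<Phi>_def)
    have "smooth_upto j \<Phi>" for j
    proof (cases j)
      case 0 then show ?thesis using d\<Phi> by (auto simp: field_differentiable_def)
    next
      case (Suc j') then show ?thesis using d\<Phi> smooth der by (auto simp: field_differentiable_def)
    qed
    then have tt: "test_function UNIV \<Phi>"
      unfolding test_function_iff using \<Phi>out by (intro conjI allI exI[of _ "{A..B}"]) auto
    have hi: "(\<lambda>x. h x * of_real (\<phi> x)) integrable_on {A..B}" if "continuous_on {A..B} \<phi>" for \<phi> :: "real \<Rightarrow> real"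
      by (intro set_lebesgue_integral_eq_integral(1) absolutely_integrable_mult_continuous h continuous_intros that)
    have "(LINT x|lebesgue_on UNIV. h x * of_real (\<eta> x)) = 0" using z[OF tt] unfolding der .
    moreover have "(LINT x|lebesgue_on UNIV. h x * of_real (\<eta> x)) = integral {A..B} (\<lambda>x. h x * of_real (\<eta> x))"
      by (rule test_integral[OF h]) (use \<eta>out \<eta>cont in auto)
    ultimately have "0 = integral {A..B} (\<lambda>x. h x * of_real (\<psi> x) + of_real (- m / m0) * (h x * of_real (\<phi>0 x)))"
      by (simp add: \<eta>_def algebra_simps)
    also have "\<dots> = integral {A..B} (\<lambda>x. h x * of_real (\<psi> x)) + of_real (- m / m0) * integral {A..B} (\<lambda>x. h x * of_real (\<phi>0 x))"
    proof -
      have "(\<lambda>x. h x * of_real (\<psi> x)) integrable_on {A..B}"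
        "(\<lambda>x. complex_of_real (- m / m0) * (h x * of_real (\<phi>0 x))) integrable_on {A..B}"
        by (intro integrable_on_mult_right hi test_function_continuous[OF t(1)] test_function_continuous[OF t(2)])+
      from Henstock_Kurzweil_Integration.integral_add[OF this]
      show ?thesis by (simp only: integral_mult_right)
    qed
    also have "integral {A..B} (\<lambda>x. h x * of_real (\<psi> x)) = integral {c..d} (\<lambda>x. h x * of_real (\<psi> x))"
      using AB \<psi>out by (intro ext) auto
    also have "integral {A..B} (\<lambda>x. h x * of_real (\<phi>0 x)) = k * of_real m0"
      using AB \<phi>out m0 unfolding k_def by (subst ext[of 0 1]) auto
    finally have e: "integral {c..d} (\<lambda>x. h x * of_real (\<psi> x)) = k * of_real m" using m0 by (simp add: algebra_simps)
    have "integral {c..d} (\<lambda>x. (h x - k) * of_real (\<psi> x)) = integral {c..d} (\<lambda>x. h x * of_real (\<psi> x) - k * of_real (\<psi> x))"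
      by (simp add: left_diff_distrib)
    also have "\<dots> = integral {c..d} (\<lambda>x. h x * of_real (\<psi> x)) - integral {c..d} (\<lambda>x. k * of_real (\<psi> x))"
      by (intro Henstock_Kurzweil_Integration.integral_diff integrable_continuous_real continuous_intros test_function_continuous[OF t(1)]
          set_lebesgue_integral_eq_integral(1) absolutely_integrable_mult_continuous h)
    also have "integral {c..d} (\<lambda>x. k * of_real (\<psi> x)) = k * of_real m"
    proof -
      have "\<psi> integrable_on {c..d}" by (intro integrable_continuous_real test_function_continuous[OF t(1)])
      from integral_linear[OF this bounded_linear_of_real[where 'a = complex]]
      have "integral {c..d} (\<lambda>x. complex_of_real (\<psi> x)) = of_real m" by (simp add: o_def m_def)
      then show ?thesis by (simp only: integral_mult_right)
    qed
    finally show ?thesis using e by (simp add: \<psi>_def)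
  qed
  have "AE x in lebesgue_on UNIV. h x - k = 0"
  proof (rule AE_open_of_intervals[OF open_UNIV])
    fix c d :: real
    have "(\<lambda>x. h x - k) absolutely_integrable_on {c..d}" by (intro set_integral_diff(1)[OF h] absolutely_integrable_continuous_real continuous_intros)
    then show "negligible {x \<in> {c..d}. \<not> h x - k = 0}" by (rule fundamental_lemma_interval) (rule main)
  qed
  then have "AE x in lebesgue. h x = k" unfolding lebesgue_on_UNIV_eq by simp
  then show ?thesis by (rule that)
qed

text \<open>
Compare \<open>f\<close> with an indefinite integral of \<open>g\<close>: the difference has weak derivative zero.
\<close>

lemma weak_deriv_imp_prim:
  assumes "has_weak_deriv UNIV f g"
  obtains F where "\<And>a b. prim a b F g" "AE x in lebesgue. f x = F x"
proof -
  note U = open_UNIV is_interval_univ UNIV_not_empty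
  have l: "locally_integrable UNIV f" "locally_integrable UNIV g" using assms by (auto simp: has_weak_deriv_def)
  obtain G where G: "\<And>a b. prim a b G g" using primitive_exists[OF locally_integrable_Icc[OF l(2) subset_UNIV]] by blast
  have w: "has_weak_deriv UNIV G g" by (rule prim_imp_weak_deriv[OF U G])
  have lG: "locally_integrable UNIV G" using w by (auto simp: has_weak_deriv_def)
  have h: "(\<lambda>x. f x - G x) absolutely_integrable_on {a..b}" for a b
    using l lG by (intro set_integral_diff locally_integrable_Icc) auto
  have lh: "locally_integrable UNIV (\<lambda>x. f x - G x)" by (rule locally_integrable_if_Icc[OF U h])
  obtain k where k: "AE x in lebesgue. f x - G x = k"
  proof (rule zero_weak_deriv_imp_const[OF h])
    fix \<phi> assume \<phi>: "test_function UNIV \<phi>"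
    obtain c d where cd: "c < d"
      and i: "\<And>f. locally_integrable UNIV f \<Longrightarrow> (LINT x|lebesgue_on UNIV. f x * of_real (\<phi> x)) = integral {c..d} (\<lambda>x. f x * of_real (\<phi> x))"
      "\<And>f. locally_integrable UNIV f \<Longrightarrow> (LINT x|lebesgue_on UNIV. f x * of_real (deriv \<phi> x)) = integral {c..d} (\<lambda>x. f x * of_real (deriv \<phi> x))"
      by (rule test_function_integrals[OF U \<phi>]) blast
    have fi: "(\<lambda>x. u x * of_real (deriv \<phi> x)) integrable_on {c..d}" if "locally_integrable UNIV u" for u
      by (intro set_lebesgue_integral_eq_integral(1) absolutely_integrable_mult_continuous locally_integrable_Icc[OF that subset_UNIV]
          continuous_intros test_function_deriv[OF \<phi>])
    have "integral {c..d} (\<lambda>x. f x * of_real (deriv \<phi> x)) = integral {c..d} (\<lambda>x. G x * of_real (deriv \<phi> x))"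
      using assms w \<phi> i(2)[OF l(1)] i(2)[OF lG] unfolding has_weak_deriv_def by simp
    then show "(LINT x|lebesgue_on UNIV. (f x - G x) * of_real (deriv \<phi> x)) = 0"
      unfolding i(2)[OF lh] using fi[OF l(1)] fi[OF lG]
      by (simp add: left_diff_distrib Henstock_Kurzweil_Integration.integral_diff)
  qed blast
  show ?thesis
  proof (rule that[of "\<lambda>x. G x + k"])
    show "prim a b (\<lambda>x. G x + k) g" for a b
      using prim_lincomb[OF G prim_const, of a b 1 k] by simp
    show "AE x in lebesgue. f x = G x + k" using k by eventually_elim (simp add: algebra_simps)
  qed
qed

section \<open>The periodic equation\<close>

lemma norm_integral_power_bound:
  fixes g :: "real \<Rightarrow> complex"
  assumes "g integrable_on {a..x}" "a \<le> x" "\<And>t. a \<le> t \<Longrightarrow> t \<le> x \<Longrightarrow> cmod (g t) \<le> K * (t - a) ^ n"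
  shows "cmod (integral {a..x} g) \<le> K * (x - a) ^ Suc n / real (Suc n)"
proof -
  have "((\<lambda>t. K * (t - a) ^ Suc n / real (Suc n)) has_real_derivative K * (t - a) ^ n) (at t within {a..x})" for t
    by (auto intro!: derivative_eq_intros simp del: of_nat_Suc power_Suc simp: field_simps)
  then have "((\<lambda>t. K * (t - a) ^ n) has_integral (K * (x - a) ^ Suc n / real (Suc n) - K * (a - a) ^ Suc n / real (Suc n))) {a..x}"
    using assms(2) by (intro fundamental_theorem_of_calculus) (auto simp: has_real_derivative_iff_has_vector_derivative simp del: power_Suc of_nat_Suc)
  then have i: "((\<lambda>t. K * (t - a) ^ n) has_integral (K * (x - a) ^ Suc n / real (Suc n))) {a..x}" by simp
  have "cmod (integral {a..x} g) \<le> integral {a..x} (\<lambda>t. K * (t - a) ^ n)"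
    using assms i by (intro Henstock_Kurzweil_Integration.integral_norm_bound_integral) auto
  then show ?thesis using integral_unique[OF i] by simp
qed

lemma borel_measurable_complex_of_real_lebesgue_on:
  "h \<in> borel_measurable borel \<Longrightarrow> (\<lambda>x::real. complex_of_real (h x)) \<in> borel_measurable (lebesgue_on S)"
  by (intro measurable_restrict_space1 measurable_completion) simp

lemma periodic_shift_int:
  fixes f :: "real \<Rightarrow> 'a"
  assumes "\<And>x. f (x + 1) = f x"
  shows "f (x + of_int n) = f x"
proof -
  have nat: "f (x + of_nat k) = f x" for x k
  proof (induction k)
    case (Suc k)
    then show ?case using assms[of "x + of_nat k"] by (simp add: add_ac)
  qed simp
  show ?thesis
    using nat[of x "nat n"] nat[of "x + of_int n" "nat (- n)"] by (cases "n \<ge> 0") auto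
qed

locale periodic_coefficients =
  fixes p q :: "real \<Rightarrow> real" and p0 qm :: real
  assumes p_cont: "\<And>X. continuous_on X p" and p_per: "\<And>x. p (x + 1) = p x" and q_per: "\<And>x. q (x + 1) = q x"
    and p0_pos: "p0 > 0" and p_ge: "\<And>x. p0 \<le> p x" and q_borel: "q \<in> borel_measurable borel"
    and q_bound: "\<And>x. \<bar>q x\<bar> \<le> qm"
begin

lemma p_pos: "p x > 0" using p0_pos p_ge[of x] by linarith

lemma qm_nonneg: "qm \<ge> 0" using q_bound[of 0] by linarith

lemma inverse_p_bound: "cmod (w / of_real (p x)) \<le> cmod w / p0"
  using p_ge[of x] p0_pos by (simp add: norm_divide frac_le)

lemma inverse_p_cont: "continuous_on X (\<lambda>x. 1 / complex_of_real (p x))"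
  using p_pos by (intro continuous_intros p_cont) (auto simp: less_le)

lemma divide_p_cont: "continuous_on X v \<Longrightarrow> continuous_on X (\<lambda>x. v x / complex_of_real (p x))"
  using p_pos by (intro continuous_intros p_cont) (auto simp: less_le)

lemma q_minus_bound: "cmod (of_real (q x) - z) \<le> qm + cmod z"
  using norm_triangle_ineq4[of "complex_of_real (q x)" z] q_bound[of x] by simp

text \<open>
\<open>V a f\<close> and \<open>U a f\<close> are the flux and the value of the solution of \<open>- (p u')' = f\<close> with zero data at \<open>a\<close>, while \<open>P a\<close>
solves the homogeneous equation with value 0 and flux 1.
\<close>

definition V :: "real \<Rightarrow> (real \<Rightarrow> complex) \<Rightarrow> real \<Rightarrow> complex" where
  "V a f x = - integral {a..x} f"

definition U :: "real \<Rightarrow> (real \<Rightarrow> complex) \<Rightarrow> real \<Rightarrow> complex" where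
  "U a f x = integral {a..x} (\<lambda>t. V a f t / of_real (p t))"

definition P :: "real \<Rightarrow> real \<Rightarrow> complex" where
  "P a x = integral {a..x} (\<lambda>t. 1 / of_real (p t))"

lemma V_start [simp]: "V a f a = 0" and U_start [simp]: "U a f a = 0" and P_start [simp]: "P a a = 0"
  by (simp_all add: V_def U_def P_def)

lemma prim_V:
  assumes "f absolutely_integrable_on {a..b}"
  shows "prim a b (V a f) (\<lambda>x. - f x)"
  using prim_cmult[OF prim_indefinite[OF assms], of "-1"] unfolding V_def by simp

lemma prim_U:
  assumes "f absolutely_integrable_on {a..b}"
  shows "prim a b (U a f) (\<lambda>x. V a f x / of_real (p x))"
proof -
  have "(\<lambda>x. V a f x / of_real (p x)) absolutely_integrable_on {a..b}"
    by (intro absolutely_integrable_continuous_real divide_p_cont prim_continuous[OF prim_V[OF assms]])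
  from prim_indefinite[OF this] show ?thesis unfolding U_def .
qed

lemma prim_P: "prim a b (P a) (\<lambda>x. 1 / of_real (p x))"
  unfolding P_def by (intro prim_indefinite absolutely_integrable_continuous_real inverse_p_cont)

lemma V_lincomb:
  assumes "f absolutely_integrable_on {a..b}" "g absolutely_integrable_on {a..b}" "x \<in> {a..b}"
  shows "V a (\<lambda>y. f y + c * g y) x = V a f x + c * V a g x"
proof (rule prim_unique[OF prim_V prim_lincomb[OF prim_V[OF assms(1)] prim_V[OF assms(2)]] _ _ assms(3)])
  show "(\<lambda>y. f y + c * g y) absolutely_integrable_on {a..b}"
    using assms by (intro set_integral_add set_integrable_mult_right) auto
qed auto

lemma U_lincomb:
  assumes "f absolutely_integrable_on {a..b}" "g absolutely_integrable_on {a..b}" "x \<in> {a..b}"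
  shows "U a (\<lambda>y. f y + c * g y) x = U a f x + c * U a g x"
proof (rule prim_unique[OF prim_U prim_lincomb[OF prim_U[OF assms(1)] prim_U[OF assms(2)]] _ _ assms(3)])
  show "(\<lambda>y. f y + c * g y) absolutely_integrable_on {a..b}"
    using assms by (intro set_integral_add set_integrable_mult_right) auto
  show "AE x in lebesgue_on {a<..<b}. V a (\<lambda>y. f y + c * g y) x / of_real (p x) = V a f x / of_real (p x) + c * (V a g x / of_real (p x))"
    by (rule AE_I2) (simp add: V_lincomb[OF assms(1,2)] add_divide_distrib)
qed auto

lemma integral_norm_le_L2:
  assumes "f \<in> L2 {a<..<b}" "a \<le> b" "a \<le> x" "x \<le> y" "y \<le> b"
  shows "integral {x..y} (\<lambda>t. cmod (f t)) \<le> sqrt (b - a) * L2_norm {a<..<b} f"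
proof -
  have f: "(\<lambda>t. cmod (f t)) absolutely_integrable_on {a..b}"
    using absolutely_integrable_norm[OF L2_absolutely_integrable[OF assms(1,2)]] by (simp add: o_def)
  have "integral {x..y} (\<lambda>t. cmod (f t)) \<le> integral {a..b} (\<lambda>t. cmod (f t))"
    using absolutely_integrable_imp_integrable_subinterval[OF f] assms by (intro integral_subset_le) auto
  also have "\<dots> = integral {a<..<b} (\<lambda>t. cmod (f t))" by (simp add: integral_open_interval_real)
  also have "\<dots> = (LINT t|lebesgue_on {a<..<b}. cmod (f t))"
    using L2_integrable_interval(1)[OF assms(1,2)] by (intro lebesgue_integral_eq_integral[symmetric]) auto
  also have "\<dots> \<le> sqrt (b - a) * L2_norm {a<..<b} f" by (rule L2_integrable_interval(2)[OF assms(1,2)])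
  finally show ?thesis .
qed

lemma V_bound:
  assumes "f \<in> L2 {a<..<b}" "a \<le> x" "x \<le> b"
  shows "cmod (V a f x) \<le> sqrt (b - a) * L2_norm {a<..<b} f"
proof -
  have ab: "a \<le> b" using assms by linarith
  from prim_norm_le[OF prim_V[OF L2_absolutely_integrable[OF assms(1) ab]], of a x]
  have "cmod (V a f x) \<le> integral {a..x} (\<lambda>t. cmod (f t))" using assms by simp
  also have "\<dots> \<le> sqrt (b - a) * L2_norm {a<..<b} f" using assms by (intro integral_norm_le_L2) auto
  finally show ?thesis .
qed

lemma U_Lipschitz:
  assumes "f \<in> L2 {a<..<b}" "a \<le> x" "x \<le> y" "y \<le> b"
  shows "cmod (U a f y - U a f x) \<le> (y - x) * (sqrt (b - a) / p0) * L2_norm {a<..<b} f"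
proof -
  have ab: "a \<le> b" using assms by linarith
  note i = L2_absolutely_integrable[OF assms(1) ab]
  have int: "(\<lambda>x. V a f x / of_real (p x)) integrable_on cbox x y"
    using absolutely_integrable_imp_integrable_subinterval[OF prim_integrable[OF prim_U[OF i]]] assms by simp
  have B: "0 \<le> sqrt (b - a) * L2_norm {a<..<b} f / p0" using ab p0_pos by simp
  have "cmod (V a f t / of_real (p t)) \<le> sqrt (b - a) * L2_norm {a<..<b} f / p0" if "t \<in> cbox x y" for t
  proof -
    have "cmod (V a f t) \<le> sqrt (b - a) * L2_norm {a<..<b} f" using assms that by (intro V_bound) auto
    then show ?thesis
      using inverse_p_bound[of "V a f t" t] p0_pos divide_right_mono[of _ _ p0] by (meson less_imp_le order_trans)
  qed
  from integrable_bound[OF B int this]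
  have "cmod (integral (cbox x y) (\<lambda>t. V a f t / of_real (p t))) \<le> (sqrt (b - a) * L2_norm {a<..<b} f / p0) * measure lborel (cbox x y)" .
  then show ?thesis using prim_diff[OF prim_U[OF i], of x y] assms by (simp add: mult_ac)
qed

text \<open>Variation of constants: a pair is recovered from \<open>f\<close> and its data at \<open>a\<close>.\<close>

lemma solution_representation:
  assumes u: "prim a b u (\<lambda>x. v x / of_real (p x))" and v: "prim a b v (\<lambda>x. - f x)"
    and x: "x \<in> {a..b}"
  shows "v x = V a f x + v a" "u x = U a f x + u a + v a * P a x"
proof -
  have f: "f absolutely_integrable_on {a..b}" using set_integrable_mult_right[of "-1", OF prim_integrable[OF v]] by simp
  have vv: "v x = V a f x + v a" if "x \<in> {a..b}" for x
  proof -
    have "prim a b (\<lambda>x. V a f x + v a) (\<lambda>x. - f x)" using prim_lincomb[OF prim_V[OF f] prim_const, of 1 "v a"] by simp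
    from prim_unique[OF v this _ _ that] show ?thesis by simp
  qed
  then show "v x = V a f x + v a" using x .
  have pp: "prim a b (\<lambda>x. U a f x + u a + v a * P a x) (\<lambda>x. V a f x / of_real (p x) + v a * (1 / of_real (p x)))"
    using prim_lincomb[OF prim_lincomb[OF prim_U[OF f] prim_const, of 1 "u a"] prim_P, of "v a"] by simp
  show "u x = U a f x + u a + v a * P a x"
  proof (rule prim_unique[OF u pp _ _ x])
    show "AE x in lebesgue_on {a<..<b}. v x / of_real (p x) = V a f x / of_real (p x) + v a * (1 / of_real (p x))"
    proof (rule AE_I2)
      fix y assume "y \<in> space (lebesgue_on {a<..<b})"
      then have "v y = V a f y + v a" by (intro vv) auto
      then show "v y / of_real (p y) = V a f y / of_real (p y) + v a * (1 / of_real (p y))" by (simp add: add_divide_distrib)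
    qed
  qed simp
qed

lemma solution_construction:
  assumes f: "f absolutely_integrable_on {a..b}"
  shows "prim a b (\<lambda>x. U a f x + c1 + c2 * P a x) (\<lambda>x. (V a f x + c2) / of_real (p x))"
    "prim a b (\<lambda>x. V a f x + c2) (\<lambda>x. - f x)"
  using prim_lincomb[OF prim_lincomb[OF prim_U[OF f] prim_const, of 1 c1] prim_P, of c2]
    prim_lincomb[OF prim_V[OF f] prim_const, of 1 c2] by (simp_all add: add_divide_distrib)

text \<open>
Solutions of the unperturbed equation as a first-order system for the value \<open>u\<close> and the flux \<open>v\<close>.
\<close>

definition osol :: "complex \<Rightarrow> real \<Rightarrow> real \<Rightarrow> (real \<Rightarrow> complex) \<Rightarrow> (real \<Rightarrow> complex) \<Rightarrow> bool" where
  "osol z a b u v \<longleftrightarrow> prim a b u (\<lambda>x. v x / of_real (p x)) \<and> prim a b v (\<lambda>x. (of_real (q x) - z) * u x)"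

lemma osol_lincomb:
  assumes "osol z a b u v" "osol z a b u' v'"
  shows "osol z a b (\<lambda>x. u x + c * u' x) (\<lambda>x. v x + c * v' x)"
proof -
  have "prim a b (\<lambda>x. u x + c * u' x) (\<lambda>x. v x / of_real (p x) + c * (v' x / of_real (p x)))"
    "prim a b (\<lambda>x. v x + c * v' x) (\<lambda>x. (of_real (q x) - z) * u x + c * ((of_real (q x) - z) * u' x))"
    using assms prim_lincomb[of a b u "\<lambda>x. v x / of_real (p x)" u' "\<lambda>x. v' x / of_real (p x)" c]
      prim_lincomb[of a b v "\<lambda>x. (of_real (q x) - z) * u x" v' "\<lambda>x. (of_real (q x) - z) * u' x" c]
    unfolding osol_def by blast+
  moreover have "(\<lambda>x. v x / of_real (p x) + c * (v' x / of_real (p x))) = (\<lambda>x. (v x + c * v' x) / of_real (p x))"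
    by (simp add: add_divide_distrib)
  moreover have "(\<lambda>x. (of_real (q x) - z) * u x + c * ((of_real (q x) - z) * u' x)) = (\<lambda>x. (of_real (q x) - z) * (u x + c * u' x))"
    by (simp add: algebra_simps)
  ultimately show ?thesis unfolding osol_def by simp
qed

text \<open>
Gronwall's argument: iterating the integral equation bounds \<open>\<bar>u\<bar> + \<bar>v\<bar>\<close> by \<open>m (\<kappa> (x - a))\<^sup>n / n!\<close> for every \<open>n\<close>.
\<close>

lemma osol_unique_zero:
  assumes s: "osol z a b u v" and z0: "u a = 0" "v a = 0" and x: "x \<in> {a..b}"
  shows "u x = 0" "v x = 0"
proof -
  have pu: "prim a b u (\<lambda>x. v x / of_real (p x))" and pv: "prim a b v (\<lambda>x. (of_real (q x) - z) * u x)"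
    using s by (auto simp: osol_def)
  define \<kappa> where "\<kappa> = 1 / p0 + qm + cmod z"
  have \<kappa>: "\<kappa> \<ge> 0" using p0_pos qm_nonneg by (simp add: \<kappa>_def)
  have "continuous_on {a..b} (\<lambda>x. cmod (u x) + cmod (v x))" by (intro continuous_intros prim_continuous[OF pu] prim_continuous[OF pv])
  then have "bounded ((\<lambda>x. cmod (u x) + cmod (v x)) ` {a..b})" using compact_continuous_image compact_imp_bounded by blast
  then obtain m where "\<forall>y\<in>(\<lambda>x. cmod (u x) + cmod (v x)) ` {a..b}. norm y \<le> m"
    unfolding bounded_iff by blast
  then have m: "cmod (u x) + cmod (v x) \<le> m" if "x \<in> {a..b}" for x using that by fastforce
  have bound: "x \<in> {a..b} \<Longrightarrow> cmod (u x) + cmod (v x) \<le> m * (\<kappa> * (x - a)) ^ n / fact n" for x n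
  proof (induction n arbitrary: x)
    case (Suc n)
    define K where "K = m * \<kappa> ^ n / fact n"
    have IH: "cmod (u t) + cmod (v t) \<le> K * (t - a) ^ n" if "t \<in> {a..x}" for t
      using Suc.IH[of t] Suc.prems that by (simp add: K_def power_mult_distrib mult_ac)
    have IH': "cmod (u t) \<le> K * (t - a) ^ n" "cmod (v t) \<le> K * (t - a) ^ n" if "t \<in> {a..x}" for t
      using IH[OF that] norm_ge_zero[of "u t"] norm_ge_zero[of "v t"] by linarith+
    have "cmod (integral {a..x} (\<lambda>t. v t / of_real (p t))) \<le> (K / p0) * (x - a) ^ Suc n / real (Suc n)"
    proof (rule norm_integral_power_bound)
      show "(\<lambda>t. v t / of_real (p t)) integrable_on {a..x}"
        using absolutely_integrable_imp_integrable_subinterval[OF prim_integrable[OF pu]] Suc.prems by simp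
      fix t assume "a \<le> t" "t \<le> x"
      then show "cmod (v t / of_real (p t)) \<le> K / p0 * (t - a) ^ n"
        using inverse_p_bound[of "v t" t] divide_right_mono[OF IH'(2)[of t], of p0] p0_pos by simp
    qed (use Suc.prems in auto)
    then have 1: "cmod (u x) \<le> (K / p0) * (x - a) ^ Suc n / real (Suc n)"
      using prim_diff[OF pu, of a x] Suc.prems z0 by simp
    have "cmod (integral {a..x} (\<lambda>t. (of_real (q t) - z) * u t)) \<le> ((qm + cmod z) * K) * (x - a) ^ Suc n / real (Suc n)"
    proof (rule norm_integral_power_bound)
      show "(\<lambda>t. (of_real (q t) - z) * u t) integrable_on {a..x}"
        using absolutely_integrable_imp_integrable_subinterval[OF prim_integrable[OF pv]] Suc.prems by simp
      fix t assume "a \<le> t" "t \<le> x"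
      then have "cmod (of_real (q t) - z) * cmod (u t) \<le> (qm + cmod z) * (K * (t - a) ^ n)"
        using q_minus_bound[of t z] IH'(1)[of t] qm_nonneg by (intro mult_mono) auto
      then show "cmod ((of_real (q t) - z) * u t) \<le> (qm + cmod z) * K * (t - a) ^ n" by (simp add: norm_mult mult.assoc)
    qed (use Suc.prems in auto)
    then have 2: "cmod (v x) \<le> ((qm + cmod z) * K) * (x - a) ^ Suc n / real (Suc n)"
      using prim_diff[OF pv, of a x] Suc.prems z0 by simp
    have "(K / p0) * (x - a) ^ Suc n / real (Suc n) + ((qm + cmod z) * K) * (x - a) ^ Suc n / real (Suc n)
        = m * (\<kappa> * (x - a)) ^ Suc n / fact (Suc n)"
    proof -
      have "(K / p0) * (x - a) ^ Suc n / real (Suc n) + ((qm + cmod z) * K) * (x - a) ^ Suc n / real (Suc n)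
        = \<kappa> * (K * (x - a) ^ Suc n / real (Suc n))"
        by (simp add: \<kappa>_def distrib_right del: of_nat_Suc power_Suc) (simp add: add_divide_distrib distrib_right)
      also have "\<dots> = m * (\<kappa> * (x - a)) ^ Suc n / fact (Suc n)"
        by (simp add: K_def power_mult_distrib mult_ac)
      finally show ?thesis .
    qed
    then show ?case using 1 2 by linarith
  qed (use m in auto)
  have "(\<lambda>n. (\<kappa> * (x - a)) ^ n / fact n) \<longlonglongrightarrow> 0"
    using summable_LIMSEQ_zero[OF summable_exp[of "\<kappa> * (x - a)"]] by (simp add: divide_inverse mult.commute)
  then have "(\<lambda>n. m * ((\<kappa> * (x - a)) ^ n / fact n)) \<longlonglongrightarrow> m * 0"
    by (intro tendsto_intros)
  then have "cmod (u x) + cmod (v x) \<le> 0"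
    using bound[OF x] by (intro LIMSEQ_le_const) auto
  then show "u x = 0" "v x = 0" using norm_ge_zero[of "u x"] norm_ge_zero[of "v x"] by (smt (verit) norm_le_zero_iff)+
qed

lemma periodic_int: "p (x + of_int n) = p x" "q (x + of_int n) = q x"
  using periodic_shift_int[where f = p, OF p_per] periodic_shift_int[where f = q, OF q_per] by auto

lemma osol_shift:
  assumes "osol z a b u v"
  shows "osol z (a - of_int n) (b - of_int n) (\<lambda>x. u (x + of_int n)) (\<lambda>x. v (x + of_int n))"
proof -
  have "prim (a - of_int n) (b - of_int n) (\<lambda>x. u (x + of_int n)) (\<lambda>x. v (x + of_int n) / of_real (p (x + of_int n)))"
    using assms unfolding osol_def by (intro prim_shift) auto
  moreover have "prim (a - of_int n) (b - of_int n) (\<lambda>x. v (x + of_int n)) (\<lambda>x. (of_real (q (x + of_int n)) - z) * u (x + of_int n))"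
    using assms unfolding osol_def by (intro prim_shift[of a b v "\<lambda>x. (of_real (q x) - z) * u x"]) auto
  ultimately show ?thesis unfolding osol_def periodic_int by simp
qed

lemma wronskian:
  assumes "osol z a b u v" "osol z a b u' v'" "a \<le> b"
  shows "u b * v' b - u' b * v b = u a * v' a - u' a * v a"
proof -
  have p: "prim a b u (\<lambda>x. v x / of_real (p x))" "prim a b v (\<lambda>x. (of_real (q x) - z) * u x)"
    "prim a b u' (\<lambda>x. v' x / of_real (p x))" "prim a b v' (\<lambda>x. (of_real (q x) - z) * u' x)"
    using assms by (auto simp: osol_def)
  let ?w = "\<lambda>x. u x * v' x + (-1) * (u' x * v x)"
  let ?w' = "\<lambda>x. (v x / of_real (p x) * v' x + u x * ((of_real (q x) - z) * u' x)) + (-1) * (v' x / of_real (p x) * v x + u' x * ((of_real (q x) - z) * u x))"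
  have "prim a b ?w ?w'" by (intro prim_lincomb prim_mult p)
  moreover have "?w' = (\<lambda>x. 0)" by (auto simp: algebra_simps)
  ultimately have "prim a b ?w (\<lambda>x. 0)" by simp
  from prim_diff[OF this, of a b] assms(3) show ?thesis by (simp add: algebra_simps)
qed

text \<open>Integrate the derivative of \<open>v\<close> times the conjugate of \<open>u\<close>.\<close>

lemma green_identity:
  assumes u: "prim a b u (\<lambda>x. v x / of_real (p x))" and v: "prim a b v w" and ab: "a \<le> b"
  shows "v b * cnj (u b) - v a * cnj (u a) = integral {a..b} (\<lambda>x. w x * cnj (u x)) + of_real (integral {a..b} (\<lambda>x. (cmod (v x))\<^sup>2 / p x))"
proof -
  have m: "prim a b (\<lambda>x. v x * cnj (u x)) (\<lambda>x. w x * cnj (u x) + v x * cnj (v x / of_real (p x)))"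
    by (intro prim_mult v prim_cnj u)
  have e: "v x * cnj (v x / of_real (p x)) = of_real ((cmod (v x))\<^sup>2 / p x)" for x
    by (simp add: complex_norm_square[symmetric])
  have vi: "(\<lambda>x. (cmod (v x))\<^sup>2 / p x) integrable_on {a..b}"
    using p_pos by (intro integrable_continuous_real continuous_intros prim_continuous[OF v] p_cont) (auto simp: less_le)
  have "(\<lambda>x. w x * cnj (u x)) integrable_on {a..b}"
    by (intro set_lebesgue_integral_eq_integral(1) absolutely_integrable_mult_continuous prim_integrable[OF v] continuous_on_cnj prim_continuous[OF u])
  moreover have "((\<lambda>x. complex_of_real ((cmod (v x))\<^sup>2 / p x)) has_integral of_real (integral {a..b} (\<lambda>x. (cmod (v x))\<^sup>2 / p x))) {a..b}"
    using has_integral_linear[OF integrable_integral[OF vi] bounded_linear_of_real[where 'a = complex]] by (simp add: o_def)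
  ultimately have "((\<lambda>x. w x * cnj (u x) + of_real ((cmod (v x))\<^sup>2 / p x)) has_integral
    (integral {a..b} (\<lambda>x. w x * cnj (u x)) + of_real (integral {a..b} (\<lambda>x. (cmod (v x))\<^sup>2 / p x)))) {a..b}"
    by (intro has_integral_add integrable_integral)
  with prim_diff[OF m, of a b] ab show ?thesis unfolding e by (simp add: integral_unique)
qed

end

lemma bounded_operatorI_pointwise:
  assumes "a \<le> b" and m: "\<And>f. f \<in> L2 {a<..<b} \<Longrightarrow> T f \<in> borel_measurable (lebesgue_on {a<..<b})"
    and k: "\<And>f x. f \<in> L2 {a<..<b} \<Longrightarrow> x \<in> {a<..<b} \<Longrightarrow> cmod (T f x) \<le> K * L2_norm {a<..<b} f"
    and l: "\<And>f g c x. f \<in> L2 {a<..<b} \<Longrightarrow> g \<in> L2 {a<..<b} \<Longrightarrow> x \<in> {a<..<b} \<Longrightarrow>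
       T (\<lambda>y. f y + c * g y) x = T f x + c * T g x"
  shows "bounded_operator {a<..<b} T"
  unfolding bounded_operator_def
proof (intro conjI ballI allI)
  fix f assume f: "f \<in> L2 {a<..<b}"
  show "T f \<in> L2 {a<..<b}" by (rule L2_bounded(1)[OF m[OF f] k[OF f] assms(1)])
next
  have "L2_norm {a<..<b} (T f) \<le> (sqrt (b - a) * K) * L2_norm {a<..<b} f" if f: "f \<in> L2 {a<..<b}" for f
    using L2_bounded(2)[OF m[OF f] k[OF f] assms(1)] by (simp add: mult.assoc)
  then show "\<exists>k. \<forall>f\<in>L2 {a<..<b}. L2_norm {a<..<b} (T f) \<le> k * L2_norm {a<..<b} f" by blast
next
  fix f g c assume "f \<in> L2 {a<..<b}" "g \<in> L2 {a<..<b}"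
  then show "AE x in lebesgue_on {a<..<b}. T (\<lambda>y. f y + c * g y) x = T f x + c * T g x"
    by (intro AE_I2) (use l in auto)
qed

lemma bounded_functionalI:
  assumes "\<And>f. f \<in> L2 S \<Longrightarrow> cmod (l f) \<le> K * L2_norm S f"
    and "\<And>f g c. f \<in> L2 S \<Longrightarrow> g \<in> L2 S \<Longrightarrow> l (\<lambda>y. f y + c * g y) = l f + c * l g"
  shows "bounded_functional S l"
  unfolding bounded_functional_def using assms by blast

lemma continuous_on_measurable_lebesgue_on:
  fixes f :: "real \<Rightarrow> complex"
  assumes "continuous_on {a..b} f"
  shows "f \<in> borel_measurable (lebesgue_on {a<..<b})"
  by (rule continuous_imp_measurable_on_sets_lebesgue[OF continuous_on_subset[OF assms]]) auto

lemma neumann_iterate_L2: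
  assumes "bounded_operator S A" "bounded_operator S B" "g0 \<in> L2 S" "g1 \<in> L2 S"
  shows "neumann_iterate A B g0 g1 z n \<in> L2 S"
proof (induction n)
  case 0 show ?case using assms(3,4) by (simp add: L2_lincomb)
next
  case (Suc n)
  then have "A (neumann_iterate A B g0 g1 z n) \<in> L2 S" "B (neumann_iterate A B g0 g1 z n) \<in> L2 S"
    using assms(1,2) unfolding bounded_operator_def by blast+
  then show ?case by (simp add: L2_lincomb)
qed

context periodic_coefficients begin

lemma U_bound:
  assumes "f \<in> L2 {a<..<b}" "x \<in> {a..b}"
  shows "cmod (U a f x) \<le> (b - a) * (sqrt (b - a) / p0) * L2_norm {a<..<b} f"
proof -
  have "cmod (U a f x) \<le> (x - a) * (sqrt (b - a) / p0) * L2_norm {a<..<b} f"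
    using U_Lipschitz[OF assms(1), of a x] assms(2) by simp
  also have "\<dots> \<le> (b - a) * (sqrt (b - a) / p0) * L2_norm {a<..<b} f"
    using assms(2) p0_pos by (intro mult_right_mono) auto
  finally show ?thesis .
qed

lemma U_continuous: "f \<in> L2 {a<..<b} \<Longrightarrow> a \<le> b \<Longrightarrow> continuous_on {a..b} (U a f)"
  by (rule prim_continuous[OF prim_U[OF L2_absolutely_integrable]])

lemma U_L2_lincomb:
  assumes "f \<in> L2 {a<..<b}" "g \<in> L2 {a<..<b}" "x \<in> {a..b}"
  shows "U a (\<lambda>y. f y + c * g y) x = U a f x + c * U a g x" "V a (\<lambda>y. f y + c * g y) x = V a f x + c * V a g x"
  using assms by (auto intro!: U_lincomb[where a = a and b = b] V_lincomb[where a = a and b = b] L2_absolutely_integrable)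

lemma U_bounded_operator: "a \<le> b \<Longrightarrow> bounded_operator {a<..<b} (U a)"
  by (rule bounded_operatorI_pointwise)
    (auto intro!: U_bound U_L2_lincomb(1)[where a = a and b = b] continuous_on_measurable_lebesgue_on U_continuous)

lemma U_bounded_functional: "x \<in> {a..b} \<Longrightarrow> bounded_functional {a<..<b} (\<lambda>f. U a f x)"
  by (rule bounded_functionalI) (auto intro!: U_bound U_L2_lincomb(1)[where a = a and b = b])

lemma V_bounded_functional: "x \<in> {a..b} \<Longrightarrow> bounded_functional {a<..<b} (\<lambda>f. V a f x)"
  by (rule bounded_functionalI) (auto intro!: V_bound U_L2_lincomb(2)[where a = a and b = b])

lemma q_measurable: "(\<lambda>x. complex_of_real (q x)) \<in> borel_measurable (lebesgue_on S)"
  by (rule borel_measurable_complex_of_real_lebesgue_on[OF q_borel])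

lemma qU_bounded_operator:
  assumes "a \<le> b"
  shows "bounded_operator {a<..<b} (\<lambda>f x. - of_real (q x) * U a f x)"
proof (rule bounded_operatorI_pointwise[OF assms])
  fix f assume f: "f \<in> L2 {a<..<b}"
  show "(\<lambda>x. - of_real (q x) * U a f x) \<in> borel_measurable (lebesgue_on {a<..<b})"
    using q_measurable continuous_on_measurable_lebesgue_on[OF U_continuous[OF f assms]] by measurable
  fix x assume "x \<in> {a<..<b}"
  then have "\<bar>q x\<bar> * cmod (U a f x) \<le> qm * ((b - a) * (sqrt (b - a) / p0) * L2_norm {a<..<b} f)"
    using q_bound qm_nonneg U_bound[OF f, of x] by (intro mult_mono) auto
  then show "cmod (- of_real (q x) * U a f x) \<le> qm * ((b - a) * (sqrt (b - a) / p0)) * L2_norm {a<..<b} f"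
    by (simp add: norm_mult mult.assoc)
next
  fix f g c x assume "f \<in> L2 {a<..<b}" "g \<in> L2 {a<..<b}" "x \<in> {a<..<b}"
  then have "U a (\<lambda>y. f y + c * g y) x = U a f x + c * U a g x" by (intro U_L2_lincomb) auto
  then show "- of_real (q x) * U a (\<lambda>y. f y + c * g y) x = - of_real (q x) * U a f x + c * (- of_real (q x) * U a g x)"
    by (simp add: algebra_simps)
qed

lemma P_Lipschitz:
  assumes "x \<le> y" "a \<le> x"
  shows "cmod (P a y - P a x) \<le> (y - x) / p0"
proof -
  have "(\<lambda>t. 1 / complex_of_real (p t)) integrable_on cbox x y"
    by (intro integrable_continuous inverse_p_cont)
  then have "cmod (integral (cbox x y) (\<lambda>t. 1 / complex_of_real (p t))) \<le> 1 / p0 * measure lborel (cbox x y)"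
    using p0_pos inverse_p_bound[of 1] by (intro integrable_bound) auto
  then show ?thesis using prim_diff[OF prim_P, of a x y y] assms by simp
qed

lemma P_continuous: "continuous_on {a..b} (P a)"
  by (rule prim_continuous[OF prim_P])

lemma P_nonzero:
  assumes "a < b" shows "P a b \<noteq> 0"
proof -
  have c: "continuous_on {a..b} (\<lambda>t. 1 / p t)" using p_pos by (intro continuous_intros p_cont) (auto simp: less_le)
  have "integral {a..b} (\<lambda>t. 1 / p t) \<noteq> 0"
    using integral_eq_0_iff[OF c] p_pos assms by (auto simp: less_imp_le less_le intro!: bexI[of _ a])
  moreover have "P a b = of_real (integral {a..b} (\<lambda>t. 1 / p t))"
    using integral_linear[OF integrable_continuous_real[OF c] bounded_linear_of_real[where 'a = complex]]
    by (simp add: P_def o_def)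
  ultimately show ?thesis by simp
qed

section \<open>Energy and transfer matrix of a period cell\<close>

text \<open>Such a \<open>u\<close> equals the multiple \<open>v a\<close> of \<open>P a\<close>, which is nonzero at \<open>b\<close>.\<close>

lemma zero_flux:
  assumes u: "prim a b u (\<lambda>x. v x / of_real (p x))" and v: "prim a b v (\<lambda>x. 0)"
    and ab: "a < b" and z: "u a = 0" "u b = 0"
  shows "v a = 0"
proof -
  have "u b = U a (\<lambda>x. 0) b + u a + v a * P a b"
    by (rule solution_representation(2)[OF u]) (use v ab in auto)
  moreover have "U a (\<lambda>x. 0) b = 0" by (simp add: U_def V_def)
  ultimately show ?thesis using z P_nonzero[OF ab] by simp
qed

lemma osol_zero:
  assumes s: "osol z a b u v" and u0: "\<And>x. x \<in> {a..b} \<Longrightarrow> u x = 0" and ab: "a < b"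
  shows "v a = 0"
proof (rule zero_flux[OF _ _ ab])
  show "prim a b u (\<lambda>x. v x / of_real (p x))" using s by (simp add: osol_def)
  have "prim a b v (\<lambda>x. (of_real (q x) - z) * u x)" using s by (simp add: osol_def)
  then show "prim a b v (\<lambda>x. 0)" by (rule prim_spike[of _ _ _ _ "{}"]) (use u0 in auto)
qed (use u0 ab in auto)

text \<open>
Imaginary and real part of Green's identity. For nonreal \<open>z\<close> the first formula measures the norm of a solution by its
boundary data, which expresses the symmetry of the periodic operator.
\<close>

lemma cell_energy:
  assumes s: "osol z a b u v" and ab: "a < b"
  defines "S \<equiv> integral {a..b} (\<lambda>x. (cmod (u x))\<^sup>2)"
  shows "Im (v b * cnj (u b)) - Im (v a * cnj (u a)) = - Im z * S"
    "Re (v b * cnj (u b)) - Re (v a * cnj (u a)) \<ge> - (qm + \<bar>Re z\<bar>) * S"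
    "S \<ge> 0" "S = 0 \<Longrightarrow> u a = 0 \<and> v a = 0"
proof -
  have pu: "prim a b u (\<lambda>x. v x / of_real (p x))" and pv: "prim a b v (\<lambda>x. (of_real (q x) - z) * u x)"
    using s by (auto simp: osol_def)
  have uc: "continuous_on {a..b} u" and vc: "continuous_on {a..b} v" using pu pv prim_continuous by blast+
  have u2: "(\<lambda>x. (cmod (u x))\<^sup>2) integrable_on {a..b}" by (intro integrable_continuous_real continuous_intros uc)
  have quu: "(\<lambda>x. (of_real (q x) - z) * u x * cnj (u x)) integrable_on {a..b}"
    by (intro set_lebesgue_integral_eq_integral(1) absolutely_integrable_mult_continuous prim_integrable[OF pv] continuous_on_cnj uc)
  have e: "(of_real (q x) - z) * u x * cnj (u x) = of_real ((q x - Re z) * (cmod (u x))\<^sup>2) - \<i> * of_real (Im z * (cmod (u x))\<^sup>2)" for x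
  proof -
    have "u x * cnj (u x) = of_real ((cmod (u x))\<^sup>2)" by (simp only: complex_norm_square)
    then have "(of_real (q x) - z) * u x * cnj (u x) = (of_real (q x) - z) * of_real ((cmod (u x))\<^sup>2)" by (simp add: mult.assoc)
    then show ?thesis by (simp add: complex_eq_iff algebra_simps)
  qed
  define I where "I = integral {a..b} (\<lambda>x. (of_real (q x) - z) * u x * cnj (u x))"
  have I: "((\<lambda>x. (of_real (q x) - z) * u x * cnj (u x)) has_integral I) {a..b}" unfolding I_def using quu by (rule integrable_integral)
  have ImI: "Im I = - Im z * S"
  proof -
    have "((\<lambda>x. - Im z * (cmod (u x))\<^sup>2) has_integral Im I) {a..b}"
      using has_integral_linear[OF I bounded_linear_Im] unfolding o_def e by simp
    moreover have "((\<lambda>x. - Im z * (cmod (u x))\<^sup>2) has_integral (- Im z * S)) {a..b}"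
      unfolding S_def by (intro has_integral_mult_right integrable_integral u2)
    ultimately show ?thesis by (rule has_integral_unique)
  qed
  have ReI: "Re I \<ge> - (qm + \<bar>Re z\<bar>) * S"
  proof (rule has_integral_le)
    show "((\<lambda>x. - (qm + \<bar>Re z\<bar>) * (cmod (u x))\<^sup>2) has_integral (- (qm + \<bar>Re z\<bar>) * S)) {a..b}"
      unfolding S_def by (intro has_integral_mult_right integrable_integral u2)
    show "((\<lambda>x. (q x - Re z) * (cmod (u x))\<^sup>2) has_integral Re I) {a..b}"
      using has_integral_linear[OF I bounded_linear_Re] unfolding o_def e by simp
    show "- (qm + \<bar>Re z\<bar>) * (cmod (u x))\<^sup>2 \<le> (q x - Re z) * (cmod (u x))\<^sup>2" for x
      using q_bound[of x] by (intro mult_right_mono) auto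
  qed
  have vn: "integral {a..b} (\<lambda>x. (cmod (v x))\<^sup>2 / p x) \<ge> 0"
  proof (rule Henstock_Kurzweil_Integration.integral_nonneg)
    show "(\<lambda>x. (cmod (v x))\<^sup>2 / p x) integrable_on {a..b}"
      using p_pos by (intro integrable_continuous_real continuous_intros vc p_cont) (auto simp: less_le)
    show "0 \<le> (cmod (v x))\<^sup>2 / p x" for x using p_pos[of x] by simp
  qed
  have g: "v b * cnj (u b) - v a * cnj (u a) = I + of_real (integral {a..b} (\<lambda>x. (cmod (v x))\<^sup>2 / p x))"
    using green_identity[OF pu pv] ab unfolding I_def by simp
  have "Im (v b * cnj (u b) - v a * cnj (u a)) = Im I" unfolding g by simp
  then show "Im (v b * cnj (u b)) - Im (v a * cnj (u a)) = - Im z * S" using ImI by simp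
  have "Re (v b * cnj (u b) - v a * cnj (u a)) \<ge> Re I" unfolding g using vn by simp
  then show "Re (v b * cnj (u b)) - Re (v a * cnj (u a)) \<ge> - (qm + \<bar>Re z\<bar>) * S" using ReI by simp
  show "S \<ge> 0" unfolding S_def by (intro Henstock_Kurzweil_Integration.integral_nonneg u2) auto
  assume "S = 0"
  then have "\<forall>x\<in>{a..b}. (cmod (u x))\<^sup>2 = 0"
    unfolding S_def using ab by (subst (asm) integral_eq_0_iff) (auto intro!: continuous_intros uc)
  then have "u x = 0" if "x \<in> {a..b}" for x using that by simp
  with osol_zero[OF s this ab] ab show "u a = 0 \<and> v a = 0" by auto
qed

text \<open>
Volterra iteration: the \<open>n\<close>-th iterate is bounded by a power divided by \<open>n!\<close>, so the Neumann series converges for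
every \<open>z\<close>.
\<close>

lemma cell_solution:
  assumes R: "R > 0"
  obtains f where "\<And>z. z \<in> ball 0 R \<Longrightarrow> f z \<in> L2 {0<..<1}"
    "\<And>z. z \<in> ball 0 R \<Longrightarrow> osol z 0 1 (\<lambda>x. U 0 (f z) x + c1 + c2 * P 0 x) (\<lambda>x. V 0 (f z) x + c2)"
    "\<And>l. bounded_functional {0<..<1} l \<Longrightarrow> (\<lambda>z. l (f z)) holomorphic_on ball 0 R"
proof -
  let ?J = "{0<..<1::real}"
  define e where "e = (\<lambda>x. c1 + c2 * P 0 x)"
  define E where "E = cmod c1 + cmod c2 / p0"
  have ec: "continuous_on {0..1} e" unfolding e_def by (intro continuous_intros P_continuous)
  have eb: "cmod (e x) \<le> E" if "x \<in> {0..1}" for x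
  proof -
    have "cmod (P 0 x) \<le> x / p0" using P_Lipschitz[of 0 x 0] that by simp
    also have "x / p0 \<le> 1 / p0" using that p0_pos by (intro divide_right_mono) auto
    finally have "cmod (P 0 x) \<le> 1 / p0" .
    then have "cmod c2 * cmod (P 0 x) \<le> cmod c2 * (1 / p0)" by (intro mult_left_mono) auto
    then show ?thesis unfolding e_def E_def using norm_triangle_ineq[of c1 "c2 * P 0 x"] by (simp add: norm_mult)
  qed
  have E0: "E \<ge> 0" using eb[of 0] by (auto intro: order_trans[OF norm_ge_zero])
  define A where "A = (\<lambda>f x. - of_real (q x) * U 0 f x)"
  have A: "bounded_operator ?J A" unfolding A_def by (rule qU_bounded_operator) simp
  have B: "bounded_operator ?J (U 0)" by (rule U_bounded_operator) simp
  define g0 where "g0 = (\<lambda>x. - of_real (q x) * e x)"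
  have g0: "g0 \<in> L2 ?J"
  proof (rule L2_bounded(1))
    show "g0 \<in> borel_measurable (lebesgue_on ?J)"
      unfolding g0_def using q_measurable continuous_on_measurable_lebesgue_on[OF ec] by measurable
    show "cmod (g0 x) \<le> qm * E" if "x \<in> ?J" for x
      unfolding g0_def using eb[of x] that q_bound[of x] qm_nonneg by (auto simp: norm_mult intro!: mult_mono)
  qed simp
  have g1: "e \<in> L2 ?J"
    by (rule L2_bounded(1)[OF continuous_on_measurable_lebesgue_on[OF ec], where B = E]) (use eb in auto)
  define it where "it = neumann_iterate A (U 0) g0 e"
  have itL: "it z n \<in> L2 ?J" for z n unfolding it_def by (rule neumann_iterate_L2[OF A B g0 g1])
  define \<kappa> where "\<kappa> = (qm + R) / p0"
  define E1 where "E1 = (qm + R) * E"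
  have pos: "\<kappa> \<ge> 0" "E1 \<ge> 0" using qm_nonneg R p0_pos E0 by (auto simp: \<kappa>_def E1_def)
  \<comment> \<open>The factor \<open>x\<^sup>n / n!\<close> comes from the first of the two integrations in \<open>U\<close>; the second, over an interval of
    length at most 1, contributes only the constant \<open>1 / p0\<close>.\<close>
  have bound: "x \<in> {0..1} \<Longrightarrow> cmod (it z n x) \<le> E1 * \<kappa> ^ n / fact n * x ^ n" if z: "z \<in> ball 0 R" for z n x
  proof (induction n arbitrary: x)
    case 0
    have "it z 0 x = - ((of_real (q x) - z) * e x)" by (simp add: it_def g0_def algebra_simps)
    moreover have "cmod (of_real (q x) - z) * cmod (e x) \<le> (qm + R) * E"
      using q_minus_bound[of x z] z eb[OF 0] qm_nonneg R by (intro mult_mono) auto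
    ultimately show ?case by (simp add: E1_def norm_mult)
  next
    case (Suc n)
    let ?f = "it z n"
    define K where "K = E1 * \<kappa> ^ n / fact n"
    have K0: "K \<ge> 0" using pos by (simp add: K_def)
    have fi: "?f absolutely_integrable_on {0..1}" by (rule L2_absolutely_integrable[OF itL]) simp
    have V: "cmod (V 0 ?f t) \<le> K * x ^ Suc n / real (Suc n)" if t: "t \<in> {0..x}" for t
    proof -
      have "cmod (integral {0..t} ?f) \<le> K * (t - 0) ^ Suc n / real (Suc n)"
      proof (rule norm_integral_power_bound)
        show "?f integrable_on {0..t}" using absolutely_integrable_imp_integrable_subinterval[OF fi, of 0 t] t Suc.prems by simp
        show "cmod (?f s) \<le> K * (s - 0) ^ n" if "0 \<le> s" "s \<le> t" for s
          using Suc.IH[of s] that t Suc.prems by (simp add: K_def)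
      qed (use t in auto)
      also have "\<dots> \<le> K * x ^ Suc n / real (Suc n)"
        using t K0 by (intro divide_right_mono mult_left_mono power_mono) auto
      finally show ?thesis by (simp add: V_def)
    qed
    have "cmod (integral {0..x} (\<lambda>t. V 0 ?f t / of_real (p t))) \<le> (K * x ^ Suc n / real (Suc n) / p0) * (x - 0)"
    proof (rule integral_bound)
      show "continuous_on {0..x} (\<lambda>t. V 0 ?f t / of_real (p t))"
        using Suc.prems by (intro divide_p_cont continuous_on_subset[OF prim_continuous[OF prim_V[OF fi]]]) auto
      show "cmod (V 0 ?f t / of_real (p t)) \<le> K * x ^ Suc n / real (Suc n) / p0" if "t \<in> {0..x}" for t
        using inverse_p_bound[of "V 0 ?f t" t] divide_right_mono[OF V[OF that], of p0] p0_pos by linarith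
    qed (use Suc.prems in auto)
    also have "\<dots> \<le> (K * x ^ Suc n / real (Suc n) / p0) * 1"
      using Suc.prems K0 p0_pos by (intro mult_left_mono) auto
    finally have Ub: "cmod (U 0 ?f x) \<le> K * x ^ Suc n / real (Suc n) / p0" by (simp add: U_def)
    have "it z (Suc n) x = - ((of_real (q x) - z) * U 0 ?f x)" by (simp add: it_def A_def algebra_simps)
    then have "cmod (it z (Suc n) x) = cmod (of_real (q x) - z) * cmod (U 0 ?f x)" by (simp add: norm_mult)
    also have "\<dots> \<le> (qm + R) * (K * x ^ Suc n / real (Suc n) / p0)"
      using q_minus_bound[of x z] z Ub qm_nonneg R by (intro mult_mono) auto
    also have "\<dots> = E1 * \<kappa> ^ Suc n / fact (Suc n) * x ^ Suc n"
      by (simp add: K_def \<kappa>_def field_simps)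
    finally show ?case .
  qed
  have cn: "L2_norm ?J (it z n) \<le> E1 * (\<kappa> ^ n / fact n)" if z: "z \<in> ball 0 R" for z n
  proof -
    have "cmod (it z n x) \<le> E1 * (\<kappa> ^ n / fact n)" if "x \<in> ?J" for x
    proof -
      have "cmod (it z n x) \<le> E1 * \<kappa> ^ n / fact n * x ^ n" using bound[OF z, of x n] that by simp
      also have "\<dots> \<le> E1 * \<kappa> ^ n / fact n * 1" using that pos by (intro mult_left_mono power_le_one) auto
      finally show ?thesis by simp
    qed
    from L2_bounded(2)[OF L2_measurable[OF itL] this] show ?thesis by simp
  qed
  have summ: "summable (\<lambda>n. E1 * (\<kappa> ^ n / fact n))"
    using summable_mult[OF summable_exp[of \<kappa>], of E1] by (simp add: divide_inverse mult_ac)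
  obtain f where f: "\<And>z. z \<in> ball 0 R \<Longrightarrow> f z \<in> L2 ?J"
    "\<And>z. z \<in> ball 0 R \<Longrightarrow> AE x in lebesgue_on ?J. f z x = g0 x + z * e x + A (f z) x + z * U 0 (f z) x"
    "\<And>l. bounded_functional ?J l \<Longrightarrow> (\<lambda>z. l (f z)) holomorphic_on ball 0 R"
  proof (rule neumann_series[OF A B g0 g1 _ open_ball cn[unfolded it_def] summ])
    fix h assume h: "\<And>z. z \<in> ball 0 R \<Longrightarrow> h z \<in> L2 ?J"
      "\<And>z. z \<in> ball 0 R \<Longrightarrow> AE x in lebesgue_on ?J. h z x = g0 x + z * e x + A (h z) x + z * U 0 (h z) x"
      "\<And>l. bounded_functional ?J l \<Longrightarrow> (\<lambda>z. l (h z)) holomorphic_on ball 0 R"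
    show thesis
    proof (rule that[of h])
      fix z :: complex assume z: "z \<in> ball 0 R"
      from h(1)[OF z] show "h z \<in> L2 {0<..<1}" .
      from h(2)[OF z] show "AE x in lebesgue_on ?J. h z x = g0 x + z * e x + A (h z) x + z * U 0 (h z) x" .
    next
      fix l assume l: "bounded_functional {0<..<1} l"
      from h(3)[OF l] show "(\<lambda>z. l (h z)) holomorphic_on ball 0 R" .
    qed
  qed simp_all
  show ?thesis
  proof (rule that[of f])
    show "f z \<in> L2 ?J" if "z \<in> ball 0 R" for z by (rule f(1)[OF that])
    show "(\<lambda>z. l (f z)) holomorphic_on ball 0 R" if "bounded_functional ?J l" for l by (rule f(3)[OF that])
    fix z :: complex assume z: "z \<in> ball 0 R"
    have fi: "f z absolutely_integrable_on {0..1}" by (rule L2_absolutely_integrable[OF f(1)[OF z]]) simp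
    have "prim 0 1 (\<lambda>x. V 0 (f z) x + c2) (\<lambda>x. (of_real (q x) - z) * (U 0 (f z) x + c1 + c2 * P 0 x))"
    proof (rule prim_AE[OF solution_construction(2)[OF fi]])
      show "AE x in lebesgue_on {0<..<1}. (of_real (q x) - z) * (U 0 (f z) x + c1 + c2 * P 0 x) = - f z x"
        using f(2)[OF z]
      proof eventually_elim
        case (elim x) show ?case by (subst elim) (simp add: g0_def e_def A_def algebra_simps)
      qed
    qed auto
    then show "osol z 0 1 (\<lambda>x. U 0 (f z) x + c1 + c2 * P 0 x) (\<lambda>x. V 0 (f z) x + c2)"
      unfolding osol_def using solution_construction(1)[OF fi] by simp
  qed
qed

lemma osol_trivial: "osol z a b (\<lambda>x. 0) (\<lambda>x. 0)"
  unfolding osol_def using prim_const[of a b 0] by simp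

text \<open>
The matrix with entries \<open>m11\<close>, \<open>m12\<close>, \<open>m21\<close>, \<open>m22\<close> maps the data of every solution at 0 to its data at 1. By
the constancy of the Wronskian its determinant is 1.
\<close>

definition transfers :: "real \<Rightarrow> (complex \<Rightarrow> complex) \<Rightarrow> (complex \<Rightarrow> complex) \<Rightarrow> (complex \<Rightarrow> complex) \<Rightarrow> (complex \<Rightarrow> complex) \<Rightarrow> bool" where
  "transfers R m11 m12 m21 m22 \<longleftrightarrow>
     (\<forall>z\<in>ball 0 R. (\<forall>u v. osol z 0 1 u v \<longrightarrow> u 1 = m11 z * u 0 + m12 z * v 0 \<and> v 1 = m21 z * u 0 + m22 z * v 0) \<and>
        m11 z * m22 z - m12 z * m21 z = 1 \<and> (\<forall>c1 c2. \<exists>u v. osol z 0 1 u v \<and> u 0 = c1 \<and> v 0 = c2))"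

text \<open>
The columns are the data at 1 of the solutions with data \<open>(1, 0)\<close> and \<open>(0, 1)\<close> at 0.
\<close>

lemma transfer_matrix:
  assumes R: "R > 0"
  obtains m11 m12 m21 m22 where "transfers R m11 m12 m21 m22" "m11 holomorphic_on ball 0 R"
    "m12 holomorphic_on ball 0 R" "m21 holomorphic_on ball 0 R" "m22 holomorphic_on ball 0 R"
proof -
  obtain f where f: "\<And>z. z \<in> ball 0 R \<Longrightarrow> f z \<in> L2 {0<..<1}"
    "\<And>z. z \<in> ball 0 R \<Longrightarrow> osol z 0 1 (\<lambda>x. U 0 (f z) x + 1 + 0 * P 0 x) (\<lambda>x. V 0 (f z) x + 0)"
    "\<And>l. bounded_functional {0<..<1} l \<Longrightarrow> (\<lambda>z. l (f z)) holomorphic_on ball 0 R"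
  proof (rule cell_solution[OF R, of 1 0])
    fix h assume h: "\<And>z. z \<in> ball 0 R \<Longrightarrow> h z \<in> L2 {0<..<1}"
      "\<And>z. z \<in> ball 0 R \<Longrightarrow> osol z 0 1 (\<lambda>x. U 0 (h z) x + 1 + 0 * P 0 x) (\<lambda>x. V 0 (h z) x + 0)"
      "\<And>l. bounded_functional {0<..<1} l \<Longrightarrow> (\<lambda>z. l (h z)) holomorphic_on ball 0 R"
    show thesis
    proof (rule that[of h])
      fix z :: complex assume z: "z \<in> ball 0 R"
      from h(1)[OF z] show "h z \<in> L2 {0<..<1}" .
      from h(2)[OF z] show "osol z 0 1 (\<lambda>x. U 0 (h z) x + 1 + 0 * P 0 x) (\<lambda>x. V 0 (h z) x + 0)" .
    next
      fix l assume l: "bounded_functional {0<..<1} l"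
      from h(3)[OF l] show "(\<lambda>z. l (h z)) holomorphic_on ball 0 R" .
    qed
  qed
  obtain g where g: "\<And>z. z \<in> ball 0 R \<Longrightarrow> g z \<in> L2 {0<..<1}"
    "\<And>z. z \<in> ball 0 R \<Longrightarrow> osol z 0 1 (\<lambda>x. U 0 (g z) x + 0 + 1 * P 0 x) (\<lambda>x. V 0 (g z) x + 1)"
    "\<And>l. bounded_functional {0<..<1} l \<Longrightarrow> (\<lambda>z. l (g z)) holomorphic_on ball 0 R"
  proof (rule cell_solution[OF R, of 0 1])
    fix h assume h: "\<And>z. z \<in> ball 0 R \<Longrightarrow> h z \<in> L2 {0<..<1}"
      "\<And>z. z \<in> ball 0 R \<Longrightarrow> osol z 0 1 (\<lambda>x. U 0 (h z) x + 0 + 1 * P 0 x) (\<lambda>x. V 0 (h z) x + 1)"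
      "\<And>l. bounded_functional {0<..<1} l \<Longrightarrow> (\<lambda>z. l (h z)) holomorphic_on ball 0 R"
    show thesis
    proof (rule that[of h])
      fix z :: complex assume z: "z \<in> ball 0 R"
      from h(1)[OF z] show "h z \<in> L2 {0<..<1}" .
      from h(2)[OF z] show "osol z 0 1 (\<lambda>x. U 0 (h z) x + 0 + 1 * P 0 x) (\<lambda>x. V 0 (h z) x + 1)" .
    next
      fix l assume l: "bounded_functional {0<..<1} l"
      from h(3)[OF l] show "(\<lambda>z. l (h z)) holomorphic_on ball 0 R" .
    qed
  qed
  define m11 m12 m21 m22 where "m11 = (\<lambda>z. U 0 (f z) 1 + 1)" and "m12 = (\<lambda>z. U 0 (g z) 1 + P 0 1)"
    and "m21 = (\<lambda>z. V 0 (f z) 1)" and "m22 = (\<lambda>z. V 0 (g z) 1 + 1)"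
  have bf: "bounded_functional {0<..<1} (\<lambda>f. U 0 f 1)" "bounded_functional {0<..<1} (\<lambda>f. V 0 f 1)"
    using U_bounded_functional[of 1 0 1] V_bounded_functional[of 1 0 1] by auto
  have "transfers R m11 m12 m21 m22"
    unfolding transfers_def
  proof (intro ballI conjI allI impI)
    fix z :: complex and u v assume z: "z \<in> ball 0 R" and s: "osol z 0 1 u v"
    have "osol z 0 1 (\<lambda>x. (u x + (- u 0) * (U 0 (f z) x + 1 + 0 * P 0 x)) + (- v 0) * (U 0 (g z) x + 0 + 1 * P 0 x))
      (\<lambda>x. (v x + (- u 0) * (V 0 (f z) x + 0)) + (- v 0) * (V 0 (g z) x + 1))"
      by (rule osol_lincomb[OF osol_lincomb[OF s f(2)[OF z]] g(2)[OF z]])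
    from osol_unique_zero[OF this, of 1]
    show "u 1 = m11 z * u 0 + m12 z * v 0" "v 1 = m21 z * u 0 + m22 z * v 0"
      by (simp_all add: m11_def m12_def m21_def m22_def algebra_simps)
  next
    fix z :: complex assume z: "z \<in> ball 0 R"
    from wronskian[OF f(2)[OF z] g(2)[OF z]] show "m11 z * m22 z - m12 z * m21 z = 1"
      by (simp add: m11_def m12_def m21_def m22_def)
    fix c1 c2
    have s: "osol z 0 1 (\<lambda>x. (0 + c1 * (U 0 (f z) x + 1 + 0 * P 0 x)) + c2 * (U 0 (g z) x + 0 + 1 * P 0 x))
      (\<lambda>x. (0 + c1 * (V 0 (f z) x + 0)) + c2 * (V 0 (g z) x + 1))"
      by (rule osol_lincomb[OF osol_lincomb[OF osol_trivial f(2)[OF z], where c = c1] g(2)[OF z], where c = c2])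
    let ?u = "\<lambda>x. (0 + c1 * (U 0 (f z) x + 1 + 0 * P 0 x)) + c2 * (U 0 (g z) x + 0 + 1 * P 0 x)"
    let ?v = "\<lambda>x. (0 + c1 * (V 0 (f z) x + 0)) + c2 * (V 0 (g z) x + 1)"
    have "?u 0 = c1" "?v 0 = c2" by simp_all
    with s have "osol z 0 1 ?u ?v \<and> ?u 0 = c1 \<and> ?v 0 = c2" by (intro conjI)
    then have "\<exists>v. osol z 0 1 ?u v \<and> ?u 0 = c1 \<and> v 0 = c2" by (rule exI[of _ ?v])
    then show "\<exists>u v. osol z 0 1 u v \<and> u 0 = c1 \<and> v 0 = c2" by (rule exI[of _ ?u])
  qed
  moreover have "m11 holomorphic_on ball 0 R"
    unfolding m11_def by (rule holomorphic_on_add[OF f(3)[OF bf(1)] holomorphic_on_const])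
  moreover have "m12 holomorphic_on ball 0 R"
    unfolding m12_def by (rule holomorphic_on_add[OF g(3)[OF bf(1)] holomorphic_on_const])
  moreover have "m21 holomorphic_on ball 0 R"
    unfolding m21_def by (rule f(3)[OF bf(2)])
  moreover have "m22 holomorphic_on ball 0 R"
    unfolding m22_def by (rule holomorphic_on_add[OF g(3)[OF bf(2)] holomorphic_on_const])
  ultimately show ?thesis by (rule that)
qed

lemma transfers_cell:
  assumes t: "transfers R m11 m12 m21 m22" and z: "z \<in> ball 0 R" and s: "osol z (of_int n) (of_int n + 1) u v"
  shows "u (of_int n + 1) = m11 z * u (of_int n) + m12 z * v (of_int n)"
    "v (of_int n + 1) = m21 z * u (of_int n) + m22 z * v (of_int n)"
proof -
  have "osol z 0 1 (\<lambda>x. u (x + of_int n)) (\<lambda>x. v (x + of_int n))" using osol_shift[OF s, of n] by simp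
  then show "u (of_int n + 1) = m11 z * u (of_int n) + m12 z * v (of_int n)"
    "v (of_int n + 1) = m21 z * u (of_int n) + m22 z * v (of_int n)"
    using t z unfolding transfers_def by (force simp: add.commute)+
qed

end

section \<open>Sobolev functions as indefinite integrals\<close>

lemma prim_degenerate: "d < c \<Longrightarrow> prim c d F f"
  by (simp add: prim_def)

lemma measurable_AE_lebesgue_on:
  fixes F G :: "real \<Rightarrow> complex"
  assumes Q: "Q \<in> sets lebesgue" and G: "G \<in> borel_measurable (lebesgue_on Q)" and e: "AE x in lebesgue_on Q. F x = G x"
  shows "F \<in> borel_measurable (lebesgue_on Q)"
proof -
  have "(\<lambda>x. if x \<in> Q then G x else 0) \<in> borel_measurable lebesgue"
    using G Q by (simp add: borel_measurable_if)
  moreover have "AE x in lebesgue. x \<in> Q \<longrightarrow> F x = G x"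
    using e Q by (subst (asm) AE_restrict_space_iff) auto
  then have "AE x in lebesgue. (if x \<in> Q then G x else 0) = (if x \<in> Q then F x else 0)"
    by (rule eventually_mono) auto
  ultimately have "(\<lambda>x. if x \<in> Q then F x else 0) \<in> borel_measurable lebesgue"
    by (rule borel_measurable_AE)
  then show ?thesis using Q by (simp add: borel_measurable_if)
qed

lemma L2_AE_transfer:
  assumes "Q \<in> sets lebesgue" "G \<in> L2 Q" "AE x in lebesgue_on Q. F x = G x"
  shows "F \<in> L2 Q" "L2_norm Q F = L2_norm Q G"
proof -
  have "AE x in lebesgue_on Q. G x = F x" using assms(3) by (auto elim: eventually_mono)
  then show F: "F \<in> L2 Q"
    by (rule L2_AE_cong[OF _ assms(2) measurable_AE_lebesgue_on[OF assms(1) L2_measurable[OF assms(2)] assms(3)]])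
  show "L2_norm Q F = L2_norm Q G" by (rule L2_norm_AE_cong[OF assms(3) F assms(2)])
qed

lemma prim_imp_W22:
  assumes ab: "a < b" and u: "prim a b u g" and g: "prim a b g h" and h: "h \<in> L2 {a<..<b}"
  defines "Q \<equiv> {a<..<b}"
  shows "restrict u Q \<in> W22 Q" "W22_norm Q (restrict u Q) \<le> L2_norm Q u + L2_norm Q g + L2_norm Q h"
proof -
  have Q: "open Q" "is_interval Q" "Q \<noteq> {}" using ab by (auto simp: Q_def is_interval_1)
  have sub: "prim c d F f" if "prim a b F f" "{c..d} \<subseteq> Q" for c d F f
  proof (cases "c \<le> d")
    case True
    then show ?thesis using that by (intro prim_subinterval[OF that(1)]) (auto simp: Q_def dest: subsetD)
  qed (simp add: prim_degenerate)
  have wu: "has_weak_deriv Q u g" and wg: "has_weak_deriv Q g h"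
    using sub[OF u] sub[OF g] by (auto intro!: prim_imp_weak_deriv[OF Q])
  have Rm: "AE x in lebesgue_on Q. u x = restrict u Q x" by (rule AE_I2) simp
  have wr: "has_weak_deriv Q (restrict u Q) g"
    by (rule has_weak_deriv_cong[OF Q wu Rm]) simp
  have bounded_L2: "F \<in> L2 Q" if "continuous_on {a..b} F" for F :: "real \<Rightarrow> complex"
  proof -
    have "bounded (F ` {a..b})" using that compact_continuous_image compact_imp_bounded by blast
    then obtain B where "\<forall>y\<in>F ` {a..b}. cmod y \<le> B" unfolding bounded_iff by blast
    then have B: "cmod (F x) \<le> B" if "x \<in> {a<..<b}" for x using that by auto
    have "F \<in> borel_measurable (lebesgue_on {a<..<b})"
      by (rule continuous_imp_measurable_on_sets_lebesgue[OF continuous_on_subset[OF that]]) auto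
    from L2_bounded(1)[OF this B] ab show ?thesis by (simp add: Q_def)
  qed
  have uL: "u \<in> L2 Q" and gL: "g \<in> L2 Q" using u g by (auto intro: bounded_L2 prim_continuous)
  have hL: "h \<in> L2 Q" using h by (simp add: Q_def)
  have Qm: "Q \<in> sets lebesgue" by (simp add: Q_def)
  have "AE x in lebesgue_on Q. restrict u Q x = u x" by (rule AE_I2) simp
  note r = L2_AE_transfer[OF Qm uL this]
  show "restrict u Q \<in> W22 Q" unfolding W22_def using r(1) gL hL wr wg by blast
  have d1: "AE x in lebesgue_on Q. weak_deriv Q (restrict u Q) x = g x" by (rule weak_deriv_AE(2)[OF Q(1) wr])
  then have d1': "AE x in lebesgue_on Q. g x = weak_deriv Q (restrict u Q) x" by (auto elim: eventually_mono)
  have "has_weak_deriv Q (weak_deriv Q (restrict u Q)) h"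
    by (rule has_weak_deriv_cong[OF Q wg d1']) simp
  then have d2: "AE x in lebesgue_on Q. weak_deriv Q (weak_deriv Q (restrict u Q)) x = h x" by (rule weak_deriv_AE(2)[OF Q(1)])
  note n1 = L2_AE_transfer(2)[OF Qm gL d1] and n2 = L2_AE_transfer(2)[OF Qm hL d2]
  have "sqrt (x\<^sup>2 + y\<^sup>2 + z\<^sup>2) \<le> x + y + z" if "x \<ge> 0" "y \<ge> 0" "z \<ge> 0" for x y z :: real
    using that by (intro real_le_lsqrt) (auto simp: power2_eq_square algebra_simps)
  then show "W22_norm Q (restrict u Q) \<le> L2_norm Q u + L2_norm Q g + L2_norm Q h"
    unfolding W22_norm_def n1 n2 r(2) by simp
qed

lemma W22_AE_transfer:
  assumes Q: "open Q" "is_interval Q" "Q \<noteq> {}" and f: "f \<in> W22 Q" and e: "AE x in lebesgue_on Q. f' x = f x"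
  shows "f' \<in> W22 Q"
proof -
  obtain g h where gh: "g \<in> L2 Q" "h \<in> L2 Q" "has_weak_deriv Q f g" "has_weak_deriv Q g h" and fL: "f \<in> L2 Q"
    using f unfolding W22_def by blast
  have Qm: "Q \<in> sets lebesgue" using Q(1) by auto
  have "AE x in lebesgue_on Q. f x = f' x" using e by (auto elim: eventually_mono)
  then have "has_weak_deriv Q f' g" by (rule has_weak_deriv_cong[OF Q gh(3)]) simp
  then show ?thesis unfolding W22_def using L2_AE_transfer(1)[OF Qm fL e] gh by blast
qed

text \<open>
One-dimensional regularity: a representative of the class is continuously differentiable in the sense of indefinite
integrals, and so is its derivative.
\<close>

lemma W22_UNIV_imp_prim:
  assumes "u \<in> W22 UNIV"
  obtains U g h where "\<And>a b. prim a b U g" "\<And>a b. prim a b g h" "AE x in lebesgue. u x = U x"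
    "has_weak_deriv UNIV u g" "U \<in> L2 UNIV" "g \<in> L2 UNIV" "h \<in> L2 UNIV"
proof -
  obtain g0 h where gh: "g0 \<in> L2 UNIV" "h \<in> L2 UNIV" "has_weak_deriv UNIV u g0" "has_weak_deriv UNIV g0 h" and uL: "u \<in> L2 UNIV"
    using assms unfolding W22_def by blast
  note Un = open_UNIV is_interval_univ UNIV_not_empty
  obtain g where g: "\<And>a b. prim a b g h" "AE x in lebesgue. g0 x = g x" by (rule weak_deriv_imp_prim[OF gh(4)]) blast
  have "AE x in lebesgue_on UNIV. g0 x = g x" using g(2) unfolding lebesgue_on_UNIV_eq .
  then have ug: "has_weak_deriv UNIV u g" by (rule has_weak_deriv_cong[OF Un gh(3) AE_I2[OF refl]])
  obtain U where U: "\<And>a b. prim a b U g" "AE x in lebesgue. u x = U x" by (rule weak_deriv_imp_prim[OF ug]) blast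
  have "AE x in lebesgue_on UNIV. g x = g0 x" using g(2) unfolding lebesgue_on_UNIV_eq by (auto elim: eventually_mono)
  then have gL: "g \<in> L2 UNIV" by (rule L2_AE_transfer(1)[rotated 2]) (use gh in auto)
  have "AE x in lebesgue_on UNIV. U x = u x" using U(2) unfolding lebesgue_on_UNIV_eq by (auto elim: eventually_mono)
  then have UL: "U \<in> L2 UNIV" by (rule L2_AE_transfer(1)[rotated 2]) (use uL in auto)
  show ?thesis by (rule that[OF U(1) g(1) U(2) ug UL gL gh(2)])
qed

text \<open>
Averaging over \<open>{y..y + 1}\<close> gives \<open>\<bar>w y\<bar>\<^sup>2 \<le> \<integral> \<bar>w\<bar>\<^sup>2 + 2 \<bar>w w'\<bar>\<close> over this interval. The integrand is integrable on the line, so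
its integrals over consecutive unit intervals are summable and tend to zero.
\<close>

lemma L2_decay:
  assumes w: "\<And>a b. prim a b w w'" and L: "w \<in> L2 UNIV" "w' \<in> L2 UNIV"
  shows "(\<lambda>n. w (x + real n)) \<longlonglongrightarrow> 0" "(\<lambda>n. w (x - real n)) \<longlonglongrightarrow> 0"
proof -
  define k where "k = (\<lambda>x. (cmod (w x))\<^sup>2 + 2 * (cmod (w x) * cmod (w' x)))"
  have k0: "k x \<ge> 0" for x by (simp add: k_def)
  have "integrable lebesgue k"
    using L L2_product_integrable[OF L] unfolding k_def L2_def lebesgue_on_UNIV_eq by auto
  then have kU: "k absolutely_integrable_on UNIV" by (simp add: set_integrable_def)
  then have kI: "k integrable_on UNIV" by (rule set_lebesgue_integral_eq_integral(1))
  have ki: "k integrable_on {s..t}" for s t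
    using set_integrable_subset[OF kU, of "{s..t}"] by (auto intro: set_lebesgue_integral_eq_integral(1))
  have bound: "(cmod (w y))\<^sup>2 \<le> integral {y..y+1} k" for y
  proof -
    have p: "prim a b (\<lambda>x. w x * cnj (w x)) (\<lambda>x. w' x * cnj (w x) + w x * cnj (w' x))" for a b
      by (intro prim_mult prim_cnj w)
    have e: "cmod (w x * cnj (w x)) = (cmod (w x))\<^sup>2" for x by (simp add: norm_mult power2_eq_square)
    have wc: "continuous_on {y..y+1} (\<lambda>x. (cmod (w x))\<^sup>2)" by (intro continuous_intros prim_continuous[OF w])
    have w2i: "(\<lambda>x. (cmod (w x))\<^sup>2) integrable_on {y..y+1}" by (rule integrable_continuous_real[OF wc])
    have kk: "(\<lambda>x. 2 * (cmod (w x) * cmod (w' x))) integrable_on {y..y+1}"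
      using Henstock_Kurzweil_Integration.integrable_diff[OF ki w2i] by (simp add: k_def)
    define T where "T = integral {y..y+1} (\<lambda>x. 2 * (cmod (w x) * cmod (w' x)))"
    have le: "(cmod (w y))\<^sup>2 - T \<le> (cmod (w s))\<^sup>2" if s: "s \<in> {y..y+1}" for s
    proof -
      have sub: "(\<lambda>x. 2 * (cmod (w x) * cmod (w' x))) integrable_on {y..s}" using kk by (rule integrable_on_subinterval) (use s in auto)
      have "cmod (w s * cnj (w s) - w y * cnj (w y)) \<le> integral {y..s} (\<lambda>x. 2 * (cmod (w x) * cmod (w' x)))"
        using s
      proof (subst prim_diff[OF p[of y "y+1"], of y s, symmetric])
        show "cmod (integral {y..s} (\<lambda>x. w' x * cnj (w x) + w x * cnj (w' x))) \<le> integral {y..s} (\<lambda>x. 2 * (cmod (w x) * cmod (w' x)))"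
        proof (rule Henstock_Kurzweil_Integration.integral_norm_bound_integral[OF _ sub])
          show "(\<lambda>x. w' x * cnj (w x) + w x * cnj (w' x)) integrable_on {y..s}"
            using absolutely_integrable_imp_integrable_subinterval[OF prim_integrable[OF p[of y s]]] by simp
          show "cmod (w' r * cnj (w r) + w r * cnj (w' r)) \<le> 2 * (cmod (w r) * cmod (w' r))" for r
            using norm_triangle_ineq[of "w' r * cnj (w r)" "w r * cnj (w' r)"] by (simp add: norm_mult mult.commute)
        qed
      qed auto
      also have "\<dots> \<le> T" unfolding T_def using s by (intro integral_subset_le sub kk) auto
      finally have "cmod (w y * cnj (w y)) - cmod (w s * cnj (w s)) \<le> T"
        using norm_triangle_ineq3[of "w s * cnj (w s)" "w y * cnj (w y)"] by linarith
      then show ?thesis unfolding e by simp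
    qed
    have "integral {y..y+1} (\<lambda>x. (cmod (w y))\<^sup>2 - T) \<le> integral {y..y+1} (\<lambda>x. (cmod (w x))\<^sup>2)"
      by (rule integral_le[OF _ w2i le]) auto
    then have "(cmod (w y))\<^sup>2 - T \<le> integral {y..y+1} (\<lambda>x. (cmod (w x))\<^sup>2)" by simp
    moreover have "integral {y..y+1} k = integral {y..y+1} (\<lambda>x. (cmod (w x))\<^sup>2) + T"
      unfolding k_def T_def by (rule Henstock_Kurzweil_Integration.integral_add[OF w2i kk])
    ultimately show ?thesis by simp
  qed
  have conv: "(\<lambda>n. integral {f n..f n + 1} k) \<longlonglongrightarrow> 0"
    if f: "\<And>n. (\<Sum>j<n. integral {f j..f j + 1} k) \<le> integral UNIV k" for f :: "nat \<Rightarrow> real"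
  proof (rule summable_LIMSEQ_zero)
    show "summable (\<lambda>n. integral {f n..f n + 1} k)"
    proof (rule bounded_imp_summable[where B = "integral UNIV k"])
      show "0 \<le> integral {f n..f n + 1} k" for n by (intro Henstock_Kurzweil_Integration.integral_nonneg ki k0)
      show "(\<Sum>j\<le>n. integral {f j..f j + 1} k) \<le> integral UNIV k" for n
        using f[of "Suc n"] by (simp only: lessThan_Suc_atMost)
    qed
  qed
  have le: "integral {s..t} k \<le> integral UNIV k" for s t
    by (intro integral_subset_le ki kI) (auto intro: k0)
  have s1: "(\<Sum>j<n. integral {x + real j..x + real j + 1} k) = integral {x..x + real n} k" for n
  proof (induction n)
    case (Suc n)
    have "integral {x..x + real n} k + integral {x + real n..x + real n + 1} k = integral {x..x + real n + 1} k"
      by (intro Henstock_Kurzweil_Integration.integral_combine ki) auto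
    then show ?case using Suc by (simp add: add_ac)
  qed simp
  have s2: "(\<Sum>j<n. integral {x - real j..x - real j + 1} k) = integral {x + 1 - real n..x + 1} k" for n
  proof (induction n)
    case (Suc n)
    have "integral {x - real n..x - real n + 1} k + integral {x - real n + 1..x + 1} k = integral {x - real n..x + 1} k"
      by (intro Henstock_Kurzweil_Integration.integral_combine ki) auto
    then show ?case using Suc by (simp add: algebra_simps)
  qed simp
  have lim: "(\<lambda>n. w (f n)) \<longlonglongrightarrow> 0" if "(\<lambda>n. integral {f n..f n + 1} k) \<longlonglongrightarrow> 0" for f :: "nat \<Rightarrow> real"
  proof -
    have "(\<lambda>n. (cmod (w (f n)))\<^sup>2) \<longlonglongrightarrow> 0"
      by (rule tendsto_sandwich[OF _ _ tendsto_const that]) (auto intro: always_eventually bound)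
    then have "(\<lambda>n. sqrt ((cmod (w (f n)))\<^sup>2)) \<longlonglongrightarrow> sqrt 0" by (intro tendsto_intros)
    then show ?thesis by (simp add: tendsto_norm_zero_iff)
  qed
  show "(\<lambda>n. w (x + real n)) \<longlonglongrightarrow> 0" by (rule lim, rule conv) (simp only: s1 le)
  show "(\<lambda>n. w (x - real n)) \<longlonglongrightarrow> 0" by (rule lim, rule conv) (simp only: s2 le)
qed

section \<open>The equation on a bounded interval\<close>

text \<open>
The perturbation \<open>\<L>\<close> acts on functions given on an interval with integer end points. It is bounded by \<kappa> relative to the norms of
the function, its flux and the derivative of the flux, which replace the norm of \<open>W22\<close>; linearity holds
almost everywhere. The first condition on the size of \<kappa> makes the equation between \<alpha> and \<beta> contractive, the
second one excludes \<i> and \<open>- \<i>\<close> as eigenvalues.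
\<close>

locale perturbed = periodic_coefficients +
  fixes \<alpha> \<beta> :: int and \<L> :: "(real \<Rightarrow> complex) \<Rightarrow> real \<Rightarrow> complex" and \<kappa> pm :: real
  assumes \<alpha>\<beta>: "\<alpha> < \<beta>" and p_le: "\<And>x. p x \<le> pm"
    and \<L>_bound: "\<And>u v w. prim \<alpha> \<beta> u (\<lambda>x. v x / of_real (p x)) \<Longrightarrow> prim \<alpha> \<beta> v w \<Longrightarrow> w \<in> L2 {\<alpha><..<\<beta>} \<Longrightarrow>
       \<L> u \<in> L2 {\<alpha><..<\<beta>} \<and> L2_norm {\<alpha><..<\<beta>} (\<L> u) \<le>
         \<kappa> * (L2_norm {\<alpha><..<\<beta>} u + L2_norm {\<alpha><..<\<beta>} v + L2_norm {\<alpha><..<\<beta>} w)"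
    and \<L>_lincomb: "\<And>u v w u' v' w' c. prim \<alpha> \<beta> u (\<lambda>x. v x / of_real (p x)) \<Longrightarrow> prim \<alpha> \<beta> v w \<Longrightarrow> w \<in> L2 {\<alpha><..<\<beta>} \<Longrightarrow>
       prim \<alpha> \<beta> u' (\<lambda>x. v' x / of_real (p x)) \<Longrightarrow> prim \<alpha> \<beta> v' w' \<Longrightarrow> w' \<in> L2 {\<alpha><..<\<beta>} \<Longrightarrow>
       AE x in lebesgue. \<L> (\<lambda>x. u x + c * u' x) x = \<L> u x + c * \<L> u' x"
    and \<L>_support: "\<And>u x. x \<notin> {real_of_int \<alpha><..<real_of_int \<beta>} \<Longrightarrow> \<L> u x = 0"
    and \<L>_local: "\<And>u u'. (\<And>x. x \<in> {real_of_int \<alpha><..<real_of_int \<beta>} \<Longrightarrow> u x = u' x) \<Longrightarrow> \<L> u = \<L> u'"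
    and \<kappa>_nonneg: "\<kappa> \<ge> 0"
    and \<kappa>_contraction: "\<kappa> * ((real_of_int (\<beta> - \<alpha>))\<^sup>2 / p0 + real_of_int (\<beta> - \<alpha>) + 1) \<le> 1 / 4"
    and \<kappa>_energy: "\<kappa> * (3 + qm + sqrt (pm * (2 * qm + 1))) < 1"
begin

abbreviation "J \<equiv> {real_of_int \<alpha><..<real_of_int \<beta>}"
abbreviation "N \<equiv> L2_norm {real_of_int \<alpha><..<real_of_int \<beta>}"
abbreviation "len \<equiv> real_of_int (\<beta> - \<alpha>)"

lemma len_pos: "len > 0" using \<alpha>\<beta> by simp

lemma \<alpha>\<beta>_real: "real_of_int \<alpha> < real_of_int \<beta>" using \<alpha>\<beta> by simp

lemma J_measurable: "J \<in> sets lebesgue" by simp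

text \<open>
Functions with square-integrable \<open>(p u')'\<close>, to which the bound on \<open>\<L>\<close> applies.
\<close>

definition in_domain :: "(real \<Rightarrow> complex) \<Rightarrow> bool" where
  "in_domain u \<longleftrightarrow> (\<exists>v w. prim \<alpha> \<beta> u (\<lambda>x. v x / of_real (p x)) \<and> prim \<alpha> \<beta> v w \<and> w \<in> L2 J)"

lemma \<L>_L2: "in_domain u \<Longrightarrow> \<L> u \<in> L2 J"
  unfolding in_domain_def using \<L>_bound by blast

lemma \<L>_add: "in_domain u \<Longrightarrow> in_domain u' \<Longrightarrow> AE x in lebesgue_on J. \<L> (\<lambda>x. u x + c * u' x) x = \<L> u x + c * \<L> u' x"
proof -
  assume "in_domain u" "in_domain u'"
  then have "AE x in lebesgue. \<L> (\<lambda>x. u x + c * u' x) x = \<L> u x + c * \<L> u' x"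
    unfolding in_domain_def using \<L>_lincomb by blast
  then show ?thesis by (subst AE_restrict_space_iff) (auto elim: eventually_mono)
qed

lemma L2_neg: "f \<in> L2 S \<Longrightarrow> (\<lambda>x. - f x) \<in> L2 S" using L2_cmult[of f S "-1"] by simp

lemma in_domain_U: "f \<in> L2 J \<Longrightarrow> in_domain (U \<alpha> f)"
  unfolding in_domain_def using prim_U prim_V L2_absolutely_integrable[of f \<alpha> \<beta>] L2_neg \<alpha>\<beta>_real by (meson less_imp_le)

lemma in_domain_const_P: "in_domain (\<lambda>x. c1 + c2 * P \<alpha> x)"
proof -
  have "prim \<alpha> \<beta> (\<lambda>x. c1 + c2 * P \<alpha> x) (\<lambda>x. 0 + c2 * (1 / of_real (p x)))"
    by (rule prim_lincomb[OF prim_const prim_P])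
  then have "prim \<alpha> \<beta> (\<lambda>x. c1 + c2 * P \<alpha> x) (\<lambda>x. c2 / of_real (p x))" by simp
  then show ?thesis unfolding in_domain_def
    by (intro exI[of _ "\<lambda>x. c2"] exI[of _ "\<lambda>x. 0"] conjI) (auto intro: prim_const)
qed

lemma \<L>U_bound:
  assumes f: "f \<in> L2 J"
  shows "N (\<L> (U \<alpha> f)) \<le> 1 / 4 * N f"
proof -
  note i = L2_absolutely_integrable[OF f less_imp_le[OF \<alpha>\<beta>_real]]
  have "N (U \<alpha> f) \<le> sqrt (real_of_int \<beta> - real_of_int \<alpha>) * (len * (sqrt len / p0) * N f)"
  proof (rule L2_bounded(2))
    show "U \<alpha> f \<in> borel_measurable (lebesgue_on J)"
      by (rule continuous_on_measurable_lebesgue_on[OF U_continuous[OF f less_imp_le[OF \<alpha>\<beta>_real]]])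
    show "cmod (U \<alpha> f x) \<le> len * (sqrt len / p0) * N f" if "x \<in> J" for x
      using U_bound[OF f, of x] that by simp
  qed (use \<alpha>\<beta>_real in simp)
  then have U: "N (U \<alpha> f) \<le> sqrt len * (len * (sqrt len / p0) * N f)" by simp
  have V: "N (V \<alpha> f) \<le> sqrt len * (sqrt len * N f)"
    using V_bound[OF f] \<alpha>\<beta>_real prim_continuous[OF prim_V[OF i]]
    by (intro order_trans[OF L2_bounded(2)]) (auto intro!: continuous_on_measurable_lebesgue_on)
  have s: "sqrt len * sqrt len = len" using len_pos by simp
  have "sqrt len * (len * (sqrt len / p0) * N f) = (sqrt len * sqrt len) * len / p0 * N f" by simp
  also have "\<dots> = len\<^sup>2 / p0 * N f" unfolding s by (simp add: power2_eq_square)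
  finally have U': "N (U \<alpha> f) \<le> len\<^sup>2 / p0 * N f" using U by linarith
  have V': "N (V \<alpha> f) \<le> len * N f" using V s by (metis mult.assoc)
  have "N (\<L> (U \<alpha> f)) \<le> \<kappa> * (N (U \<alpha> f) + N (V \<alpha> f) + N (\<lambda>x. - f x))"
    using \<L>_bound[OF prim_U[OF i] prim_V[OF i] L2_neg[OF f]] by simp
  also have "\<dots> \<le> \<kappa> * (len\<^sup>2 / p0 * N f + len * N f + N f)"
    using U' V' \<kappa>_nonneg by (intro mult_left_mono) (auto simp: L2_norm_minus)
  also have "\<dots> = \<kappa> * (len\<^sup>2 / p0 + len + 1) * N f" by (simp add: algebra_simps)
  also have "\<dots> \<le> 1 / 4 * N f" by (intro mult_right_mono \<kappa>_contraction) auto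
  finally show ?thesis .
qed

section \<open>Reduction to finitely many unknowns\<close>

definition gridpt :: "nat \<Rightarrow> nat \<Rightarrow> real" where
  "gridpt n j = \<alpha> + real j * (len / real n)"

definition cell_indicator :: "nat \<Rightarrow> nat \<Rightarrow> real \<Rightarrow> complex" where
  "cell_indicator n j = indicator {gridpt n j..<gridpt n (Suc j)}"

text \<open>The step function with value \<open>y j\<close> on the \<open>j\<close>-th grid cell.\<close>

definition sample :: "nat \<Rightarrow> (nat \<Rightarrow> complex) \<Rightarrow> real \<Rightarrow> complex" where
  "sample n y x = (\<Sum>j<n. y j * cell_indicator n j x)"

definition gridval :: "nat \<Rightarrow> (real \<Rightarrow> complex) \<Rightarrow> real \<Rightarrow> complex" where
  "gridval n u = sample n (\<lambda>j. u (gridpt n j))"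

lemma gridpt_in:
  assumes "j \<le> n" "n > 0"
  shows "gridpt n j \<in> {real_of_int \<alpha>..real_of_int \<beta>}"
proof -
  have "real j * (len / real n) \<le> real n * (len / real n)" using assms len_pos by (intro mult_right_mono) auto
  then have "real j * (len / real n) \<le> len" using assms by simp
  moreover have "0 \<le> real j * (len / real n)" using len_pos by simp
  ultimately show ?thesis by (simp add: gridpt_def)
qed

lemma sample_at:
  assumes n: "n > 0" and x: "x \<in> J"
  obtains j where "j < n" "\<And>y. sample n y x = y j" "gridpt n j \<le> x" "x - gridpt n j \<le> len / real n"
proof -
  define h where "h = len / real n"
  have h: "h > 0" using n len_pos by (simp add: h_def)
  define j where "j = nat \<lfloor>(x - \<alpha>) / h\<rfloor>"
  have q0: "(x - \<alpha>) / h \<ge> 0" using x h by simp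
  have j1: "real j \<le> (x - \<alpha>) / h" "(x - \<alpha>) / h < real j + 1"
    using q0 unfolding j_def by (simp_all add: of_nat_nat)
  have g: "gridpt n i = \<alpha> + real i * h" for i by (simp add: gridpt_def h_def)
  have l: "gridpt n j \<le> x" "x < gridpt n (Suc j)"
    using j1 h unfolding g by (simp_all add: field_simps)
  have "(x - \<alpha>) / h < real n" using x n h len_pos by (simp add: h_def field_simps)
  then have jn: "j < n" using j1 by linarith
  have ind: "cell_indicator n i x = (if i = j then 1 else 0)" for i
  proof (cases "i = j")
    case False
    then consider "i < j" | "i > j" by linarith
    then have "x \<notin> {gridpt n i..<gridpt n (Suc i)}"
    proof cases
      case 1
      then have "real (Suc i) * h \<le> real j * h" using h by (intro mult_right_mono) auto
      then show ?thesis using l(1) unfolding g by auto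
    next
      case 2
      then have "real (Suc j) * h \<le> real i * h" using h by (intro mult_right_mono) auto
      then show ?thesis using l(2) unfolding g by auto
    qed
    then show ?thesis using False by (simp add: cell_indicator_def)
  qed (use l in \<open>simp add: cell_indicator_def\<close>)
  have "sample n y x = y j" for y
  proof -
    have "sample n y x = (\<Sum>i<n. if i = j then y i else 0)" unfolding sample_def ind by (intro sum.cong) auto
    then show ?thesis using jn by simp
  qed
  moreover have "x - gridpt n j \<le> len / real n" using l(2) unfolding g h_def[symmetric] by (simp add: algebra_simps)
  ultimately show ?thesis using that jn l(1) by blast
qed

lemma sample_measurable: "sample n y \<in> borel_measurable (lebesgue_on S)"
proof -
  have "cell_indicator n j \<in> borel_measurable borel" for j unfolding cell_indicator_def by measurable
  then have "sample n y \<in> borel_measurable borel" unfolding sample_def by measurable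
  then show ?thesis by (intro measurable_restrict_space1 measurable_completion) simp
qed

lemma sample_lincomb: "sample n (\<lambda>j. y j + c * y' j) x = sample n y x + c * sample n y' x"
  unfolding sample_def by (simp add: sum.distrib sum_distrib_left algebra_simps)

lemma gridval_lincomb: "gridval n (\<lambda>x. u x + c * u' x) x = gridval n u x + c * gridval n u' x"
  unfolding gridval_def by (rule sample_lincomb)

text \<open>
As \<open>U \<alpha> f\<close> is Lipschitz continuous with constant proportional to the norm of \<open>f\<close>, it is close to its step function
on a fine grid.
\<close>

lemma gridval_U_bound:
  assumes n: "n > 0" and f: "f \<in> L2 J" and x: "x \<in> J"
  shows "cmod (U \<alpha> f x - gridval n (U \<alpha> f) x) \<le> (len / real n) * (sqrt len / p0) * N f"
proof -
  obtain j where j: "j < n" "\<And>y. sample n y x = y j" "gridpt n j \<le> x" "x - gridpt n j \<le> len / real n"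
    by (rule sample_at[OF n x]) blast
  have "cmod (U \<alpha> f x - U \<alpha> f (gridpt n j)) \<le> (x - gridpt n j) * (sqrt (real_of_int \<beta> - real_of_int \<alpha>) / p0) * N f"
    using gridpt_in[of j n] j x n by (intro U_Lipschitz[OF f]) auto
  also have "\<dots> \<le> (len / real n) * (sqrt (real_of_int \<beta> - real_of_int \<alpha>) / p0) * N f"
    using j(4) p0_pos \<alpha>\<beta>_real by (intro mult_right_mono) auto
  finally show ?thesis unfolding gridval_def j(2) by simp
qed

text \<open>
With \<open>u = U \<alpha> f + edata\<close> and with grid values \<open>y\<close>, the equation \<open>f = \<L> u - (q - z) u\<close> becomes
\<open>f = gdata0 + z gdata + opA f + z opB f\<close>: the operator \<open>opB\<close> takes the part of \<open>U \<alpha> f\<close> that the grid values do not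
capture, and \<open>opA\<close> collects the terms independent of \<open>z\<close>. The reason for the splitting is that \<open>U \<alpha>\<close> itself
is not small, whereas \<open>opB\<close> is for a fine grid.
\<close>

definition opB :: "nat \<Rightarrow> (real \<Rightarrow> complex) \<Rightarrow> real \<Rightarrow> complex" where
  "opB n f x = U \<alpha> f x - gridval n (U \<alpha> f) x"

definition opA :: "nat \<Rightarrow> (real \<Rightarrow> complex) \<Rightarrow> real \<Rightarrow> complex" where
  "opA n f x = \<L> (U \<alpha> f) x + - of_real (q x) * opB n f x"

lemma opB_measurable: "f \<in> L2 J \<Longrightarrow> opB n f \<in> borel_measurable (lebesgue_on J)"
  unfolding opB_def gridval_def
  using continuous_on_measurable_lebesgue_on[OF U_continuous[OF _ less_imp_le[OF \<alpha>\<beta>_real]]] sample_measurable by measurable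

lemma opB_L2:
  assumes n: "n > 0" and f: "f \<in> L2 J"
  shows "opB n f \<in> L2 J" "N (opB n f) \<le> (len / real n) * (len / p0) * N f"
proof -
  note b = L2_bounded[OF opB_measurable[OF f, of n], of "(len / real n) * (sqrt len / p0) * N f"]
  have le: "cmod (opB n f x) \<le> (len / real n) * (sqrt len / p0) * N f" if "x \<in> J" for x
    unfolding opB_def by (rule gridval_U_bound[OF n f that])
  show "opB n f \<in> L2 J" by (rule b(1)) (use le \<alpha>\<beta>_real in auto)
  have "N (opB n f) \<le> sqrt (real_of_int \<beta> - real_of_int \<alpha>) * ((len / real n) * (sqrt len / p0) * N f)" by (rule b(2)) (use le \<alpha>\<beta>_real in auto)
  also have "\<dots> = (len / real n) * ((sqrt len * sqrt len) / p0) * N f" by simp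
  also have "sqrt len * sqrt len = len" using len_pos by simp
  finally show "N (opB n f) \<le> (len / real n) * (len / p0) * N f" .
qed

lemma q_mult_L2:
  assumes "f \<in> L2 S"
  shows "(\<lambda>x. (of_real (q x) - z) * f x) \<in> L2 S" "L2_norm S (\<lambda>x. (of_real (q x) - z) * f x) \<le> (qm + cmod z) * L2_norm S f"
proof -
  have le: "cmod ((of_real (q x) - z) * f x) \<le> (qm + cmod z) * cmod (f x)" for x
    using q_minus_bound[of x z] by (simp add: norm_mult mult_right_mono)
  have m: "(\<lambda>x. (of_real (q x) - z) * f x) \<in> borel_measurable (lebesgue_on S)"
    using q_measurable L2_measurable[OF assms] by measurable
  have g: "(\<lambda>x. of_real (qm + cmod z) * f x) \<in> L2 S" by (rule L2_cmult[OF assms])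
  have le': "cmod ((of_real (q x) - z) * f x) \<le> cmod (of_real (qm + cmod z) * f x)" for x
    using le[of x] qm_nonneg by (simp add: norm_mult del: of_real_add)
  have "integrable (lebesgue_on S) (\<lambda>x. (cmod (of_real (qm + cmod z) * f x))\<^sup>2)" using g by (simp add: L2_def)
  from L2_dominated[OF m this] show 1: "(\<lambda>x. (of_real (q x) - z) * f x) \<in> L2 S"
    using le' by (auto intro!: power_mono)
  have "L2_norm S (\<lambda>x. (of_real (q x) - z) * f x) \<le> L2_norm S (\<lambda>x. of_real (qm + cmod z) * f x)"
    by (rule L2_norm_mono_AE[OF _ 1 g]) (use le' in auto)
  then show "L2_norm S (\<lambda>x. (of_real (q x) - z) * f x) \<le> (qm + cmod z) * L2_norm S f"
    using qm_nonneg by (simp add: L2_norm_cmult del: of_real_add)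
qed

lemma opA_L2: "n > 0 \<Longrightarrow> f \<in> L2 J \<Longrightarrow> opA n f \<in> L2 J"
  using L2_lincomb[OF \<L>_L2[OF in_domain_U] q_mult_L2(1)[OF opB_L2(1), of n f 0], of f "-1"]
  unfolding opA_def by simp

text \<open>
One quarter each comes from the smallness of \<open>\<L>\<close> and from the fineness of the grid.
\<close>

lemma opAB_bound:
  assumes n: "n > 0" and f: "f \<in> L2 J" and z: "cmod z \<le> R" and big: "(qm + R) * ((len / real n) * (len / p0)) \<le> 1 / 4"
  shows "N (\<lambda>x. opA n f x + z * opB n f x) \<le> 1 / 2 * N f"
proof -
  note BL = opB_L2[OF n f]
  have R: "R \<ge> 0" using z norm_ge_zero order_trans by blast
  have "(\<lambda>x. opA n f x + z * opB n f x) = (\<lambda>x. \<L> (U \<alpha> f) x - (of_real (q x) - z) * opB n f x)"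
    by (auto simp: opA_def algebra_simps)
  then have "N (\<lambda>x. opA n f x + z * opB n f x) \<le> N (\<L> (U \<alpha> f)) + N (\<lambda>x. (of_real (q x) - z) * opB n f x)"
    using L2_norm_triangle_diff[OF \<L>_L2[OF in_domain_U[OF f]] q_mult_L2(1)[OF BL(1), of z]] by simp
  also have "N (\<lambda>x. (of_real (q x) - z) * opB n f x) \<le> (qm + cmod z) * N (opB n f)" by (rule q_mult_L2(2)[OF BL(1)])
  also have "\<dots> \<le> (qm + R) * ((len / real n) * (len / p0) * N f)"
    using BL(2) z qm_nonneg R by (intro mult_mono) auto
  also have "\<dots> = (qm + R) * ((len / real n) * (len / p0)) * N f" by simp
  also have "\<dots> \<le> 1 / 4 * N f" by (intro mult_right_mono big) auto
  finally show ?thesis using \<L>U_bound[OF f] by linarith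
qed

lemma opB_lincomb:
  assumes n: "n > 0" and fg: "f \<in> L2 J" "g \<in> L2 J" and x: "x \<in> J"
  shows "opB n (\<lambda>y. f y + c * g y) x = opB n f x + c * opB n g x"
proof -
  obtain j where j: "j < n" "\<And>y. sample n y x = y j" by (rule sample_at[OF n x]) blast
  have "gridpt n j \<in> {real_of_int \<alpha>..real_of_int \<beta>}" using gridpt_in[of j n] j n by simp
  then show ?thesis unfolding opB_def gridval_def j(2)
    using U_L2_lincomb(1)[OF fg, of x c] U_L2_lincomb(1)[OF fg, of "gridpt n j" c] x by (simp add: algebra_simps)
qed

lemma opB_bounded: "n > 0 \<Longrightarrow> bounded_operator J (opB n)"
  unfolding bounded_operator_def
  using opB_L2 by (auto intro!: exI[of _ "(len / real n) * (len / p0)"] AE_I2 opB_lincomb)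

lemma \<L>U_lincomb:
  assumes fg: "f \<in> L2 J" "g \<in> L2 J"
  shows "AE x in lebesgue_on J. \<L> (U \<alpha> (\<lambda>y. f y + c * g y)) x = \<L> (U \<alpha> f) x + c * \<L> (U \<alpha> g) x"
proof -
  have "\<L> (U \<alpha> (\<lambda>y. f y + c * g y)) = \<L> (\<lambda>x. U \<alpha> f x + c * U \<alpha> g x)"
    by (rule \<L>_local) (use U_L2_lincomb(1)[OF fg] in auto)
  then show ?thesis using \<L>_add[OF in_domain_U[OF fg(1)] in_domain_U[OF fg(2)], of c] by simp
qed

lemma opA_bounded:
  assumes n: "n > 0"
  shows "bounded_operator J (opA n)"
  unfolding bounded_operator_def
proof (intro conjI ballI allI exI)
  fix f assume f: "f \<in> L2 J"
  show "opA n f \<in> L2 J" by (rule opA_L2[OF n f])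
next
  fix f assume f: "f \<in> L2 J"
  have "opA n f = (\<lambda>x. \<L> (U \<alpha> f) x - (of_real (q x) - 0) * opB n f x)" by (auto simp: opA_def)
  then have "N (opA n f) \<le> N (\<L> (U \<alpha> f)) + N (\<lambda>x. (of_real (q x) - 0) * opB n f x)"
    using L2_norm_triangle_diff[OF \<L>_L2[OF in_domain_U[OF f]] q_mult_L2(1)[OF opB_L2(1)[OF n f], of 0]] by simp
  also have "\<dots> \<le> 1 / 4 * N f + (qm + cmod 0) * N (opB n f)"
    by (intro add_mono \<L>U_bound[OF f] q_mult_L2(2) opB_L2(1)[OF n f])
  also have "\<dots> \<le> 1 / 4 * N f + qm * ((len / real n) * (len / p0) * N f)"
    using mult_left_mono[OF opB_L2(2)[OF n f] qm_nonneg] by simp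
  also have "\<dots> = (1 / 4 + qm * ((len / real n) * (len / p0))) * N f" by (simp add: algebra_simps)
  finally show "N (opA n f) \<le> (1 / 4 + qm * ((len / real n) * (len / p0))) * N f" .
next
  fix f g c assume fg: "f \<in> L2 J" "g \<in> L2 J"
  have "AE x in lebesgue_on J. opB n (\<lambda>y. f y + c * g y) x = opB n f x + c * opB n g x"
    by (intro AE_I2) (use opB_lincomb[OF n fg] in auto)
  then show "AE x in lebesgue_on J. opA n (\<lambda>y. f y + c * g y) x = opA n f x + c * opA n g x"
    using \<L>U_lincomb[OF fg, of c]
  proof eventually_elim
    case (elim x) then show ?case unfolding opA_def by (simp add: algebra_simps)
  qed
qed

text \<open>
The unknowns are numbered from 0 to \<open>n + 1\<close>: first the grid values of \<open>u\<close>, then its value and its flux at \<alpha>.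
\<open>edata\<close> is the part of \<open>u\<close> determined by the last two, and \<open>gdata\<close> the part of \<open>u\<close> in the term of order zero that is
determined by all of them.
\<close>

definition edata :: "nat \<Rightarrow> (nat \<Rightarrow> complex) \<Rightarrow> real \<Rightarrow> complex" where
  "edata n y x = y n + y (Suc n) * P \<alpha> x"

definition gdata :: "nat \<Rightarrow> (nat \<Rightarrow> complex) \<Rightarrow> real \<Rightarrow> complex" where
  "gdata n y x = edata n y x - gridval n (edata n y) x + sample n y x"

definition gdata0 :: "nat \<Rightarrow> (nat \<Rightarrow> complex) \<Rightarrow> real \<Rightarrow> complex" where
  "gdata0 n y x = \<L> (edata n y) x + - of_real (q x) * gdata n y x"

text \<open>
The equation for \<open>f\<close> with all unknowns \<open>y\<close> prescribed; no relation between \<open>f\<close> and the grid values is imposed yet.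
\<close>

definition fsol :: "nat \<Rightarrow> complex \<Rightarrow> (real \<Rightarrow> complex) \<Rightarrow> (nat \<Rightarrow> complex) \<Rightarrow> bool" where
  "fsol n z f y \<longleftrightarrow> f \<in> L2 J \<and>
     (AE x in lebesgue_on J. f x = gdata0 n y x + z * gdata n y x + opA n f x + z * opB n f x)"

lemma edata_lincomb: "edata n (\<lambda>j. y j + c * y' j) x = edata n y x + c * edata n y' x"
  unfolding edata_def by (simp add: algebra_simps)

lemma in_domain_edata: "in_domain (edata n y)"
  using in_domain_const_P[of "y n" "y (Suc n)"] by (simp add: edata_def[abs_def])

lemma gdata_lincomb: "gdata n (\<lambda>j. y j + c * y' j) x = gdata n y x + c * gdata n y' x"
proof -
  have "edata n (\<lambda>j. y j + c * y' j) = (\<lambda>x. edata n y x + c * edata n y' x)" by (rule ext) (rule edata_lincomb)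
  then show ?thesis unfolding gdata_def by (simp add: gridval_lincomb sample_lincomb algebra_simps)
qed

lemma edata_continuous: "continuous_on X (P \<alpha>) \<Longrightarrow> continuous_on X (edata n y)"
  unfolding edata_def[abs_def] by (intro continuous_intros)

lemma gdata_L2: 
  assumes n: "n > 0"
  shows "gdata n y \<in> L2 J"
proof -
  have c: "continuous_on {real_of_int \<alpha>..real_of_int \<beta>} (edata n y)" by (intro edata_continuous P_continuous)
  then have "bounded (edata n y ` {real_of_int \<alpha>..real_of_int \<beta>})" using compact_continuous_image compact_imp_bounded by blast
  then obtain B where B: "\<forall>w\<in>edata n y ` {real_of_int \<alpha>..real_of_int \<beta>}. cmod w \<le> B" unfolding bounded_iff by blast
  show ?thesis
  proof (rule L2_bounded(1))
    show "gdata n y \<in> borel_measurable (lebesgue_on J)"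
      unfolding gdata_def[abs_def] gridval_def
      using continuous_on_measurable_lebesgue_on[OF c] sample_measurable by measurable
    fix x assume x: "x \<in> J"
    obtain j where j: "j < n" "\<And>y. sample n y x = y j" by (rule sample_at[OF n x]) blast
    have "gridpt n j \<in> {real_of_int \<alpha>..real_of_int \<beta>}" using gridpt_in[of j n] j n by simp
    then have b: "cmod (edata n y x) \<le> B" "cmod (edata n y (gridpt n j)) \<le> B" using B x by auto
    have yj: "cmod (y j) \<le> (\<Sum>i<n. cmod (y i))" using j(1) by (intro member_le_sum) auto
    have "cmod (edata n y x - edata n y (gridpt n j) + y j) \<le> cmod (edata n y x) + cmod (edata n y (gridpt n j)) + cmod (y j)"
      by (rule order_trans[OF norm_triangle_ineq add_right_mono[OF norm_triangle_ineq4]])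
    then show "cmod (gdata n y x) \<le> 2 * B + (\<Sum>i<n. cmod (y i))"
      unfolding gdata_def gridval_def j(2) using b yj by linarith
  qed (use \<alpha>\<beta>_real in simp)
qed

lemma gdata0_L2: "n > 0 \<Longrightarrow> gdata0 n y \<in> L2 J"
proof -
  assume n: "n > 0"
  have "(\<lambda>x. (of_real (q x) - 0) * gdata n y x) \<in> L2 J" by (rule q_mult_L2(1)[OF gdata_L2[OF n]])
  from L2_diff[OF \<L>_L2[OF in_domain_edata] this] show "gdata0 n y \<in> L2 J"
    unfolding gdata0_def[abs_def] by simp
qed

lemma gdata0_lincomb: "AE x in lebesgue_on J. gdata0 n (\<lambda>j. y j + c * y' j) x = gdata0 n y x + c * gdata0 n y' x"
proof -
  have e: "edata n (\<lambda>j. y j + c * y' j) = (\<lambda>x. edata n y x + c * edata n y' x)" by (rule ext) (rule edata_lincomb)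
  show ?thesis
    using \<L>_add[OF in_domain_edata in_domain_edata, of n y c n y']
  proof eventually_elim
    case (elim x) then show ?case unfolding gdata0_def gdata_lincomb e by (simp add: algebra_simps)
  qed
qed

lemma fsol_lincomb:
  assumes n: "n > 0" and "fsol n z f y" "fsol n z f' y'"
  shows "fsol n z (\<lambda>x. f x + c * f' x) (\<lambda>j. y j + c * y' j)"
proof -
  have L: "f \<in> L2 J" "f' \<in> L2 J" using assms unfolding fsol_def by auto
  have 1: "AE x in lebesgue_on J. opA n (\<lambda>y. f y + c * f' y) x = opA n f x + c * opA n f' x"
    "AE x in lebesgue_on J. opB n (\<lambda>y. f y + c * f' y) x = opB n f x + c * opB n f' x"
    using opA_bounded[OF n] opB_bounded[OF n] L unfolding bounded_operator_def by blast+
  have 2: "AE x in lebesgue_on J. f x = gdata0 n y x + z * gdata n y x + opA n f x + z * opB n f x"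
    "AE x in lebesgue_on J. f' x = gdata0 n y' x + z * gdata n y' x + opA n f' x + z * opB n f' x"
    using assms unfolding fsol_def by auto
  have "AE x in lebesgue_on J. f x + c * f' x = gdata0 n (\<lambda>j. y j + c * y' j) x + z * gdata n (\<lambda>j. y j + c * y' j) x
     + opA n (\<lambda>x. f x + c * f' x) x + z * opB n (\<lambda>x. f x + c * f' x) x"
    using 1 2 gdata0_lincomb[of n y c y']
  proof eventually_elim
    case (elim x)
    have "f x + c * f' x = (gdata0 n y x + z * gdata n y x + opA n f x + z * opB n f x) +
      c * (gdata0 n y' x + z * gdata n y' x + opA n f' x + z * opB n f' x)" using elim(3,4) by simp
    then show ?case unfolding elim(1,2,5) gdata_lincomb by (simp add: algebra_simps)
  qed
  then show ?thesis unfolding fsol_def using L by (auto intro: L2_lincomb)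
qed

definition fine_grid :: "real \<Rightarrow> nat \<Rightarrow> bool" where
  "fine_grid R n \<longleftrightarrow> n > 0 \<and> (qm + R) * ((len / real n) * (len / p0)) \<le> 1 / 4"

lemma fine_grid_exists:
  assumes R: "R \<ge> 0" obtains n where "fine_grid R n"
proof -
  define c where "c = 4 * (qm + R) * len * len / p0"
  have c0: "c \<ge> 0" using R qm_nonneg len_pos p0_pos by (simp add: c_def)
  obtain n where n: "c < real n" using reals_Archimedean2 by blast
  then have n0: "n > 0" using c0 by (metis gr0I not_less of_nat_0)
  have "(qm + R) * ((len / real n) * (len / p0)) = c / real n / 4"
    using p0_pos n0 by (simp add: c_def field_simps)
  also have "c / real n \<le> 1" using n n0 by simp
  finally show ?thesis using that[of n] n0 by (simp add: fine_grid_def)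
qed

text \<open>A difference of two solutions is a fixed point of a contraction with factor 1/2.\<close>

lemma fsol_unique:
  assumes n: "fine_grid R n" and z: "cmod z \<le> R" and "fsol n z f y" "fsol n z f' y'" and yy: "\<And>i. i < n + 2 \<Longrightarrow> y i = y' i"
  shows "AE x in lebesgue_on J. f x = f' x"
proof -
  have n0: "n > 0" using n by (simp add: fine_grid_def)
  have L: "f \<in> L2 J" "f' \<in> L2 J" using assms unfolding fsol_def by auto
  define h where "h = (\<lambda>x. f x + (-1) * f' x)"
  have hL: "h \<in> L2 J" unfolding h_def using L by (rule L2_lincomb)
  have s: "fsol n z h (\<lambda>j. y j + (-1) * y' j)" unfolding h_def by (rule fsol_lincomb[OF n0 assms(3,4)])
  have e0: "edata n (\<lambda>j. y j + (-1) * y' j) = (\<lambda>x. 0)" using yy[of n] yy[of "Suc n"] by (auto simp: edata_def[abs_def])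
  have s0: "sample n (\<lambda>j. y j + (-1) * y' j) = (\<lambda>x. 0)" using yy by (auto simp: sample_def[abs_def] intro!: sum.neutral)
  have g0: "gdata n (\<lambda>j. y j + (-1) * y' j) = (\<lambda>x. 0)"
    unfolding gdata_def[abs_def] e0 s0 by (simp add: gridval_def sample_def)
  have "AE x in lebesgue_on J. \<L> (\<lambda>x. 0 + 1 * 0) x = \<L> (\<lambda>x. 0) x + 1 * \<L> (\<lambda>x. 0) x"
    using in_domain_const_P[of 0 0] by (intro \<L>_add) auto
  then have L0: "AE x in lebesgue_on J. \<L> (\<lambda>x. 0) x = 0" by simp
  have "AE x in lebesgue_on J. h x = gdata0 n (\<lambda>j. y j + (-1) * y' j) x + z * gdata n (\<lambda>j. y j + (-1) * y' j) x + opA n h x + z * opB n h x"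
    using s unfolding fsol_def by blast
  then have he: "AE x in lebesgue_on J. h x = opA n h x + z * opB n h x"
    using L0
  proof eventually_elim
    case (elim x) then show ?case unfolding gdata0_def e0 g0 by simp
  qed
  have "(\<lambda>x. opA n h x + z * opB n h x) \<in> L2 J"
    by (intro L2_lincomb opA_L2 opB_L2 n0 hL)
  then have "N h = N (\<lambda>x. opA n h x + z * opB n h x)" by (intro L2_norm_AE_cong he hL)
  also have "\<dots> \<le> 1 / 2 * N h" using n by (intro opAB_bound[OF n0 hL z]) (simp add: fine_grid_def)
  finally have "N h = 0" using L2_norm_nonneg[of J h] by simp
  then have "AE x in lebesgue_on J. h x = 0" using L2_norm_eq_0_iff[OF hL] by blast
  then show ?thesis unfolding h_def by (auto elim: eventually_mono)
qed

text \<open>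
The Neumann series converges geometrically with ratio 1/2, uniformly in the disc.
\<close>

lemma fsol_exists:
  assumes n: "fine_grid R n"
  obtains f where "\<And>z. z \<in> ball 0 R \<Longrightarrow> fsol n z (f z) y"
    "\<And>l. bounded_functional J l \<Longrightarrow> (\<lambda>z. l (f z)) holomorphic_on ball 0 R"
proof -
  have n0: "n > 0" using n by (simp add: fine_grid_def)
  define M where "M = N (gdata0 n y) + R * N (gdata n y)"
  have c: "N (neumann_iterate (opA n) (opB n) (gdata0 n y) (gdata n y) z k) \<le> M * (1 / 2) ^ k" if z: "z \<in> ball 0 R" for z k
  proof (induction k)
    case 0
    have "N (\<lambda>x. gdata0 n y x + z * gdata n y x) \<le> N (gdata0 n y) + cmod z * N (gdata n y)"
      using L2_norm_triangle[OF gdata0_L2[OF n0] L2_cmult[OF gdata_L2[OF n0]], of y z y] by (simp add: L2_norm_cmult)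
    also have "\<dots> \<le> M" unfolding M_def using z by (intro add_left_mono mult_right_mono) auto
    finally show ?case by simp
  next
    case (Suc k)
    let ?f = "neumann_iterate (opA n) (opB n) (gdata0 n y) (gdata n y) z k"
    have "?f \<in> L2 J" by (intro neumann_iterate_L2 opA_bounded opB_bounded gdata0_L2 gdata_L2 n0)
    then have "N (\<lambda>x. opA n ?f x + z * opB n ?f x) \<le> 1 / 2 * N ?f"
      using n z by (intro opAB_bound[OF n0, where R = R]) (auto simp: fine_grid_def)
    then show ?case using Suc by simp
  qed
  have summ: "summable (\<lambda>k. M * (1 / 2) ^ k)" by (intro summable_mult summable_geometric) simp
  show ?thesis
  proof (rule neumann_series[OF opA_bounded[OF n0] opB_bounded[OF n0] gdata0_L2[OF n0] gdata_L2[OF n0] _ open_ball c summ])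
    show "real_of_int \<alpha> \<le> real_of_int \<beta>" using \<alpha>\<beta>_real by simp
    fix h assume h: "\<And>z. z \<in> ball 0 R \<Longrightarrow> h z \<in> L2 J"
      "\<And>z. z \<in> ball 0 R \<Longrightarrow> AE x in lebesgue_on J. h z x = gdata0 n y x + z * gdata n y x + opA n (h z) x + z * opB n (h z) x"
      "\<And>l. bounded_functional J l \<Longrightarrow> (\<lambda>z. l (h z)) holomorphic_on ball 0 R"
    show thesis
    proof (rule that[of h])
      fix z :: complex assume z: "z \<in> ball 0 R"
      show "fsol n z (h z) y" unfolding fsol_def using h(1)[OF z] h(2)[OF z] by (rule conjI)
    next
      fix l assume l: "bounded_functional J l"
      from h(3)[OF l] show "(\<lambda>z. l (h z)) holomorphic_on ball 0 R" .
    qed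
  qed
qed

definition unit_vec :: "nat \<Rightarrow> nat \<Rightarrow> complex" where
  "unit_vec i j = (if j = i then 1 else 0)"

lemma fsol_combination:
  assumes n: "n > 0" and f: "\<And>i. i < n + 2 \<Longrightarrow> fsol n z (f i) (unit_vec i)"
  shows "fsol n z (\<lambda>x. \<Sum>i<n+2. y i * f i x) (\<lambda>j. if j < n + 2 then y j else 0)"
proof -
  have "m \<le> n + 2 \<Longrightarrow> fsol n z (\<lambda>x. \<Sum>i<m. y i * f i x) (\<lambda>j. if j < m then y j else 0)" for m
  proof (induction m)
    case 0
    have "fsol n z (\<lambda>x. f 0 x + (-1) * f 0 x) (\<lambda>j. unit_vec 0 j + (-1) * unit_vec 0 j)"
      using f[of 0] by (intro fsol_lincomb[OF n]) auto
    then show ?case by simp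
  next
    case (Suc m)
    have "fsol n z (\<lambda>x. (\<Sum>i<m. y i * f i x) + y m * f m x) (\<lambda>j. (if j < m then y j else 0) + y m * unit_vec m j)"
      using Suc f[of m] by (intro fsol_lincomb[OF n]) auto
    moreover have "(\<lambda>j. (if j < m then y j else 0) + y m * unit_vec m j) = (\<lambda>j. if j < Suc m then y j else 0)"
      by (auto simp: unit_vec_def fun_eq_iff less_Suc_eq)
    ultimately show ?case by simp
  qed
  then show ?thesis by blast
qed

text \<open>
Solutions of the perturbed equation between \<alpha> and \<beta>, without boundary conditions.
\<close>

definition jsol :: "complex \<Rightarrow> (real \<Rightarrow> complex) \<Rightarrow> (real \<Rightarrow> complex) \<Rightarrow> bool" where
  "jsol z u v \<longleftrightarrow> prim \<alpha> \<beta> u (\<lambda>x. v x / of_real (p x)) \<and> prim \<alpha> \<beta> v (\<lambda>x. (of_real (q x) - z) * u x - \<L> u x)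
     \<and> (\<lambda>x. (of_real (q x) - z) * u x - \<L> u x) \<in> L2 J"

definition jvec :: "nat \<Rightarrow> (real \<Rightarrow> complex) \<Rightarrow> (real \<Rightarrow> complex) \<Rightarrow> nat \<Rightarrow> complex" where
  "jvec n u v j = (if j < n then u (gridpt n j) else if j = n then u \<alpha> else if j = Suc n then v \<alpha> else 0)"

text \<open>
A solution of the perturbed equation, together with its actual grid values and data at \<alpha>, solves the extended
equation; the converse holds if the grid values are consistent.
\<close>

lemma jsol_imp_fsol:
  assumes n: "n > 0" and s: "jsol z u v"
  defines "f \<equiv> \<lambda>x. - ((of_real (q x) - z) * u x - \<L> u x)"
  shows "fsol n z f (jvec n u v)" "\<And>x. x \<in> {real_of_int \<alpha>..real_of_int \<beta>} \<Longrightarrow> u x = U \<alpha> f x + edata n (jvec n u v) x \<and> v x = V \<alpha> f x + v \<alpha>"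
proof -
  have pu: "prim \<alpha> \<beta> u (\<lambda>x. v x / of_real (p x))" and pv: "prim \<alpha> \<beta> v (\<lambda>x. - f x)"
    using s unfolding jsol_def f_def by auto
  have "(\<lambda>x. (of_real (q x) - z) * u x - \<L> u x) \<in> L2 J" using s by (simp add: jsol_def)
  then have fL: "f \<in> L2 J" unfolding f_def by (rule L2_neg)
  show rep: "u x = U \<alpha> f x + edata n (jvec n u v) x \<and> v x = V \<alpha> f x + v \<alpha>" if "x \<in> {real_of_int \<alpha>..real_of_int \<beta>}" for x
    using solution_representation[OF pu pv that] by (simp add: edata_def jvec_def)
  have Leq: "\<L> u = \<L> (\<lambda>x. edata n (jvec n u v) x + 1 * U \<alpha> f x)"
    by (rule \<L>_local) (use rep in auto)
  have ux: "AE x in lebesgue_on J. \<L> u x = \<L> (edata n (jvec n u v)) x + 1 * \<L> (U \<alpha> f) x"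
    unfolding Leq by (rule \<L>_add[OF in_domain_edata in_domain_U[OF fL]])
  have "AE x in lebesgue_on J. x \<in> J" by (rule AE_I2) simp
  then have "AE x in lebesgue_on J. f x = gdata0 n (jvec n u v) x + z * gdata n (jvec n u v) x + opA n f x + z * opB n f x"
    using ux
  proof eventually_elim
    case (elim x)
    obtain j where j: "j < n" "\<And>y. sample n y x = y j" by (rule sample_at[OF n elim(1)]) blast
    have g: "gridpt n j \<in> {real_of_int \<alpha>..real_of_int \<beta>}" using gridpt_in[of j n] j n by simp
    have "jvec n u v j = u (gridpt n j)" using j(1) by (simp add: jvec_def)
    then have jv: "jvec n u v j = U \<alpha> f (gridpt n j) + edata n (jvec n u v) (gridpt n j)" using rep[OF g] by simp
    have ue: "u x = U \<alpha> f x + edata n (jvec n u v) x" using rep[of x] elim(1) by simp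
    have gd: "gdata n (jvec n u v) x = edata n (jvec n u v) x + U \<alpha> f (gridpt n j)"
      unfolding gdata_def gridval_def j(2) using jv by simp
    have ob: "opB n f x = U \<alpha> f x - U \<alpha> f (gridpt n j)" unfolding opB_def gridval_def j(2) ..
    have fx: "f x = - ((of_real (q x) - z) * u x - \<L> u x)" by (simp add: f_def)
    show ?case
      unfolding fx elim(2) gdata0_def opA_def ob gd ue by (simp add: algebra_simps)
  qed
  then show "fsol n z f (jvec n u v)" unfolding fsol_def using fL by blast
qed

lemma fsol_imp_jsol:
  assumes n: "n > 0" and s: "fsol n z f y" and grid: "\<And>j. j < n \<Longrightarrow> U \<alpha> f (gridpt n j) + edata n y (gridpt n j) = y j"
  shows "jsol z (\<lambda>x. U \<alpha> f x + edata n y x) (\<lambda>x. V \<alpha> f x + y (Suc n))"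
proof -
  let ?u = "\<lambda>x. U \<alpha> f x + edata n y x"
  have fL: "f \<in> L2 J" using s by (simp add: fsol_def)
  note fi = L2_absolutely_integrable[OF fL less_imp_le[OF \<alpha>\<beta>_real]]
  have sc: "prim \<alpha> \<beta> ?u (\<lambda>x. (V \<alpha> f x + y (Suc n)) / of_real (p x))" "prim \<alpha> \<beta> (\<lambda>x. V \<alpha> f x + y (Suc n)) (\<lambda>x. - f x)"
    using solution_construction(1)[OF fi, of "y n" "y (Suc n)"] solution_construction(2)[OF fi, of "y (Suc n)"]
    by (simp_all add: edata_def add.assoc)
  have Leq: "\<L> ?u = \<L> (\<lambda>x. edata n y x + 1 * U \<alpha> f x)"
    by (rule \<L>_local) auto
  have ux: "AE x in lebesgue_on J. \<L> ?u x = \<L> (edata n y) x + 1 * \<L> (U \<alpha> f) x"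
    unfolding Leq by (rule \<L>_add[OF in_domain_edata in_domain_U[OF fL]])
  have fe: "AE x in lebesgue_on J. f x = gdata0 n y x + z * gdata n y x + opA n f x + z * opB n f x"
    using s by (simp add: fsol_def)
  have "AE x in lebesgue_on J. x \<in> J" by (rule AE_I2) simp
  then have e: "AE x in lebesgue_on J. (of_real (q x) - z) * ?u x - \<L> ?u x = - f x"
    using ux fe
  proof eventually_elim
    case (elim x)
    obtain j where j: "j < n" "\<And>y. sample n y x = y j" by (rule sample_at[OF n elim(1)]) blast
    have gd: "gdata n y x = edata n y x + U \<alpha> f (gridpt n j)"
      unfolding gdata_def gridval_def j(2) using grid[OF j(1)] by (simp add: algebra_simps)
    have ob: "opB n f x = U \<alpha> f x - U \<alpha> f (gridpt n j)" unfolding opB_def gridval_def j(2) ..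
    show ?case
      by (subst elim(3)) (simp only: elim(2) gdata0_def opA_def ob gd, simp add: algebra_simps)
  qed
  have "prim \<alpha> \<beta> (\<lambda>x. V \<alpha> f x + y (Suc n)) (\<lambda>x. (of_real (q x) - z) * ?u x - \<L> ?u x)"
    by (rule prim_AE[OF sc(2) e]) simp
  moreover have "(\<lambda>x. (of_real (q x) - z) * ?u x - \<L> ?u x) \<in> L2 J"
    by (rule L2_AE_transfer(1)[OF J_measurable L2_neg[OF fL] e])
  ultimately show ?thesis unfolding jsol_def using sc(1) by simp
qed

end

section \<open>Floquet multipliers and energy estimates\<close>

text \<open>
The row vector \<open>(m11 - t, m12)\<close> is a left eigenvector of the transfer matrix for the eigenvalue \<open>t'\<close>.
\<close>

lemma eigen_row_step:
  fixes m11 m12 m21 m22 t t' a b :: complex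
  assumes "m11 * m22 - m12 * m21 = 1" "t * t' = 1" "t + t' = m11 + m22"
  shows "(m11 - t) * (m11 * a + m12 * b) + m12 * (m21 * a + m22 * b) = t' * ((m11 - t) * a + m12 * b)"
proof -
  have m22: "m22 = t + t' - m11" using assms(3) by (simp add: algebra_simps)
  have "m12 * m21 = m11 * m22 - 1" using assms(1) by (simp add: algebra_simps)
  then have "m12 * m21 * a = (m11 * m22 - 1) * a" by simp
  then have "(m11 - t) * (m11 * a + m12 * b) + m12 * (m21 * a + m22 * b) =
     (m11 - t) * (m11 * a + m12 * b) + (m11 * m22 - 1) * a + m12 * m22 * b" by (simp add: algebra_simps)
  also have "\<dots> = t' * ((m11 - t) * a + m12 * b) + (t * t' - 1) * a"
    unfolding m22 by (simp add: algebra_simps)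
  finally show ?thesis using assms(2) by simp
qed

text \<open>
Data annihilated by this row vector form an eigenvector for \<open>t\<close>. The hypothesis on \<open>m12\<close> rules out that the row vector
vanishes.
\<close>

lemma eigen_second_row:
  fixes m11 m12 m21 m22 t t' a b :: complex
  assumes "m11 * m22 - m12 * m21 = 1" "t * t' = 1" "t + t' = m11 + m22" "(m11 - t) * a + m12 * b = 0" "m12 \<noteq> 0"
  shows "m11 * a + m12 * b = t * a" "m21 * a + m22 * b = t * b"
proof -
  show 1: "m11 * a + m12 * b = t * a" using assms(4) by (simp add: algebra_simps)
  have "(m11 - t) * (m11 * a + m12 * b) + m12 * (m21 * a + m22 * b) = 0"
    using eigen_row_step[OF assms(1-3), of a b] assms(4) by simp
  then have "m12 * (m21 * a + m22 * b) = - ((m11 - t) * (t * a))" unfolding 1 by (simp add: add_eq_0_iff)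
  also have "\<dots> = - (t * ((m11 - t) * a))" by (simp add: mult_ac)
  also have "(m11 - t) * a = - (m12 * b)" using assms(4) by (simp add: add_eq_0_iff2)
  finally have "m12 * (m21 * a + m22 * b) = m12 * (t * b)" by (simp add: mult_ac)
  then show "m21 * a + m22 * b = t * b" using assms(5) by simp
qed

lemma root_partner:
  fixes t D :: complex
  assumes "t\<^sup>2 - D * t + 1 = 0"
  shows "t \<noteq> 0" "t * (1 / t) = 1" "t + 1 / t = D"
proof -
  show t: "t \<noteq> 0" using assms by auto
  then show "t * (1 / t) = 1" by simp
  have "t * (t + 1 / t) = t * D" using assms t by (simp add: power2_eq_square algebra_simps)
  then show "t + 1 / t = D" using t by simp
qed

context periodic_coefficients begin

lemma transfersD:
  assumes "transfers R m11 m12 m21 m22" "z \<in> ball 0 R" "osol z 0 1 u v"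
  shows "u 1 = m11 z * u 0 + m12 z * v 0" "v 1 = m21 z * u 0 + m22 z * v 0"
  using assms unfolding transfers_def by blast+

text \<open>If \<open>m12\<close> vanished, \<open>z\<close> would be a nonreal Dirichlet eigenvalue of the cell.\<close>

lemma m12_nonzero:
  assumes t: "transfers R m11 m12 m21 m22" and z: "z \<in> ball 0 R" "Im z \<noteq> 0"
  shows "m12 z \<noteq> 0"
proof
  assume m: "m12 z = 0"
  obtain u v where uv: "osol z 0 1 u v" "u 0 = 0" "v 0 = 1" using t z unfolding transfers_def by blast
  have u1: "u 1 = 0" using transfersD(1)[OF t z(1) uv(1)] uv m by simp
  define S where "S = integral {0..1} (\<lambda>x. (cmod (u x))\<^sup>2)"
  have "- Im z * S = 0" using cell_energy(1)[OF uv(1)] u1 uv by (simp add: S_def)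
  then have "S = 0" using z by simp
  then show False using cell_energy(4)[OF uv(1)] uv by (simp add: S_def)
qed

text \<open>
Data \<open>(a, b)\<close> annihilated by the row vector belong to a Floquet solution, which is multiplied by \<open>l\<close> over a period.
Hence \<open>b\<close> times the conjugate of \<open>a\<close> is multiplied by \<open>\<bar>l\<bar>\<^sup>2\<close>, and the energy identity of the cell becomes an estimate
at a single point. It replaces integrals over half-lines.
\<close>

lemma floquet_energy:
  assumes t: "transfers R m11 m12 m21 m22" and z: "z \<in> ball 0 R" "Im z \<noteq> 0"
    and l: "l\<^sup>2 - (m11 z + m22 z) * l + 1 = 0" and ab: "(m11 z - l) * a + m12 z * b = 0"
  obtains S where "S \<ge> 0" "S = 0 \<Longrightarrow> a = 0 \<and> b = 0"
    "(1 - (cmod l)\<^sup>2) * Im (b * cnj a) = Im z * S" "(1 - (cmod l)\<^sup>2) * Re (b * cnj a) \<le> (qm + \<bar>Re z\<bar>) * S"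
proof -
  obtain u v where uv: "osol z 0 1 u v" "u 0 = a" "v 0 = b" using t z unfolding transfers_def by blast
  have d: "m11 z * m22 z - m12 z * m21 z = 1" using t z unfolding transfers_def by blast
  note r = root_partner[OF l]
  note e = eigen_second_row[OF d r(2,3) ab m12_nonzero[OF t z]]
  have u1: "u 1 = l * a" and v1: "v 1 = l * b" using transfersD[OF t z(1) uv(1)] uv(2,3) e by simp_all
  define S where "S = integral {0..1} (\<lambda>x. (cmod (u x))\<^sup>2)"
  have "v 1 * cnj (u 1) = (l * cnj l) * (b * cnj a)" using u1 v1 by simp
  also have "l * cnj l = of_real ((cmod l)\<^sup>2)" by (simp only: complex_norm_square)
  finally have X: "v 1 * cnj (u 1) = of_real ((cmod l)\<^sup>2) * (b * cnj a)" .
  have Xim: "Im (v 1 * cnj (u 1)) = (cmod l)\<^sup>2 * Im (b * cnj a)" and Xre: "Re (v 1 * cnj (u 1)) = (cmod l)\<^sup>2 * Re (b * cnj a)"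
    unfolding X by (simp_all only: Im_complex_of_real Re_complex_of_real times_complex.simps mult_zero_left add_0_right diff_0_right)
  show ?thesis
  proof (rule that[of S])
    show "S \<ge> 0" using cell_energy(3)[OF uv(1)] by (simp add: S_def)
    show "S = 0 \<Longrightarrow> a = 0 \<and> b = 0" using cell_energy(4)[OF uv(1)] uv by (simp add: S_def)
    show "(1 - (cmod l)\<^sup>2) * Im (b * cnj a) = Im z * S"
      using cell_energy(1)[OF uv(1)] uv(2,3) unfolding S_def[symmetric] Xim by (simp add: left_diff_distrib)
    show "(1 - (cmod l)\<^sup>2) * Re (b * cnj a) \<le> (qm + \<bar>Re z\<bar>) * S"
    proof -
      have "- ((qm + \<bar>Re z\<bar>) * S) \<le> (cmod l)\<^sup>2 * Re (b * cnj a) - Re (b * cnj a)"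
        using cell_energy(2)[OF uv(1)] uv(2,3) unfolding S_def[symmetric] Xre minus_mult_left by simp
      then show ?thesis unfolding left_diff_distrib mult_1 by linarith
    qed
  qed
qed

text \<open>
A Floquet solution with unimodular multiplier would have energy zero; its data may be taken as
\<open>(m12, l - m11)\<close>.
\<close>

lemma nonreal_root_not_unimodular:
  assumes t: "transfers R m11 m12 m21 m22" and z: "z \<in> ball 0 R" "Im z \<noteq> 0"
    and l: "l\<^sup>2 - (m11 z + m22 z) * l + 1 = 0"
  shows "cmod l \<noteq> 1"
proof
  assume l1: "cmod l = 1"
  have ab: "(m11 z - l) * m12 z + m12 z * (l - m11 z) = 0" by (simp add: algebra_simps)
  obtain S where S: "S = 0 \<Longrightarrow> m12 z = 0 \<and> l - m11 z = 0"
    "(1 - (cmod l)\<^sup>2) * Im ((l - m11 z) * cnj (m12 z)) = Im z * S"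
    by (rule floquet_energy[OF t z l ab]) blast
  have "S = 0" using S(2) l1 z by simp
  then show False using S(1) m12_nonzero[OF t z] by blast
qed

end

context perturbed begin

lemma square_integral_L2:
  assumes c: "continuous_on {real_of_int \<alpha>..real_of_int \<beta>} u"
  shows "u \<in> L2 J" "(N u)\<^sup>2 = integral {real_of_int \<alpha>..real_of_int \<beta>} (\<lambda>x. (cmod (u x))\<^sup>2)"
proof -
  have "bounded (u ` {real_of_int \<alpha>..real_of_int \<beta>})" using c compact_continuous_image compact_imp_bounded by blast
  then obtain B where B: "\<forall>w\<in>u ` {real_of_int \<alpha>..real_of_int \<beta>}. cmod w \<le> B" unfolding bounded_iff by blast
  show uL: "u \<in> L2 J"
    by (rule L2_bounded(1)[OF continuous_on_measurable_lebesgue_on[OF c], where B = B]) (use B \<alpha>\<beta>_real in auto)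
  have "(N u)\<^sup>2 = (LINT x|lebesgue_on J. (cmod (u x))\<^sup>2)" by (rule L2_norm_square)
  also have "\<dots> = integral J (\<lambda>x. (cmod (u x))\<^sup>2)"
    using uL by (intro lebesgue_integral_eq_integral) (auto simp: L2_def)
  also have "\<dots> = integral {real_of_int \<alpha>..real_of_int \<beta>} (\<lambda>x. (cmod (u x))\<^sup>2)" by (simp add: integral_open_interval_real)
  finally show "(N u)\<^sup>2 = integral {real_of_int \<alpha>..real_of_int \<beta>} (\<lambda>x. (cmod (u x))\<^sup>2)" .
qed

lemma L2_pairing_bound:
  assumes g: "g \<in> L2 J" and c: "continuous_on {real_of_int \<alpha>..real_of_int \<beta>} u"
  shows "(\<lambda>x. g x * cnj (u x)) integrable_on {real_of_int \<alpha>..real_of_int \<beta>}"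
    "cmod (integral {real_of_int \<alpha>..real_of_int \<beta>} (\<lambda>x. g x * cnj (u x))) \<le> N g * N u"
proof -
  have a: "(\<lambda>x. g x * cnj (u x)) absolutely_integrable_on {real_of_int \<alpha>..real_of_int \<beta>}"
    by (intro absolutely_integrable_mult_continuous L2_absolutely_integrable[OF g] continuous_on_cnj c) (use \<alpha>\<beta>_real in simp)
  then show i: "(\<lambda>x. g x * cnj (u x)) integrable_on {real_of_int \<alpha>..real_of_int \<beta>}" by (rule set_lebesgue_integral_eq_integral(1))
  have "(\<lambda>x. cmod (g x * cnj (u x))) integrable_on {real_of_int \<alpha>..real_of_int \<beta>}" using a by (simp add: absolutely_integrable_on_def)
  then have "cmod (integral {real_of_int \<alpha>..real_of_int \<beta>} (\<lambda>x. g x * cnj (u x))) \<le> integral {real_of_int \<alpha>..real_of_int \<beta>} (\<lambda>x. cmod (g x * cnj (u x)))"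
    by (intro Henstock_Kurzweil_Integration.integral_norm_bound_integral i) auto
  also have "\<dots> = integral J (\<lambda>x. cmod (g x) * cmod (u x))" by (simp add: integral_open_interval_real norm_mult)
  also have "\<dots> = (LINT x|lebesgue_on J. cmod (g x) * cmod (u x))"
    by (intro lebesgue_integral_eq_integral[symmetric] L2_product_integrable g square_integral_L2(1)[OF c]) simp
  also have "\<dots> \<le> N g * N u" by (rule L2_Cauchy_Schwarz[OF g square_integral_L2(1)[OF c]])
  finally show "cmod (integral {real_of_int \<alpha>..real_of_int \<beta>} (\<lambda>x. g x * cnj (u x))) \<le> N g * N u" .
qed

text \<open>
The boundary conditions give the boundary terms in Green's identity a favourable sign at both ends, as if integrated
over the half-lines. At \<open>z = \<plusminus> \<i>\<close>, writing \<open>g = \<L> u\<close>, the imaginary part then gives \<open>N u \<le> N g\<close> and the real part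
bounds \<open>N v\<close> by a multiple of \<open>N g\<close>. Since \<open>N g\<close> is bounded by \<kappa> times these norms and \<kappa> is small, \<open>g\<close> vanishes,
and so does \<open>u\<close>.
\<close>

lemma energy_uniqueness:
  assumes t: "transfers R m11 m12 m21 m22" and z: "z \<in> ball 0 R" "z \<in> {\<i>, - \<i>}"
    and l: "l\<^sup>2 - (m11 z + m22 z) * l + 1 = 0" "cmod l < 1"
    and s: "jsol z u v"
    and bc: "(m11 z - 1 / l) * u \<alpha> + m12 z * v \<alpha> = 0" "(m11 z - l) * u \<beta> + m12 z * v \<beta> = 0"
  shows "\<And>x. x \<in> {real_of_int \<alpha>..real_of_int \<beta>} \<Longrightarrow> u x = 0" "v \<alpha> = 0"
proof -
  define \<sigma> where "\<sigma> = Im z"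
  have zi: "Re z = 0" "\<sigma> = 1 \<or> \<sigma> = -1" "Im z \<noteq> 0" "cmod z = 1" using z(2) by (auto simp: \<sigma>_def)
  have \<sigma>2: "\<sigma> * \<sigma> = 1" using zi by auto
  define w where "w = (\<lambda>x. (of_real (q x) - z) * u x - \<L> u x)"
  have pu: "prim \<alpha> \<beta> u (\<lambda>x. v x / of_real (p x))" and pv: "prim \<alpha> \<beta> v w" and wL: "w \<in> L2 J"
    using s by (auto simp: jsol_def w_def)
  have uc: "continuous_on {real_of_int \<alpha>..real_of_int \<beta>} u" and vc: "continuous_on {real_of_int \<alpha>..real_of_int \<beta>} v"
    using pu pv prim_continuous by blast+
  define g where "g = \<L> u"
  have gb: "g \<in> L2 J" "N g \<le> \<kappa> * (N u + N v + N w)" using \<L>_bound[OF pu pv wL] by (auto simp: g_def)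
  note uL = square_integral_L2[OF uc] and vL = square_integral_L2[OF vc]
  define Xb where "Xb = v \<beta> * cnj (u \<beta>)"
  define Xa where "Xa = v \<alpha> * cnj (u \<alpha>)"
  \<comment> \<open>At \<open>\<beta>\<close> the data continue to a solution with multiplier \<open>l\<close>, decaying to the right.\<close>
  obtain Sb where Sb: "Sb \<ge> 0" "(1 - (cmod l)\<^sup>2) * Im Xb = Im z * Sb" "(1 - (cmod l)\<^sup>2) * Re Xb \<le> (qm + \<bar>Re z\<bar>) * Sb"
    unfolding Xb_def by (rule floquet_energy[OF t z(1) zi(3) l(1) bc(2)]) blast
  have l2: "(cmod l)\<^sup>2 < 1" using l(2) by (simp add: power_less_one_iff)
  have b1: "\<sigma> * Im Xb \<ge> 0"
  proof -
    have "(1 - (cmod l)\<^sup>2) * (\<sigma> * Im Xb) = \<sigma> * ((1 - (cmod l)\<^sup>2) * Im Xb)" by simp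
    also have "\<dots> = Sb" unfolding Sb(2) using \<sigma>2 by (simp add: \<sigma>_def[symmetric] mult.assoc[symmetric])
    finally show ?thesis using Sb(1) l2 by (metis diff_gt_0_iff_gt zero_le_mult_iff not_less)
  qed
  have b2: "Re Xb \<le> qm * (\<sigma> * Im Xb)"
  proof -
    have "(1 - (cmod l)\<^sup>2) * (\<sigma> * Im Xb) = \<sigma> * ((1 - (cmod l)\<^sup>2) * Im Xb)" by simp
    also have "\<dots> = Sb" unfolding Sb(2) using \<sigma>2 by (simp add: \<sigma>_def[symmetric] mult.assoc[symmetric])
    finally have "(1 - (cmod l)\<^sup>2) * Re Xb \<le> qm * ((1 - (cmod l)\<^sup>2) * (\<sigma> * Im Xb))" using Sb(3) zi(1) by simp
    then have "(1 - (cmod l)\<^sup>2) * Re Xb \<le> (1 - (cmod l)\<^sup>2) * (qm * (\<sigma> * Im Xb))" by (simp add: mult_ac)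
    then show ?thesis using l2 by (simp add: mult_le_cancel_left)
  qed
  \<comment> \<open>At \<open>\<alpha>\<close> they continue to one with multiplier \<open>k = 1 / l\<close>, decaying to the left.\<close>
  note rp = root_partner[OF l(1)]
  define k where "k = 1 / l"
  have "k\<^sup>2 - (m11 z + m22 z) * k + 1 = 0"
  proof -
    have "k\<^sup>2 - (m11 z + m22 z) * k + 1 = (1 - (m11 z + m22 z) * l + l\<^sup>2) / l\<^sup>2"
      using rp(1) by (simp add: k_def field_simps power2_eq_square)
    also have "1 - (m11 z + m22 z) * l + l\<^sup>2 = 0" using l(1) by (simp add: algebra_simps)
    finally show ?thesis by simp
  qed
  then obtain Sa where Sa: "Sa \<ge> 0" "(1 - (cmod k)\<^sup>2) * Im Xa = Im z * Sa" "(1 - (cmod k)\<^sup>2) * Re Xa \<le> (qm + \<bar>Re z\<bar>) * Sa"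
    unfolding Xa_def by (rule floquet_energy[OF t z(1) zi(3) _ bc(1)[folded k_def]]) blast
  have k2: "(cmod k)\<^sup>2 > 1"
    using l(2) rp(1) by (simp add: k_def norm_divide power_divide l2)
  have sa: "((cmod k)\<^sup>2 - 1) * (\<sigma> * Im Xa) = - Sa"
  proof -
    have "((cmod k)\<^sup>2 - 1) * (\<sigma> * Im Xa) = - (\<sigma> * ((1 - (cmod k)\<^sup>2) * Im Xa))" by (simp add: algebra_simps)
    also have "\<dots> = - Sa" unfolding Sa(2) using \<sigma>2 by (simp add: \<sigma>_def[symmetric] mult.assoc[symmetric])
    finally show ?thesis .
  qed
  have a1: "\<sigma> * Im Xa \<le> 0"
  proof (rule ccontr)
    assume "\<not> ?thesis"
    then have "\<sigma> * Im Xa > 0" "(cmod k)\<^sup>2 - 1 > 0" using k2 by auto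
    then have "((cmod k)\<^sup>2 - 1) * (\<sigma> * Im Xa) > 0" by (metis mult_pos_pos)
    then show False using sa Sa(1) by linarith
  qed
  have a2: "Re Xa \<ge> qm * (\<sigma> * Im Xa)"
  proof -
    have "((cmod k)\<^sup>2 - 1) * Re Xa \<ge> - (qm * Sa)" using Sa(3) zi(1) by (simp add: algebra_simps)
    also have "- (qm * Sa) = qm * (((cmod k)\<^sup>2 - 1) * (\<sigma> * Im Xa))" unfolding sa by simp
    finally have "((cmod k)\<^sup>2 - 1) * (qm * (\<sigma> * Im Xa)) \<le> ((cmod k)\<^sup>2 - 1) * Re Xa" by (simp add: mult_ac)
    then show ?thesis using k2 by (simp add: mult_le_cancel_left)
  qed
  \<comment> \<open>\<open>K\<close> is the kinetic energy; \<open>G\<close> is the contribution of the perturbation to Green's identity.\<close>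
  define A2 where "A2 = integral {real_of_int \<alpha>..real_of_int \<beta>} (\<lambda>x. (cmod (u x))\<^sup>2)"
  define G where "G = integral {real_of_int \<alpha>..real_of_int \<beta>} (\<lambda>x. g x * cnj (u x))"
  define K where "K = integral {real_of_int \<alpha>..real_of_int \<beta>} (\<lambda>x. (cmod (v x))\<^sup>2 / p x)"
  define qI where "qI = integral {real_of_int \<alpha>..real_of_int \<beta>} (\<lambda>x. q x * (cmod (u x))\<^sup>2)"
  have u2i: "(\<lambda>x. (cmod (u x))\<^sup>2) integrable_on {real_of_int \<alpha>..real_of_int \<beta>}" by (intro integrable_continuous_real continuous_intros uc)
  have gi: "((\<lambda>x. g x * cnj (u x)) has_integral G) {real_of_int \<alpha>..real_of_int \<beta>}"
    unfolding G_def by (rule integrable_integral[OF L2_pairing_bound(1)[OF gb(1) uc]])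
  have Gb: "cmod G \<le> N g * N u" unfolding G_def by (rule L2_pairing_bound(2)[OF gb(1) uc])
  have wi: "((\<lambda>x. w x * cnj (u x)) has_integral integral {real_of_int \<alpha>..real_of_int \<beta>} (\<lambda>x. w x * cnj (u x))) {real_of_int \<alpha>..real_of_int \<beta>}"
    by (rule integrable_integral[OF L2_pairing_bound(1)[OF wL uc]])
  have we: "w x * cnj (u x) + g x * cnj (u x) = of_real (q x * (cmod (u x))\<^sup>2) - \<i> * of_real (\<sigma> * (cmod (u x))\<^sup>2)" for x
  proof -
    have "w x * cnj (u x) + g x * cnj (u x) = (of_real (q x) - z) * (u x * cnj (u x))" by (simp add: w_def g_def algebra_simps)
    also have "u x * cnj (u x) = of_real ((cmod (u x))\<^sup>2)" by (simp only: complex_norm_square)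
    finally show ?thesis using zi(1) by (simp add: complex_eq_iff \<sigma>_def)
  qed
  have sum: "((\<lambda>x. of_real (q x * (cmod (u x))\<^sup>2) - \<i> * of_real (\<sigma> * (cmod (u x))\<^sup>2)) has_integral
     (integral {real_of_int \<alpha>..real_of_int \<beta>} (\<lambda>x. w x * cnj (u x)) + G)) {real_of_int \<alpha>..real_of_int \<beta>}"
    using has_integral_add[OF wi gi] unfolding we .
  define W where "W = integral {real_of_int \<alpha>..real_of_int \<beta>} (\<lambda>x. w x * cnj (u x)) + G"
  have Wi: "((\<lambda>x. - \<sigma> * (cmod (u x))\<^sup>2) has_integral Im W) {real_of_int \<alpha>..real_of_int \<beta>}"
    using has_integral_linear[OF sum bounded_linear_Im] unfolding o_def W_def by simp
  have "((\<lambda>x. - \<sigma> * (cmod (u x))\<^sup>2) has_integral (- \<sigma> * A2)) {real_of_int \<alpha>..real_of_int \<beta>}"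
    unfolding A2_def by (intro has_integral_mult_right integrable_integral u2i)
  with Wi have ImW: "Im W = - \<sigma> * A2" by (rule has_integral_unique)
  have Wr: "((\<lambda>x. q x * (cmod (u x))\<^sup>2) has_integral Re W) {real_of_int \<alpha>..real_of_int \<beta>}"
    using has_integral_linear[OF sum bounded_linear_Re] unfolding o_def W_def by simp
  have ReW: "Re W \<ge> - qm * A2"
  proof (rule has_integral_le[OF _ Wr])
    show "((\<lambda>x. - qm * (cmod (u x))\<^sup>2) has_integral (- qm * A2)) {real_of_int \<alpha>..real_of_int \<beta>}"
      unfolding A2_def by (intro has_integral_mult_right integrable_integral u2i)
    show "- qm * (cmod (u x))\<^sup>2 \<le> q x * (cmod (u x))\<^sup>2" for x using q_bound[of x] by (intro mult_right_mono) auto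
  qed
  have green: "Xb - Xa = W - G + of_real K"
    using green_identity[OF pu pv] \<alpha>\<beta>_real unfolding Xb_def Xa_def W_def K_def by simp
  have dI: "Im Xb - Im Xa = - \<sigma> * A2 - Im G"
    using arg_cong[OF green, of Im] ImW by simp
  have dR: "Re Xb - Re Xa = Re W - Re G + K"
    using arg_cong[OF green, of Re] by simp
  have A2N: "A2 = (N u)\<^sup>2" using uL(2) by (simp add: A2_def)
  have sI: "\<sigma> * Im Xb - \<sigma> * Im Xa = - A2 - \<sigma> * Im G"
  proof -
    have "\<sigma> * Im Xb - \<sigma> * Im Xa = \<sigma> * (Im Xb - Im Xa)" by (simp add: right_diff_distrib)
    also have "\<dots> = - (\<sigma> * \<sigma>) * A2 - \<sigma> * Im G" unfolding dI by (simp add: algebra_simps)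
    finally show ?thesis using \<sigma>2 by simp
  qed
  have sG: "\<bar>\<sigma> * Im G\<bar> \<le> cmod G" using zi(2) abs_Im_le_cmod[of G] by auto
  have A2G: "A2 \<le> cmod G" using sI b1 a1 sG by linarith
  have sI': "\<sigma> * Im Xb - \<sigma> * Im Xa \<le> cmod G" using sI sG zero_le_power2[of "N u"] A2N by linarith
  have Nu: "N u \<le> N g"
  proof (cases "N u = 0")
    case False
    then have pos: "N u > 0" using L2_norm_nonneg[of J u] by linarith
    have "N u * N u \<le> N g * N u" using A2G Gb A2N by (simp add: power2_eq_square)
    then show ?thesis using pos by simp
  qed simp
  have Gg: "cmod G \<le> (N g)\<^sup>2" using Gb mult_left_mono[OF Nu L2_norm_nonneg[of J g]] by (simp add: power2_eq_square)
  have Kb: "K \<le> (2 * qm + 1) * (N g)\<^sup>2"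
  proof -
    have "Re Xb - Re Xa \<le> qm * (\<sigma> * Im Xb - \<sigma> * Im Xa)" using a2 b2 by (simp add: right_diff_distrib)
    also have "\<dots> \<le> qm * cmod G" using sI' qm_nonneg by (rule mult_left_mono)
    finally have "K \<le> qm * cmod G + Re G + qm * A2" using dR ReW by linarith
    also have "\<dots> \<le> qm * cmod G + cmod G + qm * cmod G"
      using complex_Re_le_cmod[of G] mult_left_mono[OF A2G qm_nonneg] by linarith
    also have "\<dots> = (2 * qm + 1) * cmod G" by (simp add: algebra_simps)
    also have "\<dots> \<le> (2 * qm + 1) * (N g)\<^sup>2" using Gg qm_nonneg by (intro mult_left_mono) auto
    finally show ?thesis .
  qed
  have pm: "pm > 0" using p_le[of 0] p_pos[of 0] by linarith
  have "(N v)\<^sup>2 \<le> pm * K"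
  proof -
    have vi: "(\<lambda>x. (cmod (v x))\<^sup>2 / p x) integrable_on {real_of_int \<alpha>..real_of_int \<beta>}"
      using p_pos by (intro integrable_continuous_real continuous_intros vc p_cont) (auto simp: less_le)
    have "integral {real_of_int \<alpha>..real_of_int \<beta>} (\<lambda>x. (cmod (v x))\<^sup>2) \<le> integral {real_of_int \<alpha>..real_of_int \<beta>} (\<lambda>x. pm * ((cmod (v x))\<^sup>2 / p x))"
    proof (rule integral_le)
      show "(\<lambda>x. (cmod (v x))\<^sup>2) integrable_on {real_of_int \<alpha>..real_of_int \<beta>}" by (intro integrable_continuous_real continuous_intros vc)
      show "(\<lambda>x. pm * ((cmod (v x))\<^sup>2 / p x)) integrable_on {real_of_int \<alpha>..real_of_int \<beta>}" using vi by (rule integrable_on_mult_right)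
      show "(cmod (v x))\<^sup>2 \<le> pm * ((cmod (v x))\<^sup>2 / p x)" for x
        using p_le[of x] p_pos[of x] mult_right_mono[of "p x" pm "(cmod (v x))\<^sup>2"] by (simp add: field_simps)
    qed
    also have "\<dots> = pm * K" unfolding K_def by (rule integral_mult_right)
    finally show ?thesis unfolding vL(2) .
  qed
  also have "\<dots> \<le> pm * ((2 * qm + 1) * (N g)\<^sup>2)" using Kb pm by (intro mult_left_mono) auto
  also have "\<dots> = (sqrt (pm * (2 * qm + 1)) * N g)\<^sup>2" using pm qm_nonneg by (simp add: power_mult_distrib)
  finally have Nv: "N v \<le> sqrt (pm * (2 * qm + 1)) * N g"
    by (rule power2_le_imp_le) (use pm qm_nonneg in simp)
  have Nw: "N w \<le> (qm + 2) * N g"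
  proof -
    have "N w \<le> N (\<lambda>x. (of_real (q x) - z) * u x) + N g"
      using L2_norm_triangle_diff[OF q_mult_L2(1)[OF uL(1), of z] gb(1)] by (simp add: w_def g_def)
    also have "\<dots> \<le> (qm + 1) * N u + N g" using q_mult_L2(2)[OF uL(1), of z] zi(4) by simp
    also have "\<dots> \<le> (qm + 1) * N g + N g" using Nu qm_nonneg by (simp add: mult_left_mono)
    finally show ?thesis by (simp add: algebra_simps)
  qed
  have "N g \<le> \<kappa> * (N u + N v + N w)" by (rule gb(2))
  also have "\<dots> \<le> \<kappa> * (N g + sqrt (pm * (2 * qm + 1)) * N g + (qm + 2) * N g)"
    using Nu Nv Nw \<kappa>_nonneg by (intro mult_left_mono add_mono)
  also have "\<dots> = (\<kappa> * (3 + qm + sqrt (pm * (2 * qm + 1)))) * N g" by (simp add: algebra_simps)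
  finally have Ng: "N g = 0"
    using \<kappa>_energy L2_norm_nonneg[of J g] by (metis less_le mult_le_cancel_right1 not_le order_less_irrefl)
  then have "N u = 0" using Nu L2_norm_nonneg[of J u] by simp
  then have "integral {real_of_int \<alpha>..real_of_int \<beta>} (\<lambda>x. (cmod (u x))\<^sup>2) = 0" using uL(2) by simp
  then have "\<forall>x\<in>{real_of_int \<alpha>..real_of_int \<beta>}. (cmod (u x))\<^sup>2 = 0"
    using \<alpha>\<beta>_real by (subst (asm) integral_eq_0_iff) (auto intro!: continuous_intros uc)
  then show u0: "u x = 0" if "x \<in> {real_of_int \<alpha>..real_of_int \<beta>}" for x using that by simp
  have g0: "AE x in lebesgue_on J. g x = 0" using Ng L2_norm_eq_0_iff[OF gb(1)] by blast
  have "AE x in lebesgue_on J. x \<in> J" by (rule AE_I2) simp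
  then have "AE x in lebesgue_on J. 0 = w x" using g0
    by eventually_elim (simp add: w_def g_def[symmetric] u0)
  then have "prim \<alpha> \<beta> v (\<lambda>x. 0)" by (rule prim_AE[OF pv]) simp
  from zero_flux[OF pu this \<alpha>\<beta>_real] show "v \<alpha> = 0" using u0 \<alpha>\<beta>_real by simp
qed

end

section \<open>Decaying solutions and the characteristic determinant\<close>

lemma bounded_functional_sum:
  fixes m :: nat
  assumes l: "bounded_functional S l" and f: "\<And>i. i < m \<Longrightarrow> f i \<in> L2 S"
  shows "l (\<lambda>x. \<Sum>i<m. y i * f i x) = (\<Sum>i<m. y i * l (f i))"
proof -
  have add: "l (\<lambda>x. g x + c * h x) = l g + c * l h" if "g \<in> L2 S" "h \<in> L2 S" for g h c
    using l that unfolding bounded_functional_def by blast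
  have "k \<le> m \<Longrightarrow> l (\<lambda>x. \<Sum>i<k. y i * f i x) = (\<Sum>i<k. y i * l (f i))" for k
  proof (induction k)
    case 0
    have "l (\<lambda>x. 0 + 1 * 0) = l (\<lambda>x. 0) + 1 * l (\<lambda>x. 0)" by (rule add[OF L2_zero L2_zero])
    then show ?case by simp
  next
    case (Suc k)
    have "(\<lambda>x. \<Sum>i<k. y i * f i x) \<in> L2 S" using Suc.prems f by (intro L2_sum L2_cmult) auto
    then have "l (\<lambda>x. (\<Sum>i<k. y i * f i x) + y k * f k x) = l (\<lambda>x. \<Sum>i<k. y i * f i x) + y k * l (f k)"
      using Suc.prems f by (intro add) auto
    then show ?case using Suc by simp
  qed
  then show ?thesis by blast
qed

context periodic_coefficients begin

lemma transfers_backward_zero: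
  assumes t: "transfers R m11 m12 m21 m22" and z: "z \<in> ball 0 R"
    and s: "osol z (of_int n) (of_int n + 1) u v" and z1: "u (of_int n + 1) = 0" "v (of_int n + 1) = 0"
  shows "u (of_int n) = 0" "v (of_int n) = 0"
proof -
  note c = transfers_cell[OF t z s]
  have d: "m11 z * m22 z - m12 z * m21 z = 1" using t z unfolding transfers_def by blast
  have "(m11 z * m22 z - m12 z * m21 z) * u (of_int n) = m22 z * (m11 z * u (of_int n) + m12 z * v (of_int n)) - m12 z * (m21 z * u (of_int n) + m22 z * v (of_int n))"
    by (simp add: algebra_simps)
  then show "u (of_int n) = 0" unfolding d c[symmetric] z1 by simp
  have "(m11 z * m22 z - m12 z * m21 z) * v (of_int n) = m11 z * (m21 z * u (of_int n) + m22 z * v (of_int n)) - m21 z * (m11 z * u (of_int n) + m12 z * v (of_int n))"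
    by (simp add: algebra_simps)
  then show "v (of_int n) = 0" unfolding d c[symmetric] z1 by simp
qed

end

context perturbed begin

text \<open>
Eigenfunctions in classical form. Square integrability on the line enters only through the decay along
arithmetic progressions.
\<close>

definition esol :: "complex \<Rightarrow> (real \<Rightarrow> complex) \<Rightarrow> (real \<Rightarrow> complex) \<Rightarrow> bool" where
  "esol z u v \<longleftrightarrow> (\<forall>a b. prim a b u (\<lambda>x. v x / of_real (p x))) \<and>
     (\<forall>a b. prim a b v (\<lambda>x. (of_real (q x) - z) * u x - \<L> u x)) \<and>
     (\<lambda>x. (of_real (q x) - z) * u x - \<L> u x) \<in> L2 J \<and>
     (\<forall>x. (\<lambda>n. u (x + real n)) \<longlonglongrightarrow> 0 \<and> (\<lambda>n. u (x - real n)) \<longlonglongrightarrow> 0 \<and>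
          (\<lambda>n. v (x + real n)) \<longlonglongrightarrow> 0 \<and> (\<lambda>n. v (x - real n)) \<longlonglongrightarrow> 0)"

lemma esol_jsol: "esol z u v \<Longrightarrow> jsol z u v"
  unfolding esol_def jsol_def by blast

lemma esol_outside:
  fixes a b :: real
  assumes s: "esol z u v" and ab: "b \<le> \<alpha> \<or> \<beta> \<le> a"
  shows "osol z a b u v"
proof -
  have pv: "prim a b v (\<lambda>x. (of_real (q x) - z) * u x - \<L> u x)" using s by (simp add: esol_def)
  have out: "\<L> u x = 0" if "x \<in> {a..b}" for x by (rule \<L>_support) (use ab that in auto)
  have "prim a b v (\<lambda>x. (of_real (q x) - z) * u x)"
    by (rule prim_spike[OF pv negligible_empty]) (use out in auto)
  then show ?thesis using s by (simp add: osol_def esol_def)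
qed

lemma esol_lincomb:
  assumes "esol z u v" "esol z u' v'"
  shows "esol z (\<lambda>x. u x + c * u' x) (\<lambda>x. v x + c * v' x)"
proof -
  let ?w = "\<lambda>x. (of_real (q x) - z) * u x - \<L> u x" and ?w' = "\<lambda>x. (of_real (q x) - z) * u' x - \<L> u' x"
  let ?W = "\<lambda>x. (of_real (q x) - z) * (u x + c * u' x) - \<L> (\<lambda>x. u x + c * u' x) x"
  have p: "prim a b u (\<lambda>x. v x / of_real (p x))" "prim a b v ?w" "prim a b u' (\<lambda>x. v' x / of_real (p x))" "prim a b v' ?w'" for a b
    using assms unfolding esol_def by blast+
  have wL: "?w \<in> L2 J" "?w' \<in> L2 J" using assms unfolding esol_def by blast+
  have "AE x in lebesgue. \<L> (\<lambda>x. u x + c * u' x) x = \<L> u x + c * \<L> u' x"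
    by (rule \<L>_lincomb[OF p(1) p(2) wL(1) p(3) p(4) wL(2)])
  then have e: "AE x in lebesgue. ?W x = ?w x + c * ?w' x"
    by eventually_elim (simp add: algebra_simps)
  have e': "AE x in lebesgue_on S. ?W x = ?w x + c * ?w' x" if "S \<in> sets lebesgue" for S
    using e that by (subst AE_restrict_space_iff) (auto elim: eventually_mono)
  have "prim a b (\<lambda>x. v x + c * v' x) ?W" for a b
  proof (rule prim_AE)
    show "prim a b (\<lambda>x. v x + c * v' x) (\<lambda>x. ?w x + c * ?w' x)"
      by (rule prim_lincomb[OF p(2) p(4)])
    show "AE x in lebesgue_on {a<..<b}. ?W x = ?w x + c * ?w' x" by (rule e') simp
  qed simp
  moreover have "prim a b (\<lambda>x. u x + c * u' x) (\<lambda>x. (v x + c * v' x) / of_real (p x))" for a b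
  proof -
    have "prim a b (\<lambda>x. u x + c * u' x) (\<lambda>x. v x / of_real (p x) + c * (v' x / of_real (p x)))"
      by (rule prim_lincomb[OF p(1) p(3)])
    then show ?thesis by (simp add: add_divide_distrib)
  qed
  moreover have "?W \<in> L2 J"
    by (rule L2_AE_transfer(1)[OF J_measurable L2_lincomb[OF wL] e'[OF J_measurable]])
  moreover have lim: "(\<lambda>n. h (f n) + c * h' (f n)) \<longlonglongrightarrow> 0" if "(\<lambda>n. h (f n)) \<longlonglongrightarrow> 0" "(\<lambda>n. h' (f n)) \<longlonglongrightarrow> 0"
    for h h' :: "real \<Rightarrow> complex" and f :: "nat \<Rightarrow> real"
    using tendsto_add[OF that(1) tendsto_mult[OF tendsto_const[of c] that(2)]] by simp
  have "(\<lambda>n. u (x + real n) + c * u' (x + real n)) \<longlonglongrightarrow> 0" "(\<lambda>n. u (x - real n) + c * u' (x - real n)) \<longlonglongrightarrow> 0"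
    "(\<lambda>n. v (x + real n) + c * v' (x + real n)) \<longlonglongrightarrow> 0" "(\<lambda>n. v (x - real n) + c * v' (x - real n)) \<longlonglongrightarrow> 0" for x
    using assms unfolding esol_def by (intro lim; blast)+
  ultimately show ?thesis unfolding esol_def by (intro conjI allI)
qed

text \<open>
By \<open>eigen_row_step\<close> the left-hand side of the second condition is multiplied by \<open>1 / l\<close> with each period to the right of
\<beta>. Its modulus does not decrease, and it tends to zero, hence it is zero. Likewise to the left of \<alpha>, with the
root \<open>1 / l\<close>.
\<close>

lemma esol_boundary:
  assumes t: "transfers R m11 m12 m21 m22" and z: "z \<in> ball 0 R"
    and l: "l\<^sup>2 - (m11 z + m22 z) * l + 1 = 0" "cmod l \<le> 1" and s: "esol z u v"
  shows "(m11 z - 1 / l) * u \<alpha> + m12 z * v \<alpha> = 0" "(m11 z - l) * u \<beta> + m12 z * v \<beta> = 0"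
proof -
  note rp = root_partner[OF l(1)]
  have d: "m11 z * m22 z - m12 z * m21 z = 1" using t z unfolding transfers_def by blast
  have vanish: "w 0 = 0" if "\<And>n. w n = l * w (Suc n)" "w \<longlonglongrightarrow> 0" for w :: "nat \<Rightarrow> complex"
  proof -
    have le: "cmod (w 0) \<le> cmod (w n)" for n
    proof (induction n)
      case (Suc n)
      have "cmod (w n) = cmod l * cmod (w (Suc n))" using that(1)[of n] by (simp add: norm_mult)
      also have "\<dots> \<le> cmod (w (Suc n))" using l(2) by (simp add: mult_left_le_one_le)
      finally show ?case using Suc by simp
    qed simp
    have "(\<lambda>n. cmod (w n)) \<longlonglongrightarrow> 0" using that(2) by (simp add: tendsto_norm_zero)
    then have "cmod (w 0) \<le> 0" using le by (intro LIMSEQ_le_const) auto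
    then show ?thesis by simp
  qed
  have lim: "(\<lambda>n. A * u (f n) + B * v (f n)) \<longlonglongrightarrow> 0" if "(\<lambda>n. u (f n)) \<longlonglongrightarrow> 0" "(\<lambda>n. v (f n)) \<longlonglongrightarrow> 0" for A B and f :: "nat \<Rightarrow> real"
    using tendsto_add[OF tendsto_mult[OF tendsto_const[of A] that(1)] tendsto_mult[OF tendsto_const[of B] that(2)]] by simp
  let ?b = "\<lambda>n. (m11 z - l) * u (of_int \<beta> + real n) + m12 z * v (of_int \<beta> + real n)"
  have "?b 0 = 0"
  proof (rule vanish)
    fix n
    have e: "of_int \<beta> + real n = of_int (\<beta> + int n)" "of_int \<beta> + real (Suc n) = of_int (\<beta> + int n) + 1" by simp_all
    have "osol z (of_int (\<beta> + int n)) (of_int (\<beta> + int n) + 1) u v" by (rule esol_outside[OF s]) simp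
    note c = transfers_cell[OF t z this]
    have "?b (Suc n) = 1 / l * ?b n" unfolding e c by (rule eigen_row_step[OF d rp(2,3)])
    then show "?b n = l * ?b (Suc n)" using rp(1) by simp
  next
    show "?b \<longlonglongrightarrow> 0" using s by (intro lim) (simp_all add: esol_def)
  qed
  then show "(m11 z - l) * u \<beta> + m12 z * v \<beta> = 0" by simp
  let ?a = "\<lambda>n. (m11 z - 1 / l) * u (of_int \<alpha> - real n) + m12 z * v (of_int \<alpha> - real n)"
  have rp': "1 / l * l = 1" "1 / l + l = m11 z + m22 z" using rp by (simp_all add: add.commute)
  have "?a 0 = 0"
  proof (rule vanish)
    fix n
    have e: "of_int \<alpha> - real (Suc n) = of_int (\<alpha> - int (Suc n))" "of_int \<alpha> - real n = of_int (\<alpha> - int (Suc n)) + 1" by simp_all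
    have "osol z (of_int (\<alpha> - int (Suc n))) (of_int (\<alpha> - int (Suc n)) + 1) u v" by (rule esol_outside[OF s]) simp
    note c = transfers_cell[OF t z this]
    show "?a n = l * ?a (Suc n)" unfolding e c by (rule eigen_row_step[OF d rp'])
  next
    show "?a \<longlonglongrightarrow> 0" using s by (intro lim) (simp_all add: esol_def)
  qed
  then show "(m11 z - 1 / l) * u \<alpha> + m12 z * v \<alpha> = 0" by simp
qed

lemma esol_zero:
  assumes t: "transfers R m11 m12 m21 m22" and z: "z \<in> ball 0 R" and s: "esol z u v"
    and J0: "\<And>x. x \<in> {real_of_int \<alpha>..real_of_int \<beta>} \<Longrightarrow> u x = 0 \<and> v x = 0"
  shows "u x = 0"
proof -
  consider "x \<in> {real_of_int \<alpha>..real_of_int \<beta>}" | "x > \<beta>" | "x < \<alpha>" by fastforce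
  then show ?thesis
  proof cases
    case 2
    have "osol z \<beta> x u v" by (rule esol_outside[OF s]) simp
    then show ?thesis by (rule osol_unique_zero(1)) (use J0 \<alpha>\<beta>_real 2 in auto)
  next
    case 3
    have "u (of_int (\<alpha> - int k)) = 0 \<and> v (of_int (\<alpha> - int k)) = 0" for k
    proof (induction k)
      case 0 then show ?case using J0 \<alpha>\<beta>_real by simp
    next
      case (Suc k)
      have e: "of_int (\<alpha> - int k) = (of_int (\<alpha> - int (Suc k)) + 1 :: real)" by simp
      have "osol z (of_int (\<alpha> - int (Suc k))) (of_int (\<alpha> - int (Suc k)) + 1) u v" by (rule esol_outside[OF s]) simp
      from transfers_backward_zero[OF t z this] Suc show ?case unfolding e by blast
    qed
    moreover obtain k where k: "\<alpha> - x \<le> real k" using real_arch_simple by blast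
    moreover have "osol z (of_int (\<alpha> - int k)) \<alpha> u v" by (rule esol_outside[OF s]) simp
    ultimately show ?thesis using 3 by (intro osol_unique_zero(1)[of z "of_int (\<alpha> - int k)" \<alpha> u v x]) auto
  qed (use J0 in auto)
qed

text \<open>
The grid values and the data at \<alpha> determine a solution between \<alpha> and \<beta>.
\<close>

lemma jsol_zero:
  assumes n: "fine_grid R n" and z: "cmod z \<le> R" and s: "jsol z u v" and y0: "\<And>i. i < n + 2 \<Longrightarrow> jvec n u v i = 0"
    and x: "x \<in> {real_of_int \<alpha>..real_of_int \<beta>}"
  shows "u x = 0 \<and> v x = 0"
proof -
  have n0: "n > 0" using n by (simp add: fine_grid_def)
  define f where "f = (\<lambda>x. - ((of_real (q x) - z) * u x - \<L> u x))"
  note fs = jsol_imp_fsol[OF n0 s, folded f_def]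
  have "fsol n z (\<lambda>x. f x + (-1) * f x) (\<lambda>j. jvec n u v j + (-1) * jvec n u v j)"
    by (rule fsol_lincomb[OF n0 fs(1) fs(1)])
  then have "fsol n z (\<lambda>x. 0) (\<lambda>j. 0)" by simp
  then have e: "AE x in lebesgue_on J. f x = 0" by (rule fsol_unique[OF n z fs(1)]) (use y0 in auto)
  have fL: "f \<in> L2 J" using fs(1) by (simp add: fsol_def)
  have "U \<alpha> f x = U \<alpha> (\<lambda>x. 0) x" "V \<alpha> f x = V \<alpha> (\<lambda>x. 0) x"
    by (rule bounded_functional_cong[OF U_bounded_functional[OF x] fL L2_zero e],
        rule bounded_functional_cong[OF V_bounded_functional[OF x] fL L2_zero e])
  then have "U \<alpha> f x = 0" "V \<alpha> f x = 0" by (simp_all add: U_def V_def)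
  moreover have "v \<alpha> = 0" using y0[of "Suc n"] by (simp add: jvec_def)
  moreover have "edata n (jvec n u v) x = 0" using y0[of n] y0[of "Suc n"] by (simp add: edata_def)
  ultimately show ?thesis using fs(2)[OF x] by simp
qed

text \<open>
The function \<open>f i z\<close> solves the equation with the \<open>i\<close>-th unknown equal to 1 and the others equal to 0. The first \<open>n\<close> rows
express that the grid values are those of the solution, the last two are the boundary conditions at \<alpha> and \<beta>.
\<close>

definition eigen_matrix :: "nat \<Rightarrow> (complex \<Rightarrow> complex) \<Rightarrow> (complex \<Rightarrow> complex) \<Rightarrow> (nat \<Rightarrow> complex \<Rightarrow> real \<Rightarrow> complex) \<Rightarrow>
    complex \<Rightarrow> complex \<Rightarrow> nat \<Rightarrow> nat \<Rightarrow> complex" where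
  "eigen_matrix n m11 m12 f z l r i =
    (if r < n then U \<alpha> (f i z) (gridpt n r) + edata n (unit_vec i) (gridpt n r) - unit_vec i r
     else if r = n then (m11 z - 1 / l) * unit_vec i n + m12 z * unit_vec i (Suc n)
     else (m11 z - l) * (U \<alpha> (f i z) \<beta> + edata n (unit_vec i) \<beta>) + m12 z * (V \<alpha> (f i z) \<beta> + unit_vec i (Suc n)))"

lemma sum_unit_vec: "j < m \<Longrightarrow> (\<Sum>i<m. unit_vec i j * y i) = y j"
proof -
  assume j: "j < m"
  have "(\<Sum>i<m. unit_vec i j * y i) = (\<Sum>i<m. if j = i then y i else 0)" by (intro sum.cong) (auto simp: unit_vec_def)
  then show ?thesis using j by simp
qed

lemma eigen_matrix_rows:
  fixes y :: "nat \<Rightarrow> complex"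
  assumes n: "n > 0" and f: "\<forall>i<n+2. f i z \<in> L2 J"
  defines "F \<equiv> \<lambda>x. \<Sum>i<n+2. y i * f i z x"
  shows "r < n \<Longrightarrow> (\<Sum>i<n+2. eigen_matrix n m11 m12 f z l r i * y i) = U \<alpha> F (gridpt n r) + edata n y (gridpt n r) - y r"
    "(\<Sum>i<n+2. eigen_matrix n m11 m12 f z l n i * y i) = (m11 z - 1 / l) * y n + m12 z * y (Suc n)"
    "(\<Sum>i<n+2. eigen_matrix n m11 m12 f z l (Suc n) i * y i) =
       (m11 z - l) * (U \<alpha> F \<beta> + edata n y \<beta>) + m12 z * (V \<alpha> F \<beta> + y (Suc n))"
proof -
  have UF: "(\<Sum>i<n+2. U \<alpha> (f i z) x * y i) = U \<alpha> F x" and VF: "(\<Sum>i<n+2. V \<alpha> (f i z) x * y i) = V \<alpha> F x"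
    if "x \<in> {real_of_int \<alpha>..real_of_int \<beta>}" for x
    unfolding F_def
    using bounded_functional_sum[OF U_bounded_functional[OF that], where m = "n + 2" and y = y and f = "\<lambda>i. f i z"]
      bounded_functional_sum[OF V_bounded_functional[OF that], where m = "n + 2" and y = y and f = "\<lambda>i. f i z"] f
    by (simp_all add: mult.commute)
  have eF: "(\<Sum>i<n+2. edata n (unit_vec i) x * y i) = edata n y x" for x
  proof -
    have "(\<Sum>i<n+2. edata n (unit_vec i) x * y i) = (\<Sum>i<n+2. unit_vec i n * y i) + (\<Sum>i<n+2. unit_vec i (Suc n) * y i) * P \<alpha> x"
      unfolding edata_def by (simp only: distrib_right distrib_left sum.distrib sum_distrib_right sum_distrib_left mult_ac)
    also have "\<dots> = edata n y x" by (subst sum_unit_vec, simp, subst sum_unit_vec, simp, simp add: edata_def)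
    finally show ?thesis .
  qed
  have ends: "real_of_int \<beta> \<in> {real_of_int \<alpha>..real_of_int \<beta>}" using \<alpha>\<beta>_real by simp
  {
    assume r: "r < n"
    then have g: "gridpt n r \<in> {real_of_int \<alpha>..real_of_int \<beta>}" using gridpt_in[of r n] n by simp
    have "(\<Sum>i<n+2. eigen_matrix n m11 m12 f z l r i * y i) =
      (\<Sum>i<n+2. U \<alpha> (f i z) (gridpt n r) * y i) + (\<Sum>i<n+2. edata n (unit_vec i) (gridpt n r) * y i) - (\<Sum>i<n+2. unit_vec i r * y i)"
      using r by (simp only: eigen_matrix_def if_True distrib_right left_diff_distrib sum.distrib sum_subtractf)
    then show "(\<Sum>i<n+2. eigen_matrix n m11 m12 f z l r i * y i) = U \<alpha> F (gridpt n r) + edata n y (gridpt n r) - y r"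
      unfolding UF[OF g] eF using sum_unit_vec[of r "n + 2" y] r by simp
  }
  have "(\<Sum>i<n+2. eigen_matrix n m11 m12 f z l n i * y i) =
      (m11 z - 1 / l) * (\<Sum>i<n+2. unit_vec i n * y i) + m12 z * (\<Sum>i<n+2. unit_vec i (Suc n) * y i)"
    unfolding sum.distrib[symmetric] sum_distrib_left
    by (intro sum.cong) (simp_all add: eigen_matrix_def algebra_simps)
  then show "(\<Sum>i<n+2. eigen_matrix n m11 m12 f z l n i * y i) = (m11 z - 1 / l) * y n + m12 z * y (Suc n)"
    using sum_unit_vec[of n "n + 2" y] sum_unit_vec[of "Suc n" "n + 2" y] by simp
  have "(\<Sum>i<n+2. eigen_matrix n m11 m12 f z l (Suc n) i * y i) =
      (m11 z - l) * ((\<Sum>i<n+2. U \<alpha> (f i z) \<beta> * y i) + (\<Sum>i<n+2. edata n (unit_vec i) \<beta> * y i))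
      + m12 z * ((\<Sum>i<n+2. V \<alpha> (f i z) \<beta> * y i) + (\<Sum>i<n+2. unit_vec i (Suc n) * y i))"
    unfolding sum.distrib[symmetric] sum_distrib_left
    by (intro sum.cong) (simp_all add: eigen_matrix_def algebra_simps)
  then show "(\<Sum>i<n+2. eigen_matrix n m11 m12 f z l (Suc n) i * y i) =
       (m11 z - l) * (U \<alpha> F \<beta> + edata n y \<beta>) + m12 z * (V \<alpha> F \<beta> + y (Suc n))"
    unfolding UF[OF ends] VF[OF ends] eF using sum_unit_vec[of "Suc n" "n + 2" y] by simp
qed

lemma eigenvalue_kernel:
  assumes t: "transfers R m11 m12 m21 m22" and n: "fine_grid R n" and z: "z \<in> ball 0 R"
    and f: "\<And>i. i < n + 2 \<Longrightarrow> fsol n z (f i z) (unit_vec i)"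
    and l: "l\<^sup>2 - (m11 z + m22 z) * l + 1 = 0" "cmod l \<le> 1"
    and s: "esol z u v" and nz: "u x0 \<noteq> 0"
  shows "kernel_det (n + 2) (eigen_matrix n m11 m12 f z l) = 0"
proof -
  have n0: "n > 0" using n by (simp add: fine_grid_def)
  have zR: "cmod z \<le> R" using z by simp
  define y where "y = jvec n u v"
  define g where "g = (\<lambda>x. - ((of_real (q x) - z) * u x - \<L> u x))"
  note fs = jsol_imp_fsol[OF n0 esol_jsol[OF s], folded g_def y_def]
  define F where "F = (\<lambda>x. \<Sum>i<n+2. y i * f i z x)"
  have Fs: "fsol n z F (\<lambda>j. if j < n + 2 then y j else 0)"
    unfolding F_def by (rule fsol_combination[OF n0]) (rule f)
  have e: "AE x in lebesgue_on J. g x = F x" by (rule fsol_unique[OF n zR fs(1) Fs]) simp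
  have L: "g \<in> L2 J" "F \<in> L2 J" using fs(1) Fs by (auto simp: fsol_def)
  have UF: "U \<alpha> F x + edata n y x = u x" "V \<alpha> F x + y (Suc n) = v x" if "x \<in> {real_of_int \<alpha>..real_of_int \<beta>}" for x
    using fs(2)[OF that] bounded_functional_cong[OF U_bounded_functional[OF that] L e]
      bounded_functional_cong[OF V_bounded_functional[OF that] L e] by (auto simp: y_def jvec_def)
  have fL: "\<forall>i<n+2. f i z \<in> L2 J" using f by (auto simp: fsol_def)
  note rows = eigen_matrix_rows[where y = y and f = f and z = z, OF n0 fL, folded F_def]
  have "(\<Sum>i<n+2. eigen_matrix n m11 m12 f z l r i * y i) = 0" if r: "r < n + 2" for r
  proof -
    consider "r < n" | "r = n" | "r = Suc n" using r by linarith
    then show ?thesis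
    proof cases
      case 1
      then have "gridpt n r \<in> {real_of_int \<alpha>..real_of_int \<beta>}" using gridpt_in[of r n] n0 by simp
      from UF(1)[OF this] show ?thesis using rows(1)[OF 1] 1 by (simp add: y_def jvec_def)
    next
      case 2
      then show ?thesis using rows(2) esol_boundary(1)[OF t z l s] by (simp add: y_def jvec_def)
    next
      case 3
      then show ?thesis using rows(3) esol_boundary(2)[OF t z l s] UF[of \<beta>] \<alpha>\<beta>_real by simp
    qed
  qed
  moreover have "\<exists>i<n+2. y i \<noteq> 0"
  proof (rule ccontr)
    assume "\<not> ?thesis"
    then have "u x = 0 \<and> v x = 0" if "x \<in> {real_of_int \<alpha>..real_of_int \<beta>}" for x
      using jsol_zero[OF n zR esol_jsol[OF s] _ that] by (auto simp: y_def)
    then have "u x0 = 0" by (rule esol_zero[OF t z s])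
    then show False using nz by simp
  qed
  ultimately show ?thesis unfolding kernel_det_eq_0_iff by blast
qed

text \<open>
A kernel vector yields a solution that satisfies the boundary conditions; by the energy estimate the solution is
zero, and then so are all unknowns.
\<close>

lemma base_point_regular:
  assumes t: "transfers R m11 m12 m21 m22" and n: "fine_grid R n" and z: "z \<in> ball 0 R" "z \<in> {\<i>, - \<i>}"
    and f: "\<And>i. i < n + 2 \<Longrightarrow> fsol n z (f i z) (unit_vec i)"
    and l: "l\<^sup>2 - (m11 z + m22 z) * l + 1 = 0" "cmod l < 1"
  shows "kernel_det (n + 2) (eigen_matrix n m11 m12 f z l) \<noteq> 0"
proof
  assume "kernel_det (n + 2) (eigen_matrix n m11 m12 f z l) = 0"
  then obtain y i where y: "i < n + 2" "y i \<noteq> 0" "\<And>r. r < n + 2 \<Longrightarrow> (\<Sum>i<n+2. eigen_matrix n m11 m12 f z l r i * y i) = 0"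
    unfolding kernel_det_eq_0_iff by blast
  have n0: "n > 0" using n by (simp add: fine_grid_def)
  define F where "F = (\<lambda>x. \<Sum>i<n+2. y i * f i z x)"
  define y' where "y' = (\<lambda>j. if j < n + 2 then y j else 0)"
  have Fs: "fsol n z F y'"
    unfolding F_def y'_def by (rule fsol_combination[OF n0]) (rule f)
  have fL: "\<forall>i<n+2. f i z \<in> L2 J" using f by (auto simp: fsol_def)
  note rows = eigen_matrix_rows[where y = y and f = f and z = z, OF n0 fL, folded F_def]
  have ed: "edata n y = edata n y'" by (simp add: edata_def[abs_def] y'_def)
  have yy: "y n = y' n" "y (Suc n) = y' (Suc n)" by (simp_all add: y'_def)
  have grid: "U \<alpha> F (gridpt n j) + edata n y' (gridpt n j) = y' j" if "j < n" for j
    using rows(1)[OF that] y(3)[of j] that by (simp add: ed y'_def)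
  define u where "u = (\<lambda>x. U \<alpha> F x + edata n y' x)"
  define v where "v = (\<lambda>x. V \<alpha> F x + y' (Suc n))"
  have s: "jsol z u v" unfolding u_def v_def by (rule fsol_imp_jsol[OF n0 Fs grid])
  have ua: "u \<alpha> = y' n" "v \<alpha> = y' (Suc n)" by (simp_all add: u_def v_def edata_def)
  have "(m11 z - 1 / l) * u \<alpha> + m12 z * v \<alpha> = 0"
    using rows(2)[of m11 m12 l] y(3)[of n] unfolding ua yy by simp
  moreover have "(m11 z - l) * u \<beta> + m12 z * v \<beta> = 0"
    using rows(3)[of m11 m12 l] y(3)[of "Suc n"] unfolding u_def v_def ed yy by simp
  note bc = calculation this
  have z0: "\<And>x. x \<in> {real_of_int \<alpha>..real_of_int \<beta>} \<Longrightarrow> u x = 0"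
    by (rule energy_uniqueness(1)[OF t z l s bc])
  have z1: "v \<alpha> = 0"
    by (rule energy_uniqueness(2)[OF t z l s bc])
  have "y' j = 0" if j: "j < n + 2" for j
  proof -
    consider "j < n" | "j = n" | "j = Suc n" using j by linarith
    then show ?thesis
    proof cases
      case 1
      then have "gridpt n j \<in> {real_of_int \<alpha>..real_of_int \<beta>}" using gridpt_in[of j n] n0 by simp
      then show ?thesis using grid[OF 1] z0(1) by (simp add: u_def)
    next
      case 2 then show ?thesis using ua(1) z0(1)[of \<alpha>] \<alpha>\<beta>_real by simp
    next
      case 3 then show ?thesis using ua(2) z1 by simp
    qed
  qed
  from this[OF y(1)] y(1,2) show False by (simp add: y'_def)
qed

text \<open>The disc is chosen large enough to contain \<open>z0\<close> as well as \<i> and \<open>- \<i>\<close>.\<close>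

theorem eigenvalues_no_accumulation: "\<not> z0 islimpt {z. \<exists>u v x. esol z u v \<and> u x \<noteq> 0}"
proof -
  define R where "R = cmod z0 + 2"
  have R: "R > 1" "R > 0" "R \<ge> 0" using norm_ge_zero[of z0] unfolding R_def by linarith+
  obtain m11 m12 m21 m22 where t: "transfers R m11 m12 m21 m22" and mh: "m11 holomorphic_on ball 0 R"
    "m12 holomorphic_on ball 0 R" "m21 holomorphic_on ball 0 R" "m22 holomorphic_on ball 0 R"
    by (rule transfer_matrix[OF R(2)])
  obtain n where n: "fine_grid R n" by (rule fine_grid_exists[OF R(3)])
  have n0: "n > 0" using n by (simp add: fine_grid_def)
  have "\<exists>g. (\<forall>z\<in>ball 0 R. fsol n z (g z) (unit_vec i)) \<and> (\<forall>l. bounded_functional J l \<longrightarrow> (\<lambda>z. l (g z)) holomorphic_on ball 0 R)" for i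
  proof (rule fsol_exists[OF n, of "unit_vec i"])
    fix g assume g: "\<And>z. z \<in> ball 0 R \<Longrightarrow> fsol n z (g z) (unit_vec i)"
      "\<And>l. bounded_functional J l \<Longrightarrow> (\<lambda>z. l (g z)) holomorphic_on ball 0 R"
    show ?thesis
    proof (intro exI[of _ g] conjI ballI allI impI)
      fix z :: complex assume "z \<in> ball 0 R" then show "fsol n z (g z) (unit_vec i)" by (rule g(1))
    next
      fix l assume "bounded_functional J l" then show "(\<lambda>z. l (g z)) holomorphic_on ball 0 R" by (rule g(2))
    qed
  qed
  then have "\<forall>i. \<exists>g. (\<forall>z\<in>ball 0 R. fsol n z (g z) (unit_vec i)) \<and> (\<forall>l. bounded_functional J l \<longrightarrow> (\<lambda>z. l (g z)) holomorphic_on ball 0 R)"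
    by (rule allI)
  from choice[OF this] obtain f where f: "\<forall>i. (\<forall>z\<in>ball 0 R. fsol n z (f i z) (unit_vec i)) \<and> (\<forall>l. bounded_functional J l \<longrightarrow> (\<lambda>z. l (f i z)) holomorphic_on ball 0 R)"
    by (elim exE)
  have fs: "fsol n z (f i z) (unit_vec i)" if "z \<in> ball 0 R" for i z using f that by blast
  have fh: "(\<lambda>z. l (f i z)) holomorphic_on ball 0 R" if "bounded_functional J l" for i l
    using spec[OF conjunct2[OF spec[OF f]], of l i] that by (rule mp)
  define \<Phi> where "\<Phi> = (\<lambda>z l. kernel_det (n + 2) (eigen_matrix n m11 m12 f z l))"
  show ?thesis
  proof (rule no_accumulation[OF R(1), where D = "\<lambda>z. m11 z + m22 z" and \<Phi> = \<Phi>])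
    show "(\<lambda>z. m11 z + m22 z) holomorphic_on ball 0 R" by (intro holomorphic_on_add mh)
    show "cmod z0 < R" by (simp add: R_def)
    fix z l assume "Im z \<noteq> 0" "cmod z < R" "l\<^sup>2 - (m11 z + m22 z) * l + 1 = 0"
    then show "cmod l \<noteq> 1" by (intro nonreal_root_not_unimodular[OF t, of z]) auto
  next
    fix z l assume z: "z \<in> {\<i>, - \<i>}" and l: "l\<^sup>2 - (m11 z + m22 z) * l + 1 = 0" "cmod l < 1"
    have zR: "z \<in> ball 0 R" using z R(1) by auto
    show "\<Phi> z l \<noteq> 0" unfolding \<Phi>_def by (rule base_point_regular[where f = f, OF t n zR z fs[OF zR] l])
  next
    fix z l assume z: "z \<in> {z. \<exists>u v x. esol z u v \<and> u x \<noteq> 0}" "cmod z < R" and l: "l\<^sup>2 - (m11 z + m22 z) * l + 1 = 0" "cmod l \<le> 1"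
    have zR: "z \<in> ball 0 R" using z by auto
    obtain u v x where u: "esol z u v" "u x \<noteq> 0" using z by blast
    show "\<Phi> z l = 0" unfolding \<Phi>_def by (rule eigenvalue_kernel[where f = f, OF t n zR fs[OF zR] l u])
  next
    fix X :: "complex set" and w l :: "complex \<Rightarrow> complex"
    assume X: "open X" and w: "w holomorphic_on X" and l: "l holomorphic_on X" and wX: "w ` X \<subseteq> ball 0 R" and l0: "\<And>x. x \<in> X \<Longrightarrow> l x \<noteq> 0"
    have comp: "(\<lambda>x. h (w x)) holomorphic_on X" if "h holomorphic_on ball 0 R" for h
      using holomorphic_on_compose_gen[OF w that] wX by (auto simp: o_def)
    have right: "real_of_int \<beta> \<in> {real_of_int \<alpha>..real_of_int \<beta>}" using \<alpha>\<beta>_real by simp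
    show "(\<lambda>x. \<Phi> (w x) (l x)) holomorphic_on X"
      unfolding \<Phi>_def
    proof (rule holomorphic_kernel_det)
      fix r i assume ri: "r < n + 2" "i < n + 2"
      consider "r < n" | "r = n" | "r = Suc n" using ri by linarith
      then show "(\<lambda>x. eigen_matrix n m11 m12 f (w x) (l x) r i) holomorphic_on X"
      proof cases
        case 1
        then have "gridpt n r \<in> {real_of_int \<alpha>..real_of_int \<beta>}" using gridpt_in[of r n] n0 by simp
        note h = comp[OF fh[OF U_bounded_functional[OF this], of i]]
        show ?thesis using 1 unfolding eigen_matrix_def by (simp, intro holomorphic_on_add holomorphic_on_diff holomorphic_on_const h)
      next
        case 2
        show ?thesis using 2 l0 unfolding eigen_matrix_def
          by (simp, intro holomorphic_on_add holomorphic_on_mult holomorphic_on_diff holomorphic_on_const holomorphic_on_divide comp mh l) auto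
      next
        case 3
        note h = comp[OF fh[OF U_bounded_functional[OF right], of i]] comp[OF fh[OF V_bounded_functional[OF right], of i]]
        show ?thesis using 3 unfolding eigen_matrix_def
          by (simp, intro holomorphic_on_add holomorphic_on_mult holomorphic_on_diff holomorphic_on_const comp[OF mh(1)] comp[OF mh(2)] l h)
      qed
    qed
  qed
qed

text \<open>The map from eigenfunctions to their \<open>n + 2\<close> unknowns is linear and injective.\<close>

lemma eigenspace_finite_span:
  assumes X: "\<And>u. u \<in> X \<Longrightarrow> \<exists>v. esol z u v"
  shows "\<exists>B. finite B \<and> B \<subseteq> X \<and> (\<forall>u\<in>X. \<exists>c. \<forall>x. u x = (\<Sum>b\<in>B. c b * b x))"
proof -
  define R where "R = cmod z + 1"
  have R: "R > 0" "R \<ge> 0" "cmod z \<le> R" "z \<in> ball 0 R"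
    using norm_ge_zero[of z] unfolding R_def mem_ball_0 by linarith+
  obtain m11 m12 m21 m22 where t: "transfers R m11 m12 m21 m22"
    by (rule transfer_matrix[OF R(1)])
  obtain n where n: "fine_grid R n" by (rule fine_grid_exists[OF R(2)])
  obtain V' where V': "\<And>u. u \<in> X \<Longrightarrow> esol z u (V' u)" using X by metis
  define Y where "Y = (\<lambda>u. jvec n u (V' u)) ` X"
  obtain B0 where B0: "finite B0" "B0 \<subseteq> Y" "\<And>y. y \<in> Y \<Longrightarrow> \<exists>c. \<forall>j<n+2. y j = (\<Sum>b\<in>B0. c b * b j)"
    using finite_spanning_subset[of Y "n + 2"] by metis
  obtain B where B: "B \<subseteq> X" "inj_on (\<lambda>u. jvec n u (V' u)) B" "B0 = (\<lambda>u. jvec n u (V' u)) ` B"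
    using B0(2) unfolding Y_def subset_image_inj by blast
  have finB: "finite B" using B0(1) B(2) unfolding B(3) by (rule finite_imageD)
  have "\<exists>c. \<forall>x. u x = (\<Sum>b\<in>B. c b * b x)" if u: "u \<in> X" for u
  proof -
    obtain c where c: "\<And>j. j < n + 2 \<Longrightarrow> jvec n u (V' u) j = (\<Sum>b\<in>B0. c b * b j)"
      using B0(3)[of "jvec n u (V' u)"] u unfolding Y_def by blast
    define d where "d = (\<lambda>b. c (jvec n b (V' b)))"
    have c': "jvec n u (V' u) j = (\<Sum>b\<in>B. d b * jvec n b (V' b) j)" if "j < n + 2" for j
      using c[OF that] B(2) unfolding B(3) d_def by (simp add: sum.reindex)
    have "A \<subseteq> B \<Longrightarrow> esol z (\<lambda>x. u x - (\<Sum>b\<in>A. d b * b x)) (\<lambda>x. V' u x - (\<Sum>b\<in>A. d b * V' b x))" if "finite A" for A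
      using that
    proof (induction A)
      case empty then show ?case using V'[OF u] by simp
    next
      case (insert b A)
      then have "esol z (\<lambda>x. (u x - (\<Sum>b\<in>A. d b * b x)) + (- d b) * b x) (\<lambda>x. (V' u x - (\<Sum>b\<in>A. d b * V' b x)) + (- d b) * V' b x)"
        using B(1) by (intro esol_lincomb V') auto
      then show ?case using insert.hyps by (simp add: algebra_simps)
    qed
    from this[OF finB order_refl]
    have s: "esol z (\<lambda>x. u x - (\<Sum>b\<in>B. d b * b x)) (\<lambda>x. V' u x - (\<Sum>b\<in>B. d b * V' b x))" .
    have "jvec n (\<lambda>x. u x - (\<Sum>b\<in>B. d b * b x)) (\<lambda>x. V' u x - (\<Sum>b\<in>B. d b * V' b x)) j = 0" if "j < n + 2" for j
      using c'[OF that] that by (auto simp: jvec_def)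
    from jsol_zero[OF n R(3) esol_jsol[OF s] this] esol_zero[OF t R(4) s]
    have "u x - (\<Sum>b\<in>B. d b * b x) = 0" for x by blast
    then show ?thesis by (intro exI[of _ d]) simp
  qed
  then show ?thesis using B(1) finB by blast
qed

end

section \<open>Coefficients and the localized perturbation\<close>

text \<open>One-sided limits bound the function near every point; then use compactness.\<close>

lemma piecewise_continuous_bounded:
  assumes "piecewise_continuous f"
  shows "\<exists>B. \<forall>x\<in>{a..b}. \<bar>f x\<bar> \<le> B"
proof -
  have "\<exists>d>0. \<exists>M. \<forall>y. dist y x < d \<longrightarrow> \<bar>f y\<bar> \<le> M" for x
  proof -
    obtain l r where l: "(f \<longlongrightarrow> l) (at_left x)" and r: "(f \<longlongrightarrow> r) (at_right x)"
      using assms unfolding piecewise_continuous_def by blast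
    have "\<forall>\<^sub>F y in at_left x. \<bar>f y\<bar> < \<bar>l\<bar> + 1" "\<forall>\<^sub>F y in at_right x. \<bar>f y\<bar> < \<bar>r\<bar> + 1"
      by (rule order_tendstoD(2)[OF tendsto_rabs[OF l]], simp, rule order_tendstoD(2)[OF tendsto_rabs[OF r]], simp)
    then have "\<forall>\<^sub>F y in at_left x. \<bar>f y\<bar> \<le> \<bar>l\<bar> + \<bar>r\<bar> + 1" "\<forall>\<^sub>F y in at_right x. \<bar>f y\<bar> \<le> \<bar>l\<bar> + \<bar>r\<bar> + 1"
      by (auto elim!: eventually_mono)
    then have "\<forall>\<^sub>F y in at x. \<bar>f y\<bar> \<le> \<bar>l\<bar> + \<bar>r\<bar> + 1" by (simp add: eventually_at_split)
    then obtain d where d: "d > 0" "\<And>y. y \<noteq> x \<Longrightarrow> dist y x < d \<Longrightarrow> \<bar>f y\<bar> \<le> \<bar>l\<bar> + \<bar>r\<bar> + 1"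
      unfolding eventually_at by auto
    have "\<bar>f y\<bar> \<le> \<bar>l\<bar> + \<bar>r\<bar> + 1 + \<bar>f x\<bar>" if "dist y x < d" for y
      using d(2)[of y] that by (cases "y = x") auto
    then show ?thesis using d(1) by blast
  qed
  then obtain d M where dM: "\<And>x. d x > 0" "\<And>x y. dist y x < d x \<Longrightarrow> \<bar>f y\<bar> \<le> M x" by metis
  have "compact {a..b}" by simp
  moreover have "{a..b} \<subseteq> (\<Union>x\<in>{a..b}. ball x (d x))" using dM(1) by (auto intro!: bexI)
  ultimately obtain C where C: "C \<subseteq> {a..b}" "finite C" "{a..b} \<subseteq> (\<Union>x\<in>C. ball x (d x))"
    by (elim compactE_image[of _ "{a..b}" "\<lambda>x. ball x (d x)"]) auto
  have "\<bar>f y\<bar> \<le> (\<Sum>x\<in>C. \<bar>M x\<bar>)" if y: "y \<in> {a..b}" for y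
  proof -
    obtain x where x: "x \<in> C" "dist x y < d x" using C(3) y by auto
    then have "\<bar>f y\<bar> \<le> \<bar>M x\<bar>" using dM(2)[of y x] by (simp add: dist_commute)
    also have "\<dots> \<le> (\<Sum>x\<in>C. \<bar>M x\<bar>)" using x C(2) by (intro member_le_sum) auto
    finally show ?thesis .
  qed
  then show ?thesis by blast
qed

lemma piecewise_continuous_measurable:
  assumes "piecewise_continuous f" shows "f \<in> borel_measurable borel"
proof (rule borel_measurable_continuous_countable_exceptions)
  let ?X = "{x. \<not> isCont f x}"
  have X: "?X = (\<Union>n::nat. {x \<in> {- real n..real n}. \<not> isCont f x})"
  proof (intro equalityI subsetI)
    fix x assume "x \<in> ?X"
    moreover obtain n where "\<bar>x\<bar> \<le> real n" using real_arch_simple by blast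
    ultimately show "x \<in> (\<Union>n::nat. {x \<in> {- real n..real n}. \<not> isCont f x})" by (auto intro!: exI[of _ n])
  qed auto
  have "countable {x \<in> {- real n..real n}. \<not> isCont f x}" for n
    by (rule countable_finite) (use assms in \<open>simp only: piecewise_continuous_def\<close>)
  then show "countable ?X" by (subst X) (rule countable_UN, simp)
  show "continuous_on (- ?X) f" by (rule continuous_at_imp_continuous_on) auto
qed

lemma periodic_bounded:
  fixes f :: "real \<Rightarrow> real"
  assumes per: "\<And>x. f (x + 1) = f x" and B: "\<And>x. x \<in> {0..1} \<Longrightarrow> \<bar>f x\<bar> \<le> B"
  shows "\<bar>f x\<bar> \<le> B"
proof -
  have "f (frac x) = f x" using periodic_shift_int[of f "frac x" "\<lfloor>x\<rfloor>", OF per] by (simp add: frac_def)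
  moreover have "frac x \<in> {0..1}" by (simp add: frac_ge_0 frac_lt_1 less_imp_le)
  ultimately show ?thesis using B by metis
qed

lemma L2_subset:
  assumes f: "f \<in> L2 S" and QS: "Q \<subseteq> S" "Q \<in> sets lebesgue" "S \<in> sets lebesgue"
  shows "f \<in> L2 Q" "L2_norm Q f \<le> L2_norm S f"
proof -
  have m: "f \<in> borel_measurable (lebesgue_on Q)"
    by (rule measurable_restrict_mono[OF L2_measurable[OF f] QS(1)])
  have i: "integrable lebesgue (\<lambda>x. indicator S x *\<^sub>R (cmod (f x))\<^sup>2)"
    using f QS unfolding L2_def by (simp add: integrable_restrict_space)
  have j: "integrable lebesgue (\<lambda>x. indicator Q x *\<^sub>R (cmod (f x))\<^sup>2)"
  proof -
    have "set_integrable lebesgue Q (\<lambda>x. (cmod (f x))\<^sup>2)"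
      by (rule set_integrable_subset[of _ S]) (use i QS in \<open>auto simp: set_integrable_def\<close>)
    then show ?thesis by (simp add: set_integrable_def)
  qed
  show "f \<in> L2 Q" using m j QS unfolding L2_def by (simp add: integrable_restrict_space)
  have "(LINT x|lebesgue_on Q. (cmod (f x))\<^sup>2) = (LINT x|lebesgue. indicator Q x *\<^sub>R (cmod (f x))\<^sup>2)"
    using QS by (intro integral_restrict_space) auto
  also have "\<dots> \<le> (LINT x|lebesgue. indicator S x *\<^sub>R (cmod (f x))\<^sup>2)"
    using QS(1) by (intro integral_mono i j) (auto simp: indicator_def)
  also have "\<dots> = (LINT x|lebesgue_on S. (cmod (f x))\<^sup>2)"
    using QS by (intro integral_restrict_space[symmetric]) auto
  finally show "L2_norm Q f \<le> L2_norm S f" unfolding L2_norm_def by (rule real_sqrt_le_mono)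
qed

lemma L2_extend_zero:
  assumes f: "f \<in> L2 Q" and QS: "Q \<subseteq> S" "Q \<in> sets lebesgue" "S \<in> sets lebesgue"
  shows "(\<lambda>x. if x \<in> Q then f x else 0) \<in> L2 S" "L2_norm S (\<lambda>x. if x \<in> Q then f x else 0) = L2_norm Q f"
proof -
  let ?F = "\<lambda>x. if x \<in> Q then f x else 0"
  have m: "?F \<in> borel_measurable (lebesgue_on S)"
    using L2_measurable[OF f] QS by (simp add: borel_measurable_if_lebesgue_on)
  have e: "(\<lambda>x. indicator S x *\<^sub>R (cmod (?F x))\<^sup>2) = (\<lambda>x. indicator Q x *\<^sub>R (cmod (f x))\<^sup>2)"
    by (rule ext) (use QS(1) in \<open>auto simp: indicator_def\<close>)
  have "integrable lebesgue (\<lambda>x. indicator Q x *\<^sub>R (cmod (f x))\<^sup>2)"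
    using f QS unfolding L2_def by (simp add: integrable_restrict_space)
  then have "integrable (lebesgue_on S) (\<lambda>x. (cmod (?F x))\<^sup>2)"
    using QS e by (simp add: integrable_restrict_space)
  then show "?F \<in> L2 S" using m unfolding L2_def by simp
  have "(LINT x|lebesgue_on S. (cmod (?F x))\<^sup>2) = (LINT x|lebesgue. indicator S x *\<^sub>R (cmod (?F x))\<^sup>2)"
    using QS by (intro integral_restrict_space) auto
  also have "\<dots> = (LINT x|lebesgue_on Q. (cmod (f x))\<^sup>2)"
    unfolding e using QS by (intro integral_restrict_space[symmetric]) auto
  finally show "L2_norm S ?F = L2_norm Q f" unfolding L2_norm_def by simp
qed

lemma no_limit_points_imp_countable:
  fixes S :: "complex set"
  assumes "\<And>z. \<not> z islimpt S"
  shows "countable S"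
proof -
  have "finite (S \<inter> cball 0 (real n))" for n
  proof (rule ccontr)
    assume "infinite (S \<inter> cball 0 (real n))"
    moreover have "bounded (S \<inter> cball 0 (real n))" by (rule bounded_subset[OF bounded_cball]) auto
    ultimately obtain z where "z islimpt (S \<inter> cball 0 (real n))" using bounded_infinite_imp_islimpt by blast
    then have "z islimpt S" by (rule islimpt_subset) auto
    then show False using assms by blast
  qed
  moreover have "S = (\<Union>n. S \<inter> cball 0 (real n))" using real_arch_simple by fastforce
  ultimately show ?thesis by (metis countable_UN countableI_type countable_finite)
qed

text \<open>
The situation of the theorem for one value of \<epsilon>, with \<open>pd\<close> the derivative of \<open>p\<close> off its break points and with bounds for
the coefficients.
\<close>

locale schroedinger_setting =
  fixes p q pd :: "real \<Rightarrow> real" and p0 pm qm pdm a b \<epsilon> C :: real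
    and L :: "(real \<Rightarrow> complex) \<Rightarrow> real \<Rightarrow> complex"
  assumes p_periodic: "\<And>x. p (x + 1) = p x" and q_periodic: "\<And>x. q (x + 1) = q x"
    and p0: "p0 > 0" and p_lower: "\<And>x. p x \<ge> p0" and p_upper: "\<And>x. p x \<le> pm"
    and p_continuous: "continuous_on UNIV p"
    and pd_measurable: "pd \<in> borel_measurable borel"
    and pd_locally_bounded: "\<And>a b. \<exists>B. \<forall>x\<in>{a..b}. \<bar>pd x\<bar> \<le> B"
    and pd_deriv: "\<And>a b. finite {x \<in> {a..b}. \<not> (p has_real_derivative pd x) (at x)}"
    and pd_bound: "\<And>x. x \<in> {a..b} \<Longrightarrow> \<bar>pd x\<bar> \<le> pdm"
    and q_measurable: "q \<in> borel_measurable borel" and q_bounded: "\<And>x. \<bar>q x\<bar> \<le> qm"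
    and ab: "a < b" and \<epsilon>: "\<epsilon> > 0"
    and L_linear: "linear_W22_L2 {a<..<b} L"
    and L_bounded: "\<And>f. f \<in> W22 {a<..<b} \<Longrightarrow> L2_norm {a<..<b} (L f) \<le> C * W22_norm {a<..<b} f"
begin

abbreviation "Q \<equiv> {a<..<b}"

text \<open>
Bounds the norm of \<open>W22 Q\<close> in terms of the norms of \<open>u\<close>, of its flux and of the derivative of the flux, by
\<open>u' = v / p\<close> and \<open>u'' = v' / p - p' v / p\<^sup>2\<close>.
\<close>

definition "norm_ratio = 1 + 1 / p0 + pdm / p0\<^sup>2"

definition "\<kappa> = \<epsilon> * (\<bar>C\<bar> * norm_ratio)"

definition "\<alpha> = \<lfloor>a\<rfloor>"
definition "\<beta> = \<lceil>b\<rceil>"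

definition Loc :: "(real \<Rightarrow> complex) \<Rightarrow> real \<Rightarrow> complex" where
  "Loc u x = of_real \<epsilon> * localized Q L u x"

lemma Q_J: "real_of_int \<alpha> \<le> a" "b \<le> real_of_int \<beta>" "Q \<subseteq> {real_of_int \<alpha><..<real_of_int \<beta>}" "\<alpha> < \<beta>"
proof -
  show 1: "real_of_int \<alpha> \<le> a" and 2: "b \<le> real_of_int \<beta>" by (simp_all add: \<alpha>_def \<beta>_def)
  show "Q \<subseteq> {real_of_int \<alpha><..<real_of_int \<beta>}" using 1 2 by auto
  show "\<alpha> < \<beta>" using 1 2 ab by linarith
qed

lemma Q_interval: "open Q" "is_interval Q" "Q \<noteq> {}" "Q \<in> sets lebesgue"
  using ab by (auto simp: is_interval_1)

lemma pdm_nonneg: "pdm \<ge> 0" using pd_bound[of a] ab by auto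

lemma norm_ratio_pos: "norm_ratio > 0" unfolding norm_ratio_def using p0 pdm_nonneg by (simp add: add_pos_nonneg)

lemma p_pos': "p x > 0" using p0 p_lower[of x] by linarith

lemma pd_absolutely_integrable:
  fixes h :: "real \<Rightarrow> complex"
  assumes "continuous_on {s..t} h"
  shows "(\<lambda>x. of_real (pd x) * h x) absolutely_integrable_on {s..t}"
proof (rule absolutely_integrable_bounded_measurable_product[OF bilinear_times])
  show "(\<lambda>x. complex_of_real (pd x)) \<in> borel_measurable (lebesgue_on {s..t})"
    by (rule borel_measurable_complex_of_real_lebesgue_on[OF pd_measurable])
  show "bounded ((\<lambda>x. complex_of_real (pd x)) ` {s..t})"
    using pd_locally_bounded[of s t] unfolding bounded_iff by auto
qed (use assms in \<open>auto intro: absolutely_integrable_continuous_real\<close>)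

lemma prim_p: "prim s t (\<lambda>x. of_real (p x)) (\<lambda>x. of_real (pd x))"
proof (cases "s \<le> t")
  case True
  show ?thesis
  proof (rule prim_FTC[OF True pd_deriv[of s t]])
    show "continuous_on {s..t} (\<lambda>x. complex_of_real (p x))"
      by (intro continuous_intros continuous_on_subset[OF p_continuous]) auto
    show "(\<lambda>x. complex_of_real (pd x)) absolutely_integrable_on {s..t}"
      using pd_absolutely_integrable[of s t "\<lambda>x. 1"] by simp
    fix x assume "x \<in> {s<..<t} - {x \<in> {s..t}. \<not> (p has_real_derivative pd x) (at x)}"
    then have "(p has_real_derivative pd x) (at x)" by auto
    then show "((\<lambda>x. complex_of_real (p x)) has_vector_derivative complex_of_real (pd x)) (at x)"
      by (intro has_vector_derivative_of_real) (simp add: has_real_derivative_iff_has_vector_derivative)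
  qed
qed (simp add: prim_degenerate)

lemma prim_inverse_p: "prim s t (\<lambda>x. of_real (1 / p x)) (\<lambda>x. of_real (- pd x / (p x)\<^sup>2))"
proof (cases "s \<le> t")
  case True
  have nz: "p x \<noteq> 0" for x using p_pos'[of x] by simp
  have pc: "continuous_on {s..t} p" by (rule continuous_on_subset[OF p_continuous]) auto
  show ?thesis
  proof (rule prim_FTC[OF True pd_deriv[of s t]])
    show "continuous_on {s..t} (\<lambda>x. complex_of_real (1 / p x))"
      using nz by (intro continuous_intros pc) auto
    have "continuous_on {s..t} (\<lambda>x. complex_of_real (- 1 / (p x)\<^sup>2))" using nz by (intro continuous_intros pc) auto
    from pd_absolutely_integrable[OF this]
    show "(\<lambda>x. complex_of_real (- pd x / (p x)\<^sup>2)) absolutely_integrable_on {s..t}"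
      by (simp add: divide_inverse)
    fix x assume "x \<in> {s<..<t} - {x \<in> {s..t}. \<not> (p has_real_derivative pd x) (at x)}"
    then have "(p has_real_derivative pd x) (at x)" by auto
    then have "((\<lambda>x. 1 / p x) has_real_derivative (- pd x / (p x)\<^sup>2)) (at x)"
      using nz by (auto intro!: derivative_eq_intros simp: power2_eq_square)
    then show "((\<lambda>x. complex_of_real (1 / p x)) has_vector_derivative complex_of_real (- pd x / (p x)\<^sup>2)) (at x)"
      by (intro has_vector_derivative_of_real) (simp add: has_real_derivative_iff_has_vector_derivative)
  qed
qed (simp add: prim_degenerate)

lemma L2_scaled_real:
  assumes f: "f \<in> L2 S" and m: "m \<in> borel_measurable borel" and k: "\<And>x. x \<in> S \<Longrightarrow> \<bar>m x\<bar> \<le> k" and S: "S \<in> sets lebesgue" "k \<ge> 0"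
  shows "(\<lambda>x. of_real (m x) * f x) \<in> L2 S" "L2_norm S (\<lambda>x. of_real (m x) * f x) \<le> k * L2_norm S f"
proof -
  have mm: "(\<lambda>x. of_real (m x) * f x) \<in> borel_measurable (lebesgue_on S)"
    using borel_measurable_complex_of_real_lebesgue_on[OF m] L2_measurable[OF f] by measurable
  have g: "(\<lambda>x. of_real k * f x) \<in> L2 S" by (rule L2_cmult[OF f])
  have le: "AE x in lebesgue_on S. cmod (of_real (m x) * f x) \<le> cmod (of_real k * f x)"
    by (rule AE_I2) (use k S in \<open>auto simp: norm_mult intro!: mult_right_mono\<close>)
  have "integrable (lebesgue_on S) (\<lambda>x. (cmod (of_real k * f x))\<^sup>2)" using g by (simp add: L2_def)
  from L2_dominated[OF mm this] show 1: "(\<lambda>x. of_real (m x) * f x) \<in> L2 S"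
    using le by (auto elim!: eventually_mono intro!: power_mono)
  show "L2_norm S (\<lambda>x. of_real (m x) * f x) \<le> k * L2_norm S f"
    using L2_norm_mono_AE[OF le 1 g] S(2) by (simp add: L2_norm_cmult)
qed

lemma p_measurable: "p \<in> borel_measurable borel"
  using p_continuous by (rule borel_measurable_continuous_onI)

lemma flux_imp_prim:
  assumes u: "prim \<alpha> \<beta> u (\<lambda>x. v x / of_real (p x))" and v: "prim \<alpha> \<beta> v w" and w: "w \<in> L2 {\<alpha><..<\<beta>}"
  defines "g \<equiv> \<lambda>x. v x / of_real (p x)"
    and "h \<equiv> \<lambda>x. w x * of_real (1 / p x) + v x * of_real (- pd x / (p x)\<^sup>2)"
  shows "prim a b u g" "prim a b g h" "h \<in> L2 Q"
    "L2_norm Q u + L2_norm Q g + L2_norm Q h \<le> norm_ratio * (L2_norm {\<alpha><..<\<beta>} u + L2_norm {\<alpha><..<\<beta>} v + L2_norm {\<alpha><..<\<beta>} w)"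
proof -
  let ?J = "{real_of_int \<alpha><..<real_of_int \<beta>}"
  have Jm: "?J \<in> sets lebesgue" by simp
  show pu: "prim a b u g" unfolding g_def by (rule prim_subinterval[OF u Q_J(1,2)])
  have pv: "prim a b v w" by (rule prim_subinterval[OF v Q_J(1,2)])
  have "prim a b (\<lambda>x. v x * of_real (1 / p x)) h" unfolding h_def by (rule prim_mult[OF pv prim_inverse_p])
  moreover have g: "(\<lambda>x. v x * of_real (1 / p x)) = g" by (simp add: g_def)
  ultimately show "prim a b g h" by simp
  have bounded_L2: "F \<in> L2 ?J" if "continuous_on {real_of_int \<alpha>..real_of_int \<beta>} F" for F :: "real \<Rightarrow> complex"
  proof -
    have "bounded (F ` {real_of_int \<alpha>..real_of_int \<beta>})" using that compact_continuous_image compact_imp_bounded by blast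
    then obtain B where B: "\<forall>y\<in>F ` {real_of_int \<alpha>..real_of_int \<beta>}. cmod y \<le> B" unfolding bounded_iff by blast
    show ?thesis
      by (rule L2_bounded(1)[OF continuous_on_measurable_lebesgue_on[OF that], where B = B]) (use B Q_J(4) in auto)
  qed
  have uL: "u \<in> L2 ?J" and vL: "v \<in> L2 ?J" using prim_continuous[OF u] prim_continuous[OF v] by (auto intro: bounded_L2)
  note uQ = L2_subset[OF uL Q_J(3) Q_interval(4) Jm] and vQ = L2_subset[OF vL Q_J(3) Q_interval(4) Jm] and wQ = L2_subset[OF w Q_J(3) Q_interval(4) Jm]
  have ip: "(\<lambda>x. 1 / p x) \<in> borel_measurable borel" using p_measurable by measurable
  have ib: "\<bar>1 / p x\<bar> \<le> 1 / p0" for x using p_lower[of x] p0 p_pos'[of x] by (simp add: frac_le)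
  have dp: "(\<lambda>x. - pd x / (p x)\<^sup>2) \<in> borel_measurable borel" using p_measurable pd_measurable by measurable
  have db: "\<bar>- pd x / (p x)\<^sup>2\<bar> \<le> pdm / p0\<^sup>2" if "x \<in> Q" for x
  proof -
    have "\<bar>pd x\<bar> / (p x)\<^sup>2 \<le> pdm / p0\<^sup>2"
      using pd_bound[of x] that p_lower[of x] p0 by (intro frac_le power_mono) auto
    then show ?thesis by (simp add: abs_divide)
  qed
  note s1 = L2_scaled_real[OF wQ(1) ip ib Q_interval(4)] and s2 = L2_scaled_real[OF vQ(1) dp db Q_interval(4)] and s3 = L2_scaled_real[OF vQ(1) ip ib Q_interval(4)]
  have nn: "1 / p0 \<ge> 0" "pdm / p0\<^sup>2 \<ge> 0" using p0 pdm_nonneg by auto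
  have he: "h = (\<lambda>x. of_real (1 / p x) * w x + of_real (- pd x / (p x)\<^sup>2) * v x)" by (simp add: h_def mult.commute)
  show "h \<in> L2 Q" unfolding he by (rule L2_add[OF s1(1)[OF nn(1)] s2(1)[OF _ nn(2)]]) auto
  have hn: "L2_norm Q h \<le> 1 / p0 * L2_norm Q w + pdm / p0\<^sup>2 * L2_norm Q v"
    unfolding he
    by (rule order_trans[OF L2_norm_triangle[OF s1(1)[OF nn(1)] s2(1)[OF _ nn(2)]] add_mono[OF s1(2)[OF nn(1)] s2(2)[OF _ nn(2)]]]) auto
  have ge: "g = (\<lambda>x. of_real (1 / p x) * v x)" by (simp add: g_def)
  have gn: "L2_norm Q g \<le> 1 / p0 * L2_norm Q v" unfolding ge by (rule s3(2)[OF nn(1)])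
  define Nu Nv Nw where "Nu = L2_norm ?J u" and "Nv = L2_norm ?J v" and "Nw = L2_norm ?J w"
  have n0: "Nu \<ge> 0" "Nv \<ge> 0" "Nw \<ge> 0" by (simp_all add: Nu_def Nv_def Nw_def)
  have "L2_norm Q u + L2_norm Q g + L2_norm Q h \<le> Nu + 1 / p0 * Nv + (1 / p0 * Nw + pdm / p0\<^sup>2 * Nv)"
    using uQ(2) gn hn mult_left_mono[OF vQ(2) nn(1)] mult_left_mono[OF vQ(2) nn(2)] mult_left_mono[OF wQ(2) nn(1)]
    unfolding Nu_def Nv_def Nw_def by linarith
  also have "\<dots> \<le> norm_ratio * (Nu + Nv + Nw)"
  proof -
    have "0 \<le> Nu * (1 / p0 + pdm / p0\<^sup>2)" "0 \<le> Nv" "0 \<le> Nw * (1 + pdm / p0\<^sup>2)" using n0 nn by auto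
    moreover have "norm_ratio * (Nu + Nv + Nw) = Nu + 1 / p0 * Nv + (1 / p0 * Nw + pdm / p0\<^sup>2 * Nv) + Nu * (1 / p0 + pdm / p0\<^sup>2) + Nv + Nw * (1 + pdm / p0\<^sup>2)"
      by (simp add: norm_ratio_def algebra_simps add_divide_distrib)
    ultimately show ?thesis by linarith
  qed
  finally show "L2_norm Q u + L2_norm Q g + L2_norm Q h \<le> norm_ratio * (L2_norm ?J u + L2_norm ?J v + L2_norm ?J w)"
    by (simp add: Nu_def Nv_def Nw_def)
qed

lemma L_cong: "f \<in> W22 Q \<Longrightarrow> g \<in> W22 Q \<Longrightarrow> AE x in lebesgue_on Q. f x = g x \<Longrightarrow> AE x in lebesgue_on Q. L f x = L g x"
  and L_L2: "f \<in> W22 Q \<Longrightarrow> L f \<in> L2 Q"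
  and L_add: "f \<in> W22 Q \<Longrightarrow> g \<in> W22 Q \<Longrightarrow> AE x in lebesgue_on Q. L (\<lambda>y. f y + g y) x = L f x + L g x"
  and L_cmult: "f \<in> W22 Q \<Longrightarrow> AE x in lebesgue_on Q. L (\<lambda>y. c * f y) x = c * L f x"
  using L_linear unfolding linear_W22_L2_def by blast+

lemma Loc_alt: "Loc u = (\<lambda>x. of_real \<epsilon> * (if x \<in> Q then L (restrict u Q) x else 0))"
  by (rule ext) (simp add: Loc_def localized_def)

lemma AE_Q_extend:
  assumes "AE x in lebesgue_on Q. P x" "\<And>x. x \<notin> Q \<Longrightarrow> P x"
  shows "AE x in lebesgue. P x"
proof -
  have "AE x in lebesgue. x \<in> Q \<longrightarrow> P x" using assms(1) Q_interval(4) by (subst (asm) AE_restrict_space_iff) auto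
  then show ?thesis by (rule eventually_mono) (use assms(2) in blast)
qed

lemma Loc_inside: "x \<in> Q \<Longrightarrow> Loc u x = of_real \<epsilon> * L (restrict u Q) x"
  and Loc_outside: "x \<notin> Q \<Longrightarrow> Loc u x = 0"
  by (auto simp: Loc_def localized_def)

lemma Loc_bound:
  assumes u: "prim \<alpha> \<beta> u (\<lambda>x. v x / of_real (p x))" and v: "prim \<alpha> \<beta> v w" and w: "w \<in> L2 {\<alpha><..<\<beta>}"
  shows "Loc u \<in> L2 {\<alpha><..<\<beta>}"
    "L2_norm {\<alpha><..<\<beta>} (Loc u) \<le> \<kappa> * (L2_norm {\<alpha><..<\<beta>} u + L2_norm {\<alpha><..<\<beta>} v + L2_norm {\<alpha><..<\<beta>} w)"
proof -
  let ?J = "{real_of_int \<alpha><..<real_of_int \<beta>}"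
  note fp = flux_imp_prim[OF u v w]
  note W = prim_imp_W22[OF ab fp(1,2,3)]
  have Jm: "?J \<in> sets lebesgue" by simp
  note ext = L2_extend_zero[OF L_L2[OF W(1)] Q_J(3) Q_interval(4) Jm]
  show "Loc u \<in> L2 ?J" unfolding Loc_alt by (rule L2_cmult[OF ext(1)])
  have "L2_norm ?J (Loc u) = \<epsilon> * L2_norm Q (L (restrict u Q))"
    unfolding Loc_alt L2_norm_cmult ext(2) using \<epsilon> by simp
  also have "\<dots> \<le> \<epsilon> * (C * W22_norm Q (restrict u Q))" using \<epsilon> L_bounded[OF W(1)] by (intro mult_left_mono) auto
  also have "\<dots> \<le> \<epsilon> * (\<bar>C\<bar> * (norm_ratio * (L2_norm ?J u + L2_norm ?J v + L2_norm ?J w)))"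
  proof (intro mult_left_mono)
    have W0: "W22_norm Q (restrict u Q) \<ge> 0" by (simp add: W22_norm_def)
    have "C * W22_norm Q (restrict u Q) \<le> \<bar>C\<bar> * W22_norm Q (restrict u Q)" using W0 by (intro mult_right_mono) auto
    also have "\<dots> \<le> \<bar>C\<bar> * (norm_ratio * (L2_norm ?J u + L2_norm ?J v + L2_norm ?J w))"
      using W(2) fp(4) by (intro mult_left_mono) auto
    finally show "C * W22_norm Q (restrict u Q) \<le> \<bar>C\<bar> * (norm_ratio * (L2_norm ?J u + L2_norm ?J v + L2_norm ?J w))" .
  qed (use \<epsilon> in simp)
  finally show "L2_norm ?J (Loc u) \<le> \<kappa> * (L2_norm ?J u + L2_norm ?J v + L2_norm ?J w)" by (simp add: \<kappa>_def mult.assoc)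
qed

lemma Loc_lincomb:
  assumes u: "prim \<alpha> \<beta> u (\<lambda>x. v x / of_real (p x))" and v: "prim \<alpha> \<beta> v w" and w: "w \<in> L2 {\<alpha><..<\<beta>}"
    and u': "prim \<alpha> \<beta> u' (\<lambda>x. v' x / of_real (p x))" and v': "prim \<alpha> \<beta> v' w'" and w': "w' \<in> L2 {\<alpha><..<\<beta>}"
  shows "AE x in lebesgue. Loc (\<lambda>x. u x + c * u' x) x = Loc u x + c * Loc u' x"
proof -
  note f = flux_imp_prim[OF u v w] and f' = flux_imp_prim[OF u' v' w']
  note W = prim_imp_W22(1)[OF ab f(1,2,3)] and W' = prim_imp_W22(1)[OF ab f'(1,2,3)]
  let ?r = "restrict u Q" and ?r' = "restrict u' Q" and ?s = "restrict (\<lambda>x. u x + c * u' x) Q"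
  have cW: "(\<lambda>y. c * ?r' y) \<in> W22 Q"
  proof -
    have "restrict (\<lambda>x. c * u' x) Q \<in> W22 Q"
      by (rule prim_imp_W22(1)[OF ab prim_cmult[OF f'(1)] prim_cmult[OF f'(2)] L2_cmult[OF f'(3)]])
    then show ?thesis by (rule W22_AE_transfer[OF Q_interval(1-3)]) (rule AE_I2, auto)
  qed
  have sW: "?s \<in> W22 Q"
    by (rule prim_imp_W22(1)[OF ab prim_lincomb[OF f(1) f'(1)] prim_lincomb[OF f(2) f'(2)] L2_lincomb[OF f(3) f'(3)]])
  then have tW: "(\<lambda>y. ?r y + c * ?r' y) \<in> W22 Q" by (rule W22_AE_transfer[OF Q_interval(1-3)]) (rule AE_I2, auto)
  have 1: "AE x in lebesgue_on Q. L ?s x = L (\<lambda>y. ?r y + c * ?r' y) x" by (rule L_cong[OF sW tW]) (rule AE_I2, auto)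
  have 2: "AE x in lebesgue_on Q. L (\<lambda>y. ?r y + c * ?r' y) x = L ?r x + L (\<lambda>y. c * ?r' y) x" by (rule L_add[OF W cW])
  have 3: "AE x in lebesgue_on Q. L (\<lambda>y. c * ?r' y) x = c * L ?r' x" by (rule L_cmult[OF W'])
  have "AE x in lebesgue_on Q. Loc (\<lambda>x. u x + c * u' x) x = Loc u x + c * Loc u' x"
    using 1 2 3
  proof eventually_elim
    case (elim x) show ?case
    proof (cases "x \<in> Q")
      case True
      show ?thesis unfolding Loc_inside[OF True] elim by (simp add: algebra_simps)
    next
      case False
      show ?thesis unfolding Loc_outside[OF False] by simp
    qed
  qed
  then show ?thesis
  proof (rule AE_Q_extend)
    fix x assume n: "x \<notin> Q"
    show "Loc (\<lambda>x. u x + c * u' x) x = Loc u x + c * Loc u' x" unfolding Loc_outside[OF n] by simp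
  qed
qed

lemma perturbed:
  assumes "\<kappa> * ((real_of_int (\<beta> - \<alpha>))\<^sup>2 / p0 + real_of_int (\<beta> - \<alpha>) + 1) \<le> 1 / 4"
    and "\<kappa> * (3 + qm + sqrt (pm * (2 * qm + 1))) < 1"
  shows "perturbed p q p0 qm \<alpha> \<beta> Loc \<kappa> pm"
proof
  show "continuous_on X p" for X by (rule continuous_on_subset[OF p_continuous]) auto
  show "0 \<le> \<kappa>" unfolding \<kappa>_def using \<epsilon> norm_ratio_pos by simp
  show "Loc u x = 0" if "x \<notin> {real_of_int \<alpha><..<real_of_int \<beta>}" for u x
    using that Q_J(3) unfolding Loc_alt by auto
  show "Loc u = Loc u'" if "\<And>x. x \<in> {real_of_int \<alpha><..<real_of_int \<beta>} \<Longrightarrow> u x = u' x" for u u'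
  proof -
    have "restrict u Q = restrict u' Q" by (rule ext) (use that Q_J(3) in \<open>auto simp: restrict_def\<close>)
    then show ?thesis unfolding Loc_alt by (simp only:)
  qed
qed (use p_periodic q_periodic p0 p_lower q_measurable q_bounded Q_J(4) p_upper Loc_bound Loc_lincomb assms in auto)

end

section \<open>Eigenfunctions of the perturbed operator\<close>

lemma AE_lebesgue_on:
  assumes "AE x in lebesgue. P x" "S \<in> sets lebesgue" shows "AE x in lebesgue_on S. P x"
  using assms by (subst AE_restrict_space_iff) (auto elim: eventually_mono)

text \<open>The two smallness conditions that hold for all small \<epsilon>.\<close>

locale small_perturbation = schroedinger_setting +
  assumes small: "\<kappa> * ((real_of_int (\<beta> - \<alpha>))\<^sup>2 / p0 + real_of_int (\<beta> - \<alpha>) + 1) \<le> 1 / 4"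
    "\<kappa> * (3 + qm + sqrt (pm * (2 * qm + 1))) < 1"

sublocale small_perturbation \<subseteq> P: perturbed p q p0 qm \<alpha> \<beta> Loc \<kappa> pm
  by (rule perturbed[OF small])

context small_perturbation
begin

definition "H u = (\<lambda>x. H0 p q u x - of_real \<epsilon> * localized Q L u x)"

text \<open>
The weak derivative of \<open>p u'\<close> exists by the product rule, as \<open>p\<close> is an indefinite integral of its piecewise derivative, so
the eigenvalue equation holds almost everywhere for the continuous representatives. The passage from \<open>u\<close> to its
representative inside \<open>L\<close> uses that \<open>L\<close> respects equality almost everywhere.
\<close>

lemma eigenfunction_classical:
  assumes u: "u \<in> eigenspace (W22 UNIV) H z"
  shows "\<exists>U v. P.esol z U v \<and> (AE x in lebesgue. u x = U x)"
proof -
  have uW: "u \<in> W22 UNIV" and eq: "AE x in lebesgue. H u x = z * u x"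
    using u by (auto simp: eigenspace_def)
  obtain U g h where U: "\<And>s t. prim s t U g" and g: "\<And>s t. prim s t g h" and uU: "AE x in lebesgue. u x = U x"
    and ug: "has_weak_deriv UNIV u g" and UL: "U \<in> L2 UNIV" and gL: "g \<in> L2 UNIV" and hL: "h \<in> L2 UNIV"
    by (rule W22_UNIV_imp_prim[OF uW]) blast
  define v where "v = (\<lambda>x. of_real (p x) * g x)"
  define w where "w = (\<lambda>x. of_real (pd x) * g x + of_real (p x) * h x)"
  have v: "prim s t v w" for s t unfolding v_def w_def by (rule prim_mult[OF prim_p g])
  note Un = open_UNIV is_interval_univ UNIV_not_empty
  have 1: "AE x in lebesgue_on UNIV. weak_deriv UNIV u x = g x" by (rule weak_deriv_AE(2)[OF open_UNIV ug])
  have "has_weak_deriv UNIV v w" by (rule prim_imp_weak_deriv[OF Un v])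
  moreover have "AE x in lebesgue_on UNIV. v x = of_real (p x) * weak_deriv UNIV u x"
    using 1 by eventually_elim (simp add: v_def)
  ultimately have "has_weak_deriv UNIV (\<lambda>y. of_real (p y) * weak_deriv UNIV u y) w"
    by (rule has_weak_deriv_cong[OF Un]) simp
  from weak_deriv_AE(2)[OF open_UNIV this]
  have 2: "AE x in lebesgue. weak_deriv UNIV (\<lambda>y. of_real (p y) * weak_deriv UNIV u y) x = w x"
    unfolding lebesgue_on_UNIV_eq .
  have uUQ: "AE x in lebesgue_on Q. u x = U x" by (rule AE_lebesgue_on[OF uU Q_interval(4)])
  have UW: "restrict U Q \<in> W22 Q"
    by (rule prim_imp_W22(1)[OF ab U g L2_subset(1)[OF hL]]) auto
  have uUr: "AE x in lebesgue_on Q. restrict u Q x = restrict U Q x"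
    using uUQ by eventually_elim (simp add: restrict_def)
  have "AE x in lebesgue_on Q. L (restrict u Q) x = L (restrict U Q) x"
    by (rule L_cong[OF W22_AE_transfer[OF Q_interval(1-3) UW uUr] UW uUr])
  then have "AE x in lebesgue_on Q. Loc u x = Loc U x"
  proof eventually_elim
    case (elim x)
    show ?case
    proof (cases "x \<in> Q")
      case True show ?thesis unfolding Loc_inside[OF True] elim by simp
    next
      case False show ?thesis unfolding Loc_outside[OF False] by simp
    qed
  qed
  then have 3: "AE x in lebesgue. Loc u x = Loc U x"
  proof (rule AE_Q_extend)
    fix x assume n: "x \<notin> Q"
    show "Loc u x = Loc U x" unfolding Loc_outside[OF n] by simp
  qed
  define w' where "w' = (\<lambda>x. (of_real (q x) - z) * U x - Loc U x)"
  have w': "AE x in lebesgue. w' x = w x"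
    using eq 2 3 uU
  proof eventually_elim
    case (elim x)
    have "- w x + of_real (q x) * U x - Loc U x = z * U x"
      using elim(1) unfolding H_def H0_def elim(2) elim(4) Loc_def[symmetric] elim(3) by simp
    then show ?case unfolding w'_def by (simp add: algebra_simps)
  qed
  have pU: "prim s t U (\<lambda>x. v x / of_real (p x))" for s t
  proof -
    have "(\<lambda>x. v x / of_real (p x)) = g" using p_pos' by (auto simp: v_def fun_eq_iff less_imp_neq[symmetric])
    then show ?thesis using U by simp
  qed
  have pv: "prim s t v w'" for s t
    by (rule prim_AE[OF v AE_lebesgue_on[OF w']]) auto
  obtain B where B: "\<And>x. x \<in> {real_of_int \<alpha>..real_of_int \<beta>} \<Longrightarrow> \<bar>pd x\<bar> \<le> B" using pd_locally_bounded by blast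
  have B0: "B \<ge> 0" using B[of "real_of_int \<alpha>"] Q_J(4) by simp
  have Jm: "{real_of_int \<alpha><..<real_of_int \<beta>} \<in> sets lebesgue" by simp
  have pm0: "pm \<ge> 0" using p_lower[of 0] p_upper[of 0] p0 by linarith
  have "(\<lambda>x. of_real (pd x) * g x) \<in> L2 {real_of_int \<alpha><..<real_of_int \<beta>}"
    by (rule L2_scaled_real(1)[OF L2_subset(1)[OF gL subset_UNIV Jm] pd_measurable _ Jm B0]) (auto intro: B)
  moreover have "(\<lambda>x. of_real (p x) * h x) \<in> L2 {real_of_int \<alpha><..<real_of_int \<beta>}"
    by (rule L2_scaled_real(1)[OF L2_subset(1)[OF hL subset_UNIV Jm] p_measurable _ Jm pm0]) 
      (use p_upper p_pos' in \<open>auto simp: abs_of_pos\<close>)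
  ultimately have "w \<in> L2 {real_of_int \<alpha><..<real_of_int \<beta>}" unfolding w_def by (rule L2_add)
  from L2_AE_transfer(1)[OF Jm this AE_lebesgue_on[OF w' Jm]]
  have wL: "w' \<in> L2 {real_of_int \<alpha><..<real_of_int \<beta>}" .
  have vn: "v (x + real n) = of_real (p x) * g (x + real n)" "v (x - real n) = of_real (p x) * g (x - real n)" for x n
    using periodic_shift_int[where f = p and x = x and n = "int n", OF p_periodic]
      periodic_shift_int[where f = p and x = x and n = "- int n", OF p_periodic] by (simp_all add: v_def)
  have dec: "(\<lambda>n. U (x + real n)) \<longlonglongrightarrow> 0" "(\<lambda>n. U (x - real n)) \<longlonglongrightarrow> 0"
    "(\<lambda>n. v (x + real n)) \<longlonglongrightarrow> 0" "(\<lambda>n. v (x - real n)) \<longlonglongrightarrow> 0" for x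
    unfolding vn
    by (rule L2_decay[OF U UL gL] tendsto_mult_right_zero L2_decay[OF g gL hL])+
  have "P.esol z U v"
    unfolding P.esol_def w'_def[symmetric] by (intro conjI allI pU pv wL dec)
  then show ?thesis using uU by blast
qed

lemma point_spectrum_classical: "point_spectrum (W22 UNIV) H \<subseteq> {z. \<exists>u v x. P.esol z u v \<and> u x \<noteq> 0}"
proof
  fix z assume "z \<in> point_spectrum (W22 UNIV) H"
  then obtain u where u: "u \<in> eigenspace (W22 UNIV) H z" "\<not> (AE x in lebesgue. u x = 0)"
    by (auto simp: point_spectrum_def)
  obtain U v where U: "P.esol z U v" "AE x in lebesgue. u x = U x" using eigenfunction_classical[OF u(1)] by blast
  have "\<exists>x. U x \<noteq> 0"
  proof (rule ccontr)
    assume "\<not> ?thesis"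
    then have "AE x in lebesgue. u x = 0" using U(2) by simp
    with u(2) show False by contradiction
  qed
  then show "z \<in> {z. \<exists>u v x. P.esol z u v \<and> u x \<noteq> 0}" using U(1) by blast
qed

lemma point_spectrum_no_accumulation: "\<not> z islimpt point_spectrum (W22 UNIV) H"
  using P.eigenvalues_no_accumulation[of z] islimpt_subset[OF _ point_spectrum_classical] by blast

text \<open>
Finitely many exceptional null sets, one for each spanning function, add up to a null set.
\<close>

lemma eigenspace_finite_dimensional: "finite_dimensional (eigenspace (W22 UNIV) H z)"
proof -
  let ?E = "eigenspace (W22 UNIV) H z"
  obtain \<phi> where \<phi>: "\<And>u. u \<in> ?E \<Longrightarrow> \<exists>v. P.esol z (\<phi> u) v" "\<And>u. u \<in> ?E \<Longrightarrow> AE x in lebesgue. u x = \<phi> u x"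
  proof -
    have "\<forall>u\<in>?E. \<exists>U. (\<exists>v. P.esol z U v) \<and> (AE x in lebesgue. u x = U x)" using eigenfunction_classical by blast
    from bchoice[OF this] obtain \<phi> where "\<forall>u\<in>?E. (\<exists>v. P.esol z (\<phi> u) v) \<and> (AE x in lebesgue. u x = \<phi> u x)" ..
    then show thesis by (intro that[of \<phi>]) simp_all
  qed
  have "\<exists>v. P.esol z U v" if "U \<in> \<phi> ` ?E" for U using that \<phi>(1) by blast
  from P.eigenspace_finite_span[where X = "\<phi> ` ?E", OF this]
  obtain B where "finite B \<and> B \<subseteq> \<phi> ` ?E \<and> (\<forall>U\<in>\<phi> ` ?E. \<exists>c. \<forall>x. U x = (\<Sum>b\<in>B. c b * b x))" ..
  then have B: "finite B" "B \<subseteq> \<phi> ` ?E" "\<forall>U\<in>\<phi> ` ?E. \<exists>c. \<forall>x. U x = (\<Sum>b\<in>B. c b * b x)" by simp_all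
  obtain B' where B': "B' \<subseteq> ?E" "inj_on \<phi> B'" "B = \<phi> ` B'" using B(2) unfolding subset_image_inj by blast
  have fB: "finite B'" using B(1) B'(2,3) finite_imageD by blast
  have "\<exists>c. AE x in lebesgue. u x = (\<Sum>b\<in>B'. c b * b x)" if u: "u \<in> ?E" for u
  proof -
    obtain c where c: "\<And>x. \<phi> u x = (\<Sum>b\<in>B. c b * b x)" using bspec[OF B(3) imageI[OF u]] by (elim exE) simp
    have "AE x in lebesgue. \<forall>b\<in>B'. b x = \<phi> b x"
      using fB B'(1) \<phi>(2) by (intro AE_finite_allI) blast+
    then have "AE x in lebesgue. u x = (\<Sum>b\<in>B'. c (\<phi> b) * b x)"
      using \<phi>(2)[OF u]
    proof eventually_elim
      case (elim x)
      have "u x = (\<Sum>b\<in>B'. c (\<phi> b) * \<phi> b x)" unfolding elim(2) c B'(3) sum.reindex[OF B'(2)] by (simp add: o_def)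
      also have "\<dots> = (\<Sum>b\<in>B'. c (\<phi> b) * b x)" by (rule sum.cong) (use elim(1) in auto)
      finally show ?case .
    qed
    then show ?thesis by (rule exI[of _ "\<lambda>b. c (\<phi> b)"])
  qed
  then show ?thesis unfolding finite_dimensional_def using fB B'(1) by blast
qed

end

theorem theorem2p3:
  fixes p q :: "real \<Rightarrow> real" and p0 a b C :: real and Q :: "real set"
    and L :: "real \<Rightarrow> (real \<Rightarrow> complex) \<Rightarrow> (real \<Rightarrow> complex)"
  assumes p_periodic: "\<And>x. p (x + 1) = p x"
    and q_periodic: "\<And>x. q (x + 1) = q x"
    and p_regular: "piecewise_C1 p"
    and q_regular: "piecewise_continuous q"
    and p0_pos: "p0 > 0"
    and p_ge: "\<And>x. p x \<ge> p0"
    and p_normalized: "p 0 = 1"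
    and Q_interval: "a < b" "Q = {a<..<b}"
    and L_linear: "\<forall>\<^sub>F \<epsilon> in at_right 0. linear_W22_L2 Q (L \<epsilon>)"
    and L_bounded: "\<forall>\<^sub>F \<epsilon> in at_right 0. \<forall>f \<in> W22 Q. L2_norm Q (L \<epsilon> f) \<le> C * W22_norm Q f"
  shows "\<forall>\<^sub>F \<epsilon> in at_right 0.
           countable (point_spectrum (W22 UNIV) (H_pert p q Q L \<epsilon>)) \<and>
           (\<forall>z \<in> point_spectrum (W22 UNIV) (H_pert p q Q L \<epsilon>).
              finite_dimensional (eigenspace (W22 UNIV) (H_pert p q Q L \<epsilon>) z)) \<and>
           (\<forall>z. \<not> z islimpt point_spectrum (W22 UNIV) (H_pert p q Q L \<epsilon>))"
proof -
  obtain pd where pc: "continuous_on UNIV p" and pd: "piecewise_continuous pd"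
    and pd': "\<And>s t. finite {x \<in> {s..t}. \<not> (p has_real_derivative pd x) (at x)}"
    using p_regular unfolding piecewise_C1_def by blast
  have bnd: "\<exists>B. \<forall>x. \<bar>f x\<bar> \<le> B" if f: "\<And>x. f (x + 1) = f x" "\<exists>B. \<forall>x\<in>{0..1}. \<bar>f x\<bar> \<le> B" for f :: "real \<Rightarrow> real"
  proof -
    obtain B where "\<And>x. x \<in> {0..1} \<Longrightarrow> \<bar>f x\<bar> \<le> B" using f(2) by blast
    then have "\<bar>f x\<bar> \<le> B" for x by (rule periodic_bounded[where f = f, OF f(1)])
    then show ?thesis by blast
  qed
  have "bounded (p ` {0..1})" using compact_continuous_image[OF continuous_on_subset[OF pc subset_UNIV]] compact_imp_bounded compact_Icc by blast
  then have "\<exists>B. \<forall>x\<in>{0..1}. \<bar>p x\<bar> \<le> B" unfolding bounded_iff by auto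
  then obtain pm where pm: "\<And>x. \<bar>p x\<bar> \<le> pm" using bnd[where f = p, OF p_periodic] by blast
  obtain qm where qm: "\<And>x. \<bar>q x\<bar> \<le> qm"
    using bnd[where f = q, OF q_periodic piecewise_continuous_bounded[OF q_regular]] by blast
  obtain pdm where pdm: "\<And>x. x \<in> {a..b} \<Longrightarrow> \<bar>pd x\<bar> \<le> pdm"
    using piecewise_continuous_bounded[OF pd] by blast
  define K where "K = \<bar>C\<bar> * (1 + 1 / p0 + pdm / p0\<^sup>2)"
  define l where "l = real_of_int (\<lceil>b\<rceil> - \<lfloor>a\<rfloor>)"
  have t: "((\<lambda>\<epsilon>. \<epsilon> * K * (l\<^sup>2 / p0 + l + 1)) \<longlongrightarrow> 0) (at_right 0)" "((\<lambda>\<epsilon>. \<epsilon> * K * (3 + qm + sqrt (pm * (2 * qm + 1)))) \<longlongrightarrow> 0) (at_right 0)"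
    by (auto intro!: tendsto_eq_intros)
  have "\<forall>\<^sub>F \<epsilon> in at_right 0. \<epsilon> * K * (l\<^sup>2 / p0 + l + 1) < 1 / 4"
    "\<forall>\<^sub>F \<epsilon> in at_right 0. \<epsilon> * K * (3 + qm + sqrt (pm * (2 * qm + 1))) < 1"
    by (rule order_tendstoD(2)[OF t(1)], simp, rule order_tendstoD(2)[OF t(2)], simp)
  then show ?thesis using L_linear L_bounded eventually_at_right_less[of 0]
  proof eventually_elim
    case (elim \<epsilon>)
    interpret S: schroedinger_setting p q pd p0 pm qm pdm a b \<epsilon> C "L \<epsilon>"
    proof
      show "p x \<le> pm" for x using pm[of x] by linarith
      show "linear_W22_L2 {a<..<b} (L \<epsilon>)" using elim(3) unfolding Q_interval(2) .
      show "L2_norm {a<..<b} (L \<epsilon> f) \<le> C * W22_norm {a<..<b} f" if "f \<in> W22 {a<..<b}" for f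
        using elim(4) that unfolding Q_interval(2) by (rule bspec)
    qed (fact p_periodic q_periodic p0_pos p_ge pc piecewise_continuous_measurable[OF pd] piecewise_continuous_bounded[OF pd] pd' pdm
          piecewise_continuous_measurable[OF q_regular] qm Q_interval(1) elim(5))+
    interpret small_perturbation p q pd p0 pm qm pdm a b \<epsilon> C "L \<epsilon>"
      by unfold_locales
        (use elim(1,2) in \<open>simp_all add: S.\<kappa>_def S.norm_ratio_def S.\<alpha>_def S.\<beta>_def K_def l_def\<close>)
    have H: "H_pert p q Q L \<epsilon> = H" unfolding H_pert_def[abs_def] H_def[abs_def] Q_interval(2) ..
    show ?case
      unfolding H
      by (intro conjI ballI allI no_limit_points_imp_countable[OF point_spectrum_no_accumulation]
          eigenspace_finite_dimensional point_spectrum_no_accumulation)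
  qed
qed

end
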